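(* Let $N\ge4$, let $0<m<1$ and $a\in\mathbb{C}$ satisfy $2\sqrt m\,\mathrm{Im}(a)\ge(1-m)|\mathrm{Re}(a)|$ and, if $\mathrm{Re}(a)\ge0$, assume further that $2\sqrt m\,\mathrm{Im}(a)>(1-m)\mathrm{Re}(a)$. Let $f\in W^{1,1}_{\mathrm{loc}}\big([0,\infty);L^2(\mathbb{R}^N)\big)$ and let $u_0\in H^1(\mathbb{R}^N)$. Suppose further that one of the following holds: (i) $f\in W^{1,1}_{\mathrm{loc}}\big([0,\infty);H^1(\mathbb{R}^N)\big)$, in which case set $\ell=1$; or (ii) $u_0\in H^2(\mathbb{R}^N)\cap L^{2m}(\mathbb{R}^N)$, in which case set $\ell=2$. Let $u$ be the unique strong solution of $$\mathrm{i}u_t+\Delta u+a|u|^{-(1-m)}u=f \ \text{ in } (0,\infty)\times\mathbb{R}^N,\qquad u(0)=u_0 .$$ Finally, assume that there exists $T_0\ge0$ such that $f(t)=0$ for almost every $t>T_0$. Then for any $t\ge T_0$, $$\|u(t)\|_{L^2(\mathbb{R}^N)}\le\|u(T_0)\|_{L^2(\mathbb{R}^N)}e^{-C(t-T_0)},\qquad\text{if } N=4 \text{ and } \ell=2,$$ $$\|u(t)\|_{L^2(\mathbb{R}^N)}\le\frac{\|u(T_0)\|_{L^2(\mathbb{R}^N)}}{\left(1+C\|u(T_0)\|_{L^2(\mathbb{R}^N)}^{\frac{(1-m)(N-2\ell)}{2\ell}}(t-T_0)\right)^{\frac{2\ell}{(1-m)(N-2\ell)}}},\qquad\text{if } N\ge5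 \text{ or } \ell=1,$$ where $C=C(\|u\|_{L^\infty((0,\infty);H^\ell(\mathbb{R}^N))},\mathrm{Im}(a),N,m,\ell)$.
   Context: All functions are complex-valued. For a Banach space $X$ and $1\le p\le\infty$, $u\in L^p_{\mathrm{loc}}([0,\infty);X)$ means $u_{|(0,T)}\in L^p((0,T);X)$ for every $T>0$; similarly for $W^{1,p}_{\mathrm{loc}}([0,\infty);X)$. The expression $|z|^{-(1-m)}z$ is taken to be $0$ at $z=0$; $L^{2m}(\mathbb{R}^N)$ denotes the measurable $u$ with $\int|u|^{2m}<\infty$, even if $2m<1$. Writing a constant as $C(a_1,\dots,a_n)$, for positive parameters $a_1,\dots,a_n$, means that it is a positive constant depending only, and continuously, on $a_1,\dots,a_n$. Strong solutions: let $H=H^1(\mathbb{R}^N)$ (so $H^\star=H^{-1}(\mathbb{R}^N)$) or $H=L^2(\mathbb{R}^N)$ (identified with its dual $H^\star$). Given $f\in L^1_{\mathrm{loc}}([0,\infty);L^2(\mathbb{R}^N))$, consider (1) $u\in L^{m+1}_{\mathrm{loc}}\big([0,\infty);H^1(\mathbb{R}^N)\cap L^{m+1}(\mathbb{R}^N)\big)\cap W^{1,\frac{m+1}{m}}_{\mathrm{loc}}\big([0,\infty);H^\star+L^{\frac{m+1}{m}}(\mathbb{R}^N)\big)$ (this space embeds into $C([0,\infty);L^2(\mathbb{R}^N))$); (2) $\Delta u(t)\in H^\star$ for almost every $t>0$; (3) $u$ satisfies the equation in $\mathscr{D}'\big((0,\infty)\times\mathbb{R}^N\big)$; (4) $u(0)=u_0$.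 $u$ is an $H^1$-solution if (1)--(4) hold with $H=H^1(\mathbb{R}^N)$, an $H^2$-solution if (1)--(4) hold with $H=L^2(\mathbb{R}^N)$, and a strong solution if it is an $H^1$-solution or an $H^2$-solution. Under the hypotheses on $m$ and $a$ of the theorem, strong solutions are unique; an $H^1$-solution exists if $u_0\in H^1(\mathbb{R}^N)$ and $f\in W^{1,1}_{\mathrm{loc}}([0,\infty);H^1(\mathbb{R}^N))$, and an $H^2$-solution exists if $u_0\in H^2(\mathbb{R}^N)\cap L^{2m}(\mathbb{R}^N)$ and $f\in W^{1,1}_{\mathrm{loc}}([0,\infty);L^2(\mathbb{R}^N))$. *)

theory Defs
  imports "HOL-Probability.Essential_Supremum"
begin

text \<open>
  A Banach space \<open>X\<close> of (classes of) functions or of distributions is given by its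
  \<^emph>\<open>extended\<close> norm \<open>X :: ('c \<Rightarrow> complex) \<Rightarrow> ennreal\<close>: an object belongs to \<open>X\<close> iff \<open>X v < \<infinity>\<close>, and
  two objects are equal in \<open>X\<close> iff the norm of their difference vanishes.  For spaces of functions
  \<open>'c\<close> is \<open>'a\<close>, and the arguments are representatives modulo equality almost everywhere;
  for spaces of distributions \<open>'c\<close> is \<open>'a \<Rightarrow> complex\<close>, and the arguments are
  functionals on test functions, extended by 0 to all other functions.
\<close>

type_synonym 'c xnorm = "('c \<Rightarrow> complex) \<Rightarrow> ennreal"
type_synonym 'a functional = "('a \<Rightarrow> complex) \<Rightarrow> complex"

text \<open>Only used for exponents \<open>r > 0\<close>.\<close>

definition epowr :: "ennreal \<Rightarrow> real \<Rightarrow> ennreal" where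
  "epowr x r = (if x = \<infinity> then \<infinity> else ennreal (enn2real x powr r))"


section \<open>Test functions\<close>

definition pd :: "'a::euclidean_space \<Rightarrow> ('a \<Rightarrow> complex) \<Rightarrow> 'a \<Rightarrow> complex" where
  "pd b \<phi> x = frechet_derivative \<phi> (at x) b"

definition pds :: "'a::euclidean_space list \<Rightarrow> ('a \<Rightarrow> complex) \<Rightarrow> 'a \<Rightarrow> complex" where
  "pds bs \<phi> = foldr pd bs \<phi>"

definition laplacian :: "('a::euclidean_space \<Rightarrow> complex) \<Rightarrow> 'a \<Rightarrow> complex" where
  "laplacian \<phi> x = (\<Sum>b\<in>Basis. pd b (pd b \<phi>) x)"

primrec Ck :: "nat \<Rightarrow> ('a::euclidean_space \<Rightarrow> complex) \<Rightarrow> bool" where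
  "Ck 0 \<phi> \<longleftrightarrow> continuous_on UNIV \<phi>"
| "Ck (Suc k) \<phi> \<longleftrightarrow> \<phi> differentiable_on UNIV \<and> (\<forall>b\<in>Basis. Ck k (pd b \<phi>))"

definition test_functions :: "'a::euclidean_space set \<Rightarrow> ('a \<Rightarrow> complex) set" where
  "test_functions \<Omega> =
     {\<phi>. (\<forall>k. Ck k \<phi>) \<and> compact (closure {x. \<phi> x \<noteq> 0}) \<and> closure {x. \<phi> x \<noteq> 0} \<subseteq> \<Omega>}"


section \<open>Spaces of functions on Euclidean space\<close>

text \<open>For \<open>0 < p < 1\<close> this is only a quasi-norm, but \<open>Lp_norm p u < \<infinity>\<close> still expresses \<open>u \<in> L\<^sup>p\<close>.\<close>

definition Lp_norm :: "real \<Rightarrow> ('a::euclidean_space) xnorm" where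
  "Lp_norm p u =
     (if u \<in> borel_measurable lebesgue
      then epowr (\<integral>\<^sup>+ x. ennreal (cmod (u x) powr p) \<partial>lebesgue) (1 / p) else \<infinity>)"

text \<open>\<open>v\<close> is the weak derivative of \<open>u\<close> along the basis vectors \<open>bs\<close>; only meaningful for locally
  integrable \<open>u\<close> and \<open>v\<close>.\<close>

definition weak_deriv ::
    "'a::euclidean_space list \<Rightarrow> ('a \<Rightarrow> complex) \<Rightarrow> ('a \<Rightarrow> complex) \<Rightarrow> bool" where
  "weak_deriv bs u v \<longleftrightarrow>
     (\<forall>\<phi>\<in>test_functions UNIV.
        (LINT x|lebesgue. u x * pds bs \<phi> x) = (- 1) ^ length bs * (LINT x|lebesgue. v x * \<phi> x))"

text \<open>The norm of \<open>H\<^sup>k = W\<^sup>k\<^sup>,\<^sup>2\<close>: the square root of the sum of the squared \<open>L\<^sup>2\<close> norms of all weak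
  partial derivatives of order at most \<open>k\<close> (the empty list gives \<open>u\<close> itself).  The infimum is over
  the weak derivatives, which are unique almost everywhere; it is \<open>\<infinity>\<close> if there is none in \<open>L\<^sup>2\<close>.\<close>

definition Hk_norm :: "nat \<Rightarrow> ('a::euclidean_space) xnorm" where
  "Hk_norm k u =
     (if Lp_norm 2 u < \<infinity>
      then epowr (\<Sum>bs\<in>{bs. set bs \<subseteq> Basis \<and> length bs \<le> k}.
                    (INF v\<in>{v. weak_deriv bs u v}. Lp_norm 2 v) ^ 2) (1 / 2)
      else \<infinity>)"

definition cap_norm :: "'c xnorm \<Rightarrow> 'c xnorm \<Rightarrow> 'c xnorm" where
  "cap_norm X Y v = X v + Y v"

definition plus_norm :: "'c xnorm \<Rightarrow> 'c xnorm \<Rightarrow> 'c xnorm" where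
  "plus_norm X Y v = (INF w. X w + Y (\<lambda>c. v c - w c))"


section \<open>Spaces of distributions on Euclidean space\<close>

definition dist_of :: "('a::euclidean_space \<Rightarrow> complex) \<Rightarrow> 'a functional" where
  "dist_of u \<phi> = (if \<phi> \<in> test_functions UNIV then LINT x|lebesgue. u x * \<phi> x else 0)"

definition dist_laplacian :: "('a::euclidean_space) functional \<Rightarrow> 'a functional" where
  "dist_laplacian T \<phi> = (if \<phi> \<in> test_functions UNIV then T (laplacian \<phi>) else 0)"

definition dist_Lp_norm :: "real \<Rightarrow> ('a::euclidean_space \<Rightarrow> complex) xnorm" where
  "dist_Lp_norm p T = (INF g\<in>{g. dist_of g = T}. Lp_norm p g)"

text \<open>\<open>H\<^sup>-\<^sup>1\<close> is the dual of \<open>H\<^sup>1\<close>; its elements are determined by their restrictions to the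
  (dense) test functions.\<close>

definition Hm1_norm :: "('a::euclidean_space \<Rightarrow> complex) xnorm" where
  "Hm1_norm T =
     (if (\<forall>\<phi>\<in>test_functions UNIV. \<forall>\<psi>\<in>test_functions UNIV. \<forall>c.
            T (\<lambda>x. \<phi> x + \<psi> x) = T \<phi> + T \<psi> \<and> T (\<lambda>x. c * \<phi> x) = c * T \<phi>) \<and>
         (\<forall>\<phi>. \<phi> \<notin> test_functions UNIV \<longrightarrow> T \<phi> = 0)
      then SUP \<phi>\<in>{\<phi>\<in>test_functions UNIV. Hk_norm 1 \<phi> \<le> 1}. ennreal (cmod (T \<phi>))
      else \<infinity>)"


section \<open>Functions of time with values in a Banach space\<close>

definition X_simple :: "'c xnorm \<Rightarrow> real set \<Rightarrow> (real \<Rightarrow> 'c \<Rightarrow> complex) \<Rightarrow> bool" where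
  "X_simple X I s \<longleftrightarrow> simple_function (lebesgue_on I) s \<and> (\<forall>t\<in>I. X (s t) < \<infinity>)"

definition X_measurable :: "'c xnorm \<Rightarrow> real set \<Rightarrow> (real \<Rightarrow> 'c \<Rightarrow> complex) \<Rightarrow> bool" where
  "X_measurable X I u \<longleftrightarrow>
     (\<exists>s. (\<forall>n. X_simple X I (s n)) \<and>
          (AE t in lebesgue_on I. (\<lambda>n. X (\<lambda>c. s n t c - u t c)) \<longlonglongrightarrow> 0))"

text \<open>\<open>J\<close> is the Bochner integral over \<open>I\<close> of the \<open>X\<close>-valued function \<open>u\<close>; used for sets \<open>I\<close> of
  finite measure.\<close>

definition X_integral ::
    "'c xnorm \<Rightarrow> real set \<Rightarrow> (real \<Rightarrow> 'c \<Rightarrow> complex) \<Rightarrow> ('c \<Rightarrow> complex) \<Rightarrow> bool" where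
  "X_integral X I u J \<longleftrightarrow>
     X J < \<infinity> \<and> X_measurable X I u \<and>
     (\<exists>s. (\<forall>n. X_simple X I (s n)) \<and>
          (\<lambda>n. \<integral>\<^sup>+ t. X (\<lambda>c. s n t c - u t c) \<partial>lebesgue_on I) \<longlonglongrightarrow> 0 \<and>
          (\<lambda>n. X (\<lambda>c. (\<Sum>y\<in>s n ` I. of_real (measure lebesgue (s n -` {y} \<inter> I)) * y c) - J c))
            \<longlonglongrightarrow> 0)"

definition Lp_time :: "real \<Rightarrow> 'c xnorm \<Rightarrow> real set \<Rightarrow> (real \<Rightarrow> 'c \<Rightarrow> complex) \<Rightarrow> bool" where
  "Lp_time p X I u \<longleftrightarrow>
     X_measurable X I u \<and> (\<integral>\<^sup>+ t. epowr (X (u t)) p \<partial>lebesgue_on I) < \<infinity>"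

definition W1p_time :: "real \<Rightarrow> 'c xnorm \<Rightarrow> real set \<Rightarrow> (real \<Rightarrow> 'c \<Rightarrow> complex) \<Rightarrow> bool" where
  "W1p_time p X I u \<longleftrightarrow>
     Lp_time p X I u \<and>
     (\<exists>v. Lp_time p X I v \<and>
        (\<forall>\<theta>\<in>test_functions I. \<exists>J.
           X_integral X I (\<lambda>t c. pd 1 \<theta> t * u t c) J \<and>
           X_integral X I (\<lambda>t c. - \<theta> t * v t c) J))"

definition Lp_loc :: "real \<Rightarrow> 'c xnorm \<Rightarrow> (real \<Rightarrow> 'c \<Rightarrow> complex) \<Rightarrow> bool" where
  "Lp_loc p X u \<longleftrightarrow> (\<forall>T>0. Lp_time p X {0<..<T} u)"

definition W1p_loc :: "real \<Rightarrow> 'c xnorm \<Rightarrow> (real \<Rightarrow> 'c \<Rightarrow> complex) \<Rightarrow> bool" where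
  "W1p_loc p X u \<longleftrightarrow> (\<forall>T>0. W1p_time p X {0<..<T} u)"

definition Linf_norm :: "'c xnorm \<Rightarrow> real set \<Rightarrow> (real \<Rightarrow> 'c \<Rightarrow> complex) \<Rightarrow> ennreal" where
  "Linf_norm X I u = esssup (lebesgue_on I) (\<lambda>t. X (u t))"

definition Linf_time :: "'c xnorm \<Rightarrow> real set \<Rightarrow> (real \<Rightarrow> 'c \<Rightarrow> complex) \<Rightarrow> bool" where
  "Linf_time X I u \<longleftrightarrow> X_measurable X I u \<and> Linf_norm X I u < \<infinity>"

definition continuous_time :: "'c xnorm \<Rightarrow> (real \<Rightarrow> 'c \<Rightarrow> complex) \<Rightarrow> bool" where
  "continuous_time X u \<longleftrightarrow>
     (\<forall>t\<ge>0. X (u t) < \<infinity> \<and> ((\<lambda>s. X (\<lambda>c. u s c - u t c)) \<longlongrightarrow> 0) (at t within {0..}))"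


section \<open>Strong solutions\<close>

text \<open>\<open>|z|\<^sup>-\<^sup>(\<^sup>1\<^sup>-\<^sup>m\<^sup>) z\<close>, with value 0 at \<open>z = 0\<close>.\<close>

definition nl :: "real \<Rightarrow> complex \<Rightarrow> complex" where
  "nl m z = of_real (cmod z powr (- (1 - m))) * z"

text \<open>The distribution on \<open>(0,\<infinity>) \<times> \<real>\<^sup>N\<close> defined by \<open>v\<close>.  An iterated integral is used because
  \<open>v t\<close> is only a representative for each \<open>t\<close>, so that \<open>v\<close> need not be jointly measurable.\<close>

definition st_dist :: "(real \<Rightarrow> 'a::euclidean_space \<Rightarrow> complex) \<Rightarrow> (real \<times> 'a) functional" where
  "st_dist v \<Phi> = (LINT t|lebesgue_on {0<..}. LINT x|lebesgue. v t x * \<Phi> (t, x))"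

text \<open>\<open>i u\<^sub>t + \<Delta>u + a |u|\<^sup>-\<^sup>(\<^sup>1\<^sup>-\<^sup>m\<^sup>) u = f\<close> in the sense of distributions.\<close>

definition nls_equation ::
    "real \<Rightarrow> complex \<Rightarrow> (real \<Rightarrow> 'a::euclidean_space \<Rightarrow> complex) \<Rightarrow> (real \<Rightarrow> 'a \<Rightarrow> complex) \<Rightarrow> bool" where
  "nls_equation m a f u \<longleftrightarrow>
     (\<forall>\<Phi>\<in>test_functions ({0<..} \<times> UNIV).
        - \<i> * st_dist u (pd (1, 0) \<Phi>)
        + st_dist u (\<lambda>(t, x). laplacian (\<lambda>y. \<Phi> (t, y)) x)
        + a * st_dist (\<lambda>t x. nl m (u t x)) \<Phi>
        = st_dist f \<Phi>)"

text \<open>\<open>Hstar\<close> is the norm of \<open>H\<^sup>\<star>\<close>.  Elements of the solution space are identified with their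
  representatives that are continuous from \<open>[0,\<infinity>)\<close> to \<open>L\<^sup>2\<close>, so that \<open>u t\<close> makes sense for every
  \<open>t \<ge> 0\<close>.\<close>

definition solution ::
    "('a::euclidean_space \<Rightarrow> complex) xnorm \<Rightarrow> real \<Rightarrow> complex \<Rightarrow> (real \<Rightarrow> 'a \<Rightarrow> complex) \<Rightarrow>
     ('a \<Rightarrow> complex) \<Rightarrow> (real \<Rightarrow> 'a \<Rightarrow> complex) \<Rightarrow> bool" where
  "solution Hstar m a f u0 u \<longleftrightarrow>
     Lp_loc (m + 1) (cap_norm (Hk_norm 1) (Lp_norm (m + 1))) u \<and>
     W1p_loc ((m + 1) / m) (plus_norm Hstar (dist_Lp_norm ((m + 1) / m))) (\<lambda>t. dist_of (u t)) \<and>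
     continuous_time (Lp_norm 2) u \<and>
     (AE t in lebesgue_on {0<..}. Hstar (dist_laplacian (dist_of (u t))) < \<infinity>) \<and>
     nls_equation m a f u \<and>
     (AE x in lebesgue. u 0 x = u0 x)"

definition H1_solution where
  "H1_solution m a f u0 u \<longleftrightarrow> solution Hm1_norm m a f u0 u"

definition H2_solution where
  "H2_solution m a f u0 u \<longleftrightarrow> solution (dist_Lp_norm 2) m a f u0 u"

definition strong_solution where
  "strong_solution m a f u0 u \<longleftrightarrow> H1_solution m a f u0 u \<or> H2_solution m a f u0 u"

end

theory Submission
  imports Defs
begin

text \<open>
 The phase condition on \<open>a\<close> makes \<open>z \<mapsto> a \<bar>z\<bar>\<^sup>m\<^sup>-\<^sup>1 z\<close> dissipative, so the \<open>L\<^sup>2\<close> distance of two solutions grows at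
 most by the integral of the distance of their sources. Applied to \<open>u\<close> and its translates in space, this
 bounds the increments of \<open>u(t)\<close> and hence its \<open>H\<^sup>1\<close> norm, uniformly in time. Applied to translates in
 time, it bounds \<open>u\<^sub>t\<close> in \<open>L\<^sup>2\<close>; the \<open>H\<^sup>2\<close> bound then comes from the stationary equation, which is multiplied
 by a complex number for which both the elliptic and the nonlinear term have a sign. After \<open>T\<^sub>0\<close>
 the energy identity reads \<open>(\<parallel>u\<parallel>\<^sup>2)' = - 2 Im(a) \<parallel>u\<parallel>\<^bsub>m+1\<^esub>\<^bsup>m+1\<^esup>\<close> with norms in \<open>L\<^sup>2\<close> and \<open>L\<^sup>m\<^sup>+\<^sup>1\<close>, and a Gagliardo-Nirenberg
 inequality between \<open>L\<^sup>m\<^sup>+\<^sup>1\<close>, \<open>L\<^sup>2\<close> and \<open>H\<^sup>\<ell>\<close> turns it into a differential inequality for \<open>\<parallel>u\<parallel>\<close>. The energy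
 identity is obtained from the weak equation by mollification in space; Sobolev regularity is
 expressed throughout by bounds for increments in \<open>L\<^sup>2\<close>.
\<close>

text \<open>Two obstacles shape the proof. Solution and source are given as curves of equivalence
  classes, strongly measurable in time but not jointly measurable, so Fubini does not apply to them
  as they stand; jointly Borel representatives are built first, from continuity in time on a set of
  full measure. And z -> |z|^(m-1) z is only Hoelder continuous at 0, so the equation cannot be
  differentiated; derivatives in space and time are replaced by increments, which dissipativity
  controls.

  The data, not the kind of solution, decide between \<open>l = 1\<close> and \<open>l = 2\<close>,
  so H^1- and H^2-solutions go through the same argument.

  The constant is explicit: up to a factor it is Im(a) times an interpolation constant, found by
  averaging the correlation of u with u(. + h) over the ball of shifts for which it stays above half
  of the squared norm. With M a bound for the derivatives, that ball has radius (|u| / (N^l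
  M))^(1/l), where |u| is the L2 norm, and its volume produces the exponent
  (1-m)(N-2l)/(2l).\<close>

abbreviation nint (binder "NINT " [0] 60) where "nint f \<equiv> integral\<^sup>N lborel f"
abbreviation lint (binder "LINT " 60) where "lint f \<equiv> integral\<^sup>L lborel f"
abbreviation ae (binder "AE " 10) where "ae P \<equiv> almost_everywhere lborel P"
abbreviation evseq (binder "EV " 10) where "evseq P \<equiv> eventually P sequentially"
syntax
 "_set_nint" :: "pttrn => 'a set => ennreal => ennreal" ("(2NINT _:_./ _)" [0, 0, 60] 60)
 "_set_lint" :: "pttrn => 'a set => 'b => 'b" ("(2LINT _:_./ _)" [0, 0, 60] 60)
translations
 "NINT x:A. f" => "CONST set_nn_integral CONST lborel A (%x. f)"
 "LINT x:A. f" => "CONST set_lebesgue_integral CONST lborel A (%x. f)"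
abbreviation Borel :: "('a::topological_space => 'b::topological_space) set" where "Borel \<equiv> borel_measurable borel"
abbreviation Borel2 :: "('a::topological_space \<times> 'b::topological_space => 'c::topological_space) set"
 where "Borel2 \<equiv> borel_measurable (borel \<Otimes>\<^sub>M borel)"
abbreviation joint :: "(real => 'a::euclidean_space => complex) => bool" where "joint w \<equiv> case_prod w : Borel2"
abbreviation L1 :: "('a::euclidean_space => 'b::{banach, second_countable_topology}) => bool" where "L1 \<equiv> integrable lborel"
abbreviation set_L1 :: "'a::euclidean_space set => ('a => 'b::{banach, second_countable_topology}) => bool" where "set_L1 \<equiv> set_integrable lborel"
notation LIMSEQ (infixr "~>" 60) and scaleR (infixr "*R" 75)

section \<open>Test functions and mollifiers\<close>

lemma has_derivative_pd: assumes "(\<phi> has_derivative D) (at x)" shows "pd b \<phi> x = D b"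
 using frechet_derivative_at[OF assms] by (simp add: pd_def)

lemma Ck_SucI: assumes "!!x. (\<phi> has_derivative D x) (at x)" "!!b. b : Basis ==> Ck k (%x. D x b)" shows "Ck (Suc k) \<phi>"
proof -
 have "pd b \<phi> = (%x. D x b)" for b using has_derivative_pd[OF assms(1)] by auto
 thus ?thesis using assms by (auto simp: differentiable_on_def differentiable_def intro: has_derivative_at_withinI)
qed

lemma Ck_Suc_has_derivative: assumes "Ck (Suc k) \<phi>" shows "(\<phi> has_derivative (%b. pd b \<phi> x)) (at x)"
 using assms frechet_derivative_works[of \<phi> "at x"] by (simp add: differentiable_on_def pd_def)

lemma Ck_SucD: "Ck (Suc k) \<phi> ==> Ck k \<phi>"
proof (induction k arbitrary: \<phi>)
 case 0
 thus ?case by (simp add: differentiable_imp_continuous_on)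
next
 case (Suc k)
 thus ?case by auto
qed

lemma Ck_const: "Ck k (%x. c)"
proof (induction k arbitrary: c)
 case (Suc k)
 show ?case by (rule Ck_SucI[OF has_derivative_const]) (simp add: Suc)
qed simp

lemma Ck_add: assumes "Ck k \<phi>" "Ck k \<psi>" shows "Ck k (%x. \<phi> x + \<psi> x)" using assms
proof (induction k arbitrary: \<phi> \<psi>)
 case (Suc k)
 show ?case by (rule Ck_SucI[OF has_derivative_add[OF Ck_Suc_has_derivative[OF Suc.prems(1)] Ck_Suc_has_derivative[OF Suc.prems(2)]]])
   (use Suc in auto)
qed (auto intro: continuous_intros)

lemma Ck_mult: assumes "Ck k \<phi>" "Ck k \<psi>" shows "Ck k (%x. \<phi> x * \<psi> x)" using assms
proof (induction k arbitrary: \<phi> \<psi>)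
 case (Suc k)
 show ?case by (rule Ck_SucI[OF has_derivative_mult[OF Ck_Suc_has_derivative[OF Suc.prems(1)] Ck_Suc_has_derivative[OF Suc.prems(2)]]])
   (use Suc.prems Ck_SucD[OF Suc.prems(1)] Ck_SucD[OF Suc.prems(2)] in \<open>auto intro!: Ck_add Suc.IH\<close>)
qed (auto intro: continuous_intros)

lemma Ck_affine: assumes "Ck k \<phi>" shows "Ck k (%x. \<phi> (c + r *R x))" using assms
proof (induction k arbitrary: \<phi>)
 case 0
 thus ?case by (auto intro!: continuous_intros intro: continuous_on_compose2[where t=UNIV])
next
 case (Suc k)
 have "((%x. \<phi> (c + r *R x)) has_derivative (%b. pd (r *R b) \<phi> (c + r *R x))) (at x)" for x
 proof -
  have "((%x. c + r *R x) has_derivative (%b. r *R b)) (at x)" by (auto intro!: derivative_eq_intros)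
  from has_derivative_compose[OF this Ck_Suc_has_derivative[OF Suc.prems]]
  show ?thesis .
 qed
 thus ?case
 proof (rule Ck_SucI)
  fix b :: 'a assume b: "b : Basis"
  have "pd (r *R b) \<phi> (c + r *R x) = of_real r * pd b \<phi> (c + r *R x)" for x
   using linear_scale[OF has_derivative_linear[OF Ck_Suc_has_derivative[OF Suc.prems, of "c + r *R x"]], of r b] by (simp add: scaleR_conv_of_real)
  thus "Ck k (%x. pd (r *R b) \<phi> (c + r *R x))" using Suc b by (auto intro!: Ck_mult Ck_const)
 qed
qed

text \<open>Compactness of the closure is boundedness of the set, so compact support amounts to
  vanishing off a ball, a form that passes easily to sums, dilations and derivatives.\<close>

lemma tf_iff:
 "\<phi> : test_functions UNIV \<longleftrightarrow> (ALL k. Ck k \<phi>) \<and> (EX R>0. ALL x. norm x > R --> \<phi> x = 0)"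
proof -
 have "compact (closure {x. \<phi> x \<noteq> 0}) \<longleftrightarrow> (EX R>0. ALL x. norm x > R --> \<phi> x = 0)"
 proof -
  have "compact (closure {x. \<phi> x \<noteq> 0}) \<longleftrightarrow> bounded {x. \<phi> x \<noteq> 0}"
   by (simp add: compact_eq_bounded_closed) (meson bounded_closure bounded_subset closure_subset)
  also have "... \<longleftrightarrow> (EX R>0. ALL x. norm x > R --> \<phi> x = 0)" unfolding bounded_pos by (metis mem_Collect_eq not_le)
  finally show ?thesis .
 qed
 thus ?thesis unfolding test_functions_def by auto
qed

abbreviation tf :: "('a::euclidean_space => complex) set" where "tf \<equiv> test_functions UNIV"

lemma tf_Ck: "\<phi> : tf ==> Ck k \<phi>" by (simp add: tf_iff)

lemma tf_support: "\<phi> : tf ==> EX R>0. ALL x. norm x > R --> \<phi> x = 0" by (simp add: tf_iff)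

lemma tf_has_derivative: "\<phi> : tf ==> (\<phi> has_derivative (%b. pd b \<phi> x)) (at x)" by (rule Ck_Suc_has_derivative[OF tf_Ck])

lemma tf_continuous: "\<phi> : tf ==> continuous_on S \<phi>" using tf_Ck[of \<phi> 0] continuous_on_subset by fastforce

lemma tf_pd: assumes "\<phi> : tf" "b : Basis" shows "pd b \<phi> : tf"
proof -
 obtain R where R: "R > 0" "!!x. norm x > R ==> \<phi> x = 0" using tf_support[OF assms(1)] by auto
 have "pd b \<phi> x = 0" if "norm x > R" for x
 proof -
  have "open {x::'a. norm x > R}" by (intro open_Collect_less continuous_intros)
  hence "(\<phi> has_derivative (%_. 0)) (at x)"
   using that R(2) by (intro has_derivative_transform_within_open[of "%_. 0" "%_. 0" x UNIV "{x. norm x > R}" \<phi>]) auto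
  from has_derivative_pd[OF this] show ?thesis .
 qed
 moreover have "Ck k (pd b \<phi>)" for k using tf_Ck[OF assms(1), of "Suc k"] assms(2) by simp
 ultimately show ?thesis using R unfolding tf_iff by blast
qed

lemma tf_pds: "\<phi> : tf ==> set bs \<subseteq> Basis ==> pds bs \<phi> : tf" by (induction bs) (auto simp: pds_def intro: tf_pd)

lemma tf_add: assumes "\<phi> : tf" "\<psi> : tf" shows "(%x. \<phi> x + \<psi> x) : tf"
proof -
 obtain R where R: "R > 0" "!!x. norm x > R ==> \<phi> x = 0" using tf_support[OF assms(1)] by auto
 obtain S where S: "S > 0" "!!x. norm x > S ==> \<psi> x = 0" using tf_support[OF assms(2)] by auto
 show ?thesis unfolding tf_iff using assms R S by (intro conjI allI Ck_add tf_Ck exI[of _ "max R S"]) auto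
qed

lemma tf_cmult: assumes "\<phi> : tf" shows "(%x. c * \<phi> x) : tf"
 using tf_support[OF assms] tf_Ck[OF assms] unfolding tf_iff by (auto intro!: Ck_mult Ck_const)

lemma tf_diff: assumes "\<phi> : tf" "\<psi> : tf" shows "(%x. \<phi> x - \<psi> x) : tf"
 using tf_add[OF assms(1) tf_cmult[OF assms(2), of "-1"]] by simp

lemma tf_affine: assumes "\<phi> : tf" "r \<noteq> 0" shows "(%x. \<phi> (c + r *R x)) : tf"
proof -
 obtain R where R: "R > 0" "!!x. norm x > R ==> \<phi> x = 0" using tf_support[OF assms(1)] by auto
 have "\<phi> (c + r *R x) = 0" if "norm x > (R + norm c) / \<bar>r\<bar>" for x
 proof -
  have "R + norm c < norm x * \<bar>r\<bar>" using that assms(2) by (simp add: field_simps)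
  also have "norm x * \<bar>r\<bar> = norm ((c + r *R x) - c)" by simp
  also have "... <= norm (c + r *R x) + norm c" by (rule norm_triangle_ineq4)
  finally show ?thesis by (intro R(2)) simp
 qed
 moreover have "(R + norm c) / \<bar>r\<bar> > 0" using R assms by (auto intro!: divide_pos_pos add_pos_nonneg)
 ultimately show ?thesis unfolding tf_iff using assms by (auto intro: Ck_affine tf_Ck)
qed

lemma pd_affine: assumes "\<phi> : tf" shows "pd b (%x. \<phi> (c + r *R x)) x = of_real r * pd b \<phi> (c + r *R x)"
proof -
 have "((%x. c + r *R x) has_derivative (%b. r *R b)) (at x)" by (auto intro!: derivative_eq_intros)
 from has_derivative_pd[OF has_derivative_compose[OF this tf_has_derivative[OF assms]], of b]
  linear_scale[OF has_derivative_linear[OF tf_has_derivative[OF assms, of "c + r *R x"]], of r b]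
 show ?thesis by (simp add: scaleR_conv_of_real)
qed

lemma tf_bounded:
 fixes \<phi> :: "'a::euclidean_space => complex" assumes "\<phi> : tf" shows "EX B>0. ALL x. cmod (\<phi> x) <= B"
proof -
 obtain R where R: "R > 0" "!!x. norm x > R ==> \<phi> x = 0" using tf_support[OF assms(1)] by auto
 have "compact (\<phi> ` cball 0 R)" by (intro compact_continuous_image tf_continuous assms compact_cball)
 then obtain B where B: "B > 0" "!!x. x : cball 0 R ==> cmod (\<phi> x) <= B" using compact_imp_bounded bounded_pos by (metis imageI)
 have "cmod (\<phi> x) <= B" for x using B R(2)[of x] by (cases "norm x > R") auto
 thus ?thesis using B(1) by auto
qed

lemma tf_borel [measurable_dest]: "\<phi> : tf ==> \<phi> : Borel" by (intro borel_measurable_continuous_onI tf_continuous)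

text \<open>Mean value inequality along the line through x in direction b. The bound is uniform in
  x, which later supplies a dominating function for difference quotients.\<close>

lemma tf_lipschitz:
 fixes \<phi> :: "'a::euclidean_space => complex" assumes "\<phi> : tf" "b : Basis"
 shows "EX B>0. ALL x h. cmod (\<phi> (x + h *R b) - \<phi> x) <= B * \<bar>h\<bar>"
proof -
 obtain B where B: "B > 0" "!!x. cmod (pd b \<phi> x) <= B" using tf_bounded[OF tf_pd[OF assms]] by auto
 have "cmod (\<phi> (x + h *R b) - \<phi> (x + 0 *R b)) <= B * norm (h - 0)" for x h
 proof (rule differentiable_bound[of UNIV])
  fix r :: real
  have "((%r. x + r *R b) has_derivative (%d. d *R b)) (at r)" by (auto intro!: derivative_eq_intros)
  from has_derivative_compose[OF this tf_has_derivative[OF assms(1)]]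
  show "((%r. \<phi> (x + r *R b)) has_derivative (%d. pd (d *R b) \<phi> (x + r *R b))) (at r within UNIV)" by simp
  have *: "pd (d *R b) \<phi> (x + r *R b) = of_real d * pd b \<phi> (x + r *R b)" for d
   using linear_scale[OF has_derivative_linear[OF tf_has_derivative[OF assms(1), of "x + r *R b"]], of d b] by (simp add: scaleR_conv_of_real)
  show "onorm (%d. pd (d *R b) \<phi> (x + r *R b)) <= B"
   unfolding * using B by (intro onorm_le) (auto simp: norm_mult mult.commute[of B] intro: mult_left_mono)
 qed auto
 thus ?thesis using B by auto
qed

lemma tf_difference_quotient: assumes "\<phi> : tf" "(h::nat => real) ~> 0" "!!n. h n \<noteq> 0"
 shows "(%n. (\<phi> (x + h n *R b) - \<phi> x) / of_real (h n)) ~> pd b \<phi> x"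
proof -
 have "((%r. x + r *R b) has_derivative (%d. d *R b)) (at 0)" by (auto intro!: derivative_eq_intros)
 from has_derivative_compose[OF this tf_has_derivative[OF assms(1)]]
 have "((%r. \<phi> (x + r *R b)) has_derivative (%d. pd (d *R b) \<phi> x)) (at 0)" by simp
 moreover have "pd (d *R b) \<phi> x = d *R pd b \<phi> x" for d
  using linear_scale[OF has_derivative_linear[OF tf_has_derivative[OF assms(1), of x]], of d b] by simp
 ultimately have "((%r. \<phi> (x + r *R b)) has_vector_derivative pd b \<phi> x) (at 0)" by (simp add: has_vector_derivative_def)
 hence "((%d. norm (\<phi> (x + (0 + d) *R b) - \<phi> (x + 0 *R b) - d *R pd b \<phi> x) / norm d) \<longlongrightarrow> 0) (at 0)"
  unfolding has_vector_derivative_def has_derivative_at by blast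
 moreover have "filterlim h (at 0) sequentially" using assms by (auto simp: filterlim_at)
 ultimately have "(%n. norm (\<phi> (x + h n *R b) - \<phi> x - h n *R pd b \<phi> x) / norm (h n)) ~> 0" by (auto dest: filterlim_compose)
 moreover have "norm (\<phi> (x + h n *R b) - \<phi> x - h n *R pd b \<phi> x) / norm (h n)
   = norm ((\<phi> (x + h n *R b) - \<phi> x) / of_real (h n) - pd b \<phi> x)" for n
 proof -
  have "(\<phi> (x + h n *R b) - \<phi> x) / of_real (h n) - pd b \<phi> x
    = (\<phi> (x + h n *R b) - \<phi> x - h n *R pd b \<phi> x) / of_real (h n)" using assms(3)[of n] by (simp add: field_simps scaleR_conv_of_real)
  thus ?thesis by (simp add: norm_divide)
 qed
 ultimately show ?thesis by (simp add: LIM_zero_cancel tendsto_norm_zero_iff)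
qed

section \<open>A smooth bump function and the mollifiers\<close>

primrec bump_poly :: "nat => real poly" where
 "bump_poly 0 = 1"
| "bump_poly (Suc n) = monom 1 2 * (bump_poly n - pderiv (bump_poly n))"

text \<open>The n-th derivative of exp(-1/s), extended by 0 to s <= 0. With x = 1/s it is P(x)
  exp(-x), and differentiating once more replaces P by x^2 (P - P'), the recursion of
  \<open>bump_poly\<close>.\<close>

definition bump_deriv :: "nat => real => real" where
 "bump_deriv n s = (if s <= 0 then 0 else poly (bump_poly n) (1 / s) * exp (- (1 / s)))"

lemma tendsto_poly_mult_exp_minus:
 fixes p :: "real poly" shows "((%x. poly p x * exp (- x)) \<longlongrightarrow> 0) at_top"
proof -
 have "((%x::real. \<Sum>i\<le>degree p. coeff p i * (x ^ i / exp x)) \<longlongrightarrow> (\<Sum>i\<le>degree p. coeff p i * 0)) at_top"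
  by (intro tendsto_sum tendsto_mult tendsto_const tendsto_power_div_exp_0)
 thus ?thesis by (simp add: poly_altdef sum_distrib_right exp_minus divide_inverse mult.assoc)
qed

lemma bump_deriv_DERIV: "(bump_deriv n has_real_derivative bump_deriv (Suc n) s) (at s)"
proof (cases s "0::real" rule: linorder_cases)
 case less
 have "((%_. 0) has_real_derivative 0) (at s)" by simp
 thus ?thesis using less by (subst DERIV_cong_ev[OF refl _ refl, where g="%_. 0"])
   (auto simp: bump_deriv_def eventually_nhds intro!: exI[of _ "{..<0}"])
next
 case greater
 have "((%s. poly (bump_poly n) (1 / s) * exp (- (1 / s))) has_real_derivative
   poly (bump_poly (Suc n)) (1 / s) * exp (- (1 / s))) (at s)" using greater by (auto intro!: derivative_eq_intros DERIV_chain'[OF _ poly_DERIV]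
    simp: poly_monom field_simps power2_eq_square)
 moreover have "\<forall>\<^sub>F x in nhds s. bump_deriv n x = poly (bump_poly n) (1 / x) * exp (- (1 / x))"
  using greater by (auto simp: bump_deriv_def eventually_nhds intro!: exI[of _ "{0<..}"])
 ultimately show ?thesis using greater by (subst DERIV_cong_ev[OF refl _ refl]) (auto simp: bump_deriv_def)
next
 case equal
 have "((%k. bump_deriv n k / k) \<longlongrightarrow> 0) (at_left 0)" by (rule tendsto_eventually) (auto simp: bump_deriv_def eventually_at_filter)
 moreover have "((%k. bump_deriv n k / k) \<longlongrightarrow> 0) (at_right 0)"
 proof -
  \<comment> \<open>The quotient by k is a factor 1/k, absorbed by \<open>pCons 0\<close> as one
    more power of the variable.\<close>
  have "((%k::real. poly (pCons 0 (bump_poly n)) (inverse k) * exp (- inverse k)) \<longlongrightarrow> 0) (at_right 0)"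
   by (rule filterlim_compose[OF tendsto_poly_mult_exp_minus filterlim_inverse_at_top_right])
  thus ?thesis by (rule Lim_transform_eventually)
    (auto simp: bump_deriv_def eventually_at_filter divide_inverse)
 qed
 ultimately have "((%k. bump_deriv n k / k) \<longlongrightarrow> 0) (at 0)" by (rule filterlim_split_at)
 thus ?thesis using equal by (simp add: DERIV_def bump_deriv_def)
qed

definition bump :: "'a::euclidean_space => real" where
 "bump x = bump_deriv 0 (1 - x \<bullet> x)"

lemma Ck_inner: "Ck k (%x. complex_of_real (c * (x \<bullet> b)))"
proof (cases k)
 case (Suc j)
 have "((%x. complex_of_real (c * (x \<bullet> b))) has_derivative (%d. complex_of_real (c * (d \<bullet> b)))) (at x)" for x
  by (auto intro!: derivative_eq_intros)
 thus ?thesis unfolding Suc by (rule Ck_SucI) (rule Ck_const)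
qed (auto intro!: continuous_intros)

text \<open>The order n has to vary in the induction: each derivative raises it by one and
  contributes a linear factor.\<close>

lemma Ck_bump_deriv: "Ck k (%x::'a::euclidean_space. complex_of_real (bump_deriv n (1 - x \<bullet> x)))"
proof (induction k arbitrary: n)
 case 0
 have "continuous_on UNIV (bump_deriv n)" using bump_deriv_DERIV DERIV_isCont continuous_at_imp_continuous_on by blast
 hence "continuous_on UNIV (%x::'a. bump_deriv n (1 - x \<bullet> x))" by (rule continuous_on_compose2) (auto intro!: continuous_intros)
 thus ?case by (auto intro!: continuous_intros)
next
 case (Suc k)
 have "((%x. complex_of_real (bump_deriv n (1 - x \<bullet> x))) has_derivative
   (%d. complex_of_real (bump_deriv (Suc n) (1 - x \<bullet> x)) * complex_of_real (- 2 * (x \<bullet> d)))) (at x)" for x :: 'a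
 proof -
  have "((%x. 1 - x \<bullet> x) has_derivative (%d. - 2 * (x \<bullet> d))) (at x)" by (auto intro!: derivative_eq_intros simp: inner_commute)
  from has_derivative_compose[OF this bump_deriv_DERIV[unfolded has_field_derivative_def]]
  show ?thesis by (auto intro!: derivative_eq_intros)
 qed
 thus ?case by (rule Ck_SucI) (intro Ck_mult Suc Ck_inner)
qed

lemma bump_nonneg: "bump x >= 0" by (simp add: bump_def bump_deriv_def)

lemma bump_minus [simp]: "bump (- x) = bump x" by (simp add: bump_def)

lemma bump_eq_0: "norm x >= 1 ==> bump x = 0" by (simp add: bump_def bump_deriv_def flip: power2_norm_eq_inner)

lemma bump_0: "bump 0 > 0" by (simp add: bump_def bump_deriv_def)

lemma tf_bump: "(%x. complex_of_real (bump x)) : tf"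
 unfolding tf_iff using Ck_bump_deriv[of _ 0] by (auto simp: bump_def[symmetric] bump_eq_0 intro!: exI[of _ 1])

text \<open>Scaling by n + 1 excludes the degenerate scale 0; the support lies in the ball of radius
  1/(n + 1).\<close>

definition moll :: "nat => 'a::euclidean_space => real" where
 "moll n x = bump (real (Suc n) *R x) / (LINT y. bump (real (Suc n) *R y :: 'a))"

lemma tf_integrable: assumes "\<phi> : tf" shows "L1 \<phi>"
proof -
 obtain R where R: "R > 0" "!!x. norm x > R ==> \<phi> x = 0" using tf_support[OF assms(1)] by auto
 have "L1 (%x. indicator (cball 0 R) x *R \<phi> x)" by (intro borel_integrable_compact tf_continuous assms compact_cball)
 also have "(%x. indicator (cball 0 R) x *R \<phi> x) = \<phi>" using R by (auto simp: indicator_def fun_eq_iff not_le)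
 finally show ?thesis .
qed

lemma tf_bump_scaled: "(%x. complex_of_real (bump (real (Suc n) *R x))) : tf" using tf_affine[OF tf_bump, of "real (Suc n)" 0] by simp

lemma bump_scaled_integrable: "L1 (%x. bump (real (Suc n) *R x))" using tf_integrable[OF tf_bump_scaled, of n] integrable_Re by fastforce

text \<open>A nonnegative function with zero integral vanishes almost everywhere; its zero set is
  closed by continuity, hence everything, while the bump is positive at 0.\<close>

lemma bump_scaled_integral_pos: "(LINT y. bump (real (Suc n) *R y :: 'a::euclidean_space)) > 0"
proof (rule ccontr)
 assume "\<not> ?thesis"
 moreover have "(LINT y. bump (real (Suc n) *R y :: 'a)) >= 0" by (simp add: bump_nonneg)
 ultimately have "(LINT y. bump (real (Suc n) *R y :: 'a)) = 0" by linarith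
 hence "AE x. bump (real (Suc n) *R x :: 'a) = 0"
  using integral_nonneg_eq_0_iff_AE[OF bump_scaled_integrable[of n, where 'a='a]] by (simp add: bump_nonneg del: of_nat_Suc)
 moreover have "closed {x::'a. complex_of_real (bump (real (Suc n) *R x)) = 0}"
  by (intro closed_Collect_eq tf_continuous[OF tf_bump_scaled] continuous_intros)
 ultimately have "(0::'a) : {x. complex_of_real (bump (real (Suc n) *R x)) = 0}" by (intro mem_closed_if_AE_lebesgue) (auto simp: AE_completion_iff)
 thus False using bump_0[where 'a='a] by simp
qed

lemma tf_moll: "(%x. complex_of_real (moll n x)) : tf" using tf_cmult[OF tf_bump_scaled, of "1 / of_real (LINT y. bump (real (Suc n) *R y :: 'a))" n]
 by (simp add: moll_def)

lemma moll_nonneg: "moll n x >= 0" unfolding moll_def by (intro divide_nonneg_pos bump_nonneg bump_scaled_integral_pos)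

lemma moll_minus [simp]: "moll n (- x) = moll n x" by (simp add: moll_def)

lemma moll_eq_0: "norm x >= 1 / Suc n ==> moll n x = 0" unfolding moll_def by (subst bump_eq_0) (auto simp: field_simps simp del: of_nat_Suc)

lemma moll_integrable: "L1 (moll n)" unfolding moll_def[abs_def] by (intro integrable_divide bump_scaled_integrable)

lemma moll_integral: "(LINT y. moll n (y::'a::euclidean_space)) = 1"
 unfolding moll_def using bump_scaled_integral_pos[of n, where 'a='a] by (simp del: of_nat_Suc)

lemma moll_borel [measurable]: "moll n : Borel" using moll_integrable borel_measurable_integrable by fastforce

lemma nn_integral_moll: "(NINT y. ennreal (moll n y)) = 1" using nn_integral_eq_integral[OF moll_integrable] by (simp add: moll_nonneg moll_integral)

section \<open>Tensor products of test functions\<close>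

lemma Ck_tensor:
 fixes \<phi> :: "'a::euclidean_space => complex" assumes "Ck k \<theta>" "Ck k \<phi>" shows "Ck k (%(t::real, x). \<theta> t * \<phi> x)"
 using assms
proof (induction k arbitrary: \<theta> \<phi>)
 case 0
 hence "continuous_on UNIV (%p. \<theta> (fst p) * \<phi> (snd p))" by (auto intro!: continuous_intros intro: continuous_on_compose2)
 thus ?case by (simp add: case_prod_unfold)
next
 case (Suc k)
 have *: "((%p. \<theta> (fst p) * \<phi> (snd p)) has_derivative
   (%d. \<theta> (fst p) * pd (snd d) \<phi> (snd p) + pd (fst d) \<theta> (fst p) * \<phi> (snd p))) (at p)" for p by (rule has_derivative_mult
   has_derivative_compose[OF has_derivative_fst[OF has_derivative_ident] Ck_Suc_has_derivative[OF Suc.prems(1)]]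
   has_derivative_compose[OF has_derivative_snd[OF has_derivative_ident] Ck_Suc_has_derivative[OF Suc.prems(2)]])+
 \<comment> \<open>A basis vector of the product has one component equal to 0, and the derivative
   along 0 vanishes; so exactly one of the two terms of the product rule survives.\<close>
 have z: "pd 0 \<theta> = (%_. 0)" "pd 0 \<phi> = (%_. 0)" using linear_0[OF has_derivative_linear[OF Ck_Suc_has_derivative[OF Suc.prems(1)]]]
   linear_0[OF has_derivative_linear[OF Ck_Suc_has_derivative[OF Suc.prems(2)]]] by auto
 show ?case unfolding case_prod_unfold
 proof (rule Ck_SucI[OF *])
  fix d :: "real \<times> 'a" assume "d : Basis"
  then consider "d = (1, 0)" | b where "b : Basis" "d = (0, b)" by (auto simp: Basis_prod_def)
  thus "Ck k (%p. \<theta> (fst p) * pd (snd d) \<phi> (snd p) + pd (fst d) \<theta> (fst p) * \<phi> (snd p))"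
  proof cases
   case 1
   thus ?thesis using Suc.IH[of "pd 1 \<theta>" \<phi>] Suc.prems Ck_SucD[OF Suc.prems(2)] by (simp add: z case_prod_unfold)
  next
   case 2
   thus ?thesis using Suc.IH[of \<theta> "pd b \<phi>"] Suc.prems Ck_SucD[OF Suc.prems(1)] by (simp add: z case_prod_unfold)
  qed
 qed
qed

lemma test_functionsD: assumes "\<theta> : test_functions \<Omega>" shows "\<theta> : tf" "closure {x. \<theta> x \<noteq> 0} \<subseteq> \<Omega>"
 using assms by (auto simp: test_functions_def)

lemma test_functions_mono: "\<Omega> \<subseteq> \<Omega>' ==> test_functions \<Omega> \<subseteq> test_functions \<Omega>'"
 by (auto simp: test_functions_def)

lemma tensor_test_function:
 fixes \<phi> :: "'a::euclidean_space => complex" assumes "\<theta> : test_functions {0<..}" "\<phi> : tf"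
 shows "(%(t::real, x). \<theta> t * \<phi> x) : test_functions ({0<..} \<times> UNIV)"
proof -
 let ?A = "closure {x. \<theta> x \<noteq> 0}" and ?B = "closure {x. \<phi> x \<noteq> 0}"
 have AB: "compact ?A" "compact ?B" "?A \<subseteq> {0<..}" using assms by (auto simp: test_functions_def)
 have sub: "closure {p. (case p of (t, x) => \<theta> t * \<phi> x) \<noteq> 0} \<subseteq> ?A \<times> ?B"
  using closure_subset[of "{x. \<theta> x \<noteq> 0}"] closure_subset[of "{x. \<phi> x \<noteq> 0}"] by (intro closure_minimal closed_Times) auto
 moreover have "compact (closure {p. (case p of (t, x) => \<theta> t * \<phi> x) \<noteq> 0})"
  using compact_Int_closed[OF compact_Times[OF AB(1,2)] closed_closure] sub by (metis inf.absorb_iff2)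
 moreover have "ALL k. Ck k (%(t, x). \<theta> t * \<phi> x)" using assms by (auto intro!: Ck_tensor simp: test_functions_def)
 ultimately show ?thesis using AB(3) unfolding test_functions_def by blast
qed

lemma pd_tensor_time: assumes "\<theta> : tf" and that: "\<phi> : tf"
 shows "pd (1, 0) (%(t::real, x). \<theta> t * \<phi> x) (t, x) = pd 1 \<theta> t * \<phi> x"
proof -
 have "((%p. \<theta> (fst p) * \<phi> (snd p)) has_derivative
   (%d. \<theta> (fst p) * pd (snd d) \<phi> (snd p) + pd (fst d) \<theta> (fst p) * \<phi> (snd p))) (at p)" for p by (rule has_derivative_mult
   has_derivative_compose[OF has_derivative_fst[OF has_derivative_ident] tf_has_derivative[OF assms(1)]]
   has_derivative_compose[OF has_derivative_snd[OF has_derivative_ident] tf_has_derivative[OF that]])+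
 from has_derivative_pd[OF this, of "(1, 0)" "(t, x)"]
 show ?thesis using linear_0[OF has_derivative_linear[OF tf_has_derivative[OF that]]] by (simp add: case_prod_unfold)
qed

lemma pd_cmult: "\<phi> : tf ==> pd b (%x. c * \<phi> x) x = c * pd b \<phi> x"
 by (rule has_derivative_pd[OF has_derivative_mult_right[OF tf_has_derivative]])

lemma pd_add: "\<phi> : tf ==> \<psi> : tf ==> pd b (%x. \<phi> x + \<psi> x) x = pd b \<phi> x + pd b \<psi> x"
 by (rule has_derivative_pd[OF has_derivative_add[OF tf_has_derivative tf_has_derivative]])

lemma laplacian_cmult: assumes "\<phi> : tf" shows "laplacian (%x. c * \<phi> x) x = c * laplacian \<phi> x"
proof -
 have "pd b (%x. c * \<phi> x) = (%x. c * pd b \<phi> x)" for b using pd_cmult[OF assms] by auto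
 thus ?thesis unfolding laplacian_def by (simp add: pd_cmult tf_pd assms sum_distrib_left)
qed

lemma tf_sum: "finite S ==> (!!i. i : S ==> f i : tf) ==> (%x. SUM i:S. f i x) : tf"
proof (induction S rule: finite_induct)
 case empty
 show ?case by (auto simp: tf_iff Ck_const intro: exI[of _ 1])
qed (auto intro: tf_add)

lemma tf_laplacian: "\<phi> : tf ==> laplacian \<phi> : tf" unfolding laplacian_def[abs_def] by (intro tf_sum tf_pd finite_Basis)

section \<open>Smooth steps and plateaus in time\<close>

definition moll_step :: "nat => real => real" where
 "moll_step n r = (LINT x. indicator {..r} x * moll n x)"

lemma moll_step_DERIV: "(moll_step n has_real_derivative moll n r) (at r)"
proof -
 \<comment> \<open>The base point has to lie to the left of r and of the support of every mollifier,
   so that integrals from c agree with integrals over the whole half line.\<close>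
 define c where "c = min (r - 1) (- 2)"
 have "continuous_on UNIV (%x. Re (complex_of_real (moll n x :: real)))" by (intro continuous_intros tf_continuous[OF tf_moll])
 hence "continuous_on {c..r + 1} (moll n :: real => real)" by (auto intro: continuous_on_subset)
 hence "((%u. LBINT y=c..u. moll n y) has_vector_derivative moll n r) (at r within {c..r + 1})" by (intro interval_integral_FTC2) (auto simp: c_def)
 hence "((%u. LBINT y=c..u. moll n y) has_real_derivative moll n r) (at r)"
  by (simp add: has_real_derivative_iff_has_vector_derivative at_within_Icc_at c_def)
 moreover have "\<forall>\<^sub>F u in nhds r. moll_step n u = (LBINT y=c..u. moll n y)"
 proof -
  have "moll_step n u = (LBINT y=c..u. moll n y)" if "u > c" for u
  proof -
   have *: "moll n x = 0" if "x <= c" for x :: real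
   proof -
    have "1 / real (Suc n) <= 1" by simp
    moreover have "norm x >= 1" using that by (simp add: c_def)
    ultimately show ?thesis by (intro moll_eq_0) linarith
   qed
   have "AE x. x \<noteq> u" by (rule AE_lborel_singleton)
   hence "AE x. indicator {..u} x * moll n x = indicator (einterval c u) x *R moll n x" by eventually_elim (auto simp: indicator_def einterval_def *)
   hence "moll_step n u = (LINT x. indicator (einterval c u) x *R moll n x)" unfolding moll_step_def by (intro integral_cong_AE) auto
   thus ?thesis using that by (simp add: interval_lebesgue_integral_def set_lebesgue_integral_def)
  qed
  thus ?thesis unfolding eventually_nhds by (intro exI[of _ "{c<..}"]) (auto simp: c_def)
 qed
 ultimately show ?thesis by (subst DERIV_cong_ev[OF refl _ refl])
qed

lemma moll_step_bounds: "0 <= moll_step n r" "moll_step n r <= 1"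
proof -
 have "moll_step n r <= (LINT x. moll n (x::real))" unfolding moll_step_def
  by (intro integral_mono moll_integrable integrable_real_mult_indicator[of _ _ "moll n", simplified mult.commute])
   (auto simp: moll_nonneg indicator_def)
 thus "moll_step n r <= 1" by (simp add: moll_integral)
qed (auto simp: moll_step_def intro!: integral_nonneg simp: moll_nonneg)

lemma moll_step_eq_0: "r <= - 1 / Suc n ==> moll_step n r = 0"
 unfolding moll_step_def by (rule integral_eq_zero_AE) (auto simp: indicator_def intro!: moll_eq_0)

lemma moll_step_eq_1: assumes "r >= 1 / Suc n" shows "moll_step n r = 1"
proof -
 have "indicator {..r} x * moll n x = moll n x" for x using assms moll_eq_0[of n x] by (cases "x <= r") auto
 hence "(%x. indicator {..r} x * moll n x) = moll n" by blast
 thus ?thesis unfolding moll_step_def by (simp add: moll_integral)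
qed

text \<open>A smooth approximation of the indicator of [s, t]. Its derivative is the difference of
  the mollifiers centred at s and t, so testing a weak time derivative with it produces mollified
  values at both ends.\<close>

definition plateau :: "nat => real => real => real => complex" where
 "plateau n s t r = of_real (moll_step n (r - s) - moll_step n (r - t))"

lemma plateau_has_derivative:
 "(plateau n s t has_derivative (%d. d * of_real (moll n (r - s) - moll n (r - t)))) (at r)"
proof -
 have "((%r. moll_step n (r - s) - moll_step n (r - t)) has_real_derivative moll n (r - s) - moll n (r - t)) (at r)"
  by (auto intro!: derivative_eq_intros DERIV_chain'[OF _ moll_step_DERIV])
 from has_derivative_of_real[OF this[unfolded has_field_derivative_def]]
 show ?thesis unfolding plateau_def[abs_def] by (simp add: mult.commute)
qed

lemma pd_plateau: "pd 1 (plateau n s t) r = of_real (moll n (r - s) - moll n (r - t))"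
 using has_derivative_pd[OF plateau_has_derivative, of 1] by simp

lemma plateau_test_function: assumes "s <= t" "a < s - 1 / Suc n" "t + 1 / Suc n < b" shows "plateau n s t : test_functions {a<..<b}"
proof -
 let ?K = "{s - 1 / Suc n .. t + 1 / Suc n}"
 have "plateau n s t r = 0" if "r \<notin> ?K" for r
 proof (cases "r < s - 1 / Suc n")
  case True
  thus ?thesis using assms by (simp add: plateau_def moll_step_eq_0)
 next
  case False
  thus ?thesis using that assms by (simp add: plateau_def moll_step_eq_1)
 qed
 hence "{r. plateau n s t r \<noteq> 0} \<subseteq> ?K" by blast
 hence sub: "closure {r. plateau n s t r \<noteq> 0} \<subseteq> ?K" by (rule closure_minimal) simp
 hence "compact (closure {r. plateau n s t r \<noteq> 0})" by (metis compact_Icc compact_Int_closed closed_closure inf.absorb_iff2)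
 moreover have "closure {r. plateau n s t r \<noteq> 0} \<subseteq> {a<..<b}" using sub assms by auto
 moreover have "Ck k (plateau n s t)" for k
 proof (cases k)
  case 0
  thus ?thesis using plateau_has_derivative has_derivative_continuous continuous_at_imp_continuous_on by (metis Ck.simps(1))
 next
  case (Suc j)
  have "Ck j (%r. complex_of_real (moll n (- s + 1 *R r)) + (- 1) * complex_of_real (moll n (- t + 1 *R r)))"
   by (intro Ck_add Ck_mult Ck_const Ck_affine[OF tf_Ck[OF tf_moll]])
  hence "Ck j (%r. of_real (moll n (r - s) - moll n (r - t)))" by simp
  thus ?thesis unfolding Suc by (intro Ck_SucI[OF plateau_has_derivative]) simp
 qed
 ultimately show ?thesis by (simp add: test_functions_def)
qed

lemma norm_plateau_le: "cmod (plateau n s t r) <= 1" using moll_step_bounds[of n "r - s"] moll_step_bounds[of n "r - t"]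
 unfolding plateau_def norm_of_real by linarith

lemma plateau_tendsto: assumes "s < t" "r \<noteq> s" "r \<noteq> t" shows "(%n. plateau n s t r) ~> indicator {s..t} r"
proof (rule tendsto_eventually)
 have "(%n. 1 / real (Suc n)) ~> 0" using LIMSEQ_Suc[OF lim_1_over_n[where 'a=real]] by simp
 moreover have "min \<bar>r - s\<bar> \<bar>r - t\<bar> > 0" using assms by auto
 ultimately have "EV n. 1 / real (Suc n) < min \<bar>r - s\<bar> \<bar>r - t\<bar>" by (rule order_tendstoD)
 thus "EV n. plateau n s t r = indicator {s..t} r"
 proof eventually_elim
  case (elim n)
  consider "r < s" | "s < r" "r < t" | "t < r" using assms by linarith
  thus ?case using elim assms by cases (auto simp: plateau_def moll_step_eq_0 moll_step_eq_1)
 qed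
qed

section \<open>Translation and convolution\<close>

lemma pair_sigma_finite_lborel: "pair_sigma_finite lborel lborel" by (intro pair_sigma_finite.intro sigma_finite_lborel)

lemma nn_integral_translate:
 fixes f :: "'a::euclidean_space => ennreal" assumes [measurable]: "f : Borel" shows "(NINT x. f (c + x)) = (NINT x. f x)"
 using nn_integral_distr[of "(+) c" lborel borel f] by (simp add: lborel_distr_plus)

lemma distr_reflect: "distr lborel borel (%x. c - x) = (lborel :: 'a::euclidean_space measure)"
 using lborel_affine[of "-1" c] by (simp add: density_1 one_ennreal_def[symmetric])

lemma integral_translate:
 fixes f :: "'a::euclidean_space => 'b::{banach, second_countable_topology}" assumes [measurable]: "f : Borel"
 shows "(LINT x. f (c + x)) = (LINT x. f x)" using integral_distr[of "(+) c" lborel borel f] by (simp add: lborel_distr_plus)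

lemma integral_reflect:
 fixes f :: "'a::euclidean_space => 'b::{banach, second_countable_topology}" assumes [measurable]: "f : Borel"
 shows "(LINT x. f (c - x)) = (LINT x. f x)" using integral_distr[of "%x. c - x" lborel borel f] by (simp add: distr_reflect)

lemma integrable_translate:
 fixes f :: "'a::euclidean_space => 'b::{banach, second_countable_topology}" assumes "L1 f" shows "L1 (%x. f (c + x))"
 using integrable_distr[of "(+) c" lborel borel f] assms by (simp add: lborel_distr_plus)

section \<open>Power integrals and p-integrable functions\<close>

definition pint :: "real => ('a::euclidean_space => complex) => ennreal" where
 "pint q w = (NINT x. ennreal (cmod (w x) powr q))"

text \<open>Powers of norms are used because Tonelli applies to them directly and because exponents
  below 1 occur, for which there is no norm. Members are Borel and not just Lebesgue measurable, so
  that convolutions are measurable.\<close>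

definition LL :: "real => ('a::euclidean_space => complex) set" where
 "LL q = {w : Borel. pint q w < \<infinity>}"

lemma LL_borel [measurable_dest]: "w : LL q ==> w : Borel" by (simp add: LL_def)

lemma LL_iff_integrable: "w : LL q \<longleftrightarrow> w : Borel \<and> L1 (%x. cmod (w x) powr q)"
 by (auto simp: LL_def pint_def integrable_iff_bounded)

lemma LL_integrable: "w : LL q ==> L1 (%x. cmod (w x) powr q)" by (simp add: LL_iff_integrable)

lemma pint_eq_integral: "w : LL q ==> pint q w = ennreal (LINT x. cmod (w x) powr q)"
 unfolding pint_def by (intro nn_integral_eq_integral LL_integrable) auto

text \<open>Bounding the sum by twice the maximum gives a constant that serves every q >= 0, concave
  powers included.\<close>

lemma cmod_add_powr_le: assumes "q >= 0" shows "cmod (a + b) powr q <= 2 powr q * (cmod a powr q + cmod b powr q)"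
proof -
 have "cmod (a + b) powr q <= (2 * max (cmod a) (cmod b)) powr q" using norm_triangle_ineq[of a b] by (intro powr_mono2 assms) auto
 also have "... = 2 powr q * max (cmod a) (cmod b) powr q" by (simp add: powr_mult)
 also have "... <= 2 powr q * (cmod a powr q + cmod b powr q)" by (intro mult_left_mono) (auto simp: max_def)
 finally show ?thesis .
qed

lemma pint_add_le: assumes [measurable]: "a : Borel" "b : Borel" and "q >= 0"
 shows "pint q (%x. a x + b x) <= ennreal (2 powr q) * (pint q a + pint q b)"
proof -
 have "pint q (%x. a x + b x) <= (NINT x. ennreal (2 powr q) * (ennreal (cmod (a x) powr q) + ennreal (cmod (b x) powr q)))"
  unfolding pint_def using cmod_add_powr_le[OF assms(3)]
  by (intro nn_integral_mono) (simp add: ennreal_plus[symmetric] ennreal_mult[symmetric] del: ennreal_plus)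
 also have "... = ennreal (2 powr q) * (pint q a + pint q b)" unfolding pint_def by (simp add: nn_integral_cmult nn_integral_add)
 finally show ?thesis .
qed

lemma pint_minus: "pint q (%x. - w x) = pint q w" by (simp add: pint_def)

lemma pint_diff_le: assumes "a : Borel" "b : Borel" "q >= 0" shows "pint q (%x. a x - b x) <= ennreal (2 powr q) * (pint q a + pint q b)"
 using pint_add_le[of a "%x. - b x" q] assms by (simp add: pint_minus)

lemma LL_add: "a : LL q ==> b : LL q ==> q >= 0 ==> (%x. a x + b x) : LL q"
 using pint_add_le[of a b q] by (auto simp: LL_def ennreal_mult_less_top elim!: le_less_trans)

lemma LL_cmult: "a : LL q ==> (%x. c * a x) : LL q" by (auto simp: LL_iff_integrable norm_mult powr_mult)

lemma LL_diff: "a : LL q ==> b : LL q ==> q >= 0 ==> (%x. a x - b x) : LL q" using LL_add[of a q "%x. -1 * b x"] LL_cmult[of b q "-1"] by simp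

lemma pint_translate: "w : Borel ==> pint q (%x. w (x + h)) = pint q w"
 unfolding pint_def using nn_integral_translate[of "%x. ennreal (cmod (w x) powr q)" h] by (simp add: add.commute)

lemma LL_translate: "w : LL q ==> (%x. w (x + h)) : LL q" unfolding LL_def by (auto simp: pint_translate)

lemma tf_LL: assumes "\<phi> : tf" "q > 0" shows "\<phi> : LL q"
proof -
 obtain R where R: "R > 0" "!!x. norm x > R ==> \<phi> x = 0" using tf_support[OF assms(1)] by auto
 obtain B where B: "B > 0" "!!x. cmod (\<phi> x) <= B" using tf_bounded[OF assms(1)] by auto
 have "L1 (%x. cmod (\<phi> x) powr q)"
 proof (rule integrableI_bounded_set)
  show "cball 0 R : sets lborel" "(%x. cmod (\<phi> x) powr q) : borel_measurable lborel" using tf_borel[OF assms(1)] by auto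
  show "emeasure lborel (cball 0 R :: 'a set) < \<infinity>" by (rule emeasure_lborel_cball_finite)
  show "AE x\<in>cball 0 R in lborel. norm (cmod (\<phi> x) powr q) <= B powr q" using B assms(2) by (auto intro!: powr_mono2)
  show "AE x. x \<notin> cball 0 R --> cmod (\<phi> x) powr q = 0" using R by auto
 qed
 thus ?thesis using assms by (simp add: LL_iff_integrable tf_borel)
qed

lemma le_one_plus_powr:
 fixes a :: real assumes "a >= 0" "q >= 1" shows "a <= 1 + a powr q"
proof (cases "a <= 1")
 case False
 hence "a powr 1 <= a powr q" using assms by (intro powr_mono) auto
 thus ?thesis using False by simp
qed (auto intro: order_trans)

lemma LL_mult_tf_integrable: assumes "w : LL q" "q >= 1" "\<phi> : tf" shows "L1 (%x. w x * \<phi> x)"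
proof -
 obtain B where B: "B > 0" "!!x. cmod (\<phi> x) <= B" using tf_bounded[OF assms(3)] by auto
 have "L1 (%x. cmod (\<phi> x) + cmod (w x) powr q * B)" using integrable_norm[OF tf_integrable[OF assms(3)]] LL_integrable[OF assms(1)] by auto
 moreover have "norm (w x * \<phi> x) <= norm (cmod (\<phi> x) + cmod (w x) powr q * B)" for x
 proof -
  have "cmod (w x) * cmod (\<phi> x) <= (1 + cmod (w x) powr q) * cmod (\<phi> x)" by (intro mult_right_mono le_one_plus_powr assms) auto
  also have "... <= cmod (\<phi> x) + cmod (w x) powr q * B" using B(2)[of x] by (simp add: distrib_right mult_left_mono)
  finally show ?thesis by (simp add: norm_mult)
 qed
 ultimately show ?thesis using assms(1,3) by (intro Bochner_Integration.integrable_bound[of _ _ "%x. w x * \<phi> x"]) (auto simp: tf_borel LL_borel)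
qed

section \<open>Convolution with test functions\<close>

definition conv :: "('a::euclidean_space => complex) => ('a => complex) => 'a => complex" where
 "conv K w y = (LINT x. w x * K (y - x))"

lemma tf_reflect: "\<phi> : tf ==> (%x. \<phi> (y - x)) : tf" using tf_affine[of \<phi> "-1" y] by simp

lemma conv_integrable: "w : LL q ==> q >= 1 ==> K : tf ==> L1 (%x. w x * K (y - x))" by (rule LL_mult_tf_integrable[OF _ _ tf_reflect])

lemma conv_borel [measurable]: assumes [measurable]: "w : Borel" "K : Borel" shows "conv K w : Borel" unfolding conv_def[abs_def] by measurable

lemma conv_alt: assumes [measurable]: "w : Borel" "K : Borel" shows "conv K w y = (LINT z. w (y - z) * K z)"
 unfolding conv_def using integral_reflect[of "%x. w x * K (y - x)" y] by simp

lemma conv_diff: assumes "w : LL q" "v : LL q" "q >= 1" "K : tf" shows "conv K (%x. w x - v x) y = conv K w y - conv K v y"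
 using assms by (simp add: conv_def left_diff_distrib conv_integrable)

lemma conv_kernel_diff: assumes "w : LL q" "q >= 1" "K : tf" "K' : tf" shows "conv (%x. K x - K' x) w y = conv K w y - conv K' w y"
 using assms by (simp add: conv_def right_diff_distrib conv_integrable)

lemma conv_kernel_cmult: "conv (%x. c * K x) w y = c * conv K w y"
proof -
 have "conv (%x. c * K x) w y = (LINT x. c * (w x * K (y - x)))" by (simp add: conv_def algebra_simps)
 thus ?thesis by (simp add: conv_def)
qed

lemma conv_translate: assumes [measurable]: "w : Borel" "K : Borel" shows "conv K (%x. w (x + h)) y = conv K w (y + h)"
 by (simp add: conv_alt add.commute add_diff_eq diff_add_eq)

lemma conv_kernel_translate: "conv (%x. K (x + h)) w y = conv K w (y + h)" by (simp add: conv_def algebra_simps)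

text \<open>By convexity the tangent of x^q at A lies below the graph; the inequality is Young's
  with exponents q and q/(q-1).\<close>

lemma powr_tangent:
 fixes x A q :: real assumes "x >= 0" "A >= 0" "q >= 1" shows "A powr q * (1 - q) + q * A powr (q - 1) * x <= x powr q"
proof (cases "q = 1")
 case False
 hence q: "q > 1" using assms by simp
 have "x * A powr (q - 1) <= x powr q / q + (A powr (q - 1)) powr (q / (q - 1)) / (q / (q - 1))"
  using q assms by (intro Youngs_inequality) (auto simp: field_simps)
 also have "(A powr (q - 1)) powr (q / (q - 1)) = A powr q" using q by (simp add: powr_powr)
 finally show ?thesis using q by (simp add: field_simps)
qed (use assms in auto)

text \<open>Jensen's inequality for the measure with density k, whose mass is at most c: the tangent
  inequality at the point A = a/c is integrated.\<close>

lemma jensen_kernel: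
 fixes g k :: "'a::euclidean_space => real" assumes [measurable]: "g : Borel" and nn: "!!x. g x >= 0" "!!x. k x >= 0" and q: "q >= 1"
  and k: "L1 k" "(LINT x. k x) <= c" "c > 0" and gk: "L1 (%x. g x * k x)"
 shows "ennreal ((LINT x. g x * k x) powr q) <= ennreal (c powr (q - 1)) * (NINT x. ennreal (g x powr q) * ennreal (k x))"
proof (cases "(NINT x. ennreal (g x powr q) * ennreal (k x)) < \<infinity>")
 case False
 hence "(NINT x. ennreal (g x powr q) * ennreal (k x)) = top" by (simp add: less_top[symmetric])
 thus ?thesis using k(3) by (simp add: ennreal_mult_top)
next
 case True
 have [measurable]: "k : Borel" using k by auto
 have int: "L1 (%x. g x powr q * k x)" using True nn by (auto simp: integrable_iff_bounded ennreal_mult[symmetric])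
 define a where "a = (LINT x. g x * k x)"
 define A where "A = a / c"
 have a: "a >= 0" and A: "A >= 0" using nn k by (auto simp: a_def A_def)
 have "(LINT x. (A powr q * (1 - q)) * k x + (q * A powr (q - 1)) * (g x * k x)) <= (LINT x. g x powr q * k x)"
 proof (rule integral_mono)
  fix x
  have "(A powr q * (1 - q) + q * A powr (q - 1) * g x) * k x <= g x powr q * k x" using nn A q by (intro mult_right_mono powr_tangent) auto
  thus "(A powr q * (1 - q)) * k x + (q * A powr (q - 1)) * (g x * k x) <= g x powr q * k x" by (simp add: algebra_simps)
 qed (use k gk int in auto)
 also have "(LINT x. (A powr q * (1 - q)) * k x + (q * A powr (q - 1)) * (g x * k x))
   = (A powr q * (1 - q)) * (LINT x. k x) + (q * A powr (q - 1)) * a" using k gk by (simp add: a_def)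
 finally have "(A powr q * (1 - q)) * (LINT x. k x) + (q * A powr (q - 1)) * a <= (LINT x. g x powr q * k x)" .
 \<comment> \<open>Since 1 - q <= 0, enlarging the mass from the integral of k to c lowers this
   term.\<close>
 moreover have "(A powr q * (1 - q)) * c <= (A powr q * (1 - q)) * (LINT x. k x)"
  using q k(2) by (intro mult_left_mono_neg) (auto intro: mult_nonneg_nonpos)
 ultimately have "A powr q * (1 - q) * c + q * A powr (q - 1) * a <= (LINT x. g x powr q * k x)" by linarith
 moreover have "q * A powr (q - 1) * a = q * A powr q * c"
 proof (cases "a = 0")
  case False
  hence "A > 0" "a = A * c" using a k(3) by (auto simp: A_def)
  thus ?thesis by (simp add: powr_diff)
 qed (simp add: A_def)
 ultimately have "A powr q * (1 - q) * c + q * A powr q * c <= (LINT x. g x powr q * k x)" by simp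
 moreover have "A powr q * (1 - q) * c + q * A powr q * c = A powr q * c" by (simp add: algebra_simps)
 ultimately have *: "A powr q * c <= (LINT x. g x powr q * k x)" by simp
 have "a powr q = c powr (q - 1) * (A powr q * c)" using a k(3) by (simp add: A_def powr_divide powr_diff)
 also have "... <= c powr (q - 1) * (LINT x. g x powr q * k x)" by (intro mult_left_mono *) auto
 finally have "ennreal (a powr q) <= ennreal (c powr (q - 1)) * ennreal (LINT x. g x powr q * k x)"
  by (simp add: ennreal_mult'[symmetric] ennreal_leI)
 also have "ennreal (LINT x. g x powr q * k x) = (NINT x. ennreal (g x powr q * k x))" using int nn by (intro nn_integral_eq_integral[symmetric]) auto
 finally show ?thesis using nn by (simp add: a_def ennreal_mult)
qed

text \<open>Young's inequality for convolutions: Jensen for the kernel at each point y, then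
  Tonelli. The positive bound c stands in for the L1 norm of K, which may be zero.\<close>

lemma pint_conv_le: assumes w: "w : LL q" and q: "q >= 1" and K: "K : tf" and c: "(LINT x. cmod (K x)) <= c" "c > 0"
 shows "pint q (conv K w) <= ennreal (c powr q) * pint q w"
proof -
 have [measurable]: "w : Borel" "K : Borel" using w K by (auto simp: LL_borel tf_borel)
 have "ennreal (cmod (conv K w y) powr q) <= ennreal (c powr (q - 1)) * (NINT x. ennreal (cmod (w x) powr q) * ennreal (cmod (K (y - x))))" for y
 proof -
  have "cmod (conv K w y) <= (LINT x. cmod (w x) * cmod (K (y - x)))" unfolding conv_def norm_mult[symmetric] by (rule integral_norm_bound)
  hence "ennreal (cmod (conv K w y) powr q) <= ennreal ((LINT x. cmod (w x) * cmod (K (y - x))) powr q)"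
   using q by (intro ennreal_leI powr_mono2) auto
  also have "... <= ennreal (c powr (q - 1)) * (NINT x. ennreal (cmod (w x) powr q) * ennreal (cmod (K (y - x))))"
  proof (rule jensen_kernel[OF _ _ _ q _ _ c(2)])
   show "L1 (%x. cmod (K (y - x)))" by (intro integrable_norm tf_integrable tf_reflect K)
   show "(LINT x. cmod (K (y - x))) <= c" using c(1) integral_reflect[of "%x. cmod (K x)" y] by simp
   show "L1 (%x. cmod (w x) * cmod (K (y - x)))" using integrable_norm[OF conv_integrable[OF w q K, of y]] by (simp add: norm_mult)
  qed auto
  finally show ?thesis .
 qed
 hence "pint q (conv K w) <= (NINT y. ennreal (c powr (q - 1)) * (NINT x. ennreal (cmod (w x) powr q) * ennreal (cmod (K (y - x)))))"
  unfolding pint_def by (intro nn_integral_mono)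
 also have "... = ennreal (c powr (q - 1)) * (NINT y. (NINT x. ennreal (cmod (w x) powr q) * ennreal (cmod (K (y - x)))))"
  by (intro nn_integral_cmult) measurable
 also have "(NINT y. (NINT x. ennreal (cmod (w x) powr q) * ennreal (cmod (K (y - x)))))
   = (NINT x. (NINT y. ennreal (cmod (w x) powr q) * ennreal (cmod (K (y - x)))))"
  by (intro pair_sigma_finite.Fubini'[OF pair_sigma_finite_lborel]) measurable
 also have "... = (NINT x. ennreal (cmod (w x) powr q) * (NINT y. ennreal (cmod (K y))))"
 proof (intro nn_integral_cong)
  fix x
  have "(NINT y. ennreal (cmod (K (y - x)))) = (NINT y. ennreal (cmod (K y)))"
   using nn_integral_translate[of "%y. ennreal (cmod (K y))" "- x"] by simp
  thus "(NINT y. ennreal (cmod (w x) powr q) * ennreal (cmod (K (y - x)))) = ennreal (cmod (w x) powr q) * (NINT y. ennreal (cmod (K y)))"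
   by (simp add: nn_integral_cmult)
 qed
 also have "... = pint q w * (NINT y. ennreal (cmod (K y)))" unfolding pint_def by (simp add: nn_integral_multc)
 also have "(NINT y. ennreal (cmod (K y))) = ennreal (LINT y. cmod (K y))" by (intro nn_integral_eq_integral integrable_norm tf_integrable K) auto
 also have "... <= ennreal c" using c by (intro ennreal_leI)
 finally have "pint q (conv K w) <= ennreal (c powr (q - 1)) * (pint q w * ennreal c)" by (simp add: mult_left_mono)
 also have "... = ennreal (c powr (q - 1) * c) * pint q w" using c by (simp add: ennreal_mult mult_ac)
 also have "c powr (q - 1) * c = c powr q" using c by (simp add: powr_diff)
 finally show ?thesis .
qed

lemma conv_LL: assumes "w : LL q" "q >= 1" "K : tf" shows "conv K w : LL q"
proof -
 have "pint q (conv K w) <= ennreal (((LINT x. cmod (K x)) + 1) powr q) * pint q w" using assms by (intro pint_conv_le) (auto intro!: add_nonneg_pos)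
 thus ?thesis using assms by (auto simp: LL_def ennreal_mult_less_top tf_borel elim!: le_less_trans)
qed

abbreviation mo :: "nat => ('a::euclidean_space => complex)" where "mo n \<equiv> (%x. complex_of_real (moll n x))"

lemma pint_mo_le: "w : LL q ==> q >= 1 ==> pint q (conv (mo n) w) <= pint q w"
 using pint_conv_le[of w q "mo n" 1] by (simp add: tf_moll moll_nonneg moll_integral)

section \<open>Continuity of translations and convergence of mollifications\<close>

lemma tendsto_0_eps:
 fixes a :: "nat => real" assumes "!!n. a n >= 0" and "!!\<epsilon>. \<epsilon> > 0 ==> EX b. b ~> 0 \<and> (EV n. a n <= \<epsilon> + b n)"
 shows "a ~> 0"
proof (rule tendstoI)
 fix e :: real assume "e > 0"
 then obtain b where b: "b ~> 0" "EV n. a n <= e / 2 + b n" using assms(2)[of "e / 2"] by auto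
 have "EV n. b n < e / 2" using \<open>e > 0\<close> by (intro order_tendstoD(2)[OF b(1)]) simp
 thus "EV n. dist (a n) 0 < e" using b(2) by eventually_elim (use assms(1) in auto)
qed

text \<open>A point of an open set stays in it under small shifts, so the positive part of the
  difference tends to 0, dominated by the indicator. Both indicators have the same integral, hence
  the absolute difference has twice the integral of its positive part.\<close>

lemma L1_translate_open:
 fixes U :: "'a::euclidean_space set" and h :: "nat => 'a" assumes U: "open U" "emeasure lborel U < \<infinity>" and h: "h ~> (0::'a)"
 shows "(%n. LINT x. \<bar>indicator U (x + h n) - indicator U x :: real\<bar>) ~> 0"
proof -
 have [measurable]: "U : sets borel" using U by auto
 have int: "L1 (indicator U :: 'a => real)" using U by auto
 have int2: "L1 (%x. indicator U (x + h n) :: real)" for n using integrable_translate[OF int, of "h n"] by (simp add: add.commute)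
 let ?p = "%n x. max 0 (indicator U x - indicator U (x + h n)) :: real"
 have "(%n. LINT x. ?p n x) ~> (\<integral>x. 0 \<partial>(lborel::'a measure))"
 proof (rule integral_dominated_convergence[OF _ _ int])
  show "AE x. (%n. ?p n x) ~> 0"
  proof (rule AE_I2)
   fix x
   have "EV n. ?p n x = 0"
   proof (cases "x : U")
    case True
    have "(%n. x + h n) ~> x + 0" by (intro tendsto_intros h)
    hence "EV n. x + h n : U" using U(1) True by (auto dest: topological_tendstoD)
    thus ?thesis by eventually_elim (use True in auto)
   qed (auto simp: indicator_def)
   thus "(%n. ?p n x) ~> 0" by (rule tendsto_eventually)
  qed
 qed (auto simp: indicator_def)
 hence "(%n. 2 * (LINT x. ?p n x)) ~> 0" by (auto intro: tendsto_eq_intros)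
 moreover have "2 * (LINT x. ?p n x) = (LINT x. \<bar>indicator U (x + h n) - indicator U x :: real\<bar>)" for n
 proof -
  have "(LINT x. \<bar>indicator U (x + h n) - indicator U x :: real\<bar>)
   = (LINT x. (indicator U (x + h n) - indicator U x) + 2 * ?p n x)" by (intro Bochner_Integration.integral_cong) (auto simp: indicator_def)
  also have "... = (LINT x. indicator U (x + h n)) - (LINT x. indicator U x) + 2 * (LINT x. ?p n x)"
   using int int2[of n] by (subst Bochner_Integration.integral_add) auto
  also have "(LINT x. indicator U (x + h n)) = (LINT x. (indicator U x :: real))"
   using integral_translate[of "indicator U :: 'a => real" "h n"] by (simp add: add.commute)
  finally show ?thesis by simp
 qed
 ultimately show ?thesis by simp
qed

text \<open>By outer regularity A is replaced by an open superset; this costs the excess measure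
  twice, once at x and once at the shifted point.\<close>

lemma L1_translate_indicator:
 fixes A :: "'a::euclidean_space set" and h :: "nat => 'a" assumes A: "A : sets lborel" "emeasure lborel A < \<infinity>" and h: "h ~> (0::'a)"
 shows "(%n. LINT x. \<bar>indicator A (x + h n) - indicator A x :: real\<bar>) ~> 0"
proof (rule tendsto_0_eps)
 fix \<epsilon> :: real assume \<epsilon>: "\<epsilon> > 0"
 have [measurable]: "A : sets borel" using A by auto
 obtain U where U: "open U" "A \<subseteq> U" "emeasure lborel (U - A) < ennreal (\<epsilon> / 2)"
  using outer_regular_lborel[of A "\<epsilon> / 2"] A \<epsilon> by auto
 have [measurable]: "U : sets borel" using U by auto
 have "emeasure lborel U <= emeasure lborel A + emeasure lborel (U - A)"
  using emeasure_subadditive[of A lborel "U - A"] U(2) by (simp add: Un_absorb1)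
 also have "... < \<infinity>" using A U(3) by (auto intro: less_trans)
 finally have Uf: "emeasure lborel U < \<infinity>" .
 have fin: "emeasure lborel (U - A) < \<infinity>" using U(3) by (auto intro: less_trans)
 have m: "measure lborel (U - A) <= \<epsilon> / 2"
  using U(3) fin \<epsilon> unfolding measure_def by (metis enn2real_leI ennreal_less_top half_gt_zero le_less less_eq_real_def)
 have iD: "L1 (indicator (U - A) :: 'a => real)" and iU: "L1 (indicator U :: 'a => real)"
  and iA: "L1 (indicator A :: 'a => real)" using fin Uf A by auto
 note tr = iD[THEN integrable_translate] iU[THEN integrable_translate] iA[THEN integrable_translate]
 have "(LINT x. \<bar>indicator A (x + h n) - indicator A x :: real\<bar>)
   <= \<epsilon> + (LINT x. \<bar>indicator U (x + h n) - indicator U x :: real\<bar>)" for n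
 proof -
  have "(LINT x. \<bar>indicator A (h n + x) - indicator A x :: real\<bar>)
    <= (LINT x. indicator (U - A) (h n + x) + indicator (U - A) x + \<bar>indicator U (h n + x) - indicator U x :: real\<bar>)"
   by (intro integral_mono Bochner_Integration.integrable_add integrable_abs Bochner_Integration.integrable_diff tr iD iU iA)
    (use U(2) in \<open>auto simp: indicator_def\<close>)
  also have "... = (LINT x. indicator (U - A) (h n + x)) + (LINT x. indicator (U - A) x)
    + (LINT x. \<bar>indicator U (h n + x) - indicator U x :: real\<bar>)"
   using tr[of "h n"] iD iU iA by (subst Bochner_Integration.integral_add; auto)+
  also have "(LINT x. indicator (U - A) (h n + x)) = (LINT x. (indicator (U - A) x :: real))" by (rule integral_translate) simp
  also have "(LINT x. indicator (U - A) x) = measure lborel (U - A)" by simp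
  finally show ?thesis using m by (simp add: add.commute)
 qed
 thus "EX b. b ~> 0 \<and> (EV n. (LINT x. \<bar>indicator A (x + h n) - indicator A x :: real\<bar>) <= \<epsilon> + b n)"
  using L1_translate_open[OF U(1) Uf h] by (intro exI conjI always_eventually allI)
qed auto

lemma L1_translate:
 fixes f :: "'a::euclidean_space => complex" and h :: "nat => 'a" assumes "L1 f" and h: "h ~> (0::'a)"
 shows "(%n. LINT x. cmod (f (x + h n) - f x)) ~> 0" using assms(1)
proof induction
 case (base A c)
 have "(%n. (LINT x. \<bar>indicator A (x + h n) - indicator A x :: real\<bar>) * cmod c) ~> 0 * cmod c"
  using base by (intro tendsto_mult tendsto_const L1_translate_indicator h) auto
 moreover have "cmod (indicat_real A (x + h n) *R c - indicat_real A x *R c) = \<bar>indicator A (x + h n) - indicator A x\<bar> * cmod c" for x n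
  by (simp flip: scaleR_left_diff_distrib)
 ultimately show ?case by simp
next
 case (add f g)
 have tr: "L1 (%x. f (x + c))" "L1 (%x. g (x + c))" for c
  using integrable_translate[OF add.hyps(1), of c] integrable_translate[OF add.hyps(2), of c] by (auto simp: add.commute)
 have "(LINT x. cmod (f (x + h n) + g (x + h n) - (f x + g x)))
  <= (LINT x. cmod (f (x + h n) - f x)) + (LINT x. cmod (g (x + h n) - g x))" for n
 proof -
  have "(LINT x. cmod (f (x + h n) + g (x + h n) - (f x + g x)))
   <= (LINT x. cmod (f (x + h n) - f x) + cmod (g (x + h n) - g x))"
   using tr add.hyps by (intro integral_mono Bochner_Integration.integrable_add integrable_norm Bochner_Integration.integrable_diff)
    (auto simp: add_diff_add intro: norm_triangle_ineq)
  thus ?thesis using tr add.hyps by simp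
 qed
 thus ?case by (intro Lim_null_comparison[OF _ tendsto_add_zero[OF add.IH]]) auto
next
 case (lim f s)
 show ?case
 proof (rule tendsto_0_eps)
  fix \<epsilon> :: real assume \<epsilon>: "\<epsilon> > 0"
  have "(%i. LINT x. cmod (s i x - f x)) ~> (\<integral>x. 0 \<partial>(lborel::'a measure))"
  proof (rule integral_dominated_convergence[where w="%x. 3 * cmod (f x)"])
   show "AE x. (%i. cmod (s i x - f x)) ~> 0" using lim.hyps(2) by (auto intro!: tendsto_norm_zero LIM_zero)
   have "cmod (s i x - f x) <= 3 * cmod (f x)" for i x using norm_triangle_ineq4[of "s i x" "f x"] lim.hyps(3)[of x i] by simp
   thus "AE x. norm (cmod (s i x - f x)) <= 3 * cmod (f x)" for i by simp
  qed (use lim.hyps in auto)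
  hence "EV i. (LINT x. cmod (s i x - f x)) < \<epsilon> / 2" using \<epsilon> by (intro order_tendstoD(2)) auto
  then obtain i where i: "(LINT x. cmod (s i x - f x)) < \<epsilon> / 2" using eventually_happens' sequentially_bot by blast
  have tr: "L1 (%x. f (x + c))" "L1 (%x. s i (x + c))" for c
   using integrable_translate[OF lim.hyps(4), of c] integrable_translate[OF lim.hyps(1)[of i], of c] by (auto simp: add.commute)
  have "(LINT x. cmod (f (x + h n) - f x)) <= \<epsilon> + (LINT x. cmod (s i (x + h n) - s i x))" for n
  proof -
   have "(LINT x. cmod (f (x + h n) - f x))
    <= (LINT x. cmod (s i (x + h n) - f (x + h n)) + cmod (s i x - f x) + cmod (s i (x + h n) - s i x))"
   proof (intro integral_mono Bochner_Integration.integrable_add integrable_norm Bochner_Integration.integrable_diff tr lim.hyps)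
    fix x
    show "cmod (f (x + h n) - f x) <= cmod (s i (x + h n) - f (x + h n)) + cmod (s i x - f x) + cmod (s i (x + h n) - s i x)" by norm
   qed
   also have "... = (LINT x. cmod (s i (x + h n) - f (x + h n))) + (LINT x. cmod (s i x - f x)) + (LINT x. cmod (s i (x + h n) - s i x))"
    using tr lim.hyps by simp
   also have "(LINT x. cmod (s i (x + h n) - f (x + h n))) = (LINT x. cmod (s i x - f x))"
    using integral_translate[of "%x. cmod (s i x - f x)" "h n"] lim.hyps(1)[of i] lim.hyps(4) by (auto simp: add.commute)
   finally show ?thesis using i by simp
  qed
  thus "EX b. b ~> 0 \<and> (EV n. (LINT x. cmod (f (x + h n) - f x)) <= \<epsilon> + b n)"
   using lim.IH[of i] by (intro exI conjI always_eventually allI)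
 qed auto
qed

lemma pint_tendsto_dominated:
 fixes s :: "nat => 'a::euclidean_space => complex" assumes [measurable]: "!!n. s n : Borel" and "q > 0" and "w : LL q"
  and "AE x. (%n. s n x) ~> 0" and "!!n. AE x. cmod (s n x) <= cmod (w x)" shows "(%n. pint q (s n)) ~> 0"
proof -
 have [measurable]: "w : Borel" using assms(3) by (rule LL_borel)
 have "(%n. pint q (s n)) ~> (\<integral>\<^sup>+x. 0 \<partial>(lborel::'a measure))" unfolding pint_def
 proof (rule nn_integral_dominated_convergence[where w="%x. ennreal (cmod (w x) powr q)"])
  show "(NINT x. ennreal (cmod (w x) powr q)) < \<infinity>" using assms(3) by (simp add: LL_def pint_def)
  show "AE x. (%n. ennreal (cmod (s n x) powr q)) ~> 0" using assms(4)
  proof eventually_elim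
   case (elim x)
   hence "(%n. cmod (s n x)) ~> 0" by (rule tendsto_norm_zero)
   hence "(%n. cmod (s n x) powr q) ~> 0 powr q" using assms(2) by (intro tendsto_powr2 tendsto_const) auto
   thus ?case using tendsto_ennrealI by fastforce
  qed
  show "AE x. ennreal (cmod (s n x) powr q) <= ennreal (cmod (w x) powr q)" for n
   using assms(5)[of n] by eventually_elim (use assms(2) in \<open>auto intro!: ennreal_leI powr_mono2\<close>)
 qed auto
 thus ?thesis by simp
qed

lemma tendsto_0_eps_ennreal:
 fixes a :: "nat => ennreal" assumes "!!\<epsilon>. \<epsilon> > 0 ==> EX b. b ~> 0 \<and> (EV n. a n <= ennreal \<epsilon> + b n)" shows "a ~> 0"
proof (rule tendsto_zero_ennreal)
 fix e :: real assume "e > 0"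
 then obtain b where b: "b ~> 0" "EV n. a n <= ennreal (e / 2) + b n" using assms(1)[of "e / 2"] by auto
 have "EV n. b n < ennreal (e / 2)" using b(1) \<open>e > 0\<close> by (auto intro: order_tendstoD)
 thus "EV n. a n < ennreal e" using b(2)
 proof eventually_elim
  case (elim n)
  have "ennreal (e / 2) + b n < ennreal (e / 2) + ennreal (e / 2)" using elim by (simp add: ennreal_add_left_cancel_less)
  also have "... = ennreal e" using \<open>e > 0\<close> by (simp add: ennreal_plus[symmetric] del: ennreal_plus)
  finally show ?case using elim by (auto intro: le_less_trans)
 qed
qed

text \<open>Truncating in size and support gives bounded integrable functions, for which the L^q
  increment is controlled by the L^1 increment.\<close>

lemma LL_translate_seq:
 fixes w :: "'a::euclidean_space => complex" assumes w: "w : LL q" and q: "q >= 1" and h: "h ~> (0::'a)"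
 shows "(%n. pint q (%x. w (x + h n) - w x)) ~> 0"
proof (rule tendsto_0_eps_ennreal)
 fix \<epsilon> :: real assume \<epsilon>: "\<epsilon> > 0"
 have [measurable]: "w : Borel" using w by (rule LL_borel)
 define v where "v = (%(k::nat) x. if cmod (w x) <= k \<and> norm x <= k then w x else 0)"
 have [measurable]: "v k : Borel" for k unfolding v_def by measurable
 define C where "C = 2 powr q"
 have C: "C > 0" by (simp add: C_def)
 have "(%k. pint q (%x. w x - v k x)) ~> 0"
 proof (rule pint_tendsto_dominated[OF _ _ w])
  show "AE x. (%k. w x - v k x) ~> 0"
  proof (rule AE_I2, rule tendsto_eventually)
   fix x :: 'a
   have "EV k. k >= nat \<lceil>max (cmod (w x)) (norm x)\<rceil>" by (rule eventually_ge_at_top)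
   thus "EV k. w x - v k x = 0" by eventually_elim (simp add: v_def nat_le_iff ceiling_le_iff)
  qed
 qed (use q in \<open>auto simp: v_def\<close>)
 \<comment> \<open>The truncation error enters at x and at the shifted point and passes twice
   through the quasi-triangle inequality with constant C, which gives it the weight 2 C^2.\<close>
 hence "EV k. pint q (%x. w x - v k x) < ennreal (\<epsilon> / (2 * C * C + C))"
  using \<epsilon> C by (intro order_tendstoD) (auto intro!: divide_pos_pos add_pos_pos)
 then obtain k where k: "pint q (%x. w x - v k x) < ennreal (\<epsilon> / (2 * C * C + C))" using eventually_happens' sequentially_bot by blast
 let ?e = "pint q (%x. w x - v k x)"
 have vint: "L1 (v k)"
 proof (rule integrableI_bounded_set[where A="cball 0 (real k)" and B="real k"])
  show "emeasure lborel (cball 0 (real k) :: 'a set) < \<infinity>" by (rule emeasure_lborel_cball_finite)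
 qed (auto simp: v_def)
 have b1: "pint q (%x. v k (x + h n) - v k x) <= ennreal ((2 * k) powr (q - 1) * (LINT x. cmod (v k (x + h n) - v k x)))" for n
 proof -
  have pw: "cmod (v k (x + h n) - v k x) powr q <= (2 * k) powr (q - 1) * cmod (v k (x + h n) - v k x)" for x
  proof (cases "cmod (v k (x + h n) - v k x) = 0")
   case False
   have "cmod (v k (x + h n) - v k x) <= 2 * k" using norm_triangle_ineq4[of "v k (x + h n)" "v k x"] by (auto simp: v_def split: if_splits)
   hence "cmod (v k (x + h n) - v k x) powr (q - 1) * cmod (v k (x + h n) - v k x) <= (2 * k) powr (q - 1) * cmod (v k (x + h n) - v k x)"
    using q by (intro mult_right_mono powr_mono2) auto
   thus ?thesis using False by (simp add: powr_diff)
  qed (use q in auto)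
  have i: "L1 (%x. cmod (v k (x + h n) - v k x))" using vint integrable_translate[OF vint, of "h n"] by (auto simp: add.commute)
  have "pint q (%x. v k (x + h n) - v k x) <= (NINT x. ennreal ((2 * k) powr (q - 1) * cmod (v k (x + h n) - v k x)))"
   unfolding pint_def by (intro nn_integral_mono ennreal_leI pw)
  also have "... = ennreal (LINT x. (2 * k) powr (q - 1) * cmod (v k (x + h n) - v k x))" using i by (intro nn_integral_eq_integral) auto
  finally show ?thesis by simp
 qed
 have "(%n. ennreal C * ennreal C * pint q (%x. v k (x + h n) - v k x)) ~> 0"
 proof -
  have "(%n. C * C * ((2 * k) powr (q - 1) * (LINT x. cmod (v k (x + h n) - v k x)))) ~> C * C * ((2 * k) powr (q - 1) * 0)"
   by (intro tendsto_mult tendsto_const L1_translate[OF vint h])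
  hence "(%n. ennreal (C * C * ((2 * k) powr (q - 1) * (LINT x. cmod (v k (x + h n) - v k x))))) ~> 0" using tendsto_ennrealI by fastforce
  thus ?thesis
  proof (rule tendsto_sandwich[OF _ _ tendsto_const, rotated 2])
   show "EV n. ennreal C * ennreal C * pint q (%x. v k (x + h n) - v k x)
    <= ennreal (C * C * ((2 * k) powr (q - 1) * (LINT x. cmod (v k (x + h n) - v k x))))"
   proof (intro always_eventually allI)
    fix n
    have "ennreal (C * C) * pint q (%x. v k (x + h n) - v k x)
     <= ennreal (C * C) * ennreal ((2 * k) powr (q - 1) * (LINT x. cmod (v k (x + h n) - v k x)))" by (intro mult_left_mono b1) auto
    thus "ennreal C * ennreal C * pint q (%x. v k (x + h n) - v k x)
     <= ennreal (C * C * ((2 * k) powr (q - 1) * (LINT x. cmod (v k (x + h n) - v k x))))"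
     using C by (simp only: ennreal_mult''[symmetric] ennreal_mult'[symmetric] less_imp_le mult_nonneg_nonneg)
   qed
  qed auto
 qed
 moreover have "pint q (%x. w (x + h n) - w x) <= ennreal \<epsilon> + ennreal C * ennreal C * pint q (%x. v k (x + h n) - v k x)" for n
 proof -
  have "pint q (%x. w (x + h n) - w x) = pint q (%x. ((w (x + h n) - v k (x + h n)) - (w x - v k x)) + (v k (x + h n) - v k x))"
   by (simp add: algebra_simps)
  also have "... <= ennreal C * (pint q (%x. (w (x + h n) - v k (x + h n)) - (w x - v k x)) + pint q (%x. v k (x + h n) - v k x))"
   unfolding C_def using q by (intro pint_add_le) auto
  also have "... <= ennreal C * (ennreal C * (pint q (%x. w (x + h n) - v k (x + h n)) + ?e) + ennreal C * pint q (%x. v k (x + h n) - v k x))"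
  proof (intro mult_left_mono add_mono)
   show "pint q (%x. (w (x + h n) - v k (x + h n)) - (w x - v k x)) <= ennreal C * (pint q (%x. w (x + h n) - v k (x + h n)) + ?e)"
    unfolding C_def using q by (intro pint_diff_le) auto
   have "1 <= C" using q by (simp add: C_def ge_one_powr_ge_zero)
   hence "1 * pint q (%x. v k (x + h n) - v k x) <= ennreal C * pint q (%x. v k (x + h n) - v k x)" by (intro mult_right_mono) auto
   thus "pint q (%x. v k (x + h n) - v k x) <= ennreal C * pint q (%x. v k (x + h n) - v k x)" by simp
  qed auto
  also have "pint q (%x. w (x + h n) - v k (x + h n)) = ?e" using pint_translate[of "%x. w x - v k x" q "h n"] by simp
  also have "ennreal C * (ennreal C * (?e + ?e) + ennreal C * pint q (%x. v k (x + h n) - v k x))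
    = ennreal (2 * C * C) * ?e + ennreal C * ennreal C * pint q (%x. v k (x + h n) - v k x)"
  proof -
   have "ennreal (2 * C * C) = 2 * (ennreal C * ennreal C)" using C by (simp add: ennreal_mult mult.assoc)
   thus ?thesis by (simp only: mult_2[symmetric] distrib_left mult_ac)
  qed
  also have "ennreal (2 * C * C) * ?e <= ennreal (2 * C * C) * ennreal (\<epsilon> / (2 * C * C + C))" using k by (intro mult_left_mono) auto
  also have "... <= ennreal \<epsilon>"
  proof -
   have "2 * C * C * (\<epsilon> / (2 * C * C + C)) <= \<epsilon>" using C \<epsilon> by (simp add: pos_divide_le_eq add_pos_pos algebra_simps)
   thus ?thesis using C \<epsilon> by (simp add: ennreal_mult'[symmetric] ennreal_leI)
  qed
  finally show ?thesis by (simp add: add_right_mono)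
 qed
 ultimately show "EX b. b ~> 0 \<and> (EV n. pint q (%x. w (x + h n) - w x) <= ennreal \<epsilon> + b n)"
  by (intro exI[of _ "%n. ennreal C * ennreal C * pint q (%x. v k (x + h n) - v k x)"]) auto
qed

lemma LL_translate_uniform:
 fixes w :: "'a::euclidean_space => complex" assumes w: "w : LL q" and q: "q >= 1" and e: "e > 0"
 shows "EX \<delta>>0. ALL h. norm h < \<delta> --> pint q (%x. w (x + h) - w x) <= ennreal e"
proof (rule ccontr)
 assume "\<not> ?thesis"
 hence "ALL n. EX h::'a. norm h < 1 / real (Suc n) \<and> ennreal e < pint q (%x. w (x + h) - w x)"
  by (metis not_le of_nat_0_less_iff zero_less_Suc zero_less_divide_1_iff)
 then obtain h :: "nat => 'a" where h: "!!n. norm (h n) < 1 / real (Suc n)" "!!n. ennreal e < pint q (%x. w (x + h n) - w x)" by metis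
 have "h ~> 0" using LIMSEQ_Suc[OF lim_1_over_n[where 'a=real]] h(1)
  by (intro Lim_null_comparison[of h "%n. 1 / real (Suc n)"] always_eventually allI) (auto intro: less_imp_le simp del: of_nat_Suc)
 from LL_translate_seq[OF w q this] have "EV n. pint q (%x. w (x + h n) - w x) < ennreal e" using e by (auto intro: order_tendstoD)
 then obtain n where "pint q (%x. w (x + h n) - w x) < ennreal e" using eventually_happens' sequentially_bot by blast
 thus False using h(2)[of n] by simp
qed

text \<open>The mollification error is an average of increments w(y-z) - w(y) against
  \<open>moll n\<close>. Jensen moves the power inside, and only shifts z in the small support of
  the kernel count.\<close>

lemma mo_convergence:
 fixes w :: "'a::euclidean_space => complex" assumes w: "w : LL q" and q: "q >= 1" shows "(%n. pint q (%x. conv (mo n) w x - w x)) ~> 0"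
proof (rule tendsto_0_eps_ennreal)
 fix \<epsilon> :: real assume \<epsilon>: "\<epsilon> > 0"
 have [measurable]: "w : Borel" using w by (rule LL_borel)
 obtain \<delta> where \<delta>: "\<delta> > 0" "!!h. norm h < \<delta> ==> pint q (%x. w (x + h) - w x) <= ennreal \<epsilon>"
  using LL_translate_uniform[OF w q \<epsilon>] by auto
 have "pint q (%x. conv (mo n) w x - w x) <= ennreal \<epsilon>" if n: "1 / real (Suc n) < \<delta>" for n
 proof -
  have "ennreal (cmod (conv (mo n) w y - w y) powr q)
    <= (NINT z. ennreal (cmod (w (y - z) - w y) powr q) * ennreal (moll n z))" for y
  proof -
   have i1: "L1 (%z. w (y - z) * mo n z)" using integrable_distr[of "%z. y - z" lborel borel "%x::'a. w x * mo n (y - x)"]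
     conv_integrable[OF w q tf_moll, of n y] by (simp add: distr_reflect)
   have i2: "L1 (%z. w y * mo n (z::'a))" using moll_integrable[of n, where 'a='a] by auto
   have i3: "L1 (%z. (w (y - z) - w y) * mo n z)" using Bochner_Integration.integrable_diff[OF i1 i2] by (simp add: algebra_simps)
   have "(LINT z. (w (y - z) - w y) * mo n z) = conv (mo n) w y - w y * (LINT z. mo n (z::'a))"
   proof -
    have "(LINT z. (w (y - z) - w y) * mo n z) = (LINT z. w (y - z) * mo n z) - (LINT z. w y * mo n (z::'a))"
     using i1 i2 by (simp only: left_diff_distrib Bochner_Integration.integral_diff)
    also have "(LINT z. w (y - z) * mo n z) = conv (mo n) w y" by (rule conv_alt[symmetric]) auto
    also have "(LINT z. w y * mo n (z::'a)) = w y * (LINT z. mo n (z::'a))" by (rule integral_mult_right_zero)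
    finally show ?thesis .
   qed
   also have "(LINT z. mo n (z::'a)) = 1" by (simp add: moll_integral)
   finally have "cmod (conv (mo n) w y - w y) = cmod (LINT z. (w (y - z) - w y) * mo n z)" by simp
   also have "... <= (LINT z. cmod (w (y - z) - w y) * moll n z)"
    using integral_norm_bound[of lborel "%z. (w (y - z) - w y) * mo n z"] by (simp add: norm_mult moll_nonneg)
   finally have "ennreal (cmod (conv (mo n) w y - w y) powr q) <= ennreal ((LINT z. cmod (w (y - z) - w y) * moll n z) powr q)"
    using q by (intro ennreal_leI powr_mono2) auto
   also have "... <= ennreal (1 powr (q - 1)) * (NINT z. ennreal (cmod (w (y - z) - w y) powr q) * ennreal (moll n z))"
   proof (rule jensen_kernel[OF _ _ moll_nonneg q moll_integrable])
    show "L1 (%z. cmod (w (y - z) - w y) * moll n z)" using integrable_norm[OF i3] by (simp add: norm_mult moll_nonneg)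
   qed (simp_all add: moll_integral)
   finally show ?thesis by simp
  qed
  note * = this
  have pt: "pint q (%y. w (y + (- z)) - w y) * ennreal (moll n z) <= ennreal \<epsilon> * ennreal (moll n z)" for z :: 'a
  proof (cases "norm z < \<delta>")
   case True
   hence "pint q (%y. w (y + (- z)) - w y) <= ennreal \<epsilon>" using \<delta>(2)[of "- z"] by simp
   thus ?thesis by (rule mult_right_mono) simp
  next
   case False
   hence "moll n z = 0" using n by (intro moll_eq_0) linarith
   thus ?thesis by simp
  qed
  have "pint q (%x. conv (mo n) w x - w x)
    <= (NINT y. (NINT z. ennreal (cmod (w (y - z) - w y) powr q) * ennreal (moll n z)))" unfolding pint_def by (rule nn_integral_mono) (rule *)
  also have "... = (NINT z. (NINT y. ennreal (cmod (w (y - z) - w y) powr q) * ennreal (moll n z)))"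
   by (intro pair_sigma_finite.Fubini'[OF pair_sigma_finite_lborel]) measurable
  also have "... = (NINT z. pint q (%y. w (y + (- z)) - w y) * ennreal (moll n z))"
   unfolding pint_def by (intro nn_integral_cong) (simp add: nn_integral_multc)
  also have "... <= (\<integral>\<^sup>+z. ennreal \<epsilon> * ennreal (moll n z) \<partial>(lborel::'a measure))"
   by (rule nn_integral_mono) (rule pt)
  also have "... = ennreal \<epsilon>" by (simp add: nn_integral_cmult nn_integral_moll)
  finally show ?thesis .
 qed
 moreover have "EV n. 1 / real (Suc n) < \<delta>" using LIMSEQ_Suc[OF lim_1_over_n[where 'a=real]] \<delta>(1) by (intro order_tendstoD) auto
 ultimately show "EX b. b ~> 0 \<and> (EV n. pint q (%x. conv (mo n) w x - w x) <= ennreal \<epsilon> + b n)"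
  by (intro exI[of _ "%_. 0"]) (auto elim!: eventually_mono)
qed

section \<open>The space \<open>L\<^sup>2\<close>\<close>

definition L2 :: "'b measure => ('b => complex) set" where
 "L2 M = {w : borel_measurable M. integrable M (%x. (cmod (w x))^2)}"

definition n2 :: "'b measure => ('b => complex) => real" where
 "n2 M w = sqrt (LINT x|M. (cmod (w x))^2)"

definition ip :: "'b measure => ('b => complex) => ('b => complex) => complex" where
 "ip M u v = (LINT x|M. u x * cnj (v x))"

lemma borel_measurable_cnj [measurable (raw)]: "f : borel_measurable M ==> (%x. cnj (f x)) : borel_measurable M"
 by (rule borel_measurable_continuous_on[OF continuous_on_cnj[OF continuous_on_id]])

lemma L2_borel [measurable_dest]: "w : L2 M ==> w : borel_measurable M" by (simp add: L2_def)

lemma L2_integrable: "w : L2 M ==> integrable M (%x. (cmod (w x))^2)" by (simp add: L2_def)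

lemma n2_nonneg [simp]: "n2 M w >= 0" by (simp add: n2_def)

lemma n2_sq: "(n2 M w)^2 = (LINT x|M. (cmod (w x))^2)" by (simp add: n2_def)

lemma L2_bound_integrable: assumes "u : L2 M" "v : L2 M" "g : borel_measurable M" "!!x. cmod (g x) <= cmod (u x) * cmod (v x)" shows "integrable M g"
proof (rule Bochner_Integration.integrable_bound)
 show "integrable M (%x. (cmod (u x))^2 + (cmod (v x))^2)" using assms(1,2) by (auto simp: L2_def)
 have "cmod (g x) <= (cmod (u x))^2 + (cmod (v x))^2" for x
 proof -
  have "0 <= cmod (u x) * cmod (v x)" by simp
  thus ?thesis using assms(4)[of x] sum_squares_bound[of "cmod (u x)" "cmod (v x)"] by linarith
 qed
 thus "AE x in M. norm (g x) <= norm ((cmod (u x))^2 + (cmod (v x))^2)" by auto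
qed fact

lemma L2_mult_integrable: "u : L2 M ==> v : L2 M ==> integrable M (%x. u x * v x)" by (rule L2_bound_integrable[of u M v]) (auto simp: norm_mult)

lemma L2_ip_integrable: "u : L2 M ==> v : L2 M ==> integrable M (%x. u x * cnj (v x))" by (rule L2_bound_integrable[of u M v]) (auto simp: norm_mult)

lemma L2_cmod_mult_integrable: "u : L2 M ==> v : L2 M ==> integrable M (%x. cmod (u x) * cmod (v x))"
 using integrable_norm[OF L2_mult_integrable[of u M v]] by (simp add: norm_mult)

lemma L2_cnj: "u : L2 M ==> (%x. cnj (u x)) : L2 M" by (auto simp: L2_def)

lemma n2_cnj [simp]: "n2 M (%x. cnj (u x)) = n2 M u" by (simp add: n2_def)

lemma L2_cmult: "u : L2 M ==> (%x. c * u x) : L2 M" by (auto simp: L2_def norm_mult power_mult_distrib)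

lemma L2_zero [simp]: "(%x. 0) : L2 M" by (simp add: L2_def)

lemma L2_add: assumes "u : L2 M" "v : L2 M" shows "(%x. u x + v x) : L2 M"
proof -
 have "(cmod (u x + v x))^2 <= 2 * ((cmod (u x))^2 + (cmod (v x))^2)" for x
 proof -
  have "(cmod (u x + v x))^2 <= (cmod (u x) + cmod (v x))^2" by (intro power_mono norm_triangle_ineq) auto
  also have "... <= 2 * ((cmod (u x))^2 + (cmod (v x))^2)" using sum_squares_bound[of "cmod (u x)" "cmod (v x)"] by (simp add: power2_sum)
  finally show ?thesis .
 qed
 moreover have "integrable M (%x. 2 * ((cmod (u x))^2 + (cmod (v x))^2))" using assms by (auto simp: L2_def)
 ultimately show ?thesis using assms
  by (auto simp: L2_def intro: Bochner_Integration.integrable_bound[where f="%x. 2 * ((cmod (u x))^2 + (cmod (v x))^2)"])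
qed

lemma L2_diff: "u : L2 M ==> v : L2 M ==> (%x. u x - v x) : L2 M" using L2_add[of u M "%x. (-1) * v x"] L2_cmult[of v M "-1"] by simp

lemma L2_sum: "finite S ==> (!!i. i : S ==> f i : L2 M) ==> (%x. SUM i:S. f i x) : L2 M" by (induction S rule: finite_induct) (auto intro: L2_add)

lemma L2_cong_AE: "u : L2 M ==> v : borel_measurable M ==> AE x in M. u x = v x ==> v : L2 M"
 unfolding L2_def by (auto intro!: integrable_cong_AE_imp[of M "%x. (cmod (u x))^2"])

lemma n2_cong_AE: "u : borel_measurable M ==> v : borel_measurable M ==> AE x in M. u x = v x ==> n2 M u = n2 M v"
 unfolding n2_def by (auto intro!: arg_cong[where f=sqrt] integral_cong_AE)

lemma cauchy_schwarz_cmod: assumes "u : L2 M" "v : L2 M" shows "(LINT x|M. cmod (u x) * cmod (v x)) <= n2 M u * n2 M v"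
proof -
 have [measurable]: "u : borel_measurable M" "v : borel_measurable M" using assms by (auto simp: L2_def)
 have "(\<integral>\<^sup>+x. ennreal (cmod (u x)) * ennreal (cmod (v x)) \<partial>M)^2 <= (\<integral>\<^sup>+x. (ennreal (cmod (u x)))^2 \<partial>M) * (\<integral>\<^sup>+x. (ennreal (cmod (v x)))^2 \<partial>M)"
  by (intro Cauchy_Schwarz_nn_integral) auto
 also have "(\<integral>\<^sup>+x. (ennreal (cmod (u x)))^2 \<partial>M) = ennreal ((n2 M u)^2)"
  unfolding n2_sq using assms by (simp add: ennreal_power nn_integral_eq_integral L2_def)
 also have "(\<integral>\<^sup>+x. (ennreal (cmod (v x)))^2 \<partial>M) = ennreal ((n2 M v)^2)"
  unfolding n2_sq using assms by (simp add: ennreal_power nn_integral_eq_integral L2_def)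
 also have "(\<integral>\<^sup>+x. ennreal (cmod (u x)) * ennreal (cmod (v x)) \<partial>M) = ennreal (LINT x|M. cmod (u x) * cmod (v x))"
  using L2_cmod_mult_integrable[OF assms] by (simp add: ennreal_mult[symmetric] nn_integral_eq_integral)
 finally have "(LINT x|M. cmod (u x) * cmod (v x))^2 <= (n2 M u * n2 M v)^2" by (simp add: ennreal_power ennreal_mult[symmetric] power_mult_distrib)
 thus ?thesis by (rule power2_le_imp_le) simp
qed

lemma cauchy_schwarz: "u : L2 M ==> v : L2 M ==> cmod (LINT x|M. u x * v x) <= n2 M u * n2 M v"
 using integral_norm_bound[of M "%x. u x * v x"] cauchy_schwarz_cmod[of u M v] by (simp add: norm_mult)

lemma ip_cauchy_schwarz: "u : L2 M ==> v : L2 M ==> cmod (ip M u v) <= n2 M u * n2 M v"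
 unfolding ip_def using cauchy_schwarz[OF _ L2_cnj] by fastforce

lemma ip_self: "ip M u u = of_real ((n2 M u)^2)" unfolding ip_def n2_sq by (simp add: complex_norm_square[symmetric] del: of_real_power)

lemma ip_cnj: "cnj (ip M u v) = ip M v u" unfolding ip_def by (subst Bochner_Integration.integral_cnj[symmetric]) (simp add: mult.commute)

lemma ip_cmult_left: "ip M (%x. c * u x) v = c * ip M u v" unfolding ip_def by (simp add: mult.assoc)

lemma ip_cmult_right: "ip M u (%x. c * v x) = cnj c * ip M u v" unfolding ip_def by (simp add: mult.left_commute)

lemma ip_diff_left: "u : L2 M ==> v : L2 M ==> w : L2 M ==> ip M (%x. u x - v x) w = ip M u w - ip M v w"
 unfolding ip_def by (simp add: left_diff_distrib L2_ip_integrable)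

lemma ip_diff_right: "u : L2 M ==> v : L2 M ==> w : L2 M ==> ip M w (%x. u x - v x) = ip M w u - ip M w v"
 unfolding ip_def by (simp add: right_diff_distrib L2_ip_integrable)

lemma ip_add_left: "u : L2 M ==> v : L2 M ==> w : L2 M ==> ip M (%x. u x + v x) w = ip M u w + ip M v w"
 unfolding ip_def by (simp add: distrib_right L2_ip_integrable)

lemma ip_add_right: "u : L2 M ==> v : L2 M ==> w : L2 M ==> ip M w (%x. u x + v x) = ip M w u + ip M w v"
 unfolding ip_def by (simp add: distrib_left L2_ip_integrable)

lemma ip_sum_left: "finite S ==> (!!i. i : S ==> f i : L2 M) ==> w : L2 M ==> ip M (%x. SUM i:S. f i x) w = (SUM i:S. ip M (f i) w)"
proof (induction S rule: finite_induct)
 case (insert i S)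
 thus ?case using ip_add_left[of "f i" M "%x. SUM i:S. f i x" w] by (simp add: L2_sum)
qed (simp add: ip_def)

lemma n2_add_sq: assumes "u : L2 M" "v : L2 M" shows "(n2 M (%x. u x + v x))^2 = (n2 M u)^2 + (n2 M v)^2 + 2 * Re (ip M u v)"
proof -
 have "complex_of_real ((n2 M (%x. u x + v x))^2) = ip M u u + ip M v v + (ip M u v + cnj (ip M u v))"
  unfolding ip_self[symmetric] ip_cnj using assms by (simp add: ip_add_left ip_add_right L2_add)
 also have "... = of_real ((n2 M u)^2 + (n2 M v)^2 + 2 * Re (ip M u v))" by (simp add: ip_self complex_add_cnj)
 finally show ?thesis using of_real_eq_iff by blast
qed

lemma n2_cmult: "n2 M (%x. c * u x) = cmod c * n2 M u" unfolding n2_def by (simp add: norm_mult power_mult_distrib real_sqrt_mult)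

lemma n2_diff_sq: assumes "u : L2 M" "v : L2 M" shows "(n2 M (%x. u x - v x))^2 = (n2 M u)^2 + (n2 M v)^2 - 2 * Re (ip M u v)"
 using n2_add_sq[OF assms(1) L2_cmult[OF assms(2)], of "-1"] ip_cmult_right[of M u "-1" v] n2_cmult[of M "-1" v] by simp

lemma n2_triangle: assumes "u : L2 M" "v : L2 M" shows "n2 M (%x. u x + v x) <= n2 M u + n2 M v"
proof (rule power2_le_imp_le)
 show "(n2 M (%x. u x + v x))^2 <= (n2 M u + n2 M v)^2" unfolding n2_add_sq[OF assms] power2_sum
  using ip_cauchy_schwarz[OF assms] complex_Re_le_cmod[of "ip M u v"] by simp
qed simp

lemma n2_minus_commute: "n2 M (%x. u x - v x) = n2 M (%x. v x - u x)" by (simp add: n2_def norm_minus_commute)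

lemma n2_minus [simp]: "n2 M (%x. - u x) = n2 M u" by (simp add: n2_def)

lemma n2_zero [simp]: "n2 M (%x. 0) = 0" by (simp add: n2_def)

lemma n2_triangle_diff: "u : L2 M ==> v : L2 M ==> n2 M (%x. u x - v x) <= n2 M u + n2 M v" using n2_triangle[OF _ L2_cmult, of u M v "-1"] by simp

lemma n2_triangle3: assumes "u : L2 M" "v : L2 M" "w : L2 M" shows "n2 M (%x. u x - w x) <= n2 M (%x. u x - v x) + n2 M (%x. v x - w x)"
 using n2_triangle[OF L2_diff[OF assms(1,2)] L2_diff[OF assms(2,3)]] by simp

lemma n2_le_add:  assumes "u : L2 M" "v : L2 M" shows "n2 M u <= n2 M v + n2 M (%x. u x - v x)"
 using n2_triangle[OF assms(2) L2_diff[OF assms]] by simp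

lemma n2_reverse_triangle: assumes "u : L2 M" "v : L2 M" shows "\<bar>n2 M u - n2 M v\<bar> <= n2 M (%x. u x - v x)"
 using n2_le_add[OF assms] n2_le_add[OF assms(2,1)] n2_minus_commute[of M u v] by linarith

lemma n2_tendsto: assumes "!!n. u n : L2 M" "v : L2 M" "((%n. n2 M (%x. u n x - v x)) \<longlongrightarrow> 0) F"
 shows "((%n. n2 M (u n)) \<longlongrightarrow> n2 M v) F"
proof -
 have "((%n. n2 M (u n) - n2 M v) \<longlongrightarrow> 0) F"
  by (rule Lim_null_comparison[OF _ assms(3)]) (use n2_reverse_triangle[OF assms(1,2)] in auto)
 thus ?thesis by (rule LIM_zero_cancel)
qed

lemma ip_tendsto: assumes "!!n. u n : L2 M" "a : L2 M" "((%n. n2 M (%x. u n x - a x)) \<longlongrightarrow> 0) F"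
  and "!!n. v n : L2 M" "b : L2 M" "((%n. n2 M (%x. v n x - b x)) \<longlongrightarrow> 0) F"
 shows "((%n. ip M (u n) (v n)) \<longlongrightarrow> ip M a b) F"
proof -
 have "((%n. n2 M (%x. u n x - a x) * n2 M (v n) + n2 M a * n2 M (%x. v n x - b x)) \<longlongrightarrow> 0 * n2 M b + n2 M a * 0) F"
  by (intro tendsto_intros assms n2_tendsto)
 hence "((%n. n2 M (%x. u n x - a x) * n2 M (v n) + n2 M a * n2 M (%x. v n x - b x)) \<longlongrightarrow> 0) F" by simp
 hence "((%n. ip M (u n) (v n) - ip M a b) \<longlongrightarrow> 0) F"
 proof (rule Lim_null_comparison[rotated])
  have "cmod (ip M (u n) (v n) - ip M a b) <= n2 M (%x. u n x - a x) * n2 M (v n) + n2 M a * n2 M (%x. v n x - b x)" for n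
  proof -
   have "ip M (u n) (v n) - ip M a b = ip M (%x. u n x - a x) (v n) + ip M a (%x. v n x - b x)" using assms by (simp add: ip_diff_left ip_diff_right)
   also have "cmod ... <= cmod (ip M (%x. u n x - a x) (v n)) + cmod (ip M a (%x. v n x - b x))" by (rule norm_triangle_ineq)
   also have "... <= n2 M (%x. u n x - a x) * n2 M (v n) + n2 M a * n2 M (%x. v n x - b x)" by (intro add_mono ip_cauchy_schwarz L2_diff assms)
   finally show ?thesis .
  qed
  thus "\<forall>\<^sub>F n in F. cmod (ip M (u n) (v n) - ip M a b) <= n2 M (%x. u n x - a x) * n2 M (v n) + n2 M a * n2 M (%x. v n x - b x)" by simp
 qed
 thus ?thesis by (rule LIM_zero_cancel)
qed

section \<open>Square integrable functions on Euclidean space\<close>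

abbreviation "LB \<equiv> L2 lborel"
abbreviation "nb \<equiv> n2 lborel"
abbreviation "ib \<equiv> ip lborel"

lemma LB_eq_LL: "LB = LL 2" by (auto simp: L2_def LL_iff_integrable)

lemma pint_2: "w : LB ==> pint 2 w = ennreal ((nb w)^2)" by (simp add: LB_eq_LL pint_eq_integral n2_sq)

lemma LB_borel [measurable_dest]: "w : LB ==> w : Borel" by (simp add: L2_def)

lemma nb_le_of_pint: assumes "w : LB" "pint 2 w <= ennreal (c^2)" "c >= 0" shows "nb w <= c"
proof (rule power2_le_imp_le[OF _ assms(3)])
 have "ennreal ((nb w)^2) <= ennreal (c^2)" using assms(2) unfolding pint_2[OF assms(1)] .
 thus "(nb w)^2 <= c^2" by (subst (asm) ennreal_le_iff) auto
qed

lemma LB_translate: "w : LB ==> (%x. w (x + h)) : LB" by (simp add: LB_eq_LL LL_translate)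

lemma nb_translate: assumes [measurable]: "w : Borel" shows "nb (%x. w (x + h)) = nb w"
 unfolding n2_def using integral_translate[of "%x. (cmod (w x))^2" h] by (simp add: add.commute)

lemma ib_translate: assumes [measurable]: "u : Borel" "v : Borel" shows "ib (%x. u (x + h)) (%x. v (x + h)) = ib u v"
 unfolding ip_def using integral_translate[of "%x. u x * cnj (v x)" h] by (simp add: add.commute)

lemma tf_LB: "\<phi> : tf ==> \<phi> : LB" by (simp add: LB_eq_LL tf_LL)

lemma conv_LB: "w : LB ==> K : tf ==> conv K w : LB" by (simp add: LB_eq_LL conv_LL)

lemma nb_conv_le: assumes "w : LB" "K : tf" shows "nb (conv K w) <= (LINT x. cmod (K x)) * nb w"
proof (rule field_le_epsilon)
 fix e :: real assume e: "e > 0"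
 \<comment> \<open>\<open>pint_conv_le\<close> asks for a positive constant, while K may vanish; the
   surplus is scaled so that it costs at most e.\<close>
 define c where "c = (LINT x. cmod (K x)) + e / (nb w + 1)"
 have c: "c > 0" unfolding c_def using e by (intro add_nonneg_pos divide_pos_pos) (auto intro: add_nonneg_pos)
 have "(LINT x. cmod (K x)) <= c" using e by (simp add: c_def)
 hence "pint 2 (conv K w) <= ennreal (c powr 2) * pint 2 w" using assms c by (intro pint_conv_le) (auto simp: LB_eq_LL)
 also have "... = ennreal ((c * nb w)^2)" using assms(1) c by (simp add: pint_2 ennreal_mult[symmetric] power_mult_distrib)
 finally have "nb (conv K w) <= c * nb w" using assms c by (intro nb_le_of_pint conv_LB) auto
 also have "... <= (LINT x. cmod (K x)) * nb w + e"
 proof -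
  have "nb w / (nb w + 1) <= 1" by (simp add: add_nonneg_pos divide_le_eq)
  hence "e * (nb w / (nb w + 1)) <= e * 1" using e by (intro mult_left_mono) auto
  thus ?thesis by (simp add: c_def distrib_right)
 qed
 finally show "nb (conv K w) <= (LINT x. cmod (K x)) * nb w + e" .
qed

lemma nb_mo_le: "w : LB ==> nb (conv (mo n) w) <= nb w" using nb_conv_le[OF _ tf_moll, of w n] by (simp add: moll_nonneg moll_integral)

lemma pint_2_tendsto_iff: assumes "!!n. w n : LB" shows "(%n. pint 2 (w n)) ~> 0 \<longleftrightarrow> (%n. nb (w n)) ~> 0"
proof -
 have "(%n. pint 2 (w n)) ~> 0 \<longleftrightarrow> (%n. (nb (w n))^2) ~> 0"
  using assms ennreal_tendsto_0_iff[of "%n. (nb (w n))^2"] by (simp add: pint_2)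
 also have "... \<longleftrightarrow> (%n. nb (w n)) ~> 0" by (rule power_tendsto_0_iff) simp
 finally show ?thesis .
qed

lemma mo_convergence_nb: assumes "w : LB" shows "(%n. nb (%x. conv (mo n) w x - w x)) ~> 0"
proof -
 have "(%n. pint 2 (%x. conv (mo n) w x - w x)) ~> 0" using assms by (intro mo_convergence) (auto simp: LB_eq_LL)
 thus ?thesis by (subst (asm) pint_2_tendsto_iff) (intro L2_diff conv_LB tf_moll assms)
qed

lemma mo_nb_tendsto: "w : LB ==> (%n. nb (conv (mo n) w)) ~> nb w" by (intro n2_tendsto mo_convergence_nb conv_LB tf_moll)

lemma LL_bounded_support:
 fixes w :: "'a::euclidean_space => complex" assumes "w : Borel" "!!x. cmod (w x) <= B" "!!x. norm x > R ==> w x = 0" "q > 0" shows "w : LL q"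
proof -
 have "L1 (%x. cmod (w x) powr q)"
 proof (rule integrableI_bounded_set)
  show "cball 0 R : sets lborel" "(%x. cmod (w x) powr q) : borel_measurable lborel" using assms(1) by auto
  show "emeasure lborel (cball 0 R :: 'a set) < \<infinity>" by (rule emeasure_lborel_cball_finite)
  show "AE x\<in>cball 0 R in lborel. norm (cmod (w x) powr q) <= B powr q" using assms(2,4) by (auto intro!: powr_mono2)
  show "AE x. x \<notin> cball 0 R --> cmod (w x) powr q = 0" using assms(3) by auto
 qed
 thus ?thesis using assms by (simp add: LL_iff_integrable)
qed

section \<open>Increments and difference quotients\<close>

definition dquot :: "real => 'a::euclidean_space => ('a => complex) => 'a => complex" where
 "dquot h b \<phi> x = (\<phi> (x + h *R b) - \<phi> x) / of_real h"

lemma tf_translate: "\<phi> : tf ==> (%x. \<phi> (x + h)) : tf" using tf_affine[of \<phi> 1 h] by (simp add: add.commute)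

lemma tf_dquot: "\<phi> : tf ==> dquot h b \<phi> : tf" using tf_cmult[OF tf_diff[OF tf_translate], of \<phi> \<phi> "1 / of_real h" "h *R b"]
 by (simp add: dquot_def[abs_def])

text \<open>Dominated convergence: the difference quotients are bounded by the Lipschitz constant of
  \<phi> and, the steps being bounded by H, supported in the ball of radius R + H.\<close>

lemma dquot_pint:
 fixes \<phi> :: "'a::euclidean_space => complex"
 assumes \<phi>: "\<phi> : tf" and b: "b : Basis" and h: "h ~> 0" "!!n. h n \<noteq> 0" and q: "q > 0"
 shows "(%n. pint q (%x. dquot (h n) b \<phi> x - pd b \<phi> x)) ~> 0"
proof -
 obtain H where H: "!!n. \<bar>h n\<bar> <= H" using convergent_imp_Bseq[OF convergentI[OF h(1)]] by (auto simp: Bseq_def)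
 obtain R where R: "R > 0" "!!x. norm x > R ==> \<phi> x = 0" using tf_support[OF \<phi>] by auto
 obtain S where S: "S > 0" "!!x. norm x > S ==> pd b \<phi> x = 0" using tf_support[OF tf_pd[OF \<phi> b]] by auto
 obtain B where B: "B > 0" "!!x h. cmod (\<phi> (x + h *R b) - \<phi> x) <= B * \<bar>h\<bar>" using tf_lipschitz[OF \<phi> b] by auto
 obtain C where C: "C > 0" "!!x. cmod (pd b \<phi> x) <= C" using tf_bounded[OF tf_pd[OF \<phi> b]] by auto
 let ?w = "%x::'a. if norm x <= max (R + H) S then complex_of_real (B + C) else 0"
 have H0: "H >= 0" using H[of 0] by linarith
 show ?thesis
 proof (rule pint_tendsto_dominated[where w = ?w])
  show "(%x. dquot (h n) b \<phi> x - pd b \<phi> x) : Borel" for n using tf_borel[OF tf_dquot[OF \<phi>]] tf_borel[OF tf_pd[OF \<phi> b]] by simp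
  have "cmod (if norm x <= max (R + H) S then complex_of_real (B + C) else 0) <= B + C" for x :: 'a
   using B(1) C(1) unfolding norm_of_real by (auto simp flip: of_real_add)
  thus "?w : LL q" using q by (intro LL_bounded_support[of _ "B + C" "max (R + H) S"]) auto
  show "AE x. (%n. dquot (h n) b \<phi> x - pd b \<phi> x) ~> 0"
   using tf_difference_quotient[OF \<phi> h, of _ b] by (auto simp: dquot_def intro!: LIM_zero)
  have "cmod (dquot (h n) b \<phi> x - pd b \<phi> x) <= cmod (?w x)" for n x
  proof (cases "norm x <= max (R + H) S")
   case True
   have "cmod (dquot (h n) b \<phi> x) <= B" using B(2)[of x "h n"] h(2)[of n] by (simp add: dquot_def norm_divide divide_le_eq)
   hence "cmod (dquot (h n) b \<phi> x - pd b \<phi> x) <= B + C"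
    using C(2)[of x] norm_triangle_ineq4[of "dquot (h n) b \<phi> x" "pd b \<phi> x"] by linarith
   thus ?thesis using True B(1) C(1) unfolding if_P[OF True] norm_of_real by simp
  next
   case False
   have "norm x <= norm (x + h n *R b) + norm (h n *R b)" using norm_triangle_ineq4[of "x + h n *R b" "h n *R b"] by simp
   hence "norm (x + h n *R b) > R" using False H[of n] b by simp
   thus ?thesis using False R(2)[of x] R(2)[of "x + h n *R b"] S(2)[of x] H0 by (simp add: dquot_def)
  qed
  thus "AE x. cmod (dquot (h n) b \<phi> x - pd b \<phi> x) <= cmod (?w x)" for n by simp
 qed (use q in auto)
qed

lemma dquot_L1: assumes "\<phi> : tf" "b : Basis" "h ~> 0" "!!n. h n \<noteq> 0"
 shows "(%n. LINT x. cmod (dquot (h n) b \<phi> x - pd b \<phi> x)) ~> 0"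
proof -
 have *: "(%x. dquot (h n) b \<phi> x - pd b \<phi> x) : LL 1" for n using assms by (intro tf_LL tf_diff tf_dquot tf_pd) auto
 have "pint 1 (%x. dquot (h n) b \<phi> x - pd b \<phi> x) = ennreal (LINT x. cmod (dquot (h n) b \<phi> x - pd b \<phi> x))" for n
  by (simp add: pint_eq_integral[OF *])
 thus ?thesis using dquot_pint[OF assms, of 1] ennreal_tendsto_0_iff[of "%n. LINT x. cmod (dquot (h n) b \<phi> x - pd b \<phi> x)"] by simp
qed

lemma dquot_nb: assumes "\<phi> : tf" "b : Basis" "h ~> 0" "!!n. h n \<noteq> 0" shows "(%n. nb (%x. dquot (h n) b \<phi> x - pd b \<phi> x)) ~> 0"
proof -
 have "(%x. dquot (h n) b \<phi> x - pd b \<phi> x) : LB" for n by (intro tf_LB tf_diff tf_dquot tf_pd assms)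
 from pint_2_tendsto_iff[OF this] show ?thesis using dquot_pint[OF assms, of 2] by simp
qed

lemma conv_dquot: assumes "w : LB" "K : tf" shows "conv (dquot h b K) w = dquot h b (conv K w)"
proof
 fix y
 have "dquot h b K = (%x. (1 / of_real h) * (K (x + h *R b) - K x))" by (auto simp: dquot_def)
 hence "conv (dquot h b K) w y = (1 / of_real h) * conv (%x. K (x + h *R b) - K x) w y" by (simp only: conv_kernel_cmult)
 also have "conv (%x. K (x + h *R b) - K x) w y = conv K w (y + h *R b) - conv K w y"
  using assms by (simp add: conv_kernel_diff[of w 2] LB_eq_LL tf_translate conv_kernel_translate)
 finally show "conv (dquot h b K) w y = dquot h b (conv K w) y" unfolding dquot_def[of h b "conv K w"] by simp
qed

text \<open>The difference quotient is moved to the kernel, where it converges in L1; so a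
  mollification of an arbitrary L2 function is differentiable in the L2 sense.\<close>

lemma conv_dquot_tendsto: assumes w: "w : LB" and K: "K : tf" and b: "b : Basis" and h: "h ~> 0" "!!n. h n \<noteq> 0"
 shows "(%n. nb (%x. dquot (h n) b (conv K w) x - conv (pd b K) w x)) ~> 0"
proof (rule Lim_null_comparison)
 show "(%n. (LINT x. cmod (dquot (h n) b K x - pd b K x)) * nb w) ~> 0" by (rule tendsto_mult_left_zero[OF dquot_L1[OF K b h]])
 have "nb (%x. dquot (h n) b (conv K w) x - conv (pd b K) w x) <= (LINT x. cmod (dquot (h n) b K x - pd b K x)) * nb w" for n
 proof -
  have "(%x. dquot (h n) b (conv K w) x - conv (pd b K) w x) = conv (%x. dquot (h n) b K x - pd b K x) w"
   using w K b by (auto simp: conv_dquot[symmetric] conv_kernel_diff[of w 2] LB_eq_LL tf_dquot tf_pd fun_eq_iff)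
  thus ?thesis using nb_conv_le[OF w tf_diff[OF tf_dquot[OF K] tf_pd[OF K b]]] by simp
 qed
 thus "EV n. norm (nb (%x. dquot (h n) b (conv K w) x - conv (pd b K) w x))
   <= (LINT x. cmod (dquot (h n) b K x - pd b K x)) * nb w" by simp
qed

text \<open>Increments stand in for derivatives: they exist for every function, commute with each
  other and with convolution, and bounds for their L2 norms survive L2 limits.\<close>

definition shd :: "'a::real_normed_vector => ('a => complex) => 'a => complex" where
 "shd h w x = w (x + h) - w x"

lemma LB_shd: "w : LB ==> shd h w : LB" unfolding shd_def[abs_def] by (intro L2_diff LB_translate)

lemma LL_shd: "w : LL q ==> q >= 0 ==> shd h w : LL q" unfolding shd_def[abs_def] by (intro LL_diff LL_translate)

lemma conv_shd: "w : LL q ==> q >= 1 ==> K : tf ==> conv K (shd h w) = shd h (conv K w)" unfolding shd_def[abs_def]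
 by (auto simp: conv_diff[of _ q] LL_translate conv_translate tf_borel LL_borel)

lemma shd_zero [simp]: "shd 0 w = (%x. 0)" by (auto simp: shd_def)

lemma shd_commute: "shd h (shd k w) = shd k (shd h w)" by (auto simp: shd_def algebra_simps)

lemma nb_shd_add: assumes w: "w : LB" shows "nb (shd (h + k) w) <= nb (shd h w) + nb (shd k w)"
proof -
 have "shd (h + k) w = (%x. shd h w (x + k) + shd k w x)" by (auto simp: shd_def add_ac)
 hence "nb (shd (h + k) w) <= nb (%x. shd h w (x + k)) + nb (shd k w)" by (simp add: n2_triangle LB_translate[OF LB_shd[OF w]] LB_shd[OF w])
 thus ?thesis using nb_translate[of "shd h w" k] LB_shd[OF w, of h] by (simp add: LB_borel)
qed

lemma nb_shd_le: "w : LB ==> nb (shd h w) <= 2 * nb w" unfolding shd_def[abs_def]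
 using n2_triangle_diff[of "%x. w (x + h)" lborel w] nb_translate[of w h] by (simp add: LB_translate LB_borel)

lemma nb_shd_sum: assumes w: "w : LB" and "finite S" shows "nb (shd (SUM i:S. h i) w) <= (SUM i:S. nb (shd (h i) w))" using assms(2)
proof (induction S rule: finite_induct)
 case (insert i S)
 thus ?case using nb_shd_add[OF w, of "h i" "SUM i:S. h i"] by simp
qed simp

lemma nb_shd_nat: "w : LB ==> nb (shd (real n *R h) w) <= real n * nb (shd h w)"
proof (induction n)
 case (Suc n)
 thus ?case using nb_shd_add[of w "real n *R h" h] by (simp add: scaleR_left_distrib distrib_right algebra_simps)
qed simp

lemma lim_over_Suc: "(%n. k / real (Suc n)) ~> 0" using tendsto_mult_right_zero[OF LIMSEQ_Suc[OF lim_1_over_n[where 'a=real]], of k] by simp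

text \<open>Subdividing the increment turns the derivative bound at infinitesimal increments into one for all increments.\<close>

lemma nb_shd_conv_le: assumes w: "w : LB" and K: "K : tf" and b: "b : Basis"
 shows "nb (shd (k *R b) (conv K w)) <= \<bar>k\<bar> * nb (conv (pd b K) w)"
proof (cases "k = 0")
 case False
 define h where "h = (%n. k / real (Suc n))"
 have h: "h ~> 0" unfolding h_def by (rule lim_over_Suc)
 have h0: "h n \<noteq> 0" for n using False by (simp add: h_def)
 have V: "conv K w : LB" by (rule conv_LB[OF w K])
 have *: "nb (shd (k *R b) (conv K w)) <= \<bar>k\<bar> * nb (dquot (h n) b (conv K w))" for n
 proof -
  have r: "real (Suc n) * h n = k" by (simp add: h_def)
  have "nb (shd (k *R b) (conv K w)) = nb (shd (real (Suc n) *R (h n *R b)) (conv K w))" unfolding scaleR_scaleR r ..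
  also have "... <= real (Suc n) * nb (shd (h n *R b) (conv K w))" by (rule nb_shd_nat[OF V])
  also have "shd (h n *R b) (conv K w) = (%x. of_real (h n) * dquot (h n) b (conv K w) x)"
  proof
   fix x
   have "of_real (h n) * (c / of_real (h n)) = c" for c :: complex using h0[of n] by simp
   thus "shd (h n *R b) (conv K w) x = of_real (h n) * dquot (h n) b (conv K w) x" unfolding shd_def dquot_def by (rule sym)
  qed
  also have "real (Suc n) * nb (%x. of_real (h n) * dquot (h n) b (conv K w) x) = \<bar>k\<bar> * nb (dquot (h n) b (conv K w))"
  proof -
   have "real (Suc n) * \<bar>h n\<bar> = \<bar>k\<bar>" unfolding r[symmetric] abs_mult by simp
   thus ?thesis unfolding n2_cmult norm_of_real mult.assoc[symmetric] by simp
  qed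
  finally show ?thesis .
 qed
 have "dquot (h n) b (conv K w) : LB" for n unfolding conv_dquot[OF w K, symmetric] by (intro conv_LB tf_dquot w K)
 hence "(%n. \<bar>k\<bar> * nb (dquot (h n) b (conv K w))) ~> \<bar>k\<bar> * nb (conv (pd b K) w)"
  by (intro tendsto_intros n2_tendsto conv_dquot_tendsto conv_LB tf_pd w K b h h0)
 thus ?thesis by (rule LIMSEQ_le_const) (use * in auto)
qed simp

text \<open>Discrete integration by parts, by translation invariance of Lebesgue measure.\<close>

lemma ib_shd: "u : LB ==> v : LB ==> ib (shd h u) v = ib u (shd (- h) v)"
proof -
 assume u: "u : LB" and v: "v : LB"
 have [measurable]: "u : Borel" "v : Borel" using u v by (auto simp: LB_borel)
 have "ib (%x. u (x + h)) v = ib u (%x. v (x + (- h)))" using ib_translate[of u "%x. v (x + (- h))" h] u v by (simp add: LB_borel)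
 thus ?thesis unfolding shd_def[abs_def] using u v LB_translate[OF u] LB_translate[OF v, of "- h"] by (simp add: ip_diff_left ip_diff_right)
qed

text \<open>The limit of \<open>ib_shd\<close>. The adjoint reverses the shift, so the step is
  \<open>h n\<close> in the first factor and \<open>- h n\<close> in the second; this is where the
  sign comes from.\<close>

lemma conv_ibp: assumes w: "w : LB" and z: "z : LB" and K: "K : tf" "J : tf" and b: "b : Basis"
 shows "ib (conv (pd b K) w) (conv J z) = - ib (conv K w) (conv (pd b J) z)"
proof -
 define h where "h = (%n. 1 / real (Suc n))"
 have h: "h ~> 0" unfolding h_def by (rule lim_over_Suc)
 have h': "(%n. - h n) ~> 0" using tendsto_minus[OF h] by simp
 have h0: "h n \<noteq> 0" "- h n \<noteq> 0" for n by (simp_all add: h_def)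
 have L: "dquot c b (conv K w) : LB" "dquot c b (conv J z) : LB" for c
  unfolding conv_dquot[OF w K(1), symmetric] conv_dquot[OF z K(2), symmetric] by (intro conv_LB tf_dquot w z K)+
 have V: "conv K w : LB" "conv J z : LB" by (intro conv_LB w z K)+
 have "(%n. ib (dquot (h n) b (conv K w)) (conv J z)) ~> ib (conv (pd b K) w) (conv J z)"
  by (rule ip_tendsto) (intro L V conv_LB tf_pd w z K b conv_dquot_tendsto h h0 | simp)+
 moreover have "(%n. - ib (conv K w) (dquot (- h n) b (conv J z))) ~> - ib (conv K w) (conv (pd b J) z)"
  by (rule tendsto_minus, rule ip_tendsto) (intro L V conv_LB tf_pd w z K b conv_dquot_tendsto h' h0 | simp)+
 moreover have "ib (dquot (h n) b (conv K w)) (conv J z) = - ib (conv K w) (dquot (- h n) b (conv J z))" for n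
 proof -
  have e: "dquot c b \<phi> = (%x. of_real (1 / c) * shd (c *R b) \<phi> x)" for c and \<phi> :: "'a => complex"
   by (rule ext) (simp add: dquot_def shd_def)
  show ?thesis unfolding e ip_cmult_left ip_cmult_right ib_shd[OF V] scaleR_minus_left by simp
 qed
 ultimately show ?thesis using LIMSEQ_unique by auto
qed

section \<open>The nonlinearity\<close>

lemma powr_young_sum:
 fixes r s m :: real assumes "r > 0" "s > 0" "0 < m" "m < 1" shows "s powr m <= (1 - m) * r powr m + m * r powr (m - 1) * s"
proof -
 have "(r powr m) powr (1 - m) * (r powr (m - 1) * s) powr m <= (1 - m) * r powr m + m * (r powr (m - 1) * s)"
  using assms by (intro Youngs_inequality_0) auto
 moreover have "(r powr m) powr (1 - m) * (r powr (m - 1) * s) powr m = s powr m"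
  using assms by (simp add: powr_mult powr_powr mult.assoc[symmetric] powr_add[symmetric]) (simp add: algebra_simps)
 ultimately show ?thesis by (simp add: mult.assoc)
qed

text \<open>Both sides vanish for r = s, and the derivative in r of their difference is (1 + m)
  times the gap in the weighted mean inequality \<open>powr_young_sum\<close>.\<close>

lemma nl_cross_le:
 fixes r s m :: real assumes "s > 0" "s <= r" "0 < m" "m < 1"
 shows "(1 + m) * (s powr m * r - r powr m * s) <= (1 - m) * (r powr (1 + m) - s powr (1 + m))"
proof -
 define f where "f x = (1 - m) * (x powr (1 + m) - s powr (1 + m)) - (1 + m) * (s powr m * x - x powr m * s)" for x
 have "f s <= f r"
 proof (rule DERIV_nonneg_imp_nondecreasing[OF assms(2)])
  fix x assume x: "s <= x" "x <= r"
  have "DERIV f x :> (1 - m) * ((1 + m) * x powr (1 + m - 1)) - (1 + m) * (s powr m - m * x powr (m - 1) * s)"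
   unfolding f_def using x assms by (auto intro!: derivative_eq_intros)
  moreover have "(1 - m) * ((1 + m) * x powr (1 + m - 1)) - (1 + m) * (s powr m - m * x powr (m - 1) * s)
   = (1 + m) * ((1 - m) * x powr m + m * x powr (m - 1) * s - s powr m)" by (simp add: algebra_simps)
  moreover have "... >= 0" using powr_young_sum[of x s m] x assms by (intro mult_nonneg_nonneg) auto
  ultimately show "EX y. DERIV f x :> y \<and> y >= 0" by auto
 qed
 moreover have "f s = 0" by (simp add: f_def)
 ultimately show ?thesis by (simp add: f_def)
qed

text \<open>The squared form is symmetric in r and s, which removes the ordering; squaring is
  allowed because the cross term is nonnegative for s <= r.\<close>

lemma nl_cross_le_abs:
 fixes r s m :: real assumes "s > 0" "r > 0" "0 < m" "m < 1"
 shows "(1 + m)^2 * (s powr m * r - r powr m * s)^2 <= (1 - m)^2 * (r powr m * r - s powr m * s)^2"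
proof -
 have *: "(1 + m)^2 * (s powr m * r - r powr m * s)^2 <= (1 - m)^2 * (r powr m * r - s powr m * s)^2"
  if "s > 0" "s <= r" for r s :: real
 proof -
  have "s powr (1 - m) <= r powr (1 - m)" using that assms by (intro powr_mono2) auto
  hence "s powr m * r powr m * s powr (1 - m) <= s powr m * r powr m * r powr (1 - m)" by (intro mult_left_mono) auto
  moreover have "s powr m * s powr (1 - m) = s" "r powr m * r powr (1 - m) = r" using that by (simp_all add: powr_add[symmetric])
  hence "s powr m * r powr m * s powr (1 - m) = r powr m * s" "s powr m * r powr m * r powr (1 - m) = s powr m * r"
   by (metis mult.commute mult.left_commute)+
  ultimately have "0 <= s powr m * r - r powr m * s" by simp
  hence "((1 + m) * (s powr m * r - r powr m * s))^2 <= ((1 - m) * (r powr (1 + m) - s powr (1 + m)))^2"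
   using assms that by (intro power_mono nl_cross_le) auto
  thus ?thesis using that by (simp add: power_mult_distrib powr_add mult.commute)
 qed
 show ?thesis
 proof (cases "s <= r")
  case False
  thus ?thesis using *[of r s] assms by (simp add: power2_commute)
 qed (use * assms in auto)
qed

lemma nl_0 [simp]: "nl m 0 = 0" by (simp add: nl_def)

lemma cmod_nl: "0 < m ==> cmod (nl m z) = cmod z powr m"
proof (cases "z = 0")
 case False
 hence "cmod z powr (m - 1) * cmod z = cmod z powr m" by (simp add: powr_diff)
 thus ?thesis by (simp add: nl_def norm_mult)
qed simp

text \<open>The accretivity inequality of Liskevich and Perelmuter.\<close>

lemma nl_sector:
 fixes z w :: complex and m :: real assumes m: "0 < m" "m < 1"
 defines "D \<equiv> (nl m z - nl m w) * cnj (z - w)" shows "2 * sqrt m * \<bar>Im D\<bar> <= (1 - m) * Re D"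
proof -
 have zero: "2 * sqrt m * \<bar>Im (nl m z * cnj z)\<bar> <= (1 - m) * Re (nl m z * cnj z)" for z
 proof -
  have "nl m z * cnj z = of_real (cmod z powr (- (1 - m)) * (cmod z)^2)" by (simp add: nl_def mult.assoc complex_norm_square del: of_real_power)
  thus ?thesis using m by simp
 qed
 consider "z = 0" | "w = 0" | "z \<noteq> 0" "w \<noteq> 0" by blast
 thus ?thesis
 proof cases
  case 1
  thus ?thesis using zero[of w] by (simp add: D_def)
 next
  case 2
  thus ?thesis using zero[of z] by (simp add: D_def)
 next
  case 3
  define r s where "r = cmod z" and "s = cmod w"
  have rs: "r > 0" "s > 0" using 3 by (auto simp: r_def s_def)
  define a b where "a = r powr (m - 1)" and "b = s powr (m - 1)"
  have ab: "a > 0" "b > 0" "a * r = r powr m" "b * s = s powr m" using rs by (auto simp: a_def b_def powr_diff)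
  \<comment> \<open>Apart from the moduli, D depends on z and w only through the point X + iY of the
    circle of radius r s.\<close>
  define X Y where "X = Re (z * cnj w)" and "Y = Im (z * cnj w)"
  have XY: "X^2 + Y^2 = (r * s)^2" unfolding X_def Y_def cmod_power2[symmetric] by (simp add: norm_mult r_def s_def)
  have zz: "Re z * Re z + Im z * Im z = r^2" "Re w * Re w + Im w * Im w = s^2" by (simp_all add: r_def s_def cmod_power2 flip: power2_eq_square)
  have "Re D = a * (Re z * Re z + Im z * Im z) + b * (Re w * Re w + Im w * Im w) - (a + b) * X"
   by (simp add: D_def nl_def X_def a_def b_def r_def s_def algebra_simps)
  hence ReD: "Re D = a * r^2 + b * s^2 - (a + b) * X" by (simp add: zz)
  have ImD: "Im D = (b - a) * Y" by (simp add: D_def nl_def Y_def a_def b_def r_def s_def algebra_simps)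
  \<comment> \<open>The claim reads A X + B |Y| <= K on that circle. By Cauchy-Schwarz it follows
    from (A^2 + B^2) (r s)^2 <= K^2, which is \<open>nl_cross_le_abs\<close> once (1-m)^2 + 4m is
    recognised as (1+m)^2.\<close>
  define A B K where "A = (1 - m) * (a + b)" and "B = 2 * sqrt m * \<bar>b - a\<bar>" and "K = (1 - m) * (a * r^2 + b * s^2)"
  have "4 * m * (b * s * r - a * r * s)^2 <= (1 - m)^2 * ((a * r * r - b * s * s)^2 - (b * s * r - a * r * s)^2)"
  proof -
   have "(1 + m)^2 * (b * s * r - a * r * s)^2 <= (1 - m)^2 * (a * r * r - b * s * s)^2" unfolding ab by (rule nl_cross_le_abs[OF rs(2,1) m])
   thus ?thesis by (simp add: algebra_simps power2_eq_square)
  qed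
  moreover have "K^2 - (A^2 + B^2) * (r * s)^2
   = (1 - m)^2 * ((a * r * r - b * s * s)^2 - (b * s * r - a * r * s)^2) - 4 * m * (b * s * r - a * r * s)^2"
  proof -
   have "B^2 = 4 * m * (b - a)^2" using m by (simp add: B_def power_mult_distrib)
   thus ?thesis by (simp add: K_def A_def power2_eq_square) (simp add: algebra_simps)
  qed
  ultimately have "(A^2 + B^2) * (X^2 + Y^2) <= K^2" unfolding XY by simp
  moreover have "(A * X + B * \<bar>Y\<bar>)^2 <= (A^2 + B^2) * (X^2 + Y^2)"
  proof -
   have "(A^2 + B^2) * (X^2 + \<bar>Y\<bar>^2) - (A * X + B * \<bar>Y\<bar>)^2 = (A * \<bar>Y\<bar> - B * X)^2"
    by (simp add: power2_eq_square algebra_simps)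
   moreover have "(A * \<bar>Y\<bar> - B * X)^2 >= 0" by simp
   ultimately have "(A * X + B * \<bar>Y\<bar>)^2 <= (A^2 + B^2) * (X^2 + \<bar>Y\<bar>^2)" by linarith
   thus ?thesis by simp
  qed
  ultimately have "(A * X + B * \<bar>Y\<bar>)^2 <= K^2" by linarith
  moreover have "K >= 0" using ab m by (simp add: K_def)
  ultimately have "A * X + B * \<bar>Y\<bar> <= K" by (rule power2_le_imp_le)
  moreover have "(1 - m) * Re D = K - A * X" unfolding ReD by (simp add: K_def A_def algebra_simps)
  moreover have "2 * sqrt m * \<bar>Im D\<bar> = B * \<bar>Y\<bar>" unfolding ImD by (simp add: B_def abs_mult)
  ultimately show ?thesis by linarith
 qed
qed

text \<open>By \<open>nl_sector\<close> the values D lie in the sector |Im D| <= (1-m)/(2 sqrt m) Re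
  D. The hypothesis bounds |Re a| by the reciprocal slope times Im a, so that |Re a Im D| <= Im a Re
  D.\<close>

lemma nl_dissipative:
 fixes z w a :: complex and m :: real assumes m: "0 < m" "m < 1" and a: "2 * sqrt m * Im a >= (1 - m) * \<bar>Re a\<bar>"
 shows "Im (a * ((nl m z - nl m w) * cnj (z - w))) >= 0"
proof -
 let ?D = "(nl m z - nl m w) * cnj (z - w)"
 have s: "2 * sqrt m * \<bar>Im ?D\<bar> <= (1 - m) * Re ?D" by (rule nl_sector[OF m])
 have "0 <= 2 * sqrt m * \<bar>Im ?D\<bar>" using m by simp
 hence "0 <= (1 - m) * Re ?D" using s by linarith
 hence D0: "Re ?D >= 0" using m by (simp add: zero_le_mult_iff)
 have "(1 - m) * \<bar>Re a\<bar> * Re ?D <= 2 * sqrt m * Im a * Re ?D" using a D0 by (intro mult_right_mono)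
 moreover have "2 * sqrt m * \<bar>Im ?D\<bar> * \<bar>Re a\<bar> <= (1 - m) * Re ?D * \<bar>Re a\<bar>" using s by (intro mult_right_mono) auto
 ultimately have "2 * sqrt m * (\<bar>Re a\<bar> * \<bar>Im ?D\<bar>) <= 2 * sqrt m * (Im a * Re ?D)" by (simp add: algebra_simps)
 hence "\<bar>Re a\<bar> * \<bar>Im ?D\<bar> <= Im a * Re ?D" using m by simp
 hence "- (Re a * Im ?D) <= Im a * Re ?D" using abs_ge_minus_self[of "Re a * Im ?D"] unfolding abs_mult by linarith
 thus ?thesis unfolding times_complex.sel(2)[of a ?D] by linarith
qed

text \<open>The rotation by which the stationary equation is multiplied in the \<open>H\<^sup>2\<close> estimate.\<close>

definition rot :: "real => complex => complex" where
 "rot m a = \<i> * cnj a * Complex (2 * sqrt m) (1 - m)"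

text \<open>The real part is 2 sqrt m Im a - (1-m) Re a. The strict hypothesis settles Re a >= 0;
  for Re a < 0 the second term is positive and the first one nonnegative.\<close>

lemma rot_pos: assumes m: "0 < m" "m < 1" and a: "2 * sqrt m * Im a >= (1 - m) * \<bar>Re a\<bar>" "Re a >= 0 --> 2 * sqrt m * Im a > (1 - m) * Re a"
 shows "Re (rot m a) > 0"
proof -
 have e: "Re (rot m a) = 2 * sqrt m * Im a - (1 - m) * Re a" by (simp add: rot_def algebra_simps)
 show ?thesis
 proof (cases "Re a >= 0")
  case False
  hence "(1 - m) * Re a < 0" using m by (simp add: mult_less_0_iff)
  moreover have "(1 - m) * \<bar>Re a\<bar> >= 0" using m by simp
  ultimately show ?thesis using a(1) e by linarith
 qed (use a(2) e in auto)
qed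

text \<open>The factor conj(a) in \<open>rot\<close> turns a into |a|^2, and what remains is -((1-m)
  Re D + 2 sqrt m Im D), which is nonpositive in the sector.\<close>

lemma rot_sector: assumes m: "0 < m" "m < 1" shows "Re (rot m a * (a * ((nl m z - nl m w) * cnj (z - w)))) <= 0"
proof -
 let ?D = "(nl m z - nl m w) * cnj (z - w)"
 have s: "2 * sqrt m * \<bar>Im ?D\<bar> <= (1 - m) * Re ?D" by (rule nl_sector[OF m])
 have "rot m a * (a * ?D) = (cnj a * a) * (\<i> * Complex (2 * sqrt m) (1 - m) * ?D)" by (simp add: rot_def algebra_simps)
 also have "cnj a * a = of_real ((cmod a)^2)" by (metis complex_norm_square mult.commute)
 finally have "Re (rot m a * (a * ?D)) = (cmod a)^2 * Re (\<i> * Complex (2 * sqrt m) (1 - m) * ?D)"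
  unfolding scaleR_conv_of_real[symmetric] by (simp only: scaleR_complex.sel)
 also have "Re (\<i> * Complex (2 * sqrt m) (1 - m) * ?D) = - ((1 - m) * Re ?D + 2 * sqrt m * Im ?D)" by (simp add: algebra_simps)
 finally have e: "Re (rot m a * (a * ?D)) = (cmod a)^2 * - ((1 - m) * Re ?D + 2 * sqrt m * Im ?D)" .
 have "(1 - m) * Re ?D + 2 * sqrt m * Im ?D >= 0"
 proof -
  have "- (2 * sqrt m * Im ?D) <= 2 * sqrt m * \<bar>Im ?D\<bar>"
  proof -
   have "2 * sqrt m * (- Im ?D) <= 2 * sqrt m * \<bar>Im ?D\<bar>" using m by (intro mult_left_mono abs_ge_minus_self) simp
   thus ?thesis by (simp only: mult_minus_right)
  qed
  thus ?thesis using s by linarith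
 qed
 thus ?thesis unfolding e by (intro mult_nonneg_nonpos) simp_all
qed

text \<open>After division by x + d both terms are ratios in [0, 1], which a power m < 1 does not
  decrease.\<close>

lemma powr_subadditive:
 fixes x d m :: real assumes "x >= 0" "d >= 0" "0 < m" "m < 1" shows "(x + d) powr m <= x powr m + d powr m"
proof (cases "x + d = 0")
 case False
 hence p: "x + d > 0" using assms by simp
 have *: "y / (x + d) <= y powr m / (x + d) powr m" if "0 <= y" "y <= x + d" for y
 proof (cases "y = 0")
  case False
  have "(y / (x + d)) powr 1 <= (y / (x + d)) powr m" using that False p assms by (intro powr_mono') auto
  thus ?thesis using that p by (simp add: powr_divide)
 qed simp
 have "1 = x / (x + d) + d / (x + d)" using p by (simp add: add_divide_distrib[symmetric])
 also have "... <= x powr m / (x + d) powr m + d powr m / (x + d) powr m" using assms by (intro add_mono *) auto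
 finally show ?thesis using p by (simp add: add_divide_distrib[symmetric] le_divide_eq)
qed (use assms in auto)

text \<open>If |z| <= d = |z - w|, each term is bounded by a multiple of d^m. Otherwise the factor
  |z|^(m-1), at most d^(m-1) for d > 0, is frozen: the linear part contributes d^m and the change of
  the factor at w at most twice as much.\<close>

lemma nl_holder: assumes m: "0 < m" "m < 1" shows "cmod (nl m z - nl m w) <= 3 * cmod (z - w) powr m"
proof -
 define x y d where "x = cmod z" and "y = cmod w" and "d = cmod (z - w)"
 have xyd: "x >= 0" "y >= 0" "d >= 0" "y <= x + d" "x <= y + d"
  using norm_triangle_ineq2[of z w] norm_triangle_ineq2[of w z] by (auto simp: x_def y_def d_def norm_minus_commute)
 have ym: "y powr m <= x powr m + d powr m" using powr_mono2[of m y "x + d"] powr_subadditive[of x d m] xyd m by linarith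
 have xm: "x powr m <= y powr m + d powr m" using powr_mono2[of m x "y + d"] powr_subadditive[of y d m] xyd m by linarith
 show ?thesis
 proof (cases "x <= d")
  case True
  hence "x powr m <= d powr m" using xyd m by (intro powr_mono2) auto
  moreover have "cmod (nl m z - nl m w) <= x powr m + y powr m" using norm_triangle_ineq4[of "nl m z" "nl m w"] m by (simp add: cmod_nl x_def y_def)
  ultimately show ?thesis using ym by (simp add: d_def)
 next
  case False
  hence x: "x > 0" using xyd by linarith
  define c where "c = x powr (m - 1)"
  have cd: "c * d <= d powr m"
  proof (cases "d = 0")
   case False
   hence "x powr (m - 1) <= d powr (m - 1)" using \<open>\<not> x <= d\<close> xyd m by (intro powr_mono2') auto
   hence "c * d <= d powr (m - 1) * d" using xyd unfolding c_def by (intro mult_right_mono)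
   thus ?thesis using False xyd by (simp add: powr_diff)
  qed simp
  have "nl m z - nl m w = of_real c * (z - w) + (of_real c * w - nl m w)" by (simp add: nl_def c_def x_def algebra_simps)
  hence "cmod (nl m z - nl m w) <= cmod (of_real c * (z - w)) + cmod (of_real c * w - nl m w)" by (simp only: norm_triangle_ineq)
  also have "cmod (of_real c * (z - w)) = c * d" by (simp add: norm_mult c_def d_def)
  also have "cmod (of_real c * w - nl m w) = \<bar>c - y powr (m - 1)\<bar> * y"
  proof -
   have "of_real c * w - nl m w = of_real (c - y powr (m - 1)) * w" by (simp add: nl_def y_def algebra_simps)
   thus ?thesis by (simp add: norm_mult y_def flip: of_real_diff)
  qed
  also have "... = \<bar>c * y - y powr m\<bar>"
  proof (cases "y = 0")
   case False
   have "\<bar>c - y powr (m - 1)\<bar> * y = \<bar>(c - y powr (m - 1)) * y\<bar>" using xyd by (simp add: abs_mult)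
   also have "(c - y powr (m - 1)) * y = c * y - y powr m" using False xyd by (simp add: left_diff_distrib powr_diff)
   finally show ?thesis .
  qed simp
  also have "... <= 2 * d powr m"
  proof -
   have cx: "c * x = x powr m" using x by (simp add: c_def powr_diff)
   have "\<bar>c * y - c * x\<bar> <= c * d"
   proof -
    have "\<bar>c * (y - x)\<bar> <= c * d" unfolding abs_mult using xyd by (intro mult_mono) (auto simp: c_def)
    thus ?thesis by (simp add: right_diff_distrib)
   qed
   thus ?thesis using cx cd xm ym by linarith
  qed
  finally show ?thesis using cd by (simp add: d_def)
 qed
qed

lemma nl_borel [measurable]: "nl m : Borel" unfolding nl_def[abs_def] by measurable

text \<open>E need not be differentiable, but the left side of \<open>ineq\<close> is, as a function
  z of s. It lies below E, equals E at \<open>t1\<close> and satisfies z' <= -k z^(1+\<beta>), so ln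
  z + k s or z^(-\<beta>) - \<beta> k s is monotone.\<close>

lemma ode_comparison:
 fixes E :: "real => real" assumes t: "T0 <= t1" and E: "continuous_on {T0..t1} E" "!!s. s : {T0..t1} ==> E s >= 0"
  and k: "k >= 0" and \<beta>: "\<beta> >= 0" and pos: "E t1 > 0"
  and ineq: "!!s. s : {T0..t1} ==> E t1 + k * integral {s..t1} (%q. E q powr (1 + \<beta>)) <= E s"
 shows "\<beta> = 0 --> E t1 <= E T0 * exp (- k * (t1 - T0))"
  and "\<beta> > 0 --> E T0 powr (- \<beta>) + \<beta> * k * (t1 - T0) <= E t1 powr (- \<beta>)"
proof -
 define g where "g = (%q. E q powr (1 + \<beta>))"
 have g: "continuous_on {T0..t1} g" unfolding g_def using E \<beta> by (intro continuous_on_powr' continuous_intros) auto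
 define G where "G s = integral {T0..s} g" for s
 define z where "z s = E t1 + k * (G t1 - G s)" for s
 have int: "g integrable_on {T0..t1}" by (rule integrable_continuous_real[OF g])
 have zeq: "z s = E t1 + k * integral {s..t1} g" if "s : {T0..t1}" for s
  using Henstock_Kurzweil_Integration.integral_combine[of T0 s t1 g] that int by (simp add: z_def G_def)
 have zle: "z s <= E s" if "s : {T0..t1}" for s using ineq[OF that] zeq[OF that] by (simp add: g_def)
 have zge: "E t1 <= z s" if "s : {T0..t1}" for s
 proof -
  have "0 <= integral {s..t1} g"
   using that by (intro Henstock_Kurzweil_Integration.integral_nonneg integrable_continuous_real continuous_on_subset[OF g]) (auto simp: g_def)
  thus ?thesis unfolding zeq[OF that] using k by simp
 qed
 have zpos: "z s > 0" if "s : {T0..t1}" for s using zge[OF that] pos by linarith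
 have zD: "(z has_real_derivative - k * g s) (at s within {T0..t1})" if "s : {T0..t1}" for s
  unfolding z_def G_def using integral_has_real_derivative[OF g that] by (auto intro!: derivative_eq_intros)
 have zD': "(z has_real_derivative - k * g s) (at s)" if "T0 < s" "s < t1" for s using zD[of s] that by (simp add: at_within_Icc_at)
 have zc: "continuous_on {T0..t1} z" using zD by (intro DERIV_continuous_on)
 have gz: "z s powr (1 + \<beta>) <= g s" if "s : {T0..t1}" for s unfolding g_def using zle[OF that] zpos[OF that] \<beta> by (intro powr_mono2) auto
 have zt: "z t1 = E t1" by (simp add: z_def)
 have T0m: "T0 : {T0..t1}" using t by simp
 show "\<beta> = 0 --> E t1 <= E T0 * exp (- k * (t1 - T0))"
 proof
  assume b0: "\<beta> = 0"
  have "ln (z t1) + k * t1 <= ln (z T0) + k * T0"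
  proof (rule DERIV_nonpos_imp_decreasing_open[OF t])
   fix s assume s: "T0 < s" "s < t1"
   have "((%s. ln (z s) + k * s) has_real_derivative (- k * g s) / z s + k) (at s)" using zpos[of s] s by (auto intro!: derivative_eq_intros zD')
   moreover have "(- k * g s) / z s + k <= 0"
   proof -
    have "z s <= g s" using gz[of s] zpos[of s] s b0 by simp
    hence "k * z s <= k * g s" using k by (rule mult_left_mono)
    thus ?thesis using zpos[of s] s by (simp add: field_simps)
   qed
   ultimately show "EX y. ((%s. ln (z s) + k * s) has_real_derivative y) (at s) \<and> y <= 0" by blast
  qed (use zpos zc in \<open>auto intro!: continuous_intros simp: less_imp_neq[symmetric]\<close>)
  hence "ln (z t1) <= ln (z T0) - k * (t1 - T0)" by (simp add: algebra_simps)
  hence "z t1 <= exp (ln (z T0) - k * (t1 - T0))" using zt pos by (metis exp_le_cancel_iff exp_ln)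
  also have "... = z T0 * exp (- k * (t1 - T0))" using zpos[OF T0m] by (simp add: exp_diff exp_minus divide_inverse)
  also have "... <= E T0 * exp (- k * (t1 - T0))" using zle[OF T0m] by (intro mult_right_mono) auto
  finally show "E t1 <= E T0 * exp (- k * (t1 - T0))" using zt by simp
 qed
 show "\<beta> > 0 --> E T0 powr (- \<beta>) + \<beta> * k * (t1 - T0) <= E t1 powr (- \<beta>)"
 proof
  assume b: "\<beta> > 0"
  have "z T0 powr (- \<beta>) - \<beta> * k * T0 <= z t1 powr (- \<beta>) - \<beta> * k * t1"
  proof (rule DERIV_nonneg_imp_increasing_open[OF t])
   fix s assume s: "T0 < s" "s < t1"
   have "((%s. z s powr (- \<beta>) - \<beta> * k * s) has_real_derivative (- \<beta>) * z s powr (- \<beta> - 1) * (- k * g s) - \<beta> * k) (at s)"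
    using zpos[of s] s by (auto intro!: derivative_eq_intros zD')
   moreover have "(- \<beta>) * z s powr (- \<beta> - 1) * (- k * g s) - \<beta> * k >= 0"
   proof -
    have "z s powr (- \<beta> - 1) * z s powr (1 + \<beta>) = 1" using zpos[of s] s by (simp add: powr_add[symmetric])
    moreover have "z s powr (- \<beta> - 1) * z s powr (1 + \<beta>) <= z s powr (- \<beta> - 1) * g s"
     using gz[of s] s by (intro mult_left_mono) auto
    ultimately have "\<beta> * k * 1 <= \<beta> * k * (z s powr (- \<beta> - 1) * g s)" using b k by (intro mult_left_mono) auto
    thus ?thesis by (simp add: algebra_simps)
   qed
   ultimately show "EX y. ((%s. z s powr (- \<beta>) - \<beta> * k * s) has_real_derivative y) (at s) \<and> 0 <= y" by blast
  qed (use zpos zc in \<open>auto intro!: continuous_intros simp: less_imp_neq[symmetric]\<close>)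
  hence "z T0 powr (- \<beta>) + \<beta> * k * (t1 - T0) <= E t1 powr (- \<beta>)" by (simp add: algebra_simps zt)
  moreover have "E T0 powr (- \<beta>) <= z T0 powr (- \<beta>)" using zle[OF T0m] zpos[OF T0m] b by (intro powr_mono2') auto
  ultimately show "E T0 powr (- \<beta>) + \<beta> * k * (t1 - T0) <= E t1 powr (- \<beta>)" by linarith
 qed
qed

text \<open>Young's inequality with a free scale l, in place of Hoelder's: a suitable l makes one of
  the two terms small at the expense of the other.\<close>

lemma pairing_bound: assumes pq: "p > 1" "q > 1" "1 / p + 1 / q = 1" and XY: "X : Borel" "Y : Borel" and l: "l > 0"
 shows "(NINT x. ennreal (cmod (X x) * cmod (Y x))) <= ennreal (l powr q) * pint q X + ennreal (l powr (- p)) * pint p Y"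
proof -
 have [measurable]: "X : Borel" "Y : Borel" by fact+
 have "cmod (X x) * cmod (Y x) <= l powr q * cmod (X x) powr q + l powr (- p) * cmod (Y x) powr p" for x
 proof -
  have "(l * cmod (X x)) * (cmod (Y x) / l) <= (l * cmod (X x)) powr q / q + (cmod (Y x) / l) powr p / p" using pq l by (intro Youngs_inequality) auto
  also have "... <= (l * cmod (X x)) powr q / 1 + (cmod (Y x) / l) powr p / 1" using pq by (intro add_mono divide_left_mono) auto
  finally have "(l * cmod (X x)) * (cmod (Y x) / l) <= (l * cmod (X x)) powr q + (cmod (Y x) / l) powr p" by simp
  moreover have "(l * cmod (X x)) * (cmod (Y x) / l) = cmod (X x) * cmod (Y x)" using l by simp
  moreover have "(cmod (Y x) / l) powr p = l powr (- p) * cmod (Y x) powr p" using l by (simp add: powr_divide powr_minus_divide)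
  moreover have "(l * cmod (X x)) powr q = l powr q * cmod (X x) powr q" by (rule powr_mult)
  ultimately show ?thesis by linarith
 qed
 hence "(NINT x. ennreal (cmod (X x) * cmod (Y x)))
   <= (NINT x. ennreal (l powr q) * ennreal (cmod (X x) powr q) + ennreal (l powr (- p)) * ennreal (cmod (Y x) powr p))"
  by (intro nn_integral_mono) (simp add: ennreal_mult[symmetric] ennreal_plus[symmetric] ennreal_leI del: ennreal_plus)
 also have "... = ennreal (l powr q) * pint q X + ennreal (l powr (- p)) * pint p Y"
  unfolding pint_def by (simp add: nn_integral_add nn_integral_cmult)
 finally show ?thesis .
qed

lemma pairing_integrable: assumes pq: "p > 1" "q > 1" "1 / p + 1 / q = 1" and X: "X : LL q" and Y: "Y : LL p" shows "L1 (%x. X x * cnj (Y x))"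
proof -
 have [measurable]: "X : Borel" "Y : Borel" using X Y by (auto simp: LL_borel)
 have "(NINT x. ennreal (cmod (X x) * cmod (Y x))) < \<infinity>"
  using pairing_bound[OF pq _ _ zero_less_one, of X Y] X Y by (auto simp: LL_def elim!: le_less_trans)
 thus ?thesis by (simp add: integrable_iff_bounded norm_mult)
qed

lemma pairing_tendsto_0: assumes pq: "p > 1" "q > 1" "1 / p + 1 / q = 1" and X: "!!n. X n : Borel" "(%n. pint q (X n)) ~> 0"
  and Y: "!!n. Y n : Borel" "!!n. pint p (Y n) <= ennreal C" shows "(%n. NINT x. ennreal (cmod (X n x) * cmod (Y n x))) ~> 0"
proof (rule tendsto_0_eps_ennreal)
 fix \<epsilon> :: real assume e: "\<epsilon> > 0"
 define C' where "C' = max C 1"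
 have C': "C' > 0" "C <= C'" by (auto simp: C'_def)
 define l where "l = (C' / \<epsilon>) powr (1 / p)"
 have l: "l > 0" using e C' by (simp add: l_def)
 have "l powr (- p) * C' = \<epsilon>" using e C' pq by (simp add: l_def powr_powr powr_minus)
 hence le: "ennreal (l powr (- p)) * ennreal C' = ennreal \<epsilon>" by (simp add: ennreal_mult'[symmetric])
 have lim: "(%n. ennreal (l powr q) * pint q (X n)) ~> 0"
  using ennreal_tendsto_cmult[OF _ X(2), of "ennreal (l powr q)"] by (simp only: mult_zero_right ennreal_less_top)
 have bd: "(NINT x. ennreal (cmod (X n x) * cmod (Y n x))) <= ennreal \<epsilon> + ennreal (l powr q) * pint q (X n)" for n
 proof -
  have "ennreal (l powr (- p)) * pint p (Y n) <= ennreal (l powr (- p)) * ennreal C'"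
   by (intro mult_left_mono order_trans[OF Y(2)] ennreal_leI C') simp
  hence "ennreal (l powr q) * pint q (X n) + ennreal (l powr (- p)) * pint p (Y n) <= ennreal (l powr q) * pint q (X n) + ennreal \<epsilon>"
   unfolding le by (rule add_left_mono)
  from order_trans[OF pairing_bound[OF pq X(1) Y(1) l] this] show ?thesis by (simp only: add.commute)
 qed
 show "EX b. b ~> 0 \<and> (EV n. (NINT x. ennreal (cmod (X n x) * cmod (Y n x))) <= ennreal \<epsilon> + b n)"
  by (intro exI conjI always_eventually allI, rule lim, rule bd)
qed

text \<open>The nonlinear term and the solution are in duality between L^((1+m)/m) and L^(1+m), not
  in L2, so the limit in the energy identity needs this pairing.\<close>

lemma pairing_mo_tendsto: assumes pq: "p > 1" "q > 1" "1 / p + 1 / q = 1" and X: "X : LL q" and Y: "Y : LL p"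
 shows "(%n. ib (conv (mo n) X) (conv (mo n) Y)) ~> ib X Y"
proof -
 have [measurable]: "X : Borel" "Y : Borel" using X Y by (auto simp: LL_borel)
 have cX: "conv (mo n) X : LL q" and cY: "conv (mo n) Y : LL p" for n using X Y pq by (auto intro!: conv_LL tf_moll)
 note m = cX[THEN LL_borel] cY[THEN LL_borel]
 obtain C where C: "pint p Y = ennreal C" using Y by (auto simp: LL_def less_top_ennreal)
 obtain D where D: "pint q X = ennreal D" using X by (auto simp: LL_def less_top_ennreal)
 have 1: "(%n. NINT x. ennreal (cmod (conv (mo n) X x - X x) * cmod (conv (mo n) Y x))) ~> 0"
  using pint_mo_le[OF Y] mo_convergence[OF X] pq C by (intro pairing_tendsto_0[OF pq, where C = C]) (auto intro: m)
 have 2: "(%n. NINT x. ennreal (cmod (conv (mo n) Y x - Y x) * cmod (X x))) ~> 0"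
  using mo_convergence[OF Y] pq D by (intro pairing_tendsto_0[of q p, where C = D]) (auto intro: m)
 have "ennreal (cmod (ib (conv (mo n) X) (conv (mo n) Y) - ib X Y))
   <= (NINT x. ennreal (cmod (conv (mo n) X x - X x) * cmod (conv (mo n) Y x)))
    + (NINT x. ennreal (cmod (conv (mo n) Y x - Y x) * cmod (X x)))" for n
 proof -
  have i: "L1 (%x. conv (mo n) X x * cnj (conv (mo n) Y x))" "L1 (%x. X x * cnj (Y x))"
   by (rule pairing_integrable[OF pq cX cY] pairing_integrable[OF pq X Y])+
  have "ib (conv (mo n) X) (conv (mo n) Y) - ib X Y
    = (LINT x. conv (mo n) X x * cnj (conv (mo n) Y x) - X x * cnj (Y x))" unfolding ip_def using i by simp
  hence "ennreal (cmod (ib (conv (mo n) X) (conv (mo n) Y) - ib X Y))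
    <= (NINT x. ennreal (cmod (conv (mo n) X x * cnj (conv (mo n) Y x) - X x * cnj (Y x))))"
   using integral_norm_bound_ennreal[OF Bochner_Integration.integrable_diff[OF i]] by simp
  also have "... <= (NINT x. ennreal (cmod (conv (mo n) X x - X x) * cmod (conv (mo n) Y x)) + ennreal (cmod (conv (mo n) Y x - Y x) * cmod (X x)))"
  proof (rule nn_integral_mono)
   fix x
   have "cmod (conv (mo n) X x * cnj (conv (mo n) Y x) - X x * cnj (Y x))
     = cmod ((conv (mo n) X x - X x) * cnj (conv (mo n) Y x) + X x * cnj (conv (mo n) Y x - Y x))" by (simp add: algebra_simps)
   also have "... <= cmod (conv (mo n) X x - X x) * cmod (conv (mo n) Y x) + cmod (X x) * cmod (conv (mo n) Y x - Y x)"
    by (rule order_trans[OF norm_triangle_ineq]) (simp only: norm_mult complex_mod_cnj order_refl)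
   finally show "ennreal (cmod (conv (mo n) X x * cnj (conv (mo n) Y x) - X x * cnj (Y x)))
     <= ennreal (cmod (conv (mo n) X x - X x) * cmod (conv (mo n) Y x)) + ennreal (cmod (conv (mo n) Y x - Y x) * cmod (X x))"
    by (simp add: ennreal_plus[symmetric] mult.commute ennreal_leI del: ennreal_plus)
  qed
  also have "... = (NINT x. ennreal (cmod (conv (mo n) X x - X x) * cmod (conv (mo n) Y x)))
    + (NINT x. ennreal (cmod (conv (mo n) Y x - Y x) * cmod (X x)))" using m by (intro nn_integral_add) auto
  finally show ?thesis .
 qed
 note bd = this
 from tendsto_add[OF 1 2] have 3: "(%n. (NINT x. ennreal (cmod (conv (mo n) X x - X x) * cmod (conv (mo n) Y x)))
    + (NINT x. ennreal (cmod (conv (mo n) Y x - Y x) * cmod (X x)))) ~> 0" by (simp only: add_0_left)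
 have "(%n. ennreal (cmod (ib (conv (mo n) X) (conv (mo n) Y) - ib X Y))) ~> 0"
  by (rule tendsto_sandwich[OF _ _ tendsto_const 3]) (intro always_eventually allI zero_le, intro always_eventually allI bd)
 hence "(%n. cmod (ib (conv (mo n) X) (conv (mo n) Y) - ib X Y)) ~> 0" by (subst (asm) ennreal_tendsto_0_iff) auto
 thus ?thesis by (intro LIM_zero_cancel[where l="ib X Y"]) (rule tendsto_norm_zero_cancel)
qed

lemma pairing_cmod_le: assumes pq: "p > 1" "q > 1" "1 / p + 1 / q = 1" and X: "X : LL q" and Y: "Y : LL p"
 shows "ennreal (cmod (ib X Y)) <= pint q X + pint p Y"
proof -
 have "ennreal (cmod (ib X Y)) <= (NINT x. ennreal (cmod (X x) * cmod (Y x)))"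
  unfolding ip_def using integral_norm_bound_ennreal[OF pairing_integrable[OF assms]] by (simp add: norm_mult)
 thus ?thesis using pairing_bound[OF pq LL_borel[OF X] LL_borel[OF Y] zero_less_one] by simp
qed

text \<open>The product rule for a primitive of a merely integrable b. By Fubini the squared modulus
  of the total increment S splits over the two triangles of the square [s, t] x [s, t], whose
  contributions J and conj(J) are conjugate.\<close>

lemma ac_norm_sq:
 fixes A b :: "real => complex" assumes st: "s <= t" and b: "set_L1 {s..t} b" and A: "!!r. r : {s..t} ==> A r = A s + (LINT q:{s..r}. b q)"
 shows "(cmod (A t))^2 - (cmod (A s))^2 = 2 * (LINT q:{s..t}. Re (cnj (A q) * b q))"
proof -
 define B where "B = (%q. indicator {s..t} q *R b q)"
 have Bi: "L1 B" using b by (simp add: B_def set_integrable_def)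
 have [measurable]: "B : Borel" using Bi by auto
 have A': "A r = A s + (LINT \<tau>. indicator {..r} \<tau> * B \<tau>)" if "r : {s..t}" for r
  unfolding A[OF that] set_lebesgue_integral_def using that
  by (intro arg_cong2[where f="(+)"] Bochner_Integration.integral_cong) (auto simp: B_def indicator_def)
 let ?f = "%q \<tau>. indicator {..q} \<tau> * (cnj (B \<tau>) * B q) :: complex"
 have prod: "integrable (lborel \<Otimes>\<^sub>M lborel) (%(q, \<tau>). cnj (B \<tau>) * B q)"
 proof (rule pair_sigma_finite.Fubini_integrable[OF pair_sigma_finite_lborel])
  show "AE x. L1 (%y. case (x, y) of (q, \<tau>) => cnj (B \<tau>) * B q)" using Bi by auto
  show "L1 (%x. LINT y. norm (case (x, y) of (q, \<tau>) => cnj (B \<tau>) * B q))" using Bi by (simp add: norm_mult)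
 qed measurable
 have fi: "integrable (lborel \<Otimes>\<^sub>M lborel) (%(q, \<tau>). ?f q \<tau>)"
  by (rule Bochner_Integration.integrable_bound[OF prod]) (auto simp: norm_mult indicator_def)
 define J where "J = (LINT q. LINT \<tau>. ?f q \<tau>)"
 define S where "S = (LINT \<tau>. B \<tau>)"
 have "cnj J = (LINT q. LINT \<tau>. indicator {..q} \<tau> * (B \<tau> * cnj (B q)))" unfolding J_def Bochner_Integration.integral_cnj[symmetric]
  by (intro Bochner_Integration.integral_cong) (auto simp: indicator_def)
 also have "... = (LINT \<tau>. LINT q. indicator {..q} \<tau> * (B \<tau> * cnj (B q)))"
 proof (rule pair_sigma_finite.Fubini_integral[OF pair_sigma_finite_lborel, symmetric])
  show "integrable (lborel \<Otimes>\<^sub>M lborel) (%(q, \<tau>). indicator {..q} \<tau> * (B \<tau> * cnj (B q)))"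
   by (rule Bochner_Integration.integrable_bound[OF prod]) (auto simp: norm_mult indicator_def)
 qed
 finally have cJ: "cnj J = (LINT q. LINT \<tau>. indicator {..\<tau>} q * (B q * cnj (B \<tau>)))" .
 have fi': "integrable (lborel \<Otimes>\<^sub>M lborel) (%(q, \<tau>). indicator {..\<tau>} q * (B q * cnj (B \<tau>)))"
  by (rule Bochner_Integration.integrable_bound[OF prod]) (auto simp: norm_mult indicator_def)
 note f1 = pair_sigma_finite.integrable_fst[OF pair_sigma_finite_lborel fi] pair_sigma_finite.AE_integrable_fst[OF pair_sigma_finite_lborel fi]
 note f2 = pair_sigma_finite.integrable_fst[OF pair_sigma_finite_lborel fi'] pair_sigma_finite.AE_integrable_fst[OF pair_sigma_finite_lborel fi']
 have "J + cnj J = (LINT q. (LINT \<tau>. ?f q \<tau>) + (LINT \<tau>. indicator {..\<tau>} q * (B q * cnj (B \<tau>))))"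
  unfolding cJ unfolding J_def using f1(1) f2(1) by simp
 also have "... = (LINT q. B q * cnj S)"
 proof (rule integral_cong_AE)
  show "AE q. (LINT \<tau>. ?f q \<tau>) + (LINT \<tau>. indicator {..\<tau>} q * (B q * cnj (B \<tau>))) = B q * cnj S" using f1(2) f2(2)
  proof eventually_elim
   case (elim q)
   \<comment> \<open>The two closed triangles overlap in the diagonal, which is negligible.\<close>
   have "AE \<tau>. \<tau> \<noteq> q" by (rule AE_lborel_singleton)
   hence ae: "AE \<tau>. ?f q \<tau> + indicator {..\<tau>} q * (B q * cnj (B \<tau>)) = B q * cnj (B \<tau>)"
    by eventually_elim (auto simp: indicator_def)
   have "(LINT \<tau>. ?f q \<tau>) + (LINT \<tau>. indicator {..\<tau>} q * (B q * cnj (B \<tau>)))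
     = (LINT \<tau>. ?f q \<tau> + indicator {..\<tau>} q * (B q * cnj (B \<tau>)))" using elim by simp
   also have "... = (LINT \<tau>. B q * cnj (B \<tau>))" using Bi by (intro integral_cong_AE[OF _ _ ae] borel_measurable_integrable Bochner_Integration.integrable_add elim) simp
   finally show ?case by (simp add: S_def)
  qed
 qed (use f1(1) f2(1) in auto)
 also have "... = S * cnj S" by (simp add: S_def)
 finally have "complex_of_real (2 * Re J) = of_real ((cmod S)^2)" unfolding complex_add_cnj complex_norm_square .
 hence ReJ: "2 * Re J = (cmod S)^2" using of_real_eq_iff by blast
 have At: "A t = A s + S" unfolding A[OF atLeastAtMost_iff[THEN iffD2, OF conjI[OF st order_refl]]] S_def B_def set_lebesgue_integral_def ..
 have e: "indicator {s..t} q *R Re (cnj (A q) * b q) = Re (cnj (A s) * B q + (LINT \<tau>. ?f q \<tau>))" for q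
 proof (cases "q : {s..t}")
  case True
  have "(LINT \<tau>. ?f q \<tau>) = (LINT \<tau>. cnj (indicator {..q} \<tau> * B \<tau>) * B q)"
   by (intro Bochner_Integration.integral_cong) (auto simp: indicator_def)
  also have "... = cnj (LINT \<tau>. indicator {..q} \<tau> * B \<tau>) * B q"
   by (simp only: integral_mult_left_zero Bochner_Integration.integral_cnj)
  finally show ?thesis using True by (simp add: A'[OF True] B_def algebra_simps)
 qed (simp add: B_def)
 have "(LINT q:{s..t}. Re (cnj (A q) * b q)) = Re (LINT q. cnj (A s) * B q + (LINT \<tau>. ?f q \<tau>))"
  unfolding set_lebesgue_integral_def e using f1(1) Bi by (subst integral_Re) auto
 also have "(LINT q. cnj (A s) * B q + (LINT \<tau>. ?f q \<tau>)) = cnj (A s) * S + J" unfolding J_def S_def using f1(1) Bi by simp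
 finally have "2 * (LINT q:{s..t}. Re (cnj (A q) * b q)) = 2 * Re (cnj (A s) * S) + (cmod S)^2" using ReJ by simp
 thus ?thesis unfolding At cmod_power2 by (simp add: power2_eq_square algebra_simps)
qed

section \<open>The energy identity\<close>

text \<open>The term G is not tied to w, so that differences of solutions, translates and
  time-independent functions are evolutions too. The equation is tested in space only and integrated
  over [s, t], which makes the pairings absolutely continuous in time.\<close>

definition evolution ::
  "real => complex => (real => 'a::euclidean_space => complex) => (real => 'a => complex) => (real => 'a => complex) => bool" where
 "evolution m a w G F \<longleftrightarrow>
   joint w \<and>
   joint G \<and>
   joint F \<and>
   (ALL t>=0. w t : LB) \<and> (ALL T. EX K. ALL t:{0..T}. nb (w t) <= K) \<and>
   (ALL T. (NINT t:{0..T}. pint (1 + m) (w t)) < \<infinity>) \<and>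
   (ALL T. (NINT t:{0..T}. pint ((1 + m) / m) (G t)) < \<infinity>) \<and>
   (AE t. t >= 0 --> F t : LB) \<and>
   (ALL T. (NINT t:{0..T}. ennreal (nb (F t))) < \<infinity>) \<and>
   (ALL \<phi>:tf. ALL s>=0. ALL t>=s.
    \<i> * ((LINT x. w t x * \<phi> x) - (LINT x. w s x * \<phi> x))
    + (LINT q:{s..t}. LINT x. w q x * laplacian \<phi> x)
    + a * (LINT q:{s..t}. LINT x. G q x * \<phi> x)
    = (LINT q:{s..t}. LINT x. F q x * \<phi> x))"

lemma pint_measurable [measurable]: assumes [measurable]: "joint w" shows "(%t. pint q (w t)) : Borel" unfolding pint_def by measurable

lemma nb_measurable [measurable]: assumes [measurable]: "joint w" shows "(%t. nb (w t)) : Borel" unfolding n2_def by measurable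

lemma section_measurable: assumes [measurable]: "joint w" shows "w t : Borel" by measurable

lemma conv_joint_measurable: assumes [measurable]: "joint w" "K : Borel" shows "case_prod (%t. conv K (w t)) : Borel2"
 unfolding conv_def by measurable

lemma pair_time_integrable:
 fixes G :: "real => 'a::euclidean_space => complex" assumes G [measurable]: "joint G" and q: "q >= 1"
  and fin: "(NINT t:{s..t}. pint q (G t)) < \<infinity>" and \<phi>: "\<phi> : tf" shows "set_L1 {s..t} (%z. LINT x. G z x * \<phi> x)"
proof -
 have [measurable]: "\<phi> : Borel" using \<phi> by (rule tf_borel)
 obtain B where B: "B > 0" "!!x. cmod (\<phi> x) <= B" using tf_bounded[OF \<phi>] by auto
 have b: "ennreal (cmod (LINT x. G z x * \<phi> x)) <= pint 1 \<phi> + ennreal B * pint q (G z)" for z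
 proof -
  have "ennreal (cmod (LINT x. G z x * \<phi> x)) <= (NINT x. ennreal (cmod (G z x * \<phi> x)))"
   by (cases "L1 (%x. G z x * \<phi> x)") (auto simp: integral_norm_bound_ennreal not_integrable_integral_eq)
  also have "... <= (NINT x. ennreal (cmod (\<phi> x) powr 1) + ennreal B * ennreal (cmod (G z x) powr q))"
  proof (rule nn_integral_mono)
   fix x
   have "cmod (G z x) * cmod (\<phi> x) <= (1 + cmod (G z x) powr q) * cmod (\<phi> x)" by (intro mult_right_mono le_one_plus_powr q) auto
   also have "... <= cmod (\<phi> x) + B * cmod (G z x) powr q"
    using mult_right_mono[OF B(2)[of x], of "cmod (G z x) powr q"] by (simp add: algebra_simps)
   finally show "ennreal (cmod (G z x * \<phi> x)) <= ennreal (cmod (\<phi> x) powr 1) + ennreal B * ennreal (cmod (G z x) powr q)"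
    using B(1) by (simp add: norm_mult ennreal_plus[symmetric] ennreal_mult[symmetric] ennreal_leI del: ennreal_plus)
  qed
  also have "... = pint 1 \<phi> + ennreal B * pint q (G z)" unfolding pint_def by (simp add: nn_integral_add nn_integral_cmult)
  finally show ?thesis .
 qed
 have "(NINT z. ennreal (norm (indicator {s..t} z *R (LINT x. G z x * \<phi> x))))
   <= (NINT z. pint 1 \<phi> * indicator {s..t} z + ennreal B * (pint q (G z) * indicator {s..t} z))"
  using b by (intro nn_integral_mono) (auto simp: indicator_def)
 also have "... = pint 1 \<phi> * emeasure lborel {s..t} + ennreal B * (NINT t:{s..t}. pint q (G t))" by (simp add: nn_integral_add nn_integral_cmult)
 also have "... < \<infinity>" using tf_LL[OF \<phi>, of 1] fin by (auto simp: LL_def ennreal_mult_less_top emeasure_lborel_Icc_eq)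
 finally show ?thesis unfolding set_integrable_def integrable_iff_bounded by simp
qed

lemma pair_time_integrable_L2:
 fixes F :: "real => 'a::euclidean_space => complex" assumes F [measurable]: "joint F" and LB: "AE q. q : {s..t} --> F q : LB"
  and fin: "(NINT t:{s..t}. ennreal (nb (F t))) < \<infinity>" and \<phi>: "\<phi> : LB" shows "set_L1 {s..t} (%q. LINT x. F q x * \<phi> x)"
proof -
 have [measurable]: "\<phi> : Borel" using \<phi> by (rule LB_borel)
 have "(NINT q. ennreal (norm (indicator {s..t} q *R (LINT x. F q x * \<phi> x))))
   <= (NINT q. (ennreal (nb (F q)) * indicator {s..t} q) * ennreal (nb \<phi>))"
 proof (rule nn_integral_mono_AE)
  show "AE q. ennreal (norm (indicator {s..t} q *R (LINT x. F q x * \<phi> x)))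
    <= (ennreal (nb (F q)) * indicator {s..t} q) * ennreal (nb \<phi>)" using LB
  proof eventually_elim
   case (elim q)
   thus ?case using cauchy_schwarz[of "F q" lborel \<phi>] \<phi> by (auto simp: indicator_def ennreal_mult[symmetric] ennreal_leI)
  qed
 qed
 also have "... = (NINT t:{s..t}. ennreal (nb (F t))) * ennreal (nb \<phi>)" by (rule nn_integral_multc) measurable
 also have "... < \<infinity>" using fin by (simp add: ennreal_mult_less_top)
 finally show ?thesis unfolding set_integrable_def integrable_iff_bounded by simp
qed

lemma laplacian_reflect: assumes "\<phi> : tf" shows "laplacian (%x. \<phi> (y - x)) x = laplacian \<phi> (y - x)"
proof -
 have "pd b (pd b (%x. \<phi> (y - x))) x = pd b (pd b \<phi>) (y - x)" if b: "b : Basis" for b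
 proof -
  have "pd b (%x. \<phi> (y - x)) = (%x. (-1) * pd b \<phi> (y - x))" using pd_affine[OF assms, of b y "-1"] by auto
  moreover have "pd b (%x. (-1) * pd b \<phi> (y - x)) x = (-1) * pd b (%x. pd b \<phi> (y - x)) x"
   by (rule pd_cmult[OF tf_reflect[OF tf_pd[OF assms b]]])
  ultimately show ?thesis using pd_affine[OF tf_pd[OF assms b], of b y "-1" x] by simp
 qed
 thus ?thesis by (simp add: laplacian_def)
qed

text \<open>Integration by parts in each direction. What matters for the energy is that the value is
  real, for the elliptic estimate that it is minus the squared gradient.\<close>

lemma ib_laplacian: assumes w: "w : LB" and K: "K : tf"
 shows "ib (conv (laplacian K) w) (conv K w) = - of_real (SUM b:Basis. (nb (conv (pd b K) w))^2)"
proof -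
 have "conv (laplacian K) w = (%y. SUM b:Basis. conv (pd b (pd b K)) w y)"
 proof
  fix y
  have "conv (laplacian K) w y = (LINT x. (SUM b:Basis. w x * pd b (pd b K) (y - x)))"
   unfolding conv_def laplacian_def by (simp add: sum_distrib_left)
  also have "... = (SUM b:Basis. conv (pd b (pd b K)) w y)"
   unfolding conv_def using w K by (intro Bochner_Integration.integral_sum conv_integrable[of w 2] tf_pd) (auto simp: LB_eq_LL)
  finally show "conv (laplacian K) w y = (SUM b:Basis. conv (pd b (pd b K)) w y)" .
 qed
 hence "ib (conv (laplacian K) w) (conv K w) = (SUM b:Basis. ib (conv (pd b (pd b K)) w) (conv K w))"
  using w K by (simp add: ip_sum_left conv_LB tf_pd)
 also have "... = (SUM b:Basis. - of_real ((nb (conv (pd b K) w))^2))" using w K by (intro sum.cong refl) (simp add: conv_ibp tf_pd ip_self)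
 finally show ?thesis by (simp add: sum_negf)
qed

lemma product_integrable:
 fixes X A :: "real => 'a::euclidean_space => complex" assumes [measurable]: "joint X" "joint A"
  and bd: "AE q. q : {s..t} --> (NINT y. ennreal (cmod (X q y) * cmod (A q y))) <= g q" and fin: "(NINT q:{s..t}. g q) < \<infinity>"
 shows "integrable (lborel \<Otimes>\<^sub>M lborel) (%(q, y). indicator {s..t} q *R (X q y * cnj (A q y)))"
proof -
 have "(\<integral>\<^sup>+p. ennreal (norm (case p of (q, y) => indicator {s..t} q *R (X q y * cnj (A q y)))) \<partial>(lborel \<Otimes>\<^sub>M lborel))
   = (NINT q. NINT y. ennreal (norm (indicator {s..t} q *R (X q y * cnj (A q y)))))"
  using sigma_finite_measure.nn_integral_fst[OF sigma_finite_lborel, of "%p. ennreal (norm (case p of (q, y) => indicator {s..t} q *R (X q y * cnj (A q y))))" lborel, symmetric]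
  by simp
 also have "... <= (NINT q:{s..t}. g q)"
 proof (rule nn_integral_mono_AE)
  show "AE q. (NINT y. ennreal (norm (indicator {s..t} q *R (X q y * cnj (A q y))))) <= g q * indicator {s..t} q"
   using bd by eventually_elim (auto simp: norm_mult indicator_def)
 qed
 also have "... < \<infinity>" by (rule fin)
 finally show ?thesis unfolding integrable_iff_bounded by simp
qed

lemma nn_cauchy_schwarz: assumes "u : L2 M" "v : L2 M"
 shows "(\<integral>\<^sup>+y. ennreal (cmod (u y) * cmod (v y)) \<partial>M) <= ennreal (n2 M u * n2 M v)"
 using nn_integral_eq_integral[OF L2_cmod_mult_integrable[OF assms]] cauchy_schwarz_cmod[OF assms] by (simp add: ennreal_leI)

lemma conj_exponents: assumes "0 < m" "m < (1::real)" shows "1 + m > 1" "(1 + m) / m > 1" "1 / (1 + m) + 1 / ((1 + m) / m) = 1"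
 using assms by (auto simp: field_simps)

lemma evolution_regular: assumes "evolution m a w G F" shows "joint w" "joint G"
  "joint F"
  "t >= 0 ==> w t : LB" "AE t. t >= 0 --> F t : LB"
  "(NINT t:{0..T}. pint (1 + m) (w t)) < \<infinity>" "(NINT t:{0..T}. pint ((1 + m) / m) (G t)) < \<infinity>"
  "(NINT t:{0..T}. ennreal (nb (F t))) < \<infinity>" using assms unfolding evolution_def by blast+

lemma set_nn_mono:
 fixes f :: "real => ennreal" assumes "0 <= s" "(NINT t:{0..T}. f t) < \<infinity>" shows "(NINT t:{s..T}. f t) < \<infinity>"
 by (rule le_less_trans[OF nn_integral_mono assms(2)]) (use assms(1) in \<open>auto simp: indicator_def\<close>)

lemma evolution_bounded: "evolution m a w G F ==> EX K>=0. ALL t:{0..T}. nb (w t) <= K"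
 unfolding evolution_def by (metis abs_ge_self abs_ge_zero order_trans)

lemma AE_LL_of_time_integral:
 fixes G :: "real => 'a::euclidean_space => complex" assumes [measurable]: "joint G"
  and fin: "(NINT t:{s..t}. pint q (G t)) < \<infinity>" shows "AE z. z : {s..t} --> G z : LL q"
proof -
 have [measurable]: "(%t. pint q (G t)) : Borel" by (rule pint_measurable[OF assms(1)])
 have "AE z. pint q (G z) * indicator {s..t} z \<noteq> \<infinity>"
 proof (rule nn_integral_noteq_infinite)
  show "(%z. pint q (G z) * indicator {s..t} z) : borel_measurable lborel" by simp
 qed (use fin in simp)
 thus ?thesis by eventually_elim (auto simp: LL_def section_measurable less_top)
qed

lemma evolution_AE: assumes ev: "evolution m a w G F" and s: "0 <= s"
 shows "AE q. q : {s..t} --> w q : LB \<and> F q : LB \<and> w q : LL (1 + m) \<and> G q : LL ((1 + m) / m)" using evolution_regular(5)[OF ev]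
  AE_LL_of_time_integral[OF evolution_regular(1)[OF ev] set_nn_mono[OF s evolution_regular(6)[OF ev, of t]]]
  AE_LL_of_time_integral[OF evolution_regular(2)[OF ev] set_nn_mono[OF s evolution_regular(7)[OF ev, of t]]]
 by eventually_elim (use s evolution_regular(4)[OF ev] in auto)

text \<open>For each y the test function K(y - x) makes the mollified solution at y absolutely
  continuous in time, so \<open>ac_norm_sq\<close> applies pointwise; the identity is then
  integrated over y by Fubini.\<close>

lemma mollified_energy:
 fixes w G F :: "real => 'a::euclidean_space => complex" and a :: complex and n :: nat
 assumes ev: "evolution m a w G F" and m: "0 < m" "m < 1" and st: "0 <= s" "s <= t"
 defines "A \<equiv> %q. conv (mo n) (w q)" shows "(nb (A t))^2 - (nb (A s))^2
   = 2 * (LINT q:{s..t}. Im (ib (conv (mo n) (F q)) (A q)) - Im (a * ib (conv (mo n) (G q)) (A q)))"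
proof -
 note reg = evolution_regular[OF ev]
 note pq = conj_exponents[OF m]
 define K where "K = (mo n :: 'a => complex)"
 have K: "K : tf" by (simp add: K_def tf_moll)
 have LK: "laplacian K : tf" by (rule tf_laplacian[OF K])
 have [measurable]: "joint w" "joint G"
  "joint F" by (rule reg)+
 define FF GG W where "FF = (%q. conv K (F q))" and "GG = (%q. conv K (G q))" and "W = (%q. conv (laplacian K) (w q))"
 have A_def': "A = (%q. conv K (w q))" by (simp add: A_def K_def)
 have [measurable]: "joint A" "joint FF"
  "joint GG" "joint W" unfolding A_def' FF_def GG_def W_def by (intro conv_joint_measurable tf_borel K LK reg)+
 obtain C where C: "C >= 0" "!!q. q : {0..t} ==> nb (w q) <= C" using evolution_bounded[OF ev] by metis
 note ae = evolution_AE[OF ev st(1), of t]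
 have wfin: "(NINT q:{s..t}. ennreal (nb (w q))) < \<infinity>"
 proof -
  have "(NINT q:{s..t}. ennreal (nb (w q))) <= (NINT q. ennreal C * indicator {s..t} q)"
   using C st by (intro nn_integral_mono) (auto simp: indicator_def ennreal_leI)
  also have "... < \<infinity>" by (simp add: nn_integral_cmult emeasure_lborel_Icc_eq ennreal_mult_less_top)
  finally show ?thesis .
 qed
 have Ffin: "(NINT q:{s..t}. ennreal (nb (F q))) < \<infinity>" by (rule set_nn_mono[OF st(1) reg(8)])
 \<comment> \<open>The time derivative of the mollified solution at y, read off from the mollified
   equation.\<close>
 define b where "b y q = - \<i> * (FF q y - a * GG q y - W q y)" for y q
 have bi: "set_L1 {s..t} (%q. FF q y)" "set_L1 {s..t} (%q. GG q y)"
  "set_L1 {s..t} (%q. W q y)" for y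
 proof -
  show "set_L1 {s..t} (%q. FF q y)" unfolding FF_def conv_def
   by (rule pair_time_integrable_L2[OF reg(3) _ Ffin tf_LB[OF tf_reflect[OF K]]]) (use ae in \<open>eventually_elim, auto\<close>)
  show "set_L1 {s..t} (%q. GG q y)" unfolding GG_def conv_def
   by (rule pair_time_integrable[OF reg(2) _ set_nn_mono[OF st(1) reg(7)] tf_reflect[OF K]]) (use pq in auto)
  show "set_L1 {s..t} (%q. W q y)" unfolding W_def conv_def
   by (rule pair_time_integrable_L2[OF reg(1) _ wfin tf_LB[OF tf_reflect[OF LK]]]) (use ae in \<open>eventually_elim, auto\<close>)
 qed
 have step: "A r y = A s y + (LINT q:{s..r}. b y q)" if r: "r : {s..t}" for r y
 proof -
  have sub: "{s..r} \<subseteq> {s..t}" using r by auto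
  note bi' = bi[of y, THEN set_integrable_subset, OF _ sub, simplified]
  have "\<i> * (A r y - A s y) + (LINT q:{s..r}. W q y) + a * (LINT q:{s..r}. GG q y) = (LINT q:{s..r}. FF q y)"
  proof -
   have "\<i> * ((LINT x. w r x * K (y - x)) - (LINT x. w s x * K (y - x)))
    + (LINT q:{s..r}. LINT x. w q x * laplacian (%x. K (y - x)) x)
    + a * (LINT q:{s..r}. LINT x. G q x * K (y - x))
    = (LINT q:{s..r}. LINT x. F q x * K (y - x))" using ev tf_reflect[OF K, of y] st r unfolding evolution_def by auto
   thus ?thesis unfolding laplacian_reflect[OF K] A_def' FF_def GG_def W_def conv_def .
  qed
  hence "(LINT q:{s..r}. FF q y) - a * (LINT q:{s..r}. GG q y) - (LINT q:{s..r}. W q y) = \<i> * (A r y - A s y)" by (simp add: algebra_simps)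
  moreover have "(LINT q:{s..r}. b y q) = - \<i> * ((LINT q:{s..r}. FF q y) - a * (LINT q:{s..r}. GG q y) - (LINT q:{s..r}. W q y))"

   unfolding b_def set_integral_mult_right
   using set_integral_diff(2)[OF set_integral_diff(1)[OF bi'(1) set_integrable_mult_right[OF bi'(2), of a]] bi'(3)]
    set_integral_diff(2)[OF bi'(1) set_integrable_mult_right[OF bi'(2), of a]] by (simp only: set_integral_mult_right)
  ultimately show ?thesis by simp
 qed
 have Z: "integrable (lborel \<Otimes>\<^sub>M lborel) (%(q, y). indicator {s..t} q *R (FF q y * cnj (A q y)))"
  "integrable (lborel \<Otimes>\<^sub>M lborel) (%(q, y). indicator {s..t} q *R (GG q y * cnj (A q y)))"
  "integrable (lborel \<Otimes>\<^sub>M lborel) (%(q, y). indicator {s..t} q *R (W q y * cnj (A q y)))"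
 proof -
  show "integrable (lborel \<Otimes>\<^sub>M lborel) (%(q, y). indicator {s..t} q *R (FF q y * cnj (A q y)))"
  proof (rule product_integrable[where g="%q. ennreal (nb (F q)) * ennreal C"])
   show "AE q. q : {s..t} --> (NINT y. ennreal (cmod (FF q y) * cmod (A q y))) <= ennreal (nb (F q)) * ennreal C" using ae
   proof (eventually_elim, intro impI)
    fix q assume h: "q : {s..t} --> w q : LB \<and> F q : LB \<and> w q : LL (1 + m) \<and> G q : LL ((1 + m) / m)" and q: "q : {s..t}"
    hence "(NINT y. ennreal (cmod (FF q y) * cmod (A q y))) <= ennreal (nb (FF q) * nb (A q))"
     unfolding FF_def A_def' by (intro nn_cauchy_schwarz conv_LB K) auto
    also have "... <= ennreal (nb (F q) * C)" using h q st C nb_mo_le[of "F q" n] nb_mo_le[of "w q" n]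
     by (intro ennreal_leI mult_mono) (auto simp: FF_def A_def' K_def intro: order_trans)
    finally show "(NINT y. ennreal (cmod (FF q y) * cmod (A q y))) <= ennreal (nb (F q)) * ennreal C" by (simp add: ennreal_mult C)
   qed
   have "(NINT q:{s..t}. ennreal (nb (F q)) * ennreal C) = ennreal C * (NINT q:{s..t}. ennreal (nb (F q)))"
    by (subst nn_integral_cmult[symmetric]) (auto simp: mult_ac)
   thus "(NINT q:{s..t}. ennreal (nb (F q)) * ennreal C) < \<infinity>" using Ffin by (simp add: ennreal_mult_less_top)
  qed (measurable)
  show "integrable (lborel \<Otimes>\<^sub>M lborel) (%(q, y). indicator {s..t} q *R (GG q y * cnj (A q y)))"
  proof (rule product_integrable[where g="%q. pint ((1 + m) / m) (G q) + pint (1 + m) (w q)"])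
   show "AE q. q : {s..t} --> (NINT y. ennreal (cmod (GG q y) * cmod (A q y))) <= pint ((1 + m) / m) (G q) + pint (1 + m) (w q)" using ae
   proof (eventually_elim, intro impI)
    fix q assume h: "q : {s..t} --> w q : LB \<and> F q : LB \<and> w q : LL (1 + m) \<and> G q : LL ((1 + m) / m)" and q: "q : {s..t}"
    have "(NINT y. ennreal (cmod (GG q y) * cmod (A q y))) <= ennreal (1 powr ((1 + m) / m)) * pint ((1 + m) / m) (GG q) + ennreal (1 powr (- (1 + m))) * pint (1 + m) (A q)"
     by (rule pairing_bound[OF pq]) measurable
    also have "... <= pint ((1 + m) / m) (G q) + pint (1 + m) (w q)" using h q pq by (simp add: FF_def GG_def A_def' K_def add_mono pint_mo_le)
    finally show "(NINT y. ennreal (cmod (GG q y) * cmod (A q y))) <= pint ((1 + m) / m) (G q) + pint (1 + m) (w q)" .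
   qed
   have "(NINT q:{s..t}. pint ((1 + m) / m) (G q) + pint (1 + m) (w q))
     = (NINT q:{s..t}. pint ((1 + m) / m) (G q)) + (NINT q:{s..t}. pint (1 + m) (w q))"
    by (subst nn_integral_add[symmetric]) (auto simp: distrib_right)
   thus "(NINT q:{s..t}. pint ((1 + m) / m) (G q) + pint (1 + m) (w q)) < \<infinity>"
    using set_nn_mono[OF st(1) reg(6)] set_nn_mono[OF st(1) reg(7)] by simp
  qed (measurable)
  show "integrable (lborel \<Otimes>\<^sub>M lborel) (%(q, y). indicator {s..t} q *R (W q y * cnj (A q y)))"
  proof (rule product_integrable[where g="%q. ennreal ((LINT x. cmod (laplacian K x)) * C * C)"])
   show "AE q. q : {s..t} --> (NINT y. ennreal (cmod (W q y) * cmod (A q y))) <= ennreal ((LINT x. cmod (laplacian K x)) * C * C)"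
   proof (intro AE_I2 impI)
    fix q assume q: "q : {s..t}"
    hence wL: "w q : LB" "nb (w q) <= C" using st reg(4) C by auto
    have "(NINT y. ennreal (cmod (W q y) * cmod (A q y))) <= ennreal (nb (W q) * nb (A q))"
     unfolding W_def A_def' by (intro nn_cauchy_schwarz conv_LB K LK wL)
    also have "nb (W q) <= (LINT x. cmod (laplacian K x)) * C"
     unfolding W_def by (rule order_trans[OF nb_conv_le[OF wL(1) LK] mult_left_mono[OF wL(2)]]) simp
    hence "ennreal (nb (W q) * nb (A q)) <= ennreal ((LINT x. cmod (laplacian K x)) * C * C)" using nb_mo_le[OF wL(1), of n] wL C(1)
     by (intro ennreal_leI mult_mono) (auto simp: A_def' K_def intro: order_trans)
    finally show "(NINT y. ennreal (cmod (W q y) * cmod (A q y))) <= ennreal ((LINT x. cmod (laplacian K x)) * C * C)" .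
   qed
   show "(NINT q:{s..t}. ennreal ((LINT x. cmod (laplacian K x)) * C * C)) < \<infinity>"
    by (simp add: nn_integral_cmult emeasure_lborel_Icc_eq ennreal_mult_less_top)
  qed (measurable)
 qed
 note fst = pair_sigma_finite.AE_integrable_fst[OF pair_sigma_finite_lborel]
 \<comment> \<open>On [s, t] the imaginary part of P is the real part of conj(A) b, the density in
   \<open>ac_norm_sq\<close>.\<close>
 define P where "P = (%q y. indicator {s..t} q *R (FF q y * cnj (A q y)) - a * (indicator {s..t} q *R (GG q y * cnj (A q y))) - indicator {s..t} q *R (W q y * cnj (A q y)))"
 have P: "integrable (lborel \<Otimes>\<^sub>M lborel) (case_prod P)"
  using Bochner_Integration.integrable_diff[OF Bochner_Integration.integrable_diff[OF Z(1) integrable_mult_right[OF Z(2), of a]] Z(3)]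
  by (simp add: P_def case_prod_unfold)
 have pt: "(cmod (A t y))^2 - (cmod (A s y))^2 = 2 * Im (LINT q. P q y)" if "L1 (%q. P q y)" for y
 proof -
  have "set_L1 {s..t} (b y)" unfolding b_def by (intro set_integrable_mult_right set_integral_diff bi)
  from ac_norm_sq[OF st(2) this step]
  have "(cmod (A t y))^2 - (cmod (A s y))^2 = 2 * (LINT q:{s..t}. Re (cnj (A q y) * b y q))" by simp
  also have "(LINT q:{s..t}. Re (cnj (A q y) * b y q)) = (LINT q. Im (P q y))" unfolding set_lebesgue_integral_def
   by (intro Bochner_Integration.integral_cong) (auto simp: b_def P_def indicator_def algebra_simps)
  also have "... = Im (LINT q. P q y)" using that by simp
  finally show ?thesis .
 qed
 have AL: "A t : LB" "A s : LB" unfolding A_def' using st reg(4) by (auto intro: conv_LB K)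
 have "(nb (A t))^2 - (nb (A s))^2 = (LINT y. (cmod (A t y))^2 - (cmod (A s y))^2)" unfolding n2_sq using AL by (simp add: L2_integrable)
 also have "... = (LINT y. 2 * Im (LINT q. P q y))"
 proof (rule integral_cong_AE)
  show "AE y. (cmod (A t y))^2 - (cmod (A s y))^2 = 2 * Im (LINT q. P q y)"
   using pair_sigma_finite.AE_integrable_snd[OF pair_sigma_finite_lborel P] by eventually_elim (rule pt)
  show "(%y. 2 * Im (LINT q. P q y)) : borel_measurable lborel" using pair_sigma_finite.integrable_snd[OF pair_sigma_finite_lborel P] by auto
 qed (use AL in \<open>auto simp: LB_borel\<close>)
 also have "... = 2 * Im (LINT y. LINT q. P q y)" using pair_sigma_finite.integrable_snd[OF pair_sigma_finite_lborel P] by simp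
 also have "(LINT y. LINT q. P q y) = (LINT q. LINT y. P q y)" by (rule pair_sigma_finite.Fubini_integral[OF pair_sigma_finite_lborel P])
 also have "Im ... = (LINT q. Im (LINT y. P q y))" using pair_sigma_finite.integrable_fst[OF pair_sigma_finite_lborel P] by simp
 also have "... = (LINT q:{s..t}. Im (ib (FF q) (A q)) - Im (a * ib (GG q) (A q)))" unfolding set_lebesgue_integral_def
 proof (rule integral_cong_AE)
  show "(%q. Im (LINT y. P q y)) : borel_measurable lborel" using pair_sigma_finite.integrable_fst[OF pair_sigma_finite_lborel P] by auto
  show "(%q. indicat_real {s..t} q *R (Im (ib (FF q) (A q)) - Im (a * ib (GG q) (A q)))) : borel_measurable lborel" unfolding ip_def by measurable
  show "AE q. Im (LINT y. P q y) = indicat_real {s..t} q *R (Im (ib (FF q) (A q)) - Im (a * ib (GG q) (A q)))"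
   using fst[OF Z(1)] fst[OF Z(2)] fst[OF Z(3)]
  proof eventually_elim
   case (elim q)
   show ?case
   proof (cases "q : {s..t}")
    case True
    have "(LINT y. P q y) = ib (FF q) (A q) - a * ib (GG q) (A q) - ib (W q) (A q)" using elim True unfolding P_def ip_def by simp
    \<comment> \<open>The Laplacian pairs with the solution to a real number, so it does not enter
      the energy balance.\<close>
    moreover have "Im (ib (W q) (A q)) = 0" using ib_laplacian[OF _ K, of "w q"] reg(4) True st by (simp add: W_def A_def' del: of_real_sum)
    ultimately show ?thesis using True by simp
   qed (simp add: P_def)
  qed
 qed
 finally show ?thesis by (simp add: FF_def GG_def K_def)
qed

text \<open>The limit in n of \<open>mollified_energy\<close>. Both pairings are bounded by norms
  and power integrals that mollification does not increase, which gives an integrable majorant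
  independent of n.\<close>

lemma evolution_energy:
 fixes w G F :: "real => 'a::euclidean_space => complex" and a :: complex
 assumes ev: "evolution m a w G F" and m: "0 < m" "m < 1" and st: "0 <= s" "s <= t"
 defines "e \<equiv> %q. Im (ib (F q) (w q)) - Im (a * ib (G q) (w q))"
 shows "set_L1 {s..t} e" "(nb (w t))^2 - (nb (w s))^2 = 2 * (LINT q:{s..t}. e q)"
proof -
 note reg = evolution_regular[OF ev]
 note pq = conj_exponents[OF m]
 have [measurable]: "joint w" "joint G"
  "joint F" by (rule reg)+
 have [measurable]: "case_prod (%q. conv (mo n) (w q)) : Borel2"
  "case_prod (%q. conv (mo n) (G q)) : Borel2"
  "case_prod (%q. conv (mo n) (F q)) : Borel2" for n by (intro conv_joint_measurable tf_borel tf_moll reg)+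
 have [measurable]: "(%t. pint ((1 + m) / m) (G t)) : Borel" "(%t. pint (1 + m) (w t)) : Borel"
  "(%t. nb (F t)) : Borel" by (intro pint_measurable nb_measurable reg)+
 obtain C where C: "C >= 0" "!!q. q : {0..t} ==> nb (w q) <= C" using evolution_bounded[OF ev] by metis
 note ae = evolution_AE[OF ev st(1), of t]
 define en where "en n q = Im (ib (conv (mo n) (F q)) (conv (mo n) (w q))) - Im (a * ib (conv (mo n) (G q)) (conv (mo n) (w q)))" for n q
 have mol: "(nb (conv (mo n) (w t)))^2 - (nb (conv (mo n) (w s)))^2 = 2 * (LINT q. indicator {s..t} q *R en n q)" for n
  using mollified_energy[OF ev m st, of n] by (simp add: en_def set_lebesgue_integral_def)
 define g where "g q = indicator {s..t} q * (nb (F q) * C + cmod a * (enn2real (pint ((1 + m) / m) (G q)) + enn2real (pint (1 + m) (w q))))" for q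
 have gi: "L1 g"
 proof -
  have f1: "L1 (%q. indicator {s..t} q * nb (F q))"
  proof (rule integrableI_nonneg)
   have "(NINT q. ennreal (indicator {s..t} q * nb (F q))) = (NINT q:{s..t}. ennreal (nb (F q)))"
    by (intro nn_integral_cong) (auto simp: indicator_def)
   thus "(NINT q. ennreal (indicator {s..t} q * nb (F q))) < \<infinity>" using set_nn_mono[OF st(1) reg(8), of t] by simp
  qed auto
  have f2: "L1 (%q. indicator {s..t} q * enn2real (f q))"
   if [measurable]: "f : Borel" and fin: "(NINT q:{0..t}. f q) < \<infinity>" for f :: "real => ennreal"
  proof (rule integrableI_nonneg)
   have "(NINT q. ennreal (indicator {s..t} q * enn2real (f q))) <= (NINT q:{s..t}. f q)"
    by (intro nn_integral_mono) (auto simp: indicator_def ennreal_enn2real_if)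
   thus "(NINT q. ennreal (indicator {s..t} q * enn2real (f q))) < \<infinity>" using set_nn_mono[OF st(1) fin] by (rule le_less_trans)
  qed (auto simp: indicator_def)
  have "L1 (%q. C * (indicator {s..t} q * nb (F q))
    + cmod a * (indicator {s..t} q * enn2real (pint ((1 + m) / m) (G q)) + indicator {s..t} q * enn2real (pint (1 + m) (w q))))"
   by (intro Bochner_Integration.integrable_add integrable_mult_right f1 f2 reg) measurable
  moreover have "g = (%q. C * (indicator {s..t} q * nb (F q))
    + cmod a * (indicator {s..t} q * enn2real (pint ((1 + m) / m) (G q)) + indicator {s..t} q * enn2real (pint (1 + m) (w q))))"
   by (auto simp: g_def algebra_simps)
  ultimately show ?thesis by simp
 qed
 have lim: "AE q. (%n. indicator {s..t} q *R en n q) ~> indicator {s..t} q *R e q" using ae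
 proof eventually_elim
  case (elim q)
  show ?case
  proof (cases "q : {s..t}")
   case True
   with elim have L: "w q : LB" "F q : LB" "w q : LL (1 + m)" "G q : LL ((1 + m) / m)" by auto
   have "(%n. ib (conv (mo n) (F q)) (conv (mo n) (w q))) ~> ib (F q) (w q)" by (intro ip_tendsto conv_LB tf_moll L mo_convergence_nb)
   moreover have "(%n. ib (conv (mo n) (G q)) (conv (mo n) (w q))) ~> ib (G q) (w q)" by (rule pairing_mo_tendsto[OF pq L(4,3)])
   ultimately show ?thesis unfolding en_def e_def by (intro tendsto_intros)
  qed simp
 qed
 have bd: "AE q. norm (indicator {s..t} q *R en n q) <= g q" for n using ae
 proof eventually_elim
  case (elim q)
  show ?case
  proof (cases "q : {s..t}")
   case True
   with elim have L: "w q : LB" "F q : LB" "w q : LL (1 + m)" "G q : LL ((1 + m) / m)" by auto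
   have "\<bar>Im (ib (conv (mo n) (F q)) (conv (mo n) (w q)))\<bar> <= nb (F q) * C"
   proof -
    have "\<bar>Im (ib (conv (mo n) (F q)) (conv (mo n) (w q)))\<bar> <= nb (conv (mo n) (F q)) * nb (conv (mo n) (w q))"
     by (rule order_trans[OF abs_Im_le_cmod ip_cauchy_schwarz]) (intro conv_LB tf_moll L)+
    also have "... <= nb (F q) * C" using True st by (intro mult_mono nb_mo_le[OF L(2)] order_trans[OF nb_mo_le[OF L(1)] C(2)]) auto
    finally show ?thesis .
   qed
   moreover have "\<bar>Im (a * ib (conv (mo n) (G q)) (conv (mo n) (w q)))\<bar>
     <= cmod a * (enn2real (pint ((1 + m) / m) (G q)) + enn2real (pint (1 + m) (w q)))"
   proof -
    have "ennreal (cmod (ib (conv (mo n) (G q)) (conv (mo n) (w q)))) <= pint ((1 + m) / m) (conv (mo n) (G q)) + pint (1 + m) (conv (mo n) (w q))"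
     using pq by (intro pairing_cmod_le[OF pq] conv_LL L tf_moll) auto
    also have "... <= pint ((1 + m) / m) (G q) + pint (1 + m) (w q)" using pq by (intro add_mono pint_mo_le L) auto
    also have "... = ennreal (enn2real (pint ((1 + m) / m) (G q)) + enn2real (pint (1 + m) (w q)))" using L(3,4) by (simp add: LL_def)
    finally have "cmod (ib (conv (mo n) (G q)) (conv (mo n) (w q))) <= enn2real (pint ((1 + m) / m) (G q)) + enn2real (pint (1 + m) (w q))"
     by (subst (asm) ennreal_le_iff) auto
    thus ?thesis by (intro order_trans[OF abs_Im_le_cmod]) (simp add: norm_mult mult_left_mono)
   qed
   ultimately show ?thesis using True unfolding en_def g_def by simp
  qed (simp add: g_def)
 qed
 have em: "(%q. indicator {s..t} q *R en n q) : borel_measurable lborel"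
  "(%q. indicator {s..t} q *R e q) : borel_measurable lborel" for n unfolding en_def e_def ip_def by measurable
 show "set_L1 {s..t} e" unfolding set_integrable_def by (rule integrable_dominated_convergence[OF em(2) em(1) gi lim bd])
 have "(%n. 2 * (LINT q. indicator {s..t} q *R en n q)) ~> 2 * (LINT q. indicator {s..t} q *R e q)"
  by (intro tendsto_intros integral_dominated_convergence[OF em(2) em(1) gi lim bd])
 moreover have "(%n. (nb (conv (mo n) (w t)))^2 - (nb (conv (mo n) (w s)))^2) ~> (nb (w t))^2 - (nb (w s))^2"
  using st by (intro tendsto_intros mo_nb_tendsto reg) auto
 ultimately show "(nb (w t))^2 - (nb (w s))^2 = 2 * (LINT q:{s..t}. e q)" unfolding mol set_lebesgue_integral_def by (rule LIMSEQ_unique[rotated])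
qed

text \<open>Dropping the dissipative term bounds the squared norm at r by S (nb (w 0) + 2 B), where
  S is the supremum of the norm over [0, T]; taking the supremum over r and dividing by S gives the
  claim. The factor 2 is the price for avoiding a differential inequality for the norm
  itself.\<close>

lemma evolution_contraction:
 fixes w G F :: "real => 'a::euclidean_space => complex" and a :: complex assumes ev: "evolution m a w G F" and m: "0 < m" "m < 1"
  and diss: "!!q x. q >= 0 ==> Im (a * (G q x * cnj (w q x))) >= 0"
  and F: "(NINT t:{0..T}. ennreal (nb (F t))) <= ennreal B" "B >= 0" and t: "t : {0..T}" shows "nb (w t) <= nb (w 0) + 2 * B"
proof -
 note reg = evolution_regular[OF ev]
 have [measurable]: "joint F" by (rule reg)
 have [measurable]: "(%t. nb (F t)) : Borel" by (intro nb_measurable reg)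
 obtain C where C: "C >= 0" "!!q. q : {0..T} ==> nb (w q) <= C" using evolution_bounded[OF ev] by metis
 define S where "S = (SUP q\<in>{0..T}. nb (w q))"
 have bdd: "bdd_above ((%q. nb (w q)) ` {0..T})" using C by (auto intro!: bdd_aboveI[of _ C])
 have S: "nb (w q) <= S" if "q : {0..T}" for q unfolding S_def using that bdd by (rule cSUP_upper)
 have S0: "S >= 0" using S[OF t] n2_nonneg[of lborel "w t"] by linarith
 have main: "(nb (w r))^2 <= S * (nb (w 0) + 2 * B)" if r: "r : {0..T}" for r
 proof -
  let ?e = "%q. Im (ib (F q) (w q)) - Im (a * ib (G q) (w q))"
  have r0: "0 <= r" using r by simp
  note en = evolution_energy[OF ev m order_refl r0]
  have fi: "L1 (%q. indicator {0..r} q * nb (F q))" and fb: "(LINT q. indicator {0..r} q * nb (F q)) <= B"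
  proof -
   have *: "(NINT q. ennreal (indicator {0..r} q * nb (F q))) <= ennreal B"
   proof (rule order_trans[OF nn_integral_mono F(1)])
    show "ennreal (indicator {0..r} q * nb (F q)) <= ennreal (nb (F q)) * indicator {0..T} q" for q using r by (auto simp: indicator_def)
   qed
   show i: "L1 (%q. indicator {0..r} q * nb (F q))" using * by (intro integrableI_nonneg) (auto elim: le_less_trans)
   have "ennreal (LINT q. indicator {0..r} q * nb (F q)) <= ennreal B" using * by (subst nn_integral_eq_integral[OF i, symmetric]) auto
   thus "(LINT q. indicator {0..r} q * nb (F q)) <= B" using F(2) by simp
  qed
  have "(LINT q:{0..r}. ?e q) <= (LINT q. S * (indicator {0..r} q * nb (F q)))" unfolding set_lebesgue_integral_def
  proof (rule integral_mono_AE)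
   show "AE q. indicat_real {0..r} q *R ?e q <= S * (indicator {0..r} q * nb (F q))" using evolution_AE[OF ev order_refl, of r]
   proof eventually_elim
    case (elim q)
    show ?case
    proof (cases "q : {0..r}")
     case True
     with elim have L: "w q : LB" "F q : LB" "w q : LL (1 + m)" "G q : LL ((1 + m) / m)" by auto
     have "Im (ib (F q) (w q)) <= nb (F q) * nb (w q)" using ip_cauchy_schwarz[OF L(2,1)] abs_Im_le_cmod[of "ib (F q) (w q)"] by linarith
     also have "... <= nb (F q) * S" using True r by (intro mult_left_mono S) auto
     finally have 1: "Im (ib (F q) (w q)) <= S * nb (F q)" by (simp add: mult.commute)
     have "Im (a * ib (G q) (w q)) = (LINT x. Im (a * (G q x * cnj (w q x))))"
      using pairing_integrable[OF conj_exponents[OF m] L(4,3)] unfolding ip_def by (subst integral_Im) auto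
     also have "... >= 0" using diss True by (intro Bochner_Integration.integral_nonneg) auto
     finally show ?thesis using 1 True by simp
    qed simp
   qed
  qed (use en(1) fi in \<open>auto simp: set_integrable_def\<close>)
  also have "... = S * (LINT q. indicator {0..r} q * nb (F q))" by simp
  also have "... <= S * B" using fb S0 by (intro mult_left_mono)
  finally have "(nb (w r))^2 <= (nb (w 0))^2 + 2 * (S * B)" using en(2) by simp
  also have "(nb (w 0))^2 <= S * nb (w 0)" using S[of 0] t by (simp add: power2_eq_square mult_right_mono)
  finally show ?thesis by (simp add: algebra_simps)
 qed
 have R: "nb (w 0) + 2 * B >= 0" using F(2) by simp
 have "S <= nb (w 0) + 2 * B"
 proof (cases "S = 0")
  case False
  hence Sp: "S > 0" using S0 by simp
  have "nb (w r) <= sqrt (S * (nb (w 0) + 2 * B))" if "r : {0..T}" for r by (rule real_le_rsqrt) (rule main[OF that])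
  hence "S <= sqrt (S * (nb (w 0) + 2 * B))" unfolding S_def using t by (intro cSUP_least) auto
  hence "S^2 <= (sqrt (S * (nb (w 0) + 2 * B)))^2" using S0 by (intro power_mono)
  also have "... = S * (nb (w 0) + 2 * B)" using S0 R by simp
  finally show ?thesis using Sp by (simp add: power2_eq_square)
 qed (use R in simp)
 thus ?thesis using S[OF t] by linarith
qed

section \<open>The Gagliardo-Nirenberg inequality\<close>

text \<open>For l = 1: if xy >= 1 then xy <= (xy)^p, otherwise xy <= (xy)^(p/2), which the
  inequality of the means bounds by (x^p + y^p)/2. The scale l comes in by homogeneity.\<close>

lemma mult_le_powr_split:
 fixes x y l p :: real assumes "x >= 0" "y >= 0" "l > 0" "1 <= p" "p <= 2"
 shows "x * y <= l powr (2 - 2 * p) * (x powr p * y powr p) + l powr (2 - p) * ((x powr p + y powr p) / 2)"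
proof -
 have unit: "X * Y <= X powr p * Y powr p + (X powr p + Y powr p) / 2" if "X >= 0" "Y >= 0" for X Y :: real
 proof (cases "X * Y >= 1")
  case True
  hence "(X * Y) powr 1 <= (X * Y) powr p" using assms by (intro powr_mono) auto
  hence "X * Y <= X powr p * Y powr p" using that by (simp add: powr_mult)
  thus ?thesis by (simp add: add_increasing2)
 next
  case False
  have "X * Y <= (X powr p + Y powr p) / 2"
  proof (cases "X * Y = 0")
   case True
   thus ?thesis unfolding True by simp
  next
   case nz: False
   have "(X * Y) powr 1 <= (X * Y) powr (p / 2)" using False nz that assms by (intro powr_mono') auto
   also have "... = sqrt (X powr p * Y powr p)" using that by (simp add: powr_mult powr_half_sqrt[symmetric] powr_powr)
   also have "... <= (X powr p + Y powr p) / 2" by (rule arith_geo_mean_sqrt) auto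
   finally show ?thesis using that by simp
  qed
  thus ?thesis by (simp add: add_increasing)
 qed
 have "x * y = l^2 * ((x / l) * (y / l))" using assms by (simp add: power2_eq_square)
 also have "... <= l^2 * ((x / l) powr p * (y / l) powr p + ((x / l) powr p + (y / l) powr p) / 2)" using assms by (intro mult_left_mono unit) auto
 also have "... = l powr (2 - 2 * p) * (x powr p * y powr p) + l powr (2 - p) * ((x powr p + y powr p) / 2)"
 proof -
  have e: "l powr (2 - 2 * p) = l^2 / (l powr p * l powr p)" "l powr (2 - p) = l^2 / l powr p"
   using assms by (simp_all add: powr_diff powr_add[symmetric])
  have "l powr p > 0" using assms by simp
  thus ?thesis unfolding e using assms by (simp add: powr_divide field_simps)
 qed
 finally show ?thesis .
qed

text \<open>Averaging the increment bound over a ball replaces the Sobolev embedding.\<close>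

lemma gagliardo_nirenberg_ball:
 fixes u :: "'a::euclidean_space => complex" assumes u: "u : LB" "u : LL p" and p: "1 <= p" "p <= 2" and R: "R > 0" and l: "l > 0"
  and D: "!!h. norm h < R ==> (nb u)^2 - Re (ib u (%x. u (x + h))) <= D"
 defines "I \<equiv> enn2real (pint p u)" and "V \<equiv> measure lborel (ball (0::'a) R)"
 shows "((nb u)^2 - D) * V <= l powr (2 - 2 * p) * I^2 + l powr (2 - p) * I * V"
proof (cases "(nb u)^2 <= D")
 case True
 hence "((nb u)^2 - D) * V <= 0" by (intro mult_nonpos_nonneg) (auto simp: V_def)
 moreover have "l powr (2 - 2 * p) * I^2 + l powr (2 - p) * I * V >= 0" by (auto simp: I_def V_def)
 ultimately show ?thesis by linarith
next
 case False
 let ?B = "ball (0::'a) R"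
 have [measurable]: "u : Borel" using u by (simp add: LB_borel)
 have I: "pint p u = ennreal I" using u(2) by (simp add: I_def LL_def)
 have I0: "I >= 0" by (simp add: I_def)
 have V: "emeasure lborel ?B = ennreal V" using emeasure_lborel_ball_finite[of "0::'a" R] by (simp add: V_def emeasure_eq_ennreal_measure)
 have V0: "V >= 0" by (simp add: V_def)
 have pw: "ennreal ((nb u)^2 - D) <= (NINT x. ennreal (cmod (u x) * cmod (u (x + h))))" if "h : ?B" for h
 proof -
  have "(nb u)^2 - D <= cmod (ib u (%x. u (x + h)))" using D[of h] that complex_Re_le_cmod[of "ib u (%x. u (x + h))"] by simp
  also have "... <= (LINT x. cmod (u x) * cmod (u (x + h)))"
   unfolding ip_def using integral_norm_bound[of lborel "%x. u x * cnj (u (x + h))"] by (simp add: norm_mult)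
  finally have "ennreal ((nb u)^2 - D) <= ennreal (LINT x. cmod (u x) * cmod (u (x + h)))" by (rule ennreal_leI)
  also have "... = (NINT x. ennreal (cmod (u x) * cmod (u (x + h))))"
   using L2_cmod_mult_integrable[OF u(1) LB_translate[OF u(1)]] by (intro nn_integral_eq_integral[symmetric]) auto
  finally show ?thesis .
 qed
 have "ennreal (((nb u)^2 - D) * V) = (NINT h:?B. ennreal ((nb u)^2 - D))"
  using V V0 False by (subst nn_integral_cmult_indicator) (simp_all add: ennreal_mult)
 also have "... <= (NINT h. (NINT x. ennreal (cmod (u x) * cmod (u (x + h)))) * indicator ?B h)"
  by (intro nn_integral_mono) (auto simp: indicator_def pw)
 \<comment> \<open>In the product term the restriction to the ball is given up: integrated over all
   shifts h it is the square of the power integral. The other term does not depend on h and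
   contributes the volume.\<close>
 also have "... <= (NINT h. ennreal (l powr (2 - 2 * p)) * (NINT x. ennreal (cmod (u x) powr p) * ennreal (cmod (u (x + h)) powr p))
   + ennreal (l powr (2 - p) * I) * indicator ?B h)"
 proof (rule nn_integral_mono)
  fix h :: 'a
  have "(NINT x. ennreal (cmod (u x) * cmod (u (x + h))))
   <= (NINT x. ennreal (l powr (2 - 2 * p)) * (ennreal (cmod (u x) powr p) * ennreal (cmod (u (x + h)) powr p))
    + ennreal (l powr (2 - p) / 2) * (ennreal (cmod (u x) powr p) + ennreal (cmod (u (x + h)) powr p)))"
   using mult_le_powr_split[OF norm_ge_zero norm_ge_zero l p]
   by (intro nn_integral_mono) (simp add: ennreal_mult[symmetric] ennreal_plus[symmetric] ennreal_leI del: ennreal_plus)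
  also have "... = ennreal (l powr (2 - 2 * p)) * (NINT x. ennreal (cmod (u x) powr p) * ennreal (cmod (u (x + h)) powr p))
    + ennreal (l powr (2 - p) / 2) * (pint p u + pint p (%x. u (x + h)))" unfolding pint_def by (simp add: nn_integral_add nn_integral_cmult)
  also have "ennreal (l powr (2 - p) / 2) * (pint p u + pint p (%x. u (x + h))) = ennreal (l powr (2 - p) * I)"
  proof -
   have "pint p (%x. u (x + h)) = ennreal I" unfolding pint_translate[OF LB_borel[OF u(1)]] by (rule I)
   hence "pint p u + pint p (%x. u (x + h)) = ennreal (I + I)" unfolding I using I0 by (simp only: ennreal_plus)
   hence "ennreal (l powr (2 - p) / 2) * (pint p u + pint p (%x. u (x + h))) = ennreal (l powr (2 - p) / 2 * (I + I))"
    by (simp only: ennreal_mult'[symmetric] divide_nonneg_pos powr_ge_zero zero_less_numeral)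
   thus ?thesis by simp
  qed
  finally show "(NINT x. ennreal (cmod (u x) * cmod (u (x + h)))) * indicator ?B h
   <= ennreal (l powr (2 - 2 * p)) * (NINT x. ennreal (cmod (u x) powr p) * ennreal (cmod (u (x + h)) powr p))
   + ennreal (l powr (2 - p) * I) * indicator ?B h" by (auto simp: indicator_def)
 qed
 also have "... = ennreal (l powr (2 - 2 * p)) * (NINT h. NINT x. ennreal (cmod (u x) powr p) * ennreal (cmod (u (x + h)) powr p))
   + ennreal (l powr (2 - p) * I) * ennreal V"
 proof -
  define f where "f = (%h. NINT x. ennreal (cmod (u x) powr p) * ennreal (cmod (u (x + h)) powr p))"
  have f: "f : borel_measurable lborel" unfolding f_def by measurable
  have "(NINT h. ennreal (l powr (2 - 2 * p)) * f h + ennreal (l powr (2 - p) * I) * indicator ?B h)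
    = (NINT h. ennreal (l powr (2 - 2 * p)) * f h) + (NINT h. ennreal (l powr (2 - p) * I) * indicator ?B h)"
   by (rule nn_integral_add[OF borel_measurable_times_ennreal[OF borel_measurable_const f] borel_measurable_times_ennreal[OF borel_measurable_const borel_measurable_indicator[OF lborelD[OF borel_open[OF open_ball]]]]])
  thus ?thesis unfolding nn_integral_cmult[OF f] nn_integral_cmult_indicator[OF lborelD[OF borel_open[OF open_ball]]] V unfolding f_def .
 qed
 also have "(NINT h. NINT x. ennreal (cmod (u x) powr p) * ennreal (cmod (u (x + h)) powr p))
   = (NINT x. NINT h. ennreal (cmod (u x) powr p) * ennreal (cmod (u (x + h)) powr p))"
  by (rule pair_sigma_finite.Fubini'[OF pair_sigma_finite_lborel]) measurable
 also have "... = (NINT x. ennreal (cmod (u x) powr p) * pint p u)"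
  unfolding pint_def using nn_integral_translate[of "%y. ennreal (cmod (u y) powr p)"] by (intro nn_integral_cong) (simp add: nn_integral_cmult)
 also have "... = pint p u * pint p u" unfolding pint_def by (rule nn_integral_multc) measurable
 finally have "ennreal (((nb u)^2 - D) * V) <= ennreal (l powr (2 - 2 * p) * I^2 + l powr (2 - p) * I * V)"
  using I0 V0 by (simp add: I power2_eq_square ennreal_mult[symmetric] ennreal_plus[symmetric] del: ennreal_plus)
 thus ?thesis using I0 V0 by (subst (asm) ennreal_le_iff) auto
qed

text \<open>The base of the outer power is the volume of the ball of radius (N^l M)^(-1/l). The
  power of 2 reflects a factor 4 lost in the squared norm, one half for the correlation and one half
  for the two balanced terms.\<close>

definition gn_const :: "nat => real => real => nat => real" where
 "gn_const N M m l = 2 powr (- (1 + m)) *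
   (unit_ball_vol (real N) * (real N ^ l * M) powr (- (real N / real l))) powr ((1 - m) / 2)"

text \<open>The hypothesis on increments covers both orders: \<open>2 div l\<close> is 2 for first
  derivatives and 1 for second ones, where the bound is already quadratic in h. In either case the
  correlation of u with its translates stays above half of the squared norm on the ball of radius
  R.\<close>

lemma gagliardo_nirenberg:
 fixes u :: "'a::euclidean_space => complex" assumes u: "u : LB" "u : LL (1 + m)" and m: "0 < m" "m < 1" and M: "M > 0" and l: "l : {1, 2}"
  and inc: "!!h. (nb u)^2 - Re (ib u (%x. u (x + h))) <= (nb u)^2 / 2 * (norm h ^ l * (real DIM('a) ^ l * M) / nb u) ^ (2 div l)"
 shows "gn_const DIM('a) M m l * nb u powr (1 + m + real DIM('a) * (1 - m) / (2 * real l)) <= enn2real (pint (1 + m) u)"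
proof (cases "nb u = 0")
 case False
 define N where "N = real DIM('a)"
 have N: "N > 0" by (simp add: N_def)
 define \<mu> where "\<mu> = nb u"
 have \<mu>: "\<mu> > 0" using False n2_nonneg[of lborel u] by (simp add: \<mu>_def less_le)
 define Q where "Q = N ^ l * M"
 have Q: "Q > 0" using N M by (simp add: Q_def)
 define R where "R = (\<mu> / Q) powr (1 / real l)"
 have R: "R > 0" using \<mu> Q by (simp add: R_def)
 have Rl: "R ^ l = \<mu> / Q"
 proof -
  have "R ^ l = R powr real l" using R by (simp add: powr_realpow)
  also have "... = (\<mu> / Q) powr (1 / real l * real l)" unfolding R_def powr_powr ..
  also have "1 / real l * real l = 1" using l by auto
  finally show ?thesis using \<mu> Q by simp
 qed
 define I where "I = enn2real (pint (1 + m) u)"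
 define V where "V = measure lborel (ball (0::'a) R)"
 have V: "V = unit_ball_vol N * R powr N" using R by (simp add: V_def content_ball N_def powr_realpow)
 have V0: "V > 0" unfolding V using R N by simp
 have D: "(nb u)^2 - Re (ib u (%x. u (x + h))) <= \<mu>^2 / 2" if "norm h < R" for h
 proof -
  have "norm h ^ l <= R ^ l" using that by (intro power_mono) auto
  hence "norm h ^ l * Q / \<mu> <= 1" using Rl \<mu> Q by (simp add: field_simps)
  hence "(norm h ^ l * Q / \<mu>) ^ (2 div l) <= 1" using \<mu> Q by (intro power_le_one) auto
  hence "\<mu>^2 / 2 * (norm h ^ l * Q / \<mu>) ^ (2 div l) <= \<mu>^2 / 2 * 1" by (intro mult_left_mono) auto
  thus ?thesis using inc[of h] by (simp add: \<mu>_def Q_def N_def)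
 qed
 note gn = gagliardo_nirenberg_ball[OF u, of R _ "\<mu>^2 / 2", OF _ _ R _ D, folded I_def V_def, unfolded \<mu>_def[symmetric]]
 have I0: "I >= 0" by (simp add: I_def)
 have Ipos: "I > 0"
 proof (rule ccontr)
  assume "\<not> ?thesis"
  hence "I = 0" using I0 by simp
  hence "(\<mu>^2 - \<mu>^2 / 2) * V <= 0" using gn[of 1] m by simp
  thus False using \<mu> V0 by (simp add: mult_le_0_iff)
 qed
 \<comment> \<open>The scale at which the two terms of \<open>gagliardo_nirenberg_ball\<close> are
   equal.\<close>
 define k where "k = (I / V) powr (1 / (1 + m))"
 have k: "k > 0" using Ipos V0 by (simp add: k_def)
 have kp: "k powr (1 + m) = I / V" using Ipos V0 m by (simp add: k_def powr_powr)
 have e1: "k powr (2 - 2 * (1 + m)) = k powr (1 - m) * (V / I)"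
 proof -
  have "2 - 2 * (1 + m) = (1 - m) - (1 + m)" by simp
  hence "k powr (2 - 2 * (1 + m)) = k powr (1 - m) / k powr (1 + m)" by (simp only: powr_diff)
  thus ?thesis unfolding kp by simp
 qed
 have "(\<mu>^2 - \<mu>^2 / 2) * V <= k powr (1 - m) * (V / I) * I^2 + k powr (1 - m) * I * V" using gn[of k] k m e1 by (simp add: algebra_simps)
 also have "... = 2 * k powr (1 - m) * I * V" using Ipos by (simp add: power2_eq_square)
 finally have "\<mu>^2 / 4 <= k powr (1 - m) * I" using V0 by (simp add: field_simps)
 also have "k powr (1 - m) * I = I powr (2 / (1 + m)) * V powr (- ((1 - m) / (1 + m)))"
 proof -
  have "2 / (1 + m) = (1 - m) / (1 + m) + 1" using m by (simp add: field_simps)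
  moreover have "k powr (1 - m) = (I / V) powr ((1 - m) / (1 + m))" by (simp add: k_def powr_powr)
  ultimately show ?thesis using Ipos V0 by (simp add: powr_divide powr_minus_divide powr_add)
 qed
 finally have "(\<mu>^2 / 4) powr ((1 + m) / 2) <= (I powr (2 / (1 + m)) * V powr (- ((1 - m) / (1 + m)))) powr ((1 + m) / 2)"
  using m \<mu> by (intro powr_mono2) auto
 also have "... = I * V powr (- ((1 - m) / 2))"
 proof -
  have e: "2 / (1 + m) * ((1 + m) / 2) = 1" "- ((1 - m) / (1 + m)) * ((1 + m) / 2) = - ((1 - m) / 2)" using m by (auto simp: field_simps)
  show ?thesis unfolding powr_mult powr_powr e using Ipos by simp
 qed
 finally have "(\<mu>^2 / 4) powr ((1 + m) / 2) * V powr ((1 - m) / 2) <= I * V powr (- ((1 - m) / 2)) * V powr ((1 - m) / 2)"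
  by (intro mult_right_mono) auto
 also have "... = I" using V0 by (simp add: mult.assoc powr_add[symmetric])
 also have "(\<mu>^2 / 4) powr ((1 + m) / 2) = 2 powr (- (1 + m)) * \<mu> powr (1 + m)"
 proof -
  have "\<mu>^2 / 4 = (\<mu> / 2) powr 2" using \<mu> by (simp add: power_divide)
  hence "(\<mu>^2 / 4) powr ((1 + m) / 2) = (\<mu> / 2) powr (2 * ((1 + m) / 2))" by (simp only: powr_powr)
  also have "2 * ((1 + m) / 2) = 1 + m" by simp
  finally show ?thesis by (simp only: powr_divide powr_minus_divide times_divide_eq_left mult_1)
 qed
 also have "V powr ((1 - m) / 2) = (unit_ball_vol N * Q powr (- (N / real l))) powr ((1 - m) / 2) * \<mu> powr (N * (1 - m) / (2 * real l))"
 proof -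
  have "R powr N = (\<mu> / Q) powr (N / real l)" unfolding R_def powr_powr by simp
  also have "... = Q powr (- (N / real l)) * \<mu> powr (N / real l)" by (simp add: powr_divide powr_minus_divide)
  finally have "V = (unit_ball_vol N * Q powr (- (N / real l))) * \<mu> powr (N / real l)" unfolding V by simp
  hence "V powr ((1 - m) / 2) = (unit_ball_vol N * Q powr (- (N / real l))) powr ((1 - m) / 2) * \<mu> powr (N / real l * ((1 - m) / 2))"
   by (simp only: powr_mult powr_powr)
  also have "N / real l * ((1 - m) / 2) = N * (1 - m) / (2 * real l)" by simp
  finally show ?thesis .
 qed
 finally have "gn_const DIM('a) M m l * (\<mu> powr (1 + m) * \<mu> powr (N * (1 - m) / (2 * real l))) <= I"
  unfolding gn_const_def Q_def N_def by (simp add: mult_ac)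
 thus ?thesis by (simp add: powr_add[symmetric] \<mu>_def I_def N_def)
qed (use m l in \<open>auto simp: add_pos_nonneg\<close>)

lemma gn_const_pos: assumes "M > 0" "N > 0" shows "gn_const N M m l > 0"
proof -
 have "unit_ball_vol (real N) > 0" "(real N ^ l * M) powr (- (real N / real l)) > 0" using assms by auto
 hence "unit_ball_vol (real N) * (real N ^ l * M) powr (- (real N / real l)) > 0" by (rule mult_pos_pos)
 hence "(unit_ball_vol (real N) * (real N ^ l * M) powr (- (real N / real l))) powr ((1 - m) / 2) > 0"
  by (simp only: powr_gt_zero less_imp_neq[symmetric] simp_thms)
 thus ?thesis unfolding gn_const_def by (intro mult_pos_pos) auto
qed

section \<open>Decay of the energy\<close>

text \<open>After \<open>T0\<close> the interpolation inequality bounds the dissipation below by a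
  multiple of E^(1 + \<alpha>/2), so \<open>ode_comparison\<close> applies with \<beta> =
  \<alpha>/2. A vanishing final energy is treated apart, since the comparison needs it
  positive.\<close>

lemma energy_decay:
 fixes u F :: "real => 'a::euclidean_space => complex" and a :: complex
 assumes ev: "evolution m a u (%t x. nl m (u t x)) F" and m: "0 < m" "m < 1" and b: "Im a > 0" and c: "c > 0"
  and T0: "T0 >= 0" "T0 <= t" and F: "AE t. t > T0 --> (AE x. F t x = 0)" and cont: "continuous_on {0..} (%t. nb (u t))" and \<alpha>: "\<alpha> >= 0"
  and gn: "AE t. t > 0 --> c * nb (u t) powr (2 + \<alpha>) <= enn2real (pint (1 + m) (u t))"
 shows "\<alpha> = 0 --> nb (u t) <= nb (u T0) * exp (- (Im a * c) * (t - T0))"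
  and "\<alpha> > 0 --> nb (u t) <= nb (u T0) / (1 + \<alpha> * Im a * c * nb (u T0) powr \<alpha> * (t - T0)) powr (1 / \<alpha>)"
proof -
 define E where "E t = (nb (u t))^2" for t
 have E0: "E t >= 0" for t by (simp add: E_def)
 have Epow: "E s powr (1 + \<alpha> / 2) = nb (u s) powr (2 + \<alpha>)" for s
 proof -
  have "E s = nb (u s) powr 2" by (simp add: E_def)
  hence "E s powr (1 + \<alpha> / 2) = nb (u s) powr (2 * (1 + \<alpha> / 2))" by (simp only: powr_powr)
  also have "2 * (1 + \<alpha> / 2) = 2 + \<alpha>" by simp
  finally show ?thesis .
 qed
 have contE: "continuous_on {T0..t} E" unfolding E_def by (intro continuous_intros continuous_on_subset[OF cont]) (use T0 in auto)
 have ineq: "E t + (2 * Im a * c) * integral {s..t} (%q. E q powr (1 + \<alpha> / 2)) <= E s" if s: "s : {T0..t}" for s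
 proof -
  have s': "0 <= s" "s <= t" using s T0 by auto
  note en = evolution_energy[OF ev m s']
  have ci: "set_L1 {s..t} (%q. E q powr (1 + \<alpha> / 2))"
   by (intro borel_integrable_atLeastAtMost' continuous_on_powr' continuous_on_subset[OF contE] continuous_intros) (use s E0 \<alpha> in auto)
  let ?e = "%q. Im (ib (F q) (u q)) - Im (a * ib (%x. nl m (u q x)) (u q))"
  have "AE q. q \<noteq> T0" by (rule AE_lborel_singleton)
  hence ae: "AE q. indicator {s..t} q *R ?e q <= indicator {s..t} q *R (- (Im a * c) * E q powr (1 + \<alpha> / 2))"
   using evolution_AE[OF ev s'(1), of t] F gn
  proof eventually_elim
   case (elim q)
   show ?case
   proof (cases "q : {s..t}")
    case True
    with elim s T0 have L: "u q : LB" "F q : LB" "u q : LL (1 + m)" "AE x. F q x = 0"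
     and g: "c * nb (u q) powr (2 + \<alpha>) <= enn2real (pint (1 + m) (u q))" by auto
    have "ib (F q) (u q) = 0" unfolding ip_def using L(4) by (intro integral_eq_zero_AE) auto
    moreover have "ib (%x. nl m (u q x)) (u q) = of_real (enn2real (pint (1 + m) (u q)))"
    proof -
     have "nl m z * cnj z = of_real (cmod z powr (1 + m))" for z
     proof (cases "z = 0")
      case False
      have "nl m z * cnj z = of_real (cmod z powr (- (1 - m)) * (cmod z)^2)" by (simp add: nl_def mult.assoc complex_norm_square del: of_real_power)
      also have "cmod z powr (- (1 - m)) * (cmod z)^2 = cmod z powr (- (1 - m)) * cmod z powr 2" by simp
      also have "... = cmod z powr (1 + m)" unfolding powr_add[symmetric] by (simp add: algebra_simps)
      finally show ?thesis .
     qed simp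
     hence "ib (%x. nl m (u q x)) (u q) = of_real (LINT x. cmod (u q x) powr (1 + m))" unfolding ip_def by (simp only: integral_complex_of_real)
     thus ?thesis using pint_eq_integral[OF L(3)] by (simp add: enn2real_ennreal integral_nonneg)
    qed
    moreover have "Im a * (c * nb (u q) powr (2 + \<alpha>)) <= Im a * enn2real (pint (1 + m) (u q))" using g b by (intro mult_left_mono) auto
    ultimately show ?thesis using True unfolding Epow by simp
   qed simp
  qed
  have "(LINT q:{s..t}. ?e q) <= (LINT q:{s..t}. - (Im a * c) * E q powr (1 + \<alpha> / 2))" unfolding set_lebesgue_integral_def
   by (rule integral_mono_AE[OF _ _ ae]) (use en(1) set_integrable_mult_right[OF ci, of "- (Im a * c)"] in \<open>auto simp: set_integrable_def\<close>)
  also have "... = - (Im a * c) * (LINT q:{s..t}. E q powr (1 + \<alpha> / 2))" by (rule set_integral_mult_right)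
  also have "(LINT q:{s..t}. E q powr (1 + \<alpha> / 2)) = integral {s..t} (%q. E q powr (1 + \<alpha> / 2))"
   by (rule set_borel_integral_eq_integral[OF ci])
  finally show ?thesis using en(2) unfolding E_def by simp
 qed
 note ode = ode_comparison[OF T0(2) contE E0 _ _ _ ineq]
 have k0: "2 * Im a * c >= 0" using b c by simp
 have mono: "E t <= E T0"
 proof -
  have "0 <= integral {T0..t} (%q. E q powr (1 + \<alpha> / 2))"
   by (intro Henstock_Kurzweil_Integration.integral_nonneg integrable_continuous_real continuous_on_powr' contE continuous_intros) (use E0 \<alpha> in auto)
  hence "0 <= (2 * Im a * c) * integral {T0..t} (%q. E q powr (1 + \<alpha> / 2))" using k0 by (rule mult_nonneg_nonneg[rotated])
  moreover have "T0 : {T0..t}" using T0 by simp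
  ultimately show ?thesis using ineq[of T0] by linarith
 qed
 show "\<alpha> = 0 --> nb (u t) <= nb (u T0) * exp (- (Im a * c) * (t - T0))"
 proof
  assume a0: "\<alpha> = 0"
  show "nb (u t) <= nb (u T0) * exp (- (Im a * c) * (t - T0))"
  proof (cases "E t = 0")
   case False
   hence "E t > 0" using E0[of t] by simp
   hence "E t <= E T0 * exp (- (2 * Im a * c) * (t - T0))" using ode(1)[OF k0] a0 by simp
   also have "... = (nb (u T0) * exp (- (Im a * c) * (t - T0)))^2" by (simp add: E_def power_mult_distrib exp_double[symmetric] algebra_simps)
   finally show ?thesis unfolding E_def by (rule power2_le_imp_le) simp
  qed (simp add: E_def)
 qed
 show "\<alpha> > 0 --> nb (u t) <= nb (u T0) / (1 + \<alpha> * Im a * c * nb (u T0) powr \<alpha> * (t - T0)) powr (1 / \<alpha>)"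
 proof
  assume a0: "\<alpha> > 0"
  show "nb (u t) <= nb (u T0) / (1 + \<alpha> * Im a * c * nb (u T0) powr \<alpha> * (t - T0)) powr (1 / \<alpha>)"
  proof (cases "E t = 0")
   case False
   hence Et: "E t > 0" using E0[of t] by simp
   hence ET: "E T0 > 0" using mono by linarith
   define x y z where "x = nb (u T0)" and "y = nb (u t)" and "z = 1 + \<alpha> * Im a * c * x powr \<alpha> * (t - T0)"
   have xy: "x > 0" "y > 0" using Et ET n2_nonneg[of lborel "u T0"] n2_nonneg[of lborel "u t"] by (auto simp: E_def x_def y_def less_le)
   have z: "z >= 1" using a0 b c T0 by (simp add: z_def)
   have ex: "E T0 powr (- (\<alpha> / 2)) = x powr (- \<alpha>)" "E t powr (- (\<alpha> / 2)) = y powr (- \<alpha>)"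
   proof -
    have "E T0 = x powr 2" "E t = y powr 2" using xy by (simp_all add: E_def x_def y_def)
    thus "E T0 powr (- (\<alpha> / 2)) = x powr (- \<alpha>)" "E t powr (- (\<alpha> / 2)) = y powr (- \<alpha>)" by (simp_all add: powr_powr)
   qed
   have "x powr (- \<alpha>) + \<alpha> / 2 * (2 * Im a * c) * (t - T0) <= y powr (- \<alpha>)" using ode(2)[OF k0 _ Et] a0 unfolding ex by simp
   hence "x powr \<alpha> * (x powr (- \<alpha>) + \<alpha> / 2 * (2 * Im a * c) * (t - T0)) <= x powr \<alpha> * y powr (- \<alpha>)"
    by (intro mult_left_mono) auto
   moreover have "x powr \<alpha> * (x powr (- \<alpha>) + \<alpha> / 2 * (2 * Im a * c) * (t - T0)) = z"
    using xy by (simp add: z_def distrib_left powr_minus mult_ac)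
   moreover have "x powr \<alpha> * y powr (- \<alpha>) = (x / y) powr \<alpha>" by (simp add: powr_divide powr_minus_divide)
   ultimately have "z <= (x / y) powr \<alpha>" by metis
   hence "z powr (1 / \<alpha>) <= ((x / y) powr \<alpha>) powr (1 / \<alpha>)" using z a0 by (intro powr_mono2) auto
   also have "... = x / y" unfolding powr_powr using xy a0 by simp
   finally have "z powr (1 / \<alpha>) * y <= x" using xy(2) by (simp only: pos_le_divide_eq)
   moreover have "z powr (1 / \<alpha>) > 0" using z by simp
   ultimately have "y <= x / z powr (1 / \<alpha>)" by (simp only: pos_le_divide_eq mult.commute)
   thus ?thesis unfolding x_def y_def z_def .
  qed (simp add: E_def)
 qed
qed

section \<open>Weak derivatives\<close>

lemma riesz_fischer:
 fixes v :: "nat => 'a::euclidean_space => complex"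
 assumes v: "!!n. v n : LB" and C: "!!e. e > 0 ==> EX N. ALL m>=N. ALL n>=N. nb (%x. v m x - v n x) <= e"
 shows "EX w:LB. (%n. nb (%x. v n x - w x)) ~> 0"
proof -
 have [measurable]: "v n : Borel" for n using v by (rule LB_borel)
 have "EX N. ALL m>=N. ALL n>=N. nb (%x. v m x - v n x) <= (1 / 2) ^ k" for k :: nat by (rule C) simp
 then obtain N where N: "!!k m n. m >= N k ==> n >= N k ==> nb (%x. v m x - v n x) <= (1 / 2) ^ k" by metis
 define r where "r k = (\<Sum>j\<le>k. N j)" for k
 have r: "r k >= N k" "r (Suc k) >= r k" for k unfolding r_def by (auto intro: member_le_sum)
 have rN: "r j >= N k" if "j >= k" for j k using r lift_Suc_mono_le[of r k j] that by (metis order_trans)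
 define d where "d k x = v (r (Suc k)) x - v (r k) x" for k x
 have dL: "d k : LB" for k unfolding d_def[abs_def] by (intro L2_diff v)
 have [measurable]: "d k : Borel" for k using dL by (rule LB_borel)
 have dn: "nb (d k) <= (1 / 2) ^ k" for k unfolding d_def[abs_def] using r[of k] by (intro N) auto
 \<comment> \<open>The weight 2^k leaves the squared increments summable in the mean and makes the
   increments themselves summable at almost every x, by t <= 2^(-k) + 2^k t^2.\<close>
 have "(NINT x. (\<Sum>k. ennreal (2 ^ k * (cmod (d k x))^2))) = (\<Sum>k. NINT x. ennreal (2 ^ k * (cmod (d k x))^2))"
  by (rule nn_integral_suminf) measurable
 also have "... = (\<Sum>k. ennreal (2 ^ k * (nb (d k))^2))"
  unfolding n2_sq using dL by (intro suminf_cong) (subst nn_integral_eq_integral, auto simp: L2_integrable)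
 also have "... <= (\<Sum>k. ennreal ((1 / 2) ^ k))"
 proof (intro suminf_le ennreal_leI)
  fix k
  have "(nb (d k))^2 <= ((1 / 2) ^ k)^2" by (intro power_mono dn) auto
  hence "2 ^ k * (nb (d k))^2 <= 2 ^ k * ((1 / 2) ^ k)^2" by (intro mult_left_mono) auto
  also have "... = (1 / 2) ^ k" by (simp add: power2_eq_square power_divide)
  finally show "2 ^ k * (nb (d k))^2 <= (1 / 2) ^ k" .
 qed auto
 also have "... = ennreal (\<Sum>k. (1 / 2) ^ k)" by (intro suminf_ennreal2) auto
 also have "... < \<infinity>" by simp
 finally have "AE x. (\<Sum>k. ennreal (2 ^ k * (cmod (d k x))^2)) \<noteq> \<infinity>" by (intro nn_integral_noteq_infinite) auto
 hence conv: "AE x. convergent (%k. v (r k) x)"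
 proof eventually_elim
  case (elim x)
  hence sm: "summable (%k. (1 / 2) ^ k + 2 ^ k * (cmod (d k x))^2)" by (intro summable_add summable_geometric summable_suminf_not_top) auto
  have db: "cmod (d k x) <= (1 / 2) ^ k + 2 ^ k * (cmod (d k x))^2" for k
  proof (cases "cmod (d k x) <= (1 / 2) ^ k")
   case True
   thus ?thesis by (rule add_increasing2[rotated]) simp
  next
   case False
   hence "1 * cmod (d k x) <= (2 ^ k * cmod (d k x)) * cmod (d k x)" by (intro mult_right_mono) (auto simp: power_one_over field_simps)
   thus ?thesis by (intro add_increasing) (auto simp: power2_eq_square mult_ac)
  qed
  from sm have "summable (%k. d k x)" by (rule summable_comparison_test'[where N=0]) (rule db)
  hence "convergent (%n. \<Sum>k<n. d k x)" by (simp add: summable_iff_convergent)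
  hence "convergent (%n. (\<Sum>k<n. d k x) + v (r 0) x)" by (intro convergent_add convergent_const)
  moreover have "(\<Sum>k<n. d k x) + v (r 0) x = v (r n) x" for n unfolding d_def by (subst sum_lessThan_telescope) simp
  ultimately show ?case by simp
 qed
 define w where "w x = lim (%k. v (r k) x)" for x
 have [measurable]: "w : Borel" unfolding w_def[abs_def] by measurable
 have lim: "AE x. (%k. v (r k) x) ~> w x" using conv by eventually_elim (simp add: w_def convergent_LIMSEQ_iff)
 \<comment> \<open>Fatou's lemma turns the Cauchy bounds along the subsequence into bounds for the
   distance to the limit.\<close>
 have bound: "(NINT x. ennreal ((cmod (v n x - w x))^2)) <= ennreal (((1 / 2) ^ k)^2)" if n: "n >= N k" for n k
 proof -
  have "(NINT x. ennreal ((cmod (v n x - w x))^2)) = (NINT x. liminf (%j. ennreal ((cmod (v n x - v (r j) x))^2)))"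
  proof (rule nn_integral_cong_AE)
   show "AE x. ennreal ((cmod (v n x - w x))^2) = liminf (%j. ennreal ((cmod (v n x - v (r j) x))^2))" using lim
   proof eventually_elim
    case (elim x)
    have "(%j. ennreal ((cmod (v n x - v (r j) x))^2)) ~> ennreal ((cmod (v n x - w x))^2)" by (intro tendsto_ennrealI tendsto_intros elim)
    from lim_imp_Liminf[OF trivial_limit_sequentially this] show ?case by (rule sym)
   qed
  qed
  also have "... <= liminf (%j. NINT x. ennreal ((cmod (v n x - v (r j) x))^2))" by (rule nn_integral_liminf) measurable
  also have "... <= ennreal (((1 / 2) ^ k)^2)"
  proof (rule Liminf_le)
   show "EV j. (NINT x. ennreal ((cmod (v n x - v (r j) x))^2)) <= ennreal (((1 / 2) ^ k)^2)" using eventually_ge_at_top[of k]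
   proof eventually_elim
    case (elim j)
    have "(NINT x. ennreal ((cmod (v n x - v (r j) x))^2)) = ennreal ((nb (%x. v n x - v (r j) x))^2)"
     unfolding n2_sq by (intro nn_integral_eq_integral L2_integrable L2_diff v) auto
    also have "... <= ennreal (((1 / 2) ^ k)^2)" using N[OF n rN[OF elim]] by (intro ennreal_leI power_mono) auto
    finally show ?case .
   qed
  qed simp
  finally show ?thesis .
 qed
 have diff: "(%x. v n x - w x) : LB" if "n >= N 0" for n using bound[OF that] by (auto simp: L2_def integrable_iff_bounded elim: le_less_trans)
 have "w : LB" using L2_diff[OF v diff[OF order_refl], of "N 0"] by simp
 moreover have "(%n. nb (%x. v n x - w x)) ~> 0"
 proof (rule LIMSEQ_I)
  fix e :: real assume "e > 0"
  then obtain k where k: "(1 / 2) ^ k < e" using real_arch_pow_inv[of e "1 / 2"] by auto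
  have "nb (%x. v n x - w x) <= (1 / 2) ^ k" if "n >= N k" for n
  proof -
   have L: "(%x. v n x - w x) : LB" by (intro L2_diff v \<open>w : LB\<close>)
   have "(NINT x. ennreal ((cmod (v n x - w x))^2)) = ennreal ((nb (%x. v n x - w x))^2)"
    unfolding n2_sq by (intro nn_integral_eq_integral L2_integrable L) auto
   with bound[OF that] have "(nb (%x. v n x - w x))^2 <= ((1 / 2) ^ k)^2" by (simp add: ennreal_le_iff)
   thus ?thesis by (rule power2_le_imp_le) simp
  qed
  thus "EX no. ALL n>=no. norm (nb (%x. v n x - w x) - 0) < e" using k by (intro exI[of _ "N k"]) (auto intro: le_less_trans)
 qed
 ultimately show ?thesis by blast
qed

text \<open>Variational proof: 2 Re T(\<phi>) minus the squared norm is bounded above on test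
  functions, the parallelogram law makes a maximising sequence Cauchy, and its limit represents T.
  Everything stays within test functions, since nothing is known of T elsewhere.\<close>

lemma riesz_representation:
 fixes T :: "('a::euclidean_space => complex) => complex"
 assumes add: "!!\<phi> \<psi>. \<phi> : tf ==> \<psi> : tf ==> T (%x. \<phi> x + \<psi> x) = T \<phi> + T \<psi>"
  and mult: "!!c \<phi>. \<phi> : tf ==> T (%x. c * \<phi> x) = c * T \<phi>"
  and bd: "!!\<phi>. \<phi> : tf ==> cmod (T \<phi>) <= L * nb \<phi>" and L: "L >= 0"
 shows "EX v:LB. nb v <= L \<and> (ALL \<phi>:tf. T \<phi> = (LINT x. v x * \<phi> x))"
proof -
 define J where "J \<phi> = 2 * Re (T \<phi>) - (nb \<phi>)^2" for \<phi>
 define s where "s = (SUP \<phi>\<in>tf. J \<phi>)"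
 have "J \<phi> <= L^2" if "\<phi> : tf" for \<phi>
  using bd[OF that] complex_Re_le_cmod[of "T \<phi>"] zero_le_power2[of "L - nb \<phi>"] by (simp add: J_def power2_diff)
 hence bdd: "bdd_above (J ` tf)" by (intro bdd_aboveI[of _ "L^2"]) auto
 have Js: "J \<phi> <= s" if "\<phi> : tf" for \<phi> unfolding s_def by (rule cSUP_upper[OF that bdd])
 have "EX \<phi>:tf. s - 1 / real (Suc n) < J \<phi>" for n unfolding s_def using bdd tf_bump by (intro less_cSUP_iff[THEN iffD1]) auto
 then obtain f where f: "!!n. f n : tf" "!!n. s - 1 / real (Suc n) < J (f n)" by metis
 have fL: "f n : LB" for n by (rule tf_LB[OF f(1)])
 have cau: "(nb (%x. f m x - f n x))^2 <= 2 * (1 / real (Suc m) + 1 / real (Suc n))" for m n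
 proof -
  \<comment> \<open>The midpoint of two almost maximisers is a competitor too, which by the
    parallelogram law bounds their distance.\<close>
  let ?\<chi> = "%x. (1 / 2) * f m x + (1 / 2) * f n x"
  have "?\<chi> = (%x. (1 / 2) * (f m x + f n x))" by (simp add: distrib_left)
  hence "nb ?\<chi> = nb (%x. f m x + f n x) / 2" by (simp only: n2_cmult) simp
  hence "4 * (nb ?\<chi>)^2 = (nb (%x. f m x + f n x))^2" by (simp only: power_divide) simp
  moreover have "2 * Re (T ?\<chi>) = Re (T (f m)) + Re (T (f n))" by (subst add) (simp_all only: mult tf_cmult f(1) plus_complex.sel, simp)
  moreover have "J ?\<chi> <= s" by (intro Js tf_add tf_cmult f)
  ultimately show ?thesis using f(2)[of m] f(2)[of n] n2_add_sq[OF fL fL, of m n] n2_diff_sq[OF fL fL, of m n] unfolding J_def by argo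
 qed
 have "EX w:LB. (%n. nb (%x. f n x - w x)) ~> 0"
 proof (rule riesz_fischer[OF fL])
  fix e :: real assume e: "e > 0"
  obtain K where K: "1 / real (Suc K) < e^2 / 4" using reals_Archimedean[of "e^2 / 4"] e unfolding inverse_eq_divide by auto
  have gen: "2 * (a + b) <= e^2" if "a <= c" "b <= c" "c < e^2 / 4" for a b c :: real using that by (simp add: field_simps)
  have "nb (%x. f m x - f n x) <= e" if "m >= K" "n >= K" for m n
   by (rule power2_le_imp_le[OF order_trans[OF cau gen[OF _ _ K]]]) (use that e in \<open>auto intro!: divide_left_mono\<close>)
  thus "EX N. ALL m>=N. ALL n>=N. nb (%x. f m x - f n x) <= e" by blast
 qed
 then obtain w where w: "w : LB" "(%n. nb (%x. f n x - w x)) ~> 0" by auto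
 have re: "Re (T \<phi>) = Re (ib w \<phi>)" if \<phi>: "\<phi> : tf" for \<phi>
 proof -
  have \<phi>L: "\<phi> : LB" by (rule tf_LB[OF \<phi>])
  define d B where "d = Re (T \<phi>) - Re (ib w \<phi>)" and "B = (nb \<phi>)^2"
  \<comment> \<open>Perturbing an almost maximiser by t \<phi> cannot exceed the supremum; for small
    t the linear term would win unless d = 0.\<close>
  have key: "2 * t * d <= t^2 * B" for t
  proof -
   have "(%n. 2 * t * (Re (T \<phi>) - Re (ib (f n) \<phi>)) - t^2 * B) ~> 2 * t * d - t^2 * B"
    unfolding d_def by (intro tendsto_intros ip_tendsto fL w \<phi>L) simp
   moreover have "2 * t * (Re (T \<phi>) - Re (ib (f n) \<phi>)) - t^2 * B <= 1 / real (Suc n)" for n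
   proof -
    have "J (%x. f n x + of_real t * \<phi> x) <= s" by (intro Js tf_add tf_cmult f \<phi>)
    thus ?thesis using f(2)[of n] n2_add_sq[OF fL L2_cmult[OF \<phi>L], of n "of_real t"]
     by (simp add: J_def B_def add mult tf_cmult f(1) \<phi> n2_cmult ip_cmult_right power_mult_distrib algebra_simps)
   qed
   ultimately have "2 * t * d - t^2 * B <= 0" by (intro LIMSEQ_le[OF _ lim_over_Suc]) auto
   thus ?thesis by simp
  qed
  have B: "B >= 0" by (simp add: B_def)
  \<comment> \<open>The choice t = d / (B + 1) avoids a division by B, which may be 0.\<close>
  have "2 * (d / (B + 1)) * d <= (d / (B + 1))^2 * B" by (rule key)
  also have "... <= (d / (B + 1))^2 * (B + 1)" by (intro mult_left_mono) auto
  also have "... = d / (B + 1) * d" using B by (simp add: power2_eq_square add_nonneg_eq_0_iff)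
  finally have "d * d / (B + 1) <= 0" by simp
  hence "d = 0" using B by (auto simp: divide_le_0_iff mult_le_0_iff)
  thus ?thesis by (simp add: d_def)
 qed
 have rep: "T \<phi> = ib \<phi> w" if \<phi>: "\<phi> : tf" for \<phi>
 proof -
  \<comment> \<open>Imaginary parts are recovered by applying the identity of real parts to -i
    \<phi>.\<close>
  have "Re (- \<i> * T \<phi>) = Re (cnj (- \<i>) * ib w \<phi>)" using re[OF tf_cmult[OF \<phi>, of "- \<i>"]] by (simp only: mult[OF \<phi>] ip_cmult_right)
  thus ?thesis using re[OF \<phi>] unfolding ip_cnj[of lborel w \<phi>, symmetric] by (simp add: complex_eq_iff)
 qed
 have "nb w <= L"
 proof -
  have "(%n. ib (f n) w) ~> ib w w" by (intro ip_tendsto fL w) simp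
  hence "cmod (ib w w) <= L * nb w" by (rule LIMSEQ_le[OF tendsto_norm tendsto_mult[OF tendsto_const n2_tendsto[OF fL w]]])
    (auto simp: rep[OF f(1), symmetric] intro: bd f)
  thus ?thesis using L n2_nonneg[of lborel w] by (cases "nb w = 0") (auto simp: ip_self norm_power power2_eq_square norm_mult)
 qed
 thus ?thesis using w by (intro bexI[of _ "%x. cnj (w x)"]) (auto simp: L2_cnj rep ip_def mult.commute)
qed

section \<open>Weak derivatives and increments\<close>

definition bl :: "('a::euclidean_space => complex) => ('a => complex) => complex" where
 "bl u \<phi> = (LINT x. u x * \<phi> x)"

lemma bl_ib: "bl u \<phi> = ib u (%x. cnj (\<phi> x))" by (simp add: bl_def ip_def)

lemma bl_le: "u : LB ==> \<phi> : LB ==> cmod (bl u \<phi>) <= nb u * nb \<phi>" unfolding bl_def by (rule cauchy_schwarz)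

lemma bl_cmult: "bl (%x. c * u x) \<phi> = c * bl u \<phi>" "bl u (%x. c * \<phi> x) = c * bl u \<phi>"
proof -
 show "bl (%x. c * u x) \<phi> = c * bl u \<phi>" unfolding bl_ib by (rule ip_cmult_left)
 show "bl u (%x. c * \<phi> x) = c * bl u \<phi>" unfolding bl_ib complex_cnj_mult ip_cmult_right by simp
qed

lemma bl_add_right: "u : LB ==> \<phi> : LB ==> \<psi> : LB ==> bl u (%x. \<phi> x + \<psi> x) = bl u \<phi> + bl u \<psi>"
 unfolding bl_ib by (simp add: ip_add_right L2_cnj)

lemma bl_tendsto: assumes "!!n. u n : LB" "a : LB" "((%n. nb (%x. u n x - a x)) \<longlongrightarrow> 0) F"
  and "!!n. v n : LB" "b : LB" "((%n. nb (%x. v n x - b x)) \<longlongrightarrow> 0) F" shows "((%n. bl (u n) (v n)) \<longlongrightarrow> bl a b) F"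
proof -
 have "nb (%x. cnj (v n x) - cnj (b x)) = nb (%x. v n x - b x)" for n using n2_cnj[of lborel "%x. v n x - b x"] by simp
 thus ?thesis unfolding bl_ib using assms by (intro ip_tendsto L2_cnj) simp_all
qed

lemma bl_shd: "u : LB ==> v : LB ==> bl (shd h u) v = bl u (shd (- h) v)"
proof -
 assume u: "u : LB" and v: "v : LB"
 have "(%x. cnj (shd (- h) v x)) = shd (- h) (%x. cnj (v x))" by (auto simp: shd_def)
 thus ?thesis unfolding bl_ib using ib_shd[OF u L2_cnj[OF v]] by simp
qed

lemma bl_dquot_tendsto: assumes u: "u : LB" and \<phi>: "\<phi> : tf" and b: "b : Basis" and h: "h ~> 0" "!!n. h n \<noteq> 0"
 shows "(%n. bl (shd (- (h n *R b)) u) \<phi> / of_real (h n)) ~> bl u (pd b \<phi>)"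
proof -
 have "(%n. bl u (dquot (h n) b \<phi>)) ~> bl u (pd b \<phi>)" by (intro bl_tendsto u tf_LB tf_dquot tf_pd \<phi> b dquot_nb h) simp
 moreover have "bl u (dquot (h n) b \<phi>) = bl (shd (- (h n *R b)) u) \<phi> / of_real (h n)" for n
 proof -
  have "dquot (h n) b \<phi> = (%x. (1 / of_real (h n)) * shd (h n *R b) \<phi> x)" by (rule ext) (simp add: dquot_def shd_def)
  hence "bl u (dquot (h n) b \<phi>) = (1 / of_real (h n)) * bl u (shd (h n *R b) \<phi>)" by (simp only: bl_cmult)
  thus ?thesis using bl_shd[OF u tf_LB[OF \<phi>], of "- (h n *R b)"] by simp
 qed
 ultimately show ?thesis by simp
qed

lemma bl_pd_le: assumes u: "u : LB" and \<phi>: "\<phi> : tf" and b: "b : Basis" and C: "!!k. cmod (bl (shd (k *R b) u) \<phi>) <= \<bar>k\<bar> * C"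
 shows "cmod (bl u (pd b \<phi>)) <= C"
proof -
 define h where "h = (%n. 1 / real (Suc n))"
 have h: "h ~> 0" unfolding h_def by (rule lim_over_Suc)
 have h0: "h n \<noteq> 0" for n by (simp add: h_def)
 have "(%n. cmod (bl (shd (- (h n *R b)) u) \<phi> / of_real (h n))) ~> cmod (bl u (pd b \<phi>))"
  by (intro tendsto_norm bl_dquot_tendsto u \<phi> b h h0)
 thus ?thesis
 proof (rule LIMSEQ_le_const2, intro exI allI impI)
  fix n
  show "cmod (bl (shd (- (h n *R b)) u) \<phi> / of_real (h n)) <= C"
   using C[of "- h n"] h0[of n] by (simp add: norm_divide divide_le_eq mult.commute)
 qed
qed

lemma lebesgue_integral_borel:
 fixes f :: "'a::euclidean_space => 'b::{banach, second_countable_topology}" assumes "f : Borel" shows "(LINT x|lebesgue. f x) = (LINT x. f x)"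
 by (rule integral_completion) (simp add: assms)

lemma weak_deriv_borel: assumes [measurable]: "u : Borel" "v : Borel" and bs: "set bs \<subseteq> Basis"
 shows "weak_deriv bs u v \<longleftrightarrow> (ALL \<phi>:tf. bl u (pds bs \<phi>) = (- 1) ^ length bs * bl v \<phi>)"
proof -
 have "(LINT x|lebesgue. u x * pds bs \<phi> x) = bl u (pds bs \<phi>)" "(LINT x|lebesgue. v x * \<phi> x) = bl v \<phi>"
  if "\<phi> : tf" for \<phi>
 proof -
  have [measurable]: "pds bs \<phi> : Borel" "\<phi> : Borel" using that bs by (auto intro!: tf_borel tf_pds)
  show "(LINT x|lebesgue. u x * pds bs \<phi> x) = bl u (pds bs \<phi>)" "(LINT x|lebesgue. v x * \<phi> x) = bl v \<phi>"
   unfolding bl_def by (rule lebesgue_integral_borel, measurable)+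
 qed
 thus ?thesis unfolding weak_deriv_def by simp
qed

text \<open>A bound for the increments passes to the pairing of u with derivatives of test
  functions, which thus is a bounded functional on L2; its representative is the weak
  derivative.\<close>

lemma weak_deriv1_exists: assumes u: "u : LB" and b: "b : Basis" and L: "L >= 0" "!!k. nb (shd (k *R b) u) <= \<bar>k\<bar> * L"
 shows "EX v:LB. nb v <= L \<and> weak_deriv [b] u v"
proof -
 have bd: "cmod (- bl u (pd b \<phi>)) <= L * nb \<phi>" if \<phi>: "\<phi> : tf" for \<phi> unfolding norm_minus_cancel
 proof (rule bl_pd_le[OF u \<phi> b])
  fix k
  have "cmod (bl (shd (k *R b) u) \<phi>) <= nb (shd (k *R b) u) * nb \<phi>" by (intro bl_le LB_shd u tf_LB \<phi>)
  also have "... <= (\<bar>k\<bar> * L) * nb \<phi>" by (intro mult_right_mono L) simp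
  finally show "cmod (bl (shd (k *R b) u) \<phi>) <= \<bar>k\<bar> * (L * nb \<phi>)" by (simp add: mult.assoc)
 qed
 have "EX v:LB. nb v <= L \<and> (ALL \<phi>:tf. - bl u (pd b \<phi>) = (LINT x. v x * \<phi> x))"
 proof (rule riesz_representation[OF _ _ bd L(1)])
  fix \<phi> \<psi> :: "'a => complex" and c assume \<phi>: "\<phi> : tf"
  have "pd b (%x. c * \<phi> x) = (%x. c * pd b \<phi> x)" using pd_cmult[OF \<phi>] by auto
  thus "- bl u (pd b (%x. c * \<phi> x)) = c * - bl u (pd b \<phi>)" by (simp add: bl_cmult)
  assume \<psi>: "\<psi> : tf"
  have "pd b (%x. \<phi> x + \<psi> x) = (%x. pd b \<phi> x + pd b \<psi> x)" using pd_add[OF \<phi> \<psi>] by auto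
  thus "- bl u (pd b (%x. \<phi> x + \<psi> x)) = - bl u (pd b \<phi>) + - bl u (pd b \<psi>)"
   using u \<phi> \<psi> b by (simp add: bl_add_right tf_LB tf_pd)
 qed
 then obtain v where v: "v : LB" "nb v <= L" "!!\<phi>. \<phi> : tf ==> - bl u (pd b \<phi>) = bl v \<phi>" by (auto simp: bl_def)
 have "bl u (pd b \<phi>) = - bl v \<phi>" if "\<phi> : tf" for \<phi> using v(3)[OF that] by (metis minus_minus)
 hence "weak_deriv [b] u v" using u v(1) b by (subst weak_deriv_borel) (auto simp: LB_borel pds_def)
 thus ?thesis using v by auto
qed

text \<open>The argument of first order with \<open>bl_pd_le\<close> applied twice, once for each
  direction.\<close>

lemma weak_deriv2_exists: assumes u: "u : LB" and b: "b : Basis" "b' : Basis" and L: "L >= 0"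
  "!!k k'. nb (shd (k' *R b') (shd (k *R b) u)) <= \<bar>k'\<bar> * (\<bar>k\<bar> * L)" shows "EX v:LB. nb v <= L \<and> weak_deriv [b, b'] u v"
proof -
 have bd: "cmod (bl u (pd b (pd b' \<phi>))) <= L * nb \<phi>" if \<phi>: "\<phi> : tf" for \<phi>
 proof (rule bl_pd_le[OF u tf_pd[OF \<phi> b(2)] b(1)])
  fix k
  show "cmod (bl (shd (k *R b) u) (pd b' \<phi>)) <= \<bar>k\<bar> * (L * nb \<phi>)"
  proof (rule bl_pd_le[OF LB_shd[OF u] \<phi> b(2)])
   fix k'
   have "cmod (bl (shd (k' *R b') (shd (k *R b) u)) \<phi>) <= nb (shd (k' *R b') (shd (k *R b) u)) * nb \<phi>"
    by (intro bl_le LB_shd u tf_LB \<phi>)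
   also have "... <= (\<bar>k'\<bar> * (\<bar>k\<bar> * L)) * nb \<phi>" by (intro mult_right_mono L) simp
   finally show "cmod (bl (shd (k' *R b') (shd (k *R b) u)) \<phi>) <= \<bar>k'\<bar> * (\<bar>k\<bar> * (L * nb \<phi>))" by (simp add: mult.assoc)
  qed
 qed
 have "EX v:LB. nb v <= L \<and> (ALL \<phi>:tf. bl u (pd b (pd b' \<phi>)) = (LINT x. v x * \<phi> x))"
 proof (rule riesz_representation[OF _ _ bd L(1)])
  fix \<phi> \<psi> :: "'a => complex" and c assume \<phi>: "\<phi> : tf"
  have "pd b' (%x. c * \<phi> x) = (%x. c * pd b' \<phi> x)" using pd_cmult[OF \<phi>] by auto
  moreover have "pd b (%x. c * pd b' \<phi> x) = (%x. c * pd b (pd b' \<phi>) x)" using pd_cmult[OF tf_pd[OF \<phi> b(2)]] by auto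
  ultimately show "bl u (pd b (pd b' (%x. c * \<phi> x))) = c * bl u (pd b (pd b' \<phi>))" by (simp add: bl_cmult)
  assume \<psi>: "\<psi> : tf"
  have "pd b' (%x. \<phi> x + \<psi> x) = (%x. pd b' \<phi> x + pd b' \<psi> x)" using pd_add[OF \<phi> \<psi>] by auto
  moreover have "pd b (%x. pd b' \<phi> x + pd b' \<psi> x) = (%x. pd b (pd b' \<phi>) x + pd b (pd b' \<psi>) x)"
   using pd_add[OF tf_pd[OF \<phi> b(2)] tf_pd[OF \<psi> b(2)]] by auto
  ultimately show "bl u (pd b (pd b' (%x. \<phi> x + \<psi> x))) = bl u (pd b (pd b' \<phi>)) + bl u (pd b (pd b' \<psi>))"
   using u \<phi> \<psi> b by (simp add: bl_add_right tf_LB tf_pd)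
 qed
 then obtain v where v: "v : LB" "nb v <= L" "!!\<phi>. \<phi> : tf ==> bl u (pd b (pd b' \<phi>)) = bl v \<phi>" by (auto simp: bl_def)
 hence "weak_deriv [b, b'] u v" using u v(1) b by (subst weak_deriv_borel) (auto simp: LB_borel pds_def)
 thus ?thesis using v by auto
qed

lemma pd_reflect: "\<phi> : tf ==> pd b (%x. \<phi> (y - x)) x = - pd b \<phi> (y - x)" using pd_affine[of \<phi> b y "-1" x] by simp

lemma pds_reflect: assumes "\<phi> : tf" "set bs \<subseteq> Basis"
 shows "pds bs (%x. \<phi> (y - x)) = (%x. (- 1) ^ length bs * pds bs \<phi> (y - x))" using assms(2)
proof (induction bs)
 case (Cons b bs)
 have t: "pds bs \<phi> : tf" using Cons assms by (intro tf_pds) auto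
 have "pds (b # bs) (%x. \<phi> (y - x)) = pd b (%x. (- 1) ^ length bs * pds bs \<phi> (y - x))" using Cons by (simp add: pds_def)
 also have "... = (%x. (- 1) ^ length bs * - pd b (pds bs \<phi>) (y - x))" using pd_cmult[OF tf_reflect[OF t]] pd_reflect[OF t] by auto
 finally show ?case by (auto simp: pds_def)
qed (simp add: pds_def)

text \<open>K(y - x) is a test function of x. Its reflection produces (-1) to the order, which
  cancels the sign in the definition of weak derivatives.\<close>

lemma weak_deriv_conv: assumes u: "u : LB" and v: "v : LB" and w: "weak_deriv bs u v" and bs: "set bs \<subseteq> Basis" and K: "K : tf"
 shows "conv (pds bs K) u = conv K v"
proof
 fix y
 have "bl u (pds bs (%x. K (y - x))) = (- 1) ^ length bs * bl v (%x. K (y - x))"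
  using w tf_reflect[OF K, of y] u v bs by (subst (asm) weak_deriv_borel) (auto simp: LB_borel)
 hence "(- 1) ^ length bs * bl u (%x. pds bs K (y - x)) = (- 1) ^ length bs * bl v (%x. K (y - x))" unfolding pds_reflect[OF K bs] bl_cmult .
 thus "conv (pds bs K) u y = conv K v y" by (simp add: bl_def conv_def)
qed

lemma nb_le_of_mo: assumes u: "u : LB" and C: "!!n. nb (conv (mo n) u) <= C" shows "nb u <= C"
 by (rule LIMSEQ_le_const2[OF mo_nb_tendsto[OF u]]) (use C in auto)

text \<open>The derivative of order zero: u and v have the same pairings with test functions, hence
  the same mollifications.\<close>

lemma weak_deriv0_nb: assumes "u : LB" "v : LB" "weak_deriv [] u v" shows "nb u <= nb v"
proof (rule nb_le_of_mo[OF assms(1)])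
 fix n
 have "conv (mo n) u = conv (mo n) v" using weak_deriv_conv[OF assms _ tf_moll, of n] by (simp add: pds_def)
 thus "nb (conv (mo n) u) <= nb v" using nb_mo_le[OF assms(2)] by simp
qed

text \<open>The converse of \<open>weak_deriv1_exists\<close>: true for mollifications and preserved
  in the limit.\<close>

lemma weak_deriv1_nb: assumes "u : LB" "v : LB" "weak_deriv [b] u v" and b: "b : Basis" shows "nb (shd (k *R b) u) <= \<bar>k\<bar> * nb v"
proof (rule nb_le_of_mo[OF LB_shd[OF assms(1)]])
 fix n
 have "nb (conv (mo n) (shd (k *R b) u)) = nb (shd (k *R b) (conv (mo n) u))" using assms(1) by (subst conv_shd[of _ 2]) (auto simp: LB_eq_LL tf_moll)
 also have "... <= \<bar>k\<bar> * nb (conv (pd b (mo n)) u)" by (rule nb_shd_conv_le[OF assms(1) tf_moll b])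
 also have "conv (pd b (mo n)) u = conv (mo n) v" using weak_deriv_conv[OF assms(1-3) _ tf_moll, of n] b by (simp add: pds_def)
 finally show "nb (conv (mo n) (shd (k *R b) u)) <= \<bar>k\<bar> * nb v"
  using mult_left_mono[OF nb_mo_le[OF assms(2), of n], of "\<bar>k\<bar>"] by simp
qed

lemma nb_shd_shd_conv_le: assumes u: "u : LB" and K: "K : tf" and b: "b : Basis" "b' : Basis"
 shows "nb (shd (k *R b) (shd (k' *R b') (conv K u))) <= \<bar>k\<bar> * (\<bar>k'\<bar> * nb (conv (pd b (pd b' K)) u))"
proof -
 have c: "conv J (shd h u) = shd h (conv J u)" if "J : tf" for J h using u that by (intro conv_shd[of _ 2]) (auto simp: LB_eq_LL)
 have "nb (shd (k' *R b') (shd (k *R b) (conv K u))) = nb (shd (k' *R b') (conv K (shd (k *R b) u)))" by (simp add: c K)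
 also have "... <= \<bar>k'\<bar> * nb (conv (pd b' K) (shd (k *R b) u))" by (intro nb_shd_conv_le LB_shd u K b)
 also have "conv (pd b' K) (shd (k *R b) u) = shd (k *R b) (conv (pd b' K) u)" by (intro c tf_pd K b)
 also have "nb ... <= \<bar>k\<bar> * nb (conv (pd b (pd b' K)) u)" by (intro nb_shd_conv_le u tf_pd K b)
 finally show ?thesis by (simp add: shd_commute[of "k *R b"] mult_left_mono mult.left_commute)
qed

lemma weak_deriv2_nb: assumes "u : LB" "v : LB" "weak_deriv [b, b'] u v" and b: "b : Basis" "b' : Basis"
 shows "nb (shd (k *R b) (shd (k' *R b') u)) <= \<bar>k\<bar> * (\<bar>k'\<bar> * nb v)"
proof (rule nb_le_of_mo[OF LB_shd[OF LB_shd[OF assms(1)]]])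
 fix n
 have "conv (mo n) (shd (k *R b) (shd (k' *R b') u)) = shd (k *R b) (shd (k' *R b') (conv (mo n) u))"
  using assms(1) LB_shd[OF assms(1)] by (simp add: conv_shd[of _ 2] LB_eq_LL tf_moll LL_shd)
 hence "nb (conv (mo n) (shd (k *R b) (shd (k' *R b') u))) <= \<bar>k\<bar> * (\<bar>k'\<bar> * nb (conv (pd b (pd b' (mo n))) u))"
  using nb_shd_shd_conv_le[OF assms(1) tf_moll b] by simp
 also have "conv (pd b (pd b' (mo n))) u = conv (mo n) v" using weak_deriv_conv[OF assms(1-3) _ tf_moll, of n] b by (simp add: pds_def)
 finally show "nb (conv (mo n) (shd (k *R b) (shd (k' *R b') u))) <= \<bar>k\<bar> * (\<bar>k'\<bar> * nb v)"
  by (rule order_trans) (intro mult_left_mono nb_mo_le assms, auto)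
qed

lemma conv_bl_pd: assumes w: "w : LB" and K: "K : tf" and \<phi>: "\<phi> : tf" and b: "b : Basis"
 shows "bl (conv K w) (pd b \<phi>) = - bl (conv (pd b K) w) \<phi>"
proof -
 define h where "h = (%n. 1 / real (Suc n))"
 have h: "h ~> 0" unfolding h_def by (rule lim_over_Suc)
 have h': "(%n. - h n) ~> 0" using tendsto_minus[OF h] by simp
 have h0: "h n \<noteq> 0" "- h n \<noteq> 0" for n by (simp_all add: h_def)
 have V: "conv K w : LB" by (rule conv_LB[OF w K])
 have 1: "(%n. bl (shd (- (h n *R b)) (conv K w)) \<phi> / of_real (h n)) ~> bl (conv K w) (pd b \<phi>)"
  by (rule bl_dquot_tendsto[OF V \<phi> b h h0(1)])
 have L: "dquot c b (conv K w) : LB" for c unfolding conv_dquot[OF w K, symmetric] by (intro conv_LB tf_dquot w K)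
 have "(%n. - bl (dquot (- h n) b (conv K w)) \<phi>) ~> - bl (conv (pd b K) w) \<phi>"
  by (rule tendsto_minus, rule bl_tendsto) (intro L conv_LB tf_pd w K b tf_LB \<phi> conv_dquot_tendsto h' h0 | simp)+
 moreover have "- bl (dquot (- h n) b (conv K w)) \<phi> = bl (shd (- (h n *R b)) (conv K w)) \<phi> / of_real (h n)" for n
 proof -
  have "dquot (- h n) b (conv K w) = (%x. (- 1 / of_real (h n)) * shd (- (h n *R b)) (conv K w) x)" by (rule ext) (simp add: dquot_def shd_def)
  thus ?thesis by (simp only: bl_cmult) simp
 qed
 ultimately show ?thesis using LIMSEQ_unique[OF 1] by simp
qed

text \<open>All derivatives fall on the kernel, and one new kernel serves every w; so mollification
  maps L2 boundedly into each H^k.\<close>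

lemma kernel_deriv:
 fixes K :: "'a::euclidean_space => complex" assumes "K : tf" "set bs \<subseteq> Basis"
 shows "EX \<kappa>:tf. ALL w:LB. weak_deriv bs (conv K w) (conv \<kappa> w)"
proof -
 have "EX \<kappa>:tf. ALL w:LB. ALL \<phi>:tf. bl (conv K w) (pds bs \<phi>) = (- 1) ^ length bs * bl (conv \<kappa> w) \<phi>" using assms
 proof (induction bs arbitrary: K)
  case Nil
  thus ?case by (auto simp: pds_def)
 next
  case (Cons b bs)
  have "pd b K : tf" "set bs \<subseteq> Basis" using Cons.prems tf_pd[of K b] by auto
  from Cons.IH[OF this] obtain \<kappa> where \<kappa>: "\<kappa> : tf"
   "!!w \<phi>. w : LB ==> \<phi> : tf ==> bl (conv (pd b K) w) (pds bs \<phi>) = (- 1) ^ length bs * bl (conv \<kappa> w) \<phi>" by blast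
  have "bl (conv K w) (pds (b # bs) \<phi>) = (- 1) ^ length (b # bs) * bl (conv \<kappa> w) \<phi>" if "w : LB" "\<phi> : tf" for w \<phi>
  proof -
   have "bl (conv K w) (pd b (pds bs \<phi>)) = - bl (conv (pd b K) w) (pds bs \<phi>)" using Cons.prems that by (intro conv_bl_pd tf_pds) auto
   thus ?thesis using \<kappa>(2)[OF that] by (simp add: pds_def)
  qed
  thus ?case using \<kappa>(1) by blast
 qed
 then obtain \<kappa> where \<kappa>: "\<kappa> : tf" "!!w \<phi>. w : LB ==> \<phi> : tf ==> bl (conv K w) (pds bs \<phi>) = (- 1) ^ length bs * bl (conv \<kappa> w) \<phi>"
  by blast
 have "weak_deriv bs (conv K w) (conv \<kappa> w)" if "w : LB" for w
  using \<kappa> that assms by (subst weak_deriv_borel) (auto intro: LB_borel conv_LB)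
 thus ?thesis using \<kappa>(1) by blast
qed

text \<open>A convolution is an average of translates and can be moved to the test function; this is
  why weak derivatives commute with mollification.\<close>

lemma bl_conv: assumes u: "u : LB" and K: "K : tf" and \<psi>: "\<psi> : tf" shows "bl (conv K u) \<psi> = (LINT z. K z * bl u (%x. \<psi> (x + z)))"
proof -
 have [measurable]: "u : Borel" "K : Borel" "\<psi> : Borel" using u K \<psi> by (auto simp: LB_borel tf_borel)
 have ut: "(%y. u (y - z)) : LB" "nb (%y. u (y - z)) = nb u" for z using LB_translate[OF u, of "- z"] nb_translate[of u "- z"] by auto
 have i: "integrable (lborel \<Otimes>\<^sub>M lborel) (%(z, y). K z * (u (y - z) * \<psi> y))"
 proof (rule pair_sigma_finite.Fubini_integrable[OF pair_sigma_finite_lborel])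
  show "AE z. L1 (%y. case (z, y) of (z, y) => K z * (u (y - z) * \<psi> y))" using ut \<psi> by (simp add: L2_mult_integrable tf_LB)
  have "L1 (%z. cmod (K z) * (LINT y. cmod (u (y - z)) * cmod (\<psi> y)))"
  proof (rule Bochner_Integration.integrable_bound[of lborel "%z. cmod (K z) * (nb u * nb \<psi>)"])
   show "L1 (%z. cmod (K z) * (nb u * nb \<psi>))" using integrable_norm[OF tf_integrable[OF K]] by simp
   show "AE z. norm (cmod (K z) * (LINT y. cmod (u (y - z)) * cmod (\<psi> y))) <= norm (cmod (K z) * (nb u * nb \<psi>))"
   proof (rule AE_I2)
    fix z
    have "(LINT y. cmod (u (y - z)) * cmod (\<psi> y)) <= nb u * nb \<psi>"
     using cauchy_schwarz_cmod[OF ut(1) tf_LB[OF \<psi>], of z] by (simp add: ut)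
    hence "cmod (K z) * (LINT y. cmod (u (y - z)) * cmod (\<psi> y)) <= cmod (K z) * (nb u * nb \<psi>)" by (rule mult_left_mono) simp
    thus "norm (cmod (K z) * (LINT y. cmod (u (y - z)) * cmod (\<psi> y))) <= norm (cmod (K z) * (nb u * nb \<psi>))" by (simp add: abs_mult)
   qed
  qed measurable
  thus "L1 (%z. LINT y. norm (case (z, y) of (z, y) => K z * (u (y - z) * \<psi> y)))" by (simp add: norm_mult)
 qed measurable
 have "bl (conv K u) \<psi> = (LINT y. LINT z. K z * (u (y - z) * \<psi> y))" unfolding bl_def
 proof (intro Bochner_Integration.integral_cong refl)
  fix y
  have "conv K u y * \<psi> y = (LINT z. u (y - z) * K z * \<psi> y)" by (subst conv_alt) (simp_all only: integral_mult_left_zero, measurable)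
  thus "conv K u y * \<psi> y = (LINT z. K z * (u (y - z) * \<psi> y))" by (simp only: mult_ac)
 qed
 also have "... = (LINT z. LINT y. K z * (u (y - z) * \<psi> y))" by (rule pair_sigma_finite.Fubini_integral[OF pair_sigma_finite_lborel i])
 also have "... = (LINT z. K z * bl u (%x. \<psi> (x + z)))"
 proof (intro Bochner_Integration.integral_cong refl)
  fix z
  have "(LINT y. u (y - z) * \<psi> y) = (LINT x. u (z + x - z) * \<psi> (z + x))" by (rule integral_translate[symmetric]) measurable
  thus "(LINT y. K z * (u (y - z) * \<psi> y)) = K z * bl u (%x. \<psi> (x + z))" unfolding bl_def by (simp add: add.commute)
 qed
 finally show ?thesis .
qed

lemma pds_translate: assumes "\<phi> : tf" "set bs \<subseteq> Basis" shows "pds bs (%x. \<phi> (x + z)) = (%x. pds bs \<phi> (x + z))" using assms(2)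
proof (induction bs)
 case (Cons b bs)
 have t: "pds bs \<phi> : tf" using Cons assms by (intro tf_pds) auto
 have "pds (b # bs) (%x. \<phi> (x + z)) = pd b (%x. pds bs \<phi> (x + z))" using Cons by (simp add: pds_def)
 also have "... = (%x. pd b (pds bs \<phi>) (x + z))" using pd_affine[OF t, of b z 1] by (auto simp: add.commute)
 finally show ?case by (simp add: pds_def)
qed (simp add: pds_def)

lemma weak_deriv_mollify: assumes u: "u : LB" and v: "v : LB" and w: "weak_deriv bs u v" and bs: "set bs \<subseteq> Basis" and K: "K : tf"
 shows "weak_deriv bs (conv K u) (conv K v)"
proof (subst weak_deriv_borel)
 show "conv K u : Borel" "conv K v : Borel" using u v K by (auto intro: LB_borel conv_LB)
 show "ALL \<phi>:tf. bl (conv K u) (pds bs \<phi>) = (- 1) ^ length bs * bl (conv K v) \<phi>"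
 proof
  fix \<phi> assume \<phi>: "\<phi> : (tf :: ('a => complex) set)"
  have "bl u (%x. pds bs \<phi> (x + z)) = (- 1) ^ length bs * bl v (%x. \<phi> (x + z))" for z using w tf_translate[OF \<phi>, of z] u v bs
   by (subst (asm) weak_deriv_borel) (auto simp: LB_borel pds_translate[OF \<phi> bs, symmetric])
  hence "bl (conv K u) (pds bs \<phi>) = (LINT z. (- 1) ^ length bs * (K z * bl v (%x. \<phi> (x + z))))"
   by (subst bl_conv[OF u K tf_pds[OF \<phi> bs]]) (simp only: mult_ac)
  also have "... = (- 1) ^ length bs * bl (conv K v) \<phi>" by (simp only: integral_mult_right_zero bl_conv[OF v K \<phi>])
  finally show "bl (conv K u) (pds bs \<phi>) = (- 1) ^ length bs * bl (conv K v) \<phi>" .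
 qed
qed (rule bs)

section \<open>Sobolev norms\<close>

lemma borel_measurable_lebesgue_cong:
 fixes u v :: "'a::euclidean_space => 'b::topological_space" assumes "u : borel_measurable lebesgue" "AE x. u x = v x"
 shows "v : borel_measurable lebesgue"
proof (rule measurableI)
 fix A :: "'b set" assume A: "A : sets borel"
 have ae: "AE x in lebesgue. u x = v x" using assms(2) by (simp add: AE_completion)
 have "u -` A : sets lebesgue" using measurable_sets[OF assms(1) A] by simp
 moreover have "AE x in lebesgue. x : u -` A \<longleftrightarrow> x : v -` A" using ae by eventually_elim simp
 ultimately show "v -` A \<inter> space lebesgue : sets lebesgue" using completion.in_sets_AE[of "u -` A" "v -` A" lborel] by simp
qed simp

lemma borel_measurable_lebesgue_cong_iff:
 fixes u v :: "'a::euclidean_space => 'b::topological_space" assumes "AE x. u x = v x"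
 shows "u : borel_measurable lebesgue \<longleftrightarrow> v : borel_measurable lebesgue"
proof -
 have "AE x. v x = u x" using assms by eventually_elim simp
 thus ?thesis using borel_measurable_lebesgue_cong assms by blast
qed

lemma lebesgue_integral_cong:
 fixes u v :: "'a::euclidean_space => complex" assumes ae: "AE x. u x = v x" shows "(LINT x|lebesgue. u x) = (LINT x|lebesgue. v x)"
proof (cases "u : borel_measurable lebesgue")
 case True
 thus ?thesis using borel_measurable_lebesgue_cong[OF True ae] ae by (intro integral_cong_AE) (auto intro: AE_completion)
next
 case False
 hence "\<not> integrable lebesgue u" "\<not> integrable lebesgue v"
  using borel_measurable_lebesgue_cong_iff[OF ae] borel_measurable_integrable by blast+
 thus ?thesis by (simp add: not_integrable_integral_eq)
qed

lemma Lp_norm_cong: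
 fixes u v :: "'a::euclidean_space => complex" assumes ae: "AE x. u x = v x" shows "Lp_norm p u = Lp_norm p v"
proof -
 have "u : borel_measurable lebesgue \<longleftrightarrow> v : borel_measurable lebesgue" by (rule borel_measurable_lebesgue_cong_iff[OF ae])
 moreover have "(\<integral>\<^sup>+x. ennreal (cmod (u x) powr p) \<partial>lebesgue) = (\<integral>\<^sup>+x. ennreal (cmod (v x) powr p) \<partial>lebesgue)"
  using ae by (intro nn_integral_cong_AE AE_completion) auto
 ultimately show ?thesis by (simp add: Lp_norm_def)
qed

lemma weak_deriv_cong: assumes u: "AE x. u x = u' x" and v: "AE x. v x = v' x" shows "weak_deriv bs u v \<longleftrightarrow> weak_deriv bs u' v'"
proof -
 have "(LINT x|lebesgue. u x * \<phi> x) = (LINT x|lebesgue. u' x * \<phi> x)" "(LINT x|lebesgue. v x * \<phi> x) = (LINT x|lebesgue. v' x * \<phi> x)" for \<phi>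
  using u v by (auto intro!: lebesgue_integral_cong elim: AE_mp)
 thus ?thesis unfolding weak_deriv_def by simp
qed

lemma Hk_norm_cong:
 fixes u v :: "'a::euclidean_space => complex" assumes ae: "AE x. u x = v x" shows "Hk_norm k u = Hk_norm k v"
 unfolding Hk_norm_def Lp_norm_cong[OF ae] weak_deriv_cong[OF ae AE_I2[OF refl]] ..

lemma borel_representative:
 fixes u :: "'a::euclidean_space => complex" assumes "u : borel_measurable lebesgue" shows "EX v:Borel. AE x. u x = v x"
proof -
 have re: "(%x. Re (u x)) : borel_measurable lebesgue" and im: "(%x. Im (u x)) : borel_measurable lebesgue" using assms by measurable
 obtain a where a: "a : borel_measurable lborel" "AE x. Re (u x) = a x" using completion_ex_borel_measurable_real[OF re] by blast
 obtain b where b: "b : borel_measurable lborel" "AE x. Im (u x) = b x" using completion_ex_borel_measurable_real[OF im] by blast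
 have "AE x. u x = Complex (a x) (b x)" using a(2) b(2) by eventually_elim (simp add: complex_eq_iff)
 moreover have "(%x. Complex (a x) (b x)) : Borel" using a(1) b(1) by (simp add: Complex_eq)
 ultimately show ?thesis by (rule rev_bexI[rotated])
qed

lemma Lp_norm_borel: assumes "u : Borel" shows "Lp_norm p u = epowr (pint p u) (1 / p)"
 using assms unfolding Lp_norm_def pint_def by (simp add: nn_integral_completion measurable_completion)

lemma epowr_finite_iff: "epowr x r < top \<longleftrightarrow> x < top" by (simp add: epowr_def top.not_eq_extremum)

lemma Lp_norm_LB: "u : LB ==> Lp_norm 2 u = ennreal (nb u)" by (subst Lp_norm_borel) (auto simp: LB_borel pint_2 epowr_def powr_half_sqrt)

lemma Lp_norm_representative:
 fixes u :: "'a::euclidean_space => complex" assumes "Lp_norm p u < \<infinity>" shows "EX v:LL p. AE x. u x = v x"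
proof -
 have "u : borel_measurable lebesgue" using assms by (auto simp: Lp_norm_def split: if_splits)
 then obtain v where v: "v : Borel" "AE x. u x = v x" using borel_representative by blast
 have "Lp_norm p v < \<infinity>" using assms Lp_norm_cong[OF v(2)] by simp
 hence "v : LL p" using v(1) by (simp add: LL_def Lp_norm_borel epowr_finite_iff)
 thus ?thesis using v(2) by blast
qed

lemma Lp_norm2_representative: "Lp_norm 2 u < \<infinity> ==> EX v:LB. AE x. u x = v x" unfolding LB_eq_LL by (rule Lp_norm_representative)

section \<open>Sobolev functions with their families of derivatives\<close>

definition multi :: "nat => 'a::euclidean_space list set" where
 "multi k = {bs. set bs \<subseteq> Basis \<and> length bs <= k}"

text \<open>A Borel function together with a chosen family of weak derivatives in L2; in this form
  the infima in \<open>Hk_norm\<close> disappear.\<close>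

definition sobolev :: "nat => ('a::euclidean_space => complex) => ('a list => 'a => complex) => bool" where
 "sobolev k u v \<longleftrightarrow> u : LB \<and> (ALL bs:multi k. v bs : LB \<and> weak_deriv bs u (v bs))"

lemma finite_multi [simp]: "finite (multi k)" unfolding multi_def by (intro finite_lists_length_le) simp

lemma weak_deriv_diff: assumes "u : LB" "v : LB" "u' : LB" "v' : LB" "set bs \<subseteq> Basis" "weak_deriv bs u v" "weak_deriv bs u' v'"
 shows "weak_deriv bs (%x. u x - u' x) (%x. v x - v' x)"
proof -
 have bl: "bl (%x. a x - b x) \<phi> = bl a \<phi> - bl b \<phi>" if "a : LB" "b : LB" "\<phi> : tf" for a b \<phi> :: "'a => complex"
  using ip_diff_left[OF that(1,2) L2_cnj[OF tf_LB[OF that(3)]]] by (simp add: bl_ib)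
 show ?thesis using assms by (subst (asm) (1 2) weak_deriv_borel, simp_all add: LB_borel, subst weak_deriv_borel)
   (auto simp: LB_borel L2_diff bl tf_pds right_diff_distrib)
qed

lemma weak_deriv_unique:
 assumes u: "u : LB" and v: "v : LB" "v' : LB" and bs: "set bs \<subseteq> Basis" and w: "weak_deriv bs u v" "weak_deriv bs u v'"
 shows "nb (%x. v x - v' x) = 0"
proof -
 have "weak_deriv [] (%x. v x - v' x) (%x. 0)"
 proof (subst weak_deriv_borel)
  have "bl v \<phi> = bl v' \<phi>" if "\<phi> : tf" for \<phi> using w u v bs that by (subst (asm) (1 2) weak_deriv_borel) (auto simp: LB_borel)
  thus "ALL \<phi>:tf. bl (%x. v x - v' x) (pds [] \<phi>) = (- 1) ^ length ([] :: 'a list) * bl (%x. 0) \<phi>"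
   using v by (auto simp: pds_def bl_def left_diff_distrib L2_mult_integrable tf_LB)
 qed (use v in \<open>auto simp: LB_borel\<close>)
 from weak_deriv0_nb[OF L2_diff[OF v] _ this] show ?thesis by (simp add: antisym)
qed

text \<open>The infimum is attained because weak derivatives are unique up to null sets; a
  competitor outside L2 has infinite norm.\<close>

lemma Hk_norm_eq: assumes s: "sobolev k u v" shows "Hk_norm k u = ennreal (sqrt (SUM bs:multi k. (nb (v bs))^2))"
proof -
 have u: "u : LB" using s by (simp add: sobolev_def)
 have inf: "(INF w\<in>{w. weak_deriv bs u w}. Lp_norm 2 w) = ennreal (nb (v bs))" if bs: "bs : multi k" for bs
 proof (rule antisym)
  have v: "v bs : LB" "weak_deriv bs u (v bs)" using s bs by (auto simp: sobolev_def)
  thus "(INF w\<in>{w. weak_deriv bs u w}. Lp_norm 2 w) <= ennreal (nb (v bs))" by (intro INF_lower2[of "v bs"]) (auto simp: Lp_norm_LB)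
  show "ennreal (nb (v bs)) <= (INF w\<in>{w. weak_deriv bs u w}. Lp_norm 2 w)"
  proof (rule INF_greatest)
   fix w assume "w : {w. weak_deriv bs u w}"
   hence w: "weak_deriv bs u w" by simp
   show "ennreal (nb (v bs)) <= Lp_norm 2 w"
   proof (cases "Lp_norm 2 w < \<infinity>")
    case True
    from Lp_norm2_representative[OF this] obtain w' where w': "w' : LB" "AE x. w x = w' x" by auto
    have "weak_deriv bs u w'" using w weak_deriv_cong[OF AE_I2[OF refl] w'(2)] by simp
    hence "nb (%x. v bs x - w' x) = 0" using weak_deriv_unique[OF u v(1) w'(1) _ v(2)] bs by (simp add: multi_def)
    hence "nb (v bs) = nb w'" using n2_reverse_triangle[OF v(1) w'(1)] by simp
    thus ?thesis using Lp_norm_LB[OF w'(1)] Lp_norm_cong[OF w'(2)] by simp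
   qed (simp add: not_less top_unique)
  qed
 qed
 have "(SUM bs:multi k. (INF w\<in>{w. weak_deriv bs u w}. Lp_norm 2 w) ^ 2) = ennreal (SUM bs:multi k. (nb (v bs))^2)"
  by (simp add: inf ennreal_power sum_ennreal)
 thus ?thesis unfolding Hk_norm_def multi_def[symmetric] by (simp add: Lp_norm_LB[OF u] epowr_def powr_half_sqrt sum_nonneg)
qed

lemma Hk_norm_sobolev:
 fixes u :: "'a::euclidean_space => complex" assumes "Hk_norm k u < \<infinity>" shows "EX w v. (AE x. u x = w x) \<and> sobolev k w v"
proof -
 have L: "Lp_norm 2 u < \<infinity>" using assms by (auto simp: Hk_norm_def split: if_splits)
 from Lp_norm2_representative[OF this] obtain w where w: "w : LB" "AE x. u x = w x" by auto
 have "EX v:LB. weak_deriv bs w v" if bs: "bs : multi k" for bs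
 proof -
  have "(SUM bs:multi k. (INF w\<in>{w. weak_deriv bs u w}. Lp_norm 2 w) ^ 2) < \<infinity>"
   using assms L unfolding Hk_norm_def multi_def[symmetric] by (simp add: epowr_finite_iff)
  hence "(INF w\<in>{w. weak_deriv bs u w}. Lp_norm 2 w) ^ 2 < \<infinity>" using bs by simp
  hence "(INF w\<in>{w. weak_deriv bs u w}. Lp_norm 2 w) < \<infinity>" by (simp add: power_less_top_ennreal)
  then obtain v where v: "weak_deriv bs u v" "Lp_norm 2 v < \<infinity>" by (auto simp: Inf_less_iff)
  from Lp_norm2_representative[OF v(2)] obtain v' where v': "v' : LB" "AE x. v x = v' x" by auto
  show ?thesis using v' weak_deriv_cong[OF w(2) v'(2)] v(1) by auto
 qed
 then obtain v where "ALL bs:multi k. v bs : LB \<and> weak_deriv bs w (v bs)" by metis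
 thus "EX w v. (AE x. u x = w x) \<and> sobolev k w v" using w unfolding sobolev_def by blast
qed

text \<open>The shift is decomposed along the basis and each coordinate is bounded by the norm of h.
  This crude step is the origin of the dimension factor in \<open>gn_const\<close>.\<close>

lemma nb_shd_directional:
 fixes u :: "'a::euclidean_space => complex" assumes u: "u : LB" and L: "L >= 0" "!!b k. b : Basis ==> nb (shd (k *R b) u) <= \<bar>k\<bar> * L"
 shows "nb (shd h u) <= norm h * (real DIM('a) * L)"
proof -
 have "nb (shd (SUM b:Basis. (h \<bullet> b) *R b) u) <= (SUM b:Basis. nb (shd ((h \<bullet> b) *R b) u))" by (rule nb_shd_sum[OF u]) simp
 also have "... <= (SUM b:(Basis :: 'a set). norm h * L)" using L by (intro sum_mono order_trans[OF L(2)] mult_right_mono Basis_le_norm) auto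
 finally show ?thesis by (simp add: euclidean_representation mult_ac)
qed

text \<open>Interpolation between orders 0 and 2 by discrete integration by parts: increments of
  second order control those of first order.\<close>

lemma nb_shd_sq_le: assumes u: "u : LB" shows "(nb (shd h u))^2 <= nb u * nb (shd (- h) (shd h u))"
proof -
 have "(nb (shd h u))^2 = cmod (ib (shd h u) (shd h u))" unfolding ip_self norm_of_real by simp
 also have "... = cmod (ib u (shd (- h) (shd h u)))" by (simp add: ib_shd u LB_shd)
 also have "... <= nb u * nb (shd (- h) (shd h u))" by (intro ip_cauchy_schwarz u LB_shd)
 finally show ?thesis .
qed

lemma multi_cases: assumes "bs : multi k" "k : {1, 2}"
 obtains "bs = []" | b where "b : Basis" "bs = [b]" | b b' where "k = 2" "b : Basis" "b' : Basis" "bs = [b, b']"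
proof (cases bs)
 case (Cons b cs)
 show ?thesis
 proof (cases cs)
  case Nil
  thus ?thesis using Cons assms that(2) by (auto simp: multi_def)
 next
  case (Cons b' ds)
  thus ?thesis using \<open>bs = b # cs\<close> assms that(3) by (auto simp: multi_def)
 qed
qed (rule that(1))

text \<open>The left side of the increment hypothesis in \<open>gagliardo_nirenberg\<close> is half
  the squared increment. For l = 1 it is bounded by first derivatives, for l = 2 through
  \<open>nb_shd_sq_le\<close> by the norm times second derivatives.\<close>

lemma sobolev_gagliardo_nirenberg:
 fixes u :: "'a::euclidean_space => complex" assumes s: "sobolev l u v" and M: "M > 0" "!!bs. bs : multi l ==> nb (v bs) <= M" and l: "l : {1, 2}"
  and p: "u : LL (1 + m)" and m: "0 < m" "m < 1"
 shows "gn_const DIM('a) M m l * nb u powr (1 + m + real DIM('a) * (1 - m) / (2 * real l)) <= enn2real (pint (1 + m) u)"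
proof (rule gagliardo_nirenberg[OF _ p m M(1) l])
 show u: "u : LB" using s by (simp add: sobolev_def)
 have v: "v bs : LB" "weak_deriv bs u (v bs)" if "bs : multi l" for bs using s that by (auto simp: sobolev_def)
 fix h :: 'a
 have half: "(nb u)^2 - Re (ib u (%x. u (x + h))) = (nb (shd h u))^2 / 2"
 proof -
  have "(nb (shd h u))^2 = (nb (%x. u (x + h)))^2 + (nb u)^2 - 2 * Re (ib (%x. u (x + h)) u)"
   unfolding shd_def[abs_def] by (intro n2_diff_sq LB_translate u)
  moreover have "Re (ib (%x. u (x + h)) u) = Re (ib u (%x. u (x + h)))"
   using ip_cnj[of lborel u "%x. u (x + h)"] by (metis complex_cnj_cnj complex_cnj(1) cnj.simps(1))
  ultimately show ?thesis using nb_translate[of u h] u by (simp add: LB_borel)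
 qed
 show "(nb u)^2 - Re (ib u (%x. u (x + h))) <= (nb u)^2 / 2 * (norm h ^ l * (real DIM('a) ^ l * M) / nb u) ^ (2 div l)"
 proof (cases "nb u = 0")
  case True
  hence "nb (shd h u) = 0" using nb_shd_le[OF u, of h] by (simp add: antisym)
  thus ?thesis unfolding half by (simp add: True)
 next
  case False
  consider "l = 1" | "l = 2" using l by auto
  thus ?thesis
  proof cases
   case 1
   have "nb (shd h u) <= norm h * (real DIM('a) * M)"
   proof (rule nb_shd_directional[OF u])
    fix b :: 'a and k assume b: "b : Basis"
    hence "[b] : multi l" using 1 by (simp add: multi_def)
    thus "nb (shd (k *R b) u) <= \<bar>k\<bar> * M" by (intro order_trans[OF weak_deriv1_nb[OF u v b]] mult_left_mono M) auto
   qed (use M in simp)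
   hence "(nb (shd h u))^2 <= (norm h * (real DIM('a) * M))^2" by (rule power_mono) simp
   thus ?thesis unfolding half using 1 False by (simp add: power_divide)
  next
   case 2
   have "nb (shd (- h) (shd h u)) <= norm (- h) * (real DIM('a) * (norm h * (real DIM('a) * M)))"
   proof (rule nb_shd_directional[OF LB_shd[OF u]])
    fix b :: 'a and k assume b: "b : Basis"
    have "nb (shd h (shd (k *R b) u)) <= norm h * (real DIM('a) * (\<bar>k\<bar> * M))"
    proof (rule nb_shd_directional[OF LB_shd[OF u]])
     fix b' :: 'a and k' assume b': "b' : Basis"
     hence "[b', b] : multi l" using 2 b by (simp add: multi_def)
     hence "nb (shd (k' *R b') (shd (k *R b) u)) <= \<bar>k'\<bar> * (\<bar>k\<bar> * M)"
      by (intro order_trans[OF weak_deriv2_nb[OF u v b' b]] mult_left_mono M) auto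
     thus "nb (shd (k' *R b') (shd (k *R b) u)) <= \<bar>k'\<bar> * (\<bar>k\<bar> * M)" .
    qed (use M in simp)
    thus "nb (shd (k *R b) (shd h u)) <= \<bar>k\<bar> * (norm h * (real DIM('a) * M))" by (simp add: shd_commute[of h] mult_ac)
   qed (use M in simp)
   hence "nb u * nb (shd (- h) (shd h u)) <= nb u * ((norm h)^2 * ((real DIM('a))^2 * M))"
    by (intro mult_left_mono) (auto simp: power2_eq_square mult_ac)
   hence "(nb (shd h u))^2 <= nb u * ((norm h)^2 * ((real DIM('a))^2 * M))" using nb_shd_sq_le[OF u, of h] by linarith
   moreover have "(nb u)^2 * X / nb u = nb u * X" for X using False by (simp add: power2_eq_square)
   ultimately show ?thesis unfolding half using 2 by (simp add: mult.assoc)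
  qed
 qed
qed

text \<open>The summands of the bound serve the derivatives of order zero, those of top order and,
  for l = 2, those of first order, where \<open>nb_shd_sq_le\<close> interpolates.\<close>

lemma sobolev_of_increments:
 fixes u :: "'a::euclidean_space => complex" assumes u: "u : LB" and L: "L >= 0" and l: "l : {1, 2}"
  and inc1: "l = 1 ==> ALL b:Basis. ALL k. nb (shd (k *R b) u) <= \<bar>k\<bar> * L"
  and inc2: "l = 2 ==> ALL b:Basis. ALL b':Basis. ALL k k'. nb (shd (k' *R b') (shd (k *R b) u)) <= \<bar>k'\<bar> * (\<bar>k\<bar> * L)"
 shows "EX v. sobolev l u v \<and> (ALL bs:multi l. nb (v bs) <= nb u + L + sqrt (nb u * L))"
proof -
 define B where "B = nb u + L + sqrt (nb u * L)"
 have B: "L <= B" "sqrt (nb u * L) <= B" "nb u <= B" using L by (auto simp: B_def)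
 have "EX w:LB. nb w <= B \<and> weak_deriv bs u w" if bs: "bs : multi l" for bs using bs l
 proof (cases rule: multi_cases)
  case 1
  have "weak_deriv [] u u" by (simp add: weak_deriv_def pds_def)
  thus ?thesis using u B 1 by blast
 next
  case (2 b)
  have "nb (shd (k *R b) u) <= \<bar>k\<bar> * B" for k
  proof (cases "l = 1")
   case True
   hence "nb (shd (k *R b) u) <= \<bar>k\<bar> * L" using inc1 2 by blast
   thus ?thesis using mult_left_mono[OF B(1), of "\<bar>k\<bar>"] by simp
  next
   case False
   hence "nb (shd ((- k) *R b) (shd (k *R b) u)) <= \<bar>- k\<bar> * (\<bar>k\<bar> * L)" using inc2 2 l by blast
   hence "(nb (shd (k *R b) u))^2 <= nb u * (\<bar>k\<bar> * (\<bar>k\<bar> * L))"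
    using nb_shd_sq_le[OF u, of "k *R b"] mult_left_mono[of _ _ "nb u"] by (fastforce intro: order_trans)
   also have "... = (\<bar>k\<bar> * sqrt (nb u * L))^2" using L by (simp add: power_mult_distrib) (simp add: power2_eq_square)
   finally have "nb (shd (k *R b) u) <= \<bar>k\<bar> * sqrt (nb u * L)" by (rule power2_le_imp_le) (use L in simp)
   thus ?thesis using mult_left_mono[OF B(2), of "\<bar>k\<bar>"] by simp
  qed
  thus ?thesis using weak_deriv1_exists[OF u 2(1), of B] B L 2(2) by auto
 next
  case (3 b b')
  have "nb (shd (k' *R b') (shd (k *R b) u)) <= \<bar>k'\<bar> * (\<bar>k\<bar> * B)" for k k'
  proof -
   have "nb (shd (k' *R b') (shd (k *R b) u)) <= \<bar>k'\<bar> * (\<bar>k\<bar> * L)" using inc2 3 by blast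
   also have "... <= \<bar>k'\<bar> * (\<bar>k\<bar> * B)" by (intro mult_left_mono B) auto
   finally show ?thesis .
  qed
  thus ?thesis using weak_deriv2_exists[OF u 3(2,3), of B] B L 3(4) by auto
 qed
 then obtain v where "ALL bs:multi l. v bs : LB \<and> nb (v bs) <= B \<and> weak_deriv bs u (v bs)" by metis
 thus ?thesis using u unfolding sobolev_def B_def by blast
qed

lemma sobolev_mollify: "sobolev k u v ==> K : tf ==> sobolev k (conv K u) (%bs. conv K (v bs))"
 unfolding sobolev_def by (auto intro!: conv_LB weak_deriv_mollify simp: multi_def)

lemma sobolev_kernel:
 fixes K :: "'a::euclidean_space => complex" assumes "K : tf"
 shows "EX \<kappa> c. c >= 0 \<and> (ALL w:LB. sobolev k (conv K w) (%bs. conv (\<kappa> bs) w)) \<and> (ALL w:LB. ALL bs:multi k. nb (conv (\<kappa> bs) w) <= c * nb w)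
  \<and> (ALL bs:multi k. \<kappa> bs : tf)"
proof -
 have "EX \<kappa>:tf. ALL w:LB. weak_deriv bs (conv K w) (conv \<kappa> w)" if "bs : multi k" for bs
  using kernel_deriv[OF assms, of bs] that by (simp add: multi_def)
 then obtain \<kappa> where \<kappa>: "!!bs. bs : multi k ==> \<kappa> bs : tf" "!!bs w. bs : multi k ==> w : LB ==> weak_deriv bs (conv K w) (conv (\<kappa> bs) w)"
  by metis
 define c where "c = (SUM bs:multi k. LINT x. cmod (\<kappa> bs x))"
 have "nb (conv (\<kappa> bs) w) <= c * nb w" if "w : LB" "bs : multi k" for w bs
 proof -
  have "(LINT x. cmod (\<kappa> bs x)) <= c" unfolding c_def using that by (intro member_le_sum) (auto intro: Bochner_Integration.integral_nonneg)
  thus ?thesis using nb_conv_le[OF that(1) \<kappa>(1)[OF that(2)]] mult_right_mono[of _ c "nb w"] by fastforce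
 qed
 moreover have "c >= 0" unfolding c_def by (intro sum_nonneg Bochner_Integration.integral_nonneg) auto
 ultimately show ?thesis using \<kappa> assms unfolding sobolev_def by (intro exI[of _ \<kappa>] exI[of _ c]) (auto intro!: conv_LB)
qed

text \<open>Continuity is available only in L2, while simple approximations in H^k are wanted.
  Mollification maps L2 into H^k with some bound \<open>c n\<close>; the mollified curve is
  therefore sampled on a time grid so fine that the L2 oscillation within a cell beats
  \<open>c n\<close>.\<close>

lemma sobolev_X_measurable:
 fixes w :: "real => 'a::euclidean_space => complex" assumes w: "!!t. t >= 0 ==> w t : LB"
  and cont: "!!T e. e > 0 ==> EX d>0. ALL s:{0..T}. ALL t:{0..T}. \<bar>s - t\<bar> < d --> nb (%x. w s x - w t x) < e"
  and v: "!!t. t > 0 ==> sobolev k (w t) (v t)"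
 shows "X_measurable (Hk_norm k) {0<..} w" "(%t. Hk_norm k (w t)) : borel_measurable (lebesgue_on {0<..})"
proof -
 have "EX \<kappa> c. c >= 0 \<and> (ALL w:LB. sobolev k (conv (mo n) w) (%bs. conv (\<kappa> bs) w)) \<and>
   (ALL w:LB. ALL bs:multi k. nb (conv (\<kappa> bs) w) <= c * nb w) \<and> (ALL bs:multi k. \<kappa> bs : (tf :: ('a => complex) set))" for n
  by (rule sobolev_kernel[OF tf_moll])
 then obtain \<kappa> :: "nat => 'a list => 'a => complex" and c where \<kappa>: "!!n. c n >= 0" "!!n w. w : LB ==> sobolev k (conv (mo n) w) (%bs. conv (\<kappa> n bs) w)"
  "!!n bs w. w : LB ==> bs : multi k ==> nb (conv (\<kappa> n bs) w) <= c n * nb w" "!!n bs. bs : multi k ==> \<kappa> n bs : tf" by metis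
 have "EX N::nat. N > 0 \<and> (ALL s:{0..real n}. ALL t:{0..real n}. \<bar>s - t\<bar> < 1 / real N --> nb (%x. w s x - w t x) < 1 / ((c n + 1) * real (Suc n)))" for n
 proof -
  have "1 / ((c n + 1) * real (Suc n)) > 0" using \<kappa>(1)[of n] by (intro divide_pos_pos mult_pos_pos) auto
  from cont[OF this, of "real n"] obtain d where d: "d > 0" "ALL s:{0..real n}. ALL t:{0..real n}. \<bar>s - t\<bar> < d --> nb (%x. w s x - w t x) < 1 / ((c n + 1) * real (Suc n))"
   by blast
  obtain N where "1 / real (Suc N) < d" using reals_Archimedean[OF d(1)] unfolding inverse_eq_divide by blast
  thus ?thesis using d(2) by (intro exI[of _ "Suc N"]) (meson less_trans zero_less_Suc)
 qed
 then obtain N where N: "!!n. N n > 0" "!!n s t. s : {0..real n} ==> t : {0..real n} ==> \<bar>s - t\<bar> < 1 / real (N n) ==> nb (%x. w s x - w t x) < 1 / ((c n + 1) * real (Suc n))"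
  by metis
 \<comment> \<open>The index of the grid cell, with -1 standing for the zero function outside (0,
   n); the range is thus finite, as a simple function requires.\<close>
 define i where "i n t = (if 0 < t \<and> t < real n then \<lfloor>real (N n) * t\<rfloor> else - 1)" for n and t :: real
 define s where "s n t = conv (mo n) (if i n t = - 1 then (%x. 0) else w (of_int (i n t) / real (N n)))" for n t
 have i0: "i n t = - 1 \<or> (i n t >= 0 \<and> i n t <= \<lfloor>real (N n) * real n\<rfloor>)" for n t
  by (auto simp: i_def intro!: floor_mono mult_left_mono)
 have sL: "(if i n t = - 1 then (%x. 0) else w (of_int (i n t) / real (N n))) : LB" for n t using i0[of n t] by (auto intro!: w)
 have simp: "simple_function (lebesgue_on {0<..}) (s n)" for n
 proof -
  have "simple_function (lebesgue_on {0<..}) (i n)" unfolding simple_function_eq_measurable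
  proof
   have "i n ` space (lebesgue_on {0<..}) \<subseteq> insert (- 1) {0..\<lfloor>real (N n) * real n\<rfloor>}" using i0 by (intro image_subsetI) (metis atLeastAtMost_iff insert_iff)
   thus "finite (i n ` space (lebesgue_on {0<..}))" by (rule finite_subset) simp
   have "i n : borel \<rightarrow>\<^sub>M count_space UNIV" unfolding i_def[abs_def] by measurable
   thus "i n : lebesgue_on {0<..} \<rightarrow>\<^sub>M count_space UNIV" by (intro measurable_restrict_space1 measurable_completion) simp
  qed
  hence "simple_function (lebesgue_on {0<..}) ((%j. conv (mo n) (if j = - 1 then (%x. 0) else w (of_int j / real (N n)))) \<circ> i n)"
   by (rule simple_function_compose)
  thus ?thesis by (simp add: comp_def s_def[abs_def])
 qed
 have fin: "Hk_norm k (s n t) < \<infinity>" for n t unfolding s_def using Hk_norm_eq[OF \<kappa>(2)[OF sL]] by simp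
 have lim: "(%n. nb (%x. conv (\<kappa> n bs) (if i n t = - 1 then (%x. 0) else w (of_int (i n t) / real (N n))) x - v t bs x)) ~> 0"
  if t: "t > 0" and bs: "bs : multi k" for t bs
 proof (rule Lim_null_comparison)
  have vL: "v t bs : LB" "weak_deriv bs (w t) (v t bs)" using v[OF t] bs by (auto simp: sobolev_def)
  have wt: "w t : LB" using t by (intro w) simp
  have "(%n. 1 / real (Suc n) + nb (%x. conv (mo n) (v t bs) x - v t bs x)) ~> 0 + 0" by (intro tendsto_add mo_convergence_nb vL lim_over_Suc)
  thus "(%n. 1 / real (Suc n) + nb (%x. conv (mo n) (v t bs) x - v t bs x)) ~> 0" by simp
  obtain n0 :: nat where n0: "t < real n0" using reals_Archimedean2 by blast
  show "EV n. norm (nb (%x. conv (\<kappa> n bs) (if i n t = - 1 then (%x. 0) else w (of_int (i n t) / real (N n))) x - v t bs x))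
    <= 1 / real (Suc n) + nb (%x. conv (mo n) (v t bs) x - v t bs x)" using eventually_ge_at_top[of n0]
  proof eventually_elim
   case (elim n)
   hence tn: "t < real n" using n0 by (meson less_le_trans of_nat_le_iff)
   define \<tau> where "\<tau> = of_int \<lfloor>real (N n) * t\<rfloor> / real (N n)"
   have Np: "real (N n) > 0" using N(1)[of n] by simp
   have f: "of_int \<lfloor>real (N n) * t\<rfloor> <= real (N n) * t" "real (N n) * t < of_int \<lfloor>real (N n) * t\<rfloor> + 1" by linarith+
   have f0: "0 <= \<lfloor>real (N n) * t\<rfloor>" using t Np by simp
   have \<tau>: "0 <= \<tau>" "\<tau> <= t" "t < \<tau> + 1 / real (N n)" using f f0 Np by (auto simp: \<tau>_def field_simps)
   have it: "(if i n t = - 1 then (%x. 0) else w (of_int (i n t) / real (N n))) = w \<tau>"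
   proof -
    have "\<lfloor>real (N n) * t\<rfloor> \<noteq> - 1" using f0 by linarith
    thus ?thesis using t tn by (simp add: i_def \<tau>_def)
   qed
   have w\<tau>: "w \<tau> : LB" using \<tau> by (intro w)
   note L = conv_LB[OF w\<tau> \<kappa>(4)[OF bs, of n]] conv_LB[OF wt \<kappa>(4)[OF bs, of n]]
   have "nb (%x. conv (\<kappa> n bs) (w \<tau>) x - conv (\<kappa> n bs) (w t) x) = nb (conv (\<kappa> n bs) (%x. w \<tau> x - w t x))"
    by (rule arg_cong[where f = nb], rule ext, rule conv_diff[symmetric, of _ 2])
     (use w\<tau> wt \<kappa>(4)[OF bs] in \<open>auto simp: LB_eq_LL\<close>)
   also have "... <= c n * nb (%x. w \<tau> x - w t x)" by (intro \<kappa>(3) L2_diff w\<tau> wt bs)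
   also have "... <= c n * (1 / ((c n + 1) * real (Suc n)))" using N(2)[of \<tau> n t] \<tau> t tn \<kappa>(1)[of n] by (intro mult_left_mono) auto
   also have "... <= 1 / real (Suc n)"
   proof -
    have "c n / (c n + 1) * (1 / real (Suc n)) <= 1 * (1 / real (Suc n))" using \<kappa>(1)[of n] by (intro mult_right_mono) auto
    thus ?thesis by simp
   qed
   finally have 1: "nb (%x. conv (\<kappa> n bs) (w \<tau>) x - conv (\<kappa> n bs) (w t) x) <= 1 / real (Suc n)" .
   have bs': "set bs \<subseteq> Basis" using bs by (simp add: multi_def)
   \<comment> \<open>Differentiating the kernel and mollifying the derivative give two weak
     derivatives of the same function.\<close>
   have "nb (%x. conv (\<kappa> n bs) (w t) x - conv (mo n) (v t bs) x) = 0"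
    using \<kappa>(2)[OF wt, of n] sobolev_mollify[OF v[OF t] tf_moll, of n] bs
    by (intro weak_deriv_unique[OF conv_LB[OF wt tf_moll] L(2) conv_LB[OF vL(1) tf_moll] bs']) (auto simp: sobolev_def)
   moreover note n2_triangle3[OF L(2) conv_LB[OF vL(1) tf_moll] vL(1), of n] n2_triangle3[OF L vL(1)]
   ultimately show ?case unfolding it real_norm_def abs_of_nonneg[OF n2_nonneg] using 1 by linarith
  qed
 qed
 have "(%n. Hk_norm k (%x. s n t x - w t x)) ~> 0" if t: "t > 0" for t
 proof -
  have "sobolev k (%x. s n t x - w t x) (%bs x. conv (\<kappa> n bs) (if i n t = - 1 then (%x. 0) else w (of_int (i n t) / real (N n))) x - v t bs x)" for n
   using \<kappa>(2)[OF sL, of n n t] v[OF t] unfolding sobolev_def s_def[symmetric] by (auto intro!: L2_diff weak_deriv_diff simp: multi_def)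
  from Hk_norm_eq[OF this] have "Hk_norm k (%x. s n t x - w t x) = ennreal (sqrt (SUM bs:multi k. (nb (%x. conv (\<kappa> n bs) (if i n t = - 1 then (%x. 0) else w (of_int (i n t) / real (N n))) x - v t bs x))^2))" for n .
  moreover have "(%n. ennreal (sqrt (SUM bs:multi k. (nb (%x. conv (\<kappa> n bs) (if i n t = - 1 then (%x. 0) else w (of_int (i n t) / real (N n))) x - v t bs x))^2)))
    ~> ennreal (sqrt (SUM bs:(multi k :: 'a list set). 0^2))" by (intro tendsto_ennrealI tendsto_real_sqrt tendsto_sum tendsto_power lim t)
  ultimately show ?thesis by simp
 qed
 thus "X_measurable (Hk_norm k) {0<..} w" unfolding X_measurable_def X_simple_def using simp fin
  by (intro exI[of _ s] conjI allI ballI AE_I2) (auto simp: space_restrict_space)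
 have "(%n. Hk_norm k (s n t)) ~> Hk_norm k (w t)" if t: "t > 0" for t unfolding s_def Hk_norm_eq[OF \<kappa>(2)[OF sL]] Hk_norm_eq[OF v[OF t]]
 proof (intro tendsto_ennrealI tendsto_real_sqrt tendsto_sum tendsto_power)
  fix bs :: "'a list" assume bs: "bs : multi k"
  show "(%n. nb (conv (\<kappa> n bs) (if i n t = - 1 then (%x. 0) else w (of_int (i n t) / real (N n))))) ~> nb (v t bs)"
   using v[OF t] bs by (intro n2_tendsto lim t bs conv_LB sL \<kappa>(4)) (auto simp: sobolev_def)
 qed
 note lim' = this
 show "(%t. Hk_norm k (w t)) : borel_measurable (lebesgue_on {0<..})"
 proof (rule borel_measurable_LIMSEQ_order)
  show "(%n. Hk_norm k (s n t)) ~> Hk_norm k (w t)" if "t : space (lebesgue_on {0<..})" for t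
   using that by (intro lim') (simp add: space_restrict_space)
  show "(%t. Hk_norm k (s n t)) : borel_measurable (lebesgue_on {0<..})" for n
   by (rule borel_measurable_simple_function[OF simple_function_compose1[OF simp]])
 qed
qed

section \<open>Functions of time with values in \<open>L\<^sup>2\<close>\<close>

text \<open>Geometric decay in L2 makes the squared errors summable at almost every point.\<close>

lemma nb_geometric_AE: assumes v: "!!n. v n : LB" and w: "w : LB" and C: "EV n. nb (%x. v n x - w x) <= (1 / 2) ^ n" shows "AE x. (%n. v n x) ~> w x"
proof -
 obtain k where k: "!!n. n >= k ==> nb (%x. v n x - w x) <= (1 / 2) ^ n" using C by (auto simp: eventually_sequentially)
 have [measurable]: "v n : Borel" "w : Borel" for n using v w by (auto simp: LB_borel)
 have L: "(%x. v n x - w x) : LB" for n by (intro L2_diff v w)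
 have "(NINT x. (\<Sum>n. ennreal ((cmod (v (n + k) x - w x))^2))) = (\<Sum>n. NINT x. ennreal ((cmod (v (n + k) x - w x))^2))"
  by (rule nn_integral_suminf) measurable
 also have "... = (\<Sum>n. ennreal ((nb (%x. v (n + k) x - w x))^2))"
  unfolding n2_sq using L by (intro suminf_cong nn_integral_eq_integral L2_integrable) auto
 also have "... <= (\<Sum>n. ennreal ((1 / 2) ^ n))"
 proof (intro suminf_le ennreal_leI)
  fix n
  have "(nb (%x. v (n + k) x - w x))^2 <= ((1 / 2) ^ (n + k))^2" by (intro power_mono k) auto
  also have "... <= ((1 / 2) ^ n)^2" by (intro power_mono power_decreasing) auto
  also have "... <= (1 / 2) ^ n" by (simp add: power2_eq_square mult_le_cancel_left1 power_le_one)
  finally show "(nb (%x. v (n + k) x - w x))^2 <= (1 / 2) ^ n" .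
 qed auto
 also have "... = ennreal (\<Sum>k. (1 / 2) ^ k)" by (intro suminf_ennreal2) auto
 also have "... < \<infinity>" by simp
 finally have "AE x. (\<Sum>n. ennreal ((cmod (v (n + k) x - w x))^2)) \<noteq> \<infinity>" by (intro nn_integral_noteq_infinite) auto
 thus ?thesis
 proof eventually_elim
  case (elim x)
  hence "summable (%n. (cmod (v (n + k) x - w x))^2)" by (intro summable_suminf_not_top) auto
  hence "(%n. (cmod (v (n + k) x - w x))^2) ~> 0" by (rule summable_LIMSEQ_zero)
  hence "(%n. sqrt ((cmod (v (n + k) x - w x))^2)) ~> sqrt 0" by (rule tendsto_real_sqrt)
  hence "(%n. v (n + k) x - w x) ~> 0" by (simp add: tendsto_norm_zero_iff)
  hence "(%n. v (n + k) x) ~> w x" by (rule LIM_zero_cancel)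
  thus ?case by (rule LIMSEQ_offset)
 qed
qed

text \<open>The representative is an almost everywhere limit of functions that are constant in time on
 dyadic-like cells, each being sampled at a point of \<open>S\<close>.\<close>

lemma joint_representative:
 fixes f :: "real => 'a::euclidean_space => complex" assumes S: "S \<subseteq> {0..}" and f: "!!t. t : S ==> f t : LB"
  and cont: "!!T e. e > 0 ==> EX d>0. ALL s:S. ALL t:S. s <= T --> t <= T --> \<bar>s - t\<bar> < d --> nb (%x. f s x - f t x) < e"
 shows "EX F. joint F \<and> (ALL t:S. AE x. F t x = f t x)"
proof -
 have "EX N::nat. N > 0 \<and> (ALL s:S. ALL t:S. s <= real n --> t <= real n --> \<bar>s - t\<bar> < 1 / real N --> nb (%x. f s x - f t x) < (1 / 2) ^ n)" for n
 proof -
  have "(1 / 2 :: real) ^ n > 0" by simp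
  from cont[OF this, of "real n"] obtain d where d: "d > 0" "ALL s:S. ALL t:S. s <= real n --> t <= real n --> \<bar>s - t\<bar> < d --> nb (%x. f s x - f t x) < (1 / 2) ^ n"
   by blast
  obtain N where "1 / real (Suc N) < d" using reals_Archimedean[OF d(1)] unfolding inverse_eq_divide by blast
  thus ?thesis using d(2) by (intro exI[of _ "Suc N"]) (meson less_trans zero_less_Suc)
 qed
 then obtain N where N: "!!n. N n > 0" "!!n s t. s : S ==> t : S ==> s <= real n ==> t <= real n ==> \<bar>s - t\<bar> < 1 / real (N n) ==> nb (%x. f s x - f t x) < (1 / 2) ^ n"
  by metis
 define P where "P n j s \<longleftrightarrow> s : S \<and> s <= real n \<and> \<lfloor>real (N n) * s\<rfloor> = j" for n j s
 \<comment> \<open>The sample must lie in S, where alone f is controlled. Cells that contain no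
   admissible point receive 0; for t in S this does not happen once n >= t.\<close>
 define g where "g n j = (if EX s. P n j s then f (SOME s. P n j s) else (%x. 0))" for n j
 have gL: "g n j : LB" for n j
 proof (cases "EX s. P n j s")
  case True
  hence "P n j (SOME s. P n j s)" by (rule someI_ex)
  hence "(SOME s. P n j s) : S" by (rule P_def[THEN iffD1, THEN conjunct1])
  thus ?thesis using True f by (simp add: g_def)
 next
  case False
  hence "g n j = (%x. 0)" unfolding g_def by (rule if_not_P)
  thus ?thesis by simp
 qed
 define Fn where "Fn n t x = g n \<lfloor>real (N n) * t\<rfloor> x" for n t x
 have m: "case_prod (Fn n) : Borel2" for n
 proof -
  have "(%p. g n \<lfloor>real (N n) * fst p\<rfloor> (snd p)) : Borel2"
  proof (rule measurable_compose_countable)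
   show "(%p. g n i (snd p)) : Borel2" for i using gL[of n i, THEN LB_borel] by measurable
   show "(%p. \<lfloor>real (N n) * fst p\<rfloor>) : borel \<Otimes>\<^sub>M borel \<rightarrow>\<^sub>M count_space UNIV" by measurable
  qed
  thus ?thesis by (simp add: Fn_def case_prod_beta')
 qed
 define F where "F t x = lim (%n. Fn n t x)" for t x
 have "joint F"
 proof -
  have [measurable]: "(%p. Fn n (fst p) (snd p)) : Borel2" for n using m[of n] by (simp add: case_prod_beta')
  show ?thesis unfolding F_def case_prod_beta' by measurable
 qed
 moreover have "AE x. F t x = f t x" if t: "t : S" for t
 proof -
  obtain n0 :: nat where n0: "t < real n0" using reals_Archimedean2 by blast
  have "AE x. (%n. g n \<lfloor>real (N n) * t\<rfloor> x) ~> f t x"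
  proof (rule nb_geometric_AE[OF gL f[OF t]])
   show "EV n. nb (%x. g n \<lfloor>real (N n) * t\<rfloor> x - f t x) <= (1 / 2) ^ n" using eventually_ge_at_top[of n0]
   proof eventually_elim
    case (elim n)
    hence tn: "t <= real n" using n0 by (meson less_imp_le less_le_trans of_nat_le_iff)
    define j where "j = \<lfloor>real (N n) * t\<rfloor>"
    define s where "s = (SOME s. P n j s)"
    have ex: "EX s. P n j s" using t tn by (auto simp: P_def j_def)
    hence s: "P n j s" unfolding s_def by (rule someI_ex)
    have "\<lfloor>real (N n) * s\<rfloor> = \<lfloor>real (N n) * t\<rfloor>" using s by (simp add: P_def j_def)
    hence "\<bar>real (N n) * s - real (N n) * t\<bar> < 1" by linarith
    hence "real (N n) * \<bar>s - t\<bar> < 1" by (simp add: abs_mult right_diff_distrib[symmetric])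
    hence "\<bar>s - t\<bar> < 1 / real (N n)" using N(1)[of n] by (simp add: field_simps)
    hence "nb (%x. f s x - f t x) < (1 / 2) ^ n" using s t tn by (intro N) (auto simp: P_def)
    moreover have "g n j = f s" using ex by (simp add: g_def s_def)
    ultimately show ?case by (simp add: j_def)
   qed
  qed
  thus ?thesis by eventually_elim (simp add: F_def Fn_def limI)
 qed
 ultimately show ?thesis by blast
qed

section \<open>Scalar functions of time with an integrable weak derivative\<close>

lemma pairing_plateau_tendsto:
 fixes B :: "real => complex" assumes st: "s < t" and I: "{s..t} \<subseteq> I" and Im: "I : sets borel" and B: "set_L1 I B"
 shows "(%n. LINT r:I. plateau n s t r * B r) ~> (LINT r:{s..t}. B r)"
proof -
 have [measurable]: "I : sets borel" by (rule Im)
 have [measurable]: "plateau n s t : Borel" for n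
 proof -
  have "plateau n s t : test_functions {s - 1 / Suc n - 1<..<t + 1 / Suc n + 1}" using st by (intro plateau_test_function) auto
  thus ?thesis by (intro tf_borel test_functionsD(1))
 qed
 define b where "b = (%r. indicator I r *R B r)"
 have bi: "L1 b" using B by (simp add: b_def set_integrable_def)
 have "(%n. LINT r. plateau n s t r * b r) ~> (LINT r. indicator {s..t} r *R b r)"
 proof (rule integral_dominated_convergence[where w = "%r. norm (b r)"])
  show "L1 (%r. norm (b r))" using bi by (rule integrable_norm)
  have "AE r. r \<noteq> s" "AE r. r \<noteq> t" by (rule AE_lborel_singleton)+
  thus "AE r. (%n. plateau n s t r * b r) ~> indicator {s..t} r *R b r"
  proof eventually_elim
   case (elim r)
   have "(%n. plateau n s t r * b r) ~> indicator {s..t} r * b r" by (intro tendsto_mult tendsto_const plateau_tendsto st elim)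
   moreover have "indicator {s..t} r * b r = indicator {s..t} r *R b r" by (simp add: indicator_def)
   ultimately show ?case by (simp only:)
  qed
  show "AE r. norm (plateau n s t r * b r) <= norm (b r)" for n by (rule AE_I2) (simp add: norm_mult mult_left_le_one_le norm_plateau_le)
 qed (use bi in measurable)
 moreover have "indicator {s..t} r *R b r = indicator {s..t} r *R B r" for r using I by (auto simp: indicator_def b_def)
 moreover have "plateau n s t r * b r = indicator I r *R (plateau n s t r * B r)" for n r by (simp add: b_def)
 ultimately show ?thesis unfolding set_lebesgue_integral_def by (simp only:)
qed

lemma set_integrable_LL1: "set_L1 I A ==> (%r. indicator I r *R A r) : LL 1"
 unfolding set_integrable_def using integrable_norm by (auto simp: LL_iff_integrable simp del: norm_scaleR)

lemma pairing_pd_plateau: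
 fixes A :: "real => complex" assumes A: "set_L1 I A" shows "(LINT r:I. pd 1 (plateau n s t) r * A r)
  = conv (mo n) (%r. indicator I r *R A r) s - conv (mo n) (%r. indicator I r *R A r) t"
proof -
 let ?A = "%r. indicator I r *R A r"
 have A1: "?A : LL 1" by (rule set_integrable_LL1[OF A])
 have i: "L1 (%r. ?A r * mo n (y - r))" for y by (rule conv_integrable[OF A1 _ tf_moll]) simp
 have e: "mo n (y - r) = complex_of_real (moll n (r - y))" for y r using moll_minus[of n "r - y"] by simp
 have "(LINT r:I. pd 1 (plateau n s t) r * A r) = (LINT r. ?A r * mo n (s - r) - ?A r * mo n (t - r))"
  unfolding set_lebesgue_integral_def by (intro Bochner_Integration.integral_cong refl) (simp add: pd_plateau e algebra_simps)
 also have "... = conv (mo n) ?A s - conv (mo n) ?A t" unfolding conv_def by (rule Bochner_Integration.integral_diff[OF i i])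
 finally show ?thesis .
qed

text \<open>The set S consists of the times at which a subsequence of mollifications converges to A.
  Between two such times the increment is the integral of B; it is recorded through the majorant
  \<beta>, which will be common to countably many pairings.\<close>

lemma du_bois_reymond_increment:
 fixes A B :: "real => complex" and \<beta> :: "real => real" assumes T: "T > 0" and A: "set_L1 {0<..<T} A" and B: "set_L1 {0<..<T} B"
  and \<beta>: "set_L1 {0<..<T} \<beta>" "AE r. r : {0<..<T} --> cmod (B r) <= \<beta> r"
  and eq: "!!\<theta>. \<theta> : test_functions {0<..<T} ==> (LINT r:{0<..<T}. pd 1 \<theta> r * A r) = - (LINT r:{0<..<T}. \<theta> r * B r)"
 shows "EX S. (AE r. r : {0<..<T} --> r : S) \<and> (ALL s:S. ALL t:S. 0 < s \<and> s < t \<and> t < T --> cmod (A t - A s) <= (LINT r:{s..t}. \<beta> r))"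
proof -
 let ?I = "{0<..<T}"
 let ?A = "%r. indicator ?I r *R A r"
 have A1: "?A : LL 1" by (rule set_integrable_LL1[OF A])
 have D: "(%x. conv (mo n) ?A x - ?A x) : LL 1" for n by (intro LL_diff conv_LL A1 tf_moll) auto
 have "(%n. pint 1 (%x. conv (mo n) ?A x - ?A x)) ~> 0" by (rule mo_convergence[OF A1]) simp
 moreover have "pint 1 (%x. conv (mo n) ?A x - ?A x) = ennreal (LINT x. cmod (conv (mo n) ?A x - ?A x))" for n
  by (subst pint_eq_integral[OF D]) (simp only: powr_one norm_ge_zero)
 ultimately have "(%n. ennreal (LINT x. cmod (conv (mo n) ?A x - ?A x))) ~> 0" by (simp only:)
 hence L1: "(%n. LINT x. norm (conv (mo n) ?A x - ?A x)) ~> 0"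
  by (subst (asm) ennreal_tendsto_0_iff) (auto intro: Bochner_Integration.integral_nonneg)
 have "L1 (%x. conv (mo n) ?A x - ?A x)" for n using D[of n] by (subst integrable_norm_iff[symmetric]) (auto simp: LL_iff_integrable)
 from tendsto_L1_AE_subseq[OF this L1] obtain r where r: "strict_mono r" "AE x. (%n. conv (mo (r n)) ?A x - ?A x) ~> 0" by blast
 define S where "S = {x. (%n. conv (mo (r n)) ?A x - ?A x) ~> 0}"
 have "cmod (A t - A s) <= (LINT r:{s..t}. \<beta> r)" if st: "s : S" "t : S" "0 < s" "s < t" "t < T" for s t
 proof -
  let ?\<theta> = "%n. plateau (r n) s t"
  have l: "(%n. conv (mo (r n)) ?A x) ~> A x" if "x : S" "x : ?I" for x
   using that LIM_zero_cancel[of "%n. conv (mo (r n)) ?A x" "?A x" sequentially] by (simp add: S_def)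
  have 1: "(%n. conv (mo (r n)) ?A s - conv (mo (r n)) ?A t) ~> A s - A t" using st by (intro tendsto_diff l) auto
  have 2: "(%n. - (LINT x:?I. ?\<theta> n x * B x)) ~> - (LINT x:{s..t}. B x)"
  proof (rule tendsto_minus)
   have sub: "{s..t} \<subseteq> ?I" using st by auto
   have "?I : sets borel" by simp
   from LIMSEQ_subseq_LIMSEQ[OF pairing_plateau_tendsto[OF st(4) sub this B] r(1)]
   show "(%n. LINT x:?I. ?\<theta> n x * B x) ~> (LINT x:{s..t}. B x)" by (simp only: comp_def)
  qed
  have "(%n. 1 / real (Suc (r n))) ~> 0" using LIMSEQ_subseq_LIMSEQ[OF lim_over_Suc r(1)] by (simp add: comp_def)
  moreover have "min s (T - t) > 0" using st by simp
  ultimately have "EV n. 1 / real (Suc (r n)) < min s (T - t)" by (rule order_tendstoD(2))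
  hence "EV n. conv (mo (r n)) ?A s - conv (mo (r n)) ?A t = - (LINT x:?I. ?\<theta> n x * B x)"
  proof eventually_elim
   case (elim n)
   define d where "d = 1 / real (Suc (r n))"
   have "?\<theta> n : test_functions ?I"
    by (rule plateau_test_function) (use elim st in \<open>auto simp: d_def[symmetric] simp del: of_nat_Suc\<close>)
   from eq[OF this] show ?case unfolding pairing_pd_plateau[OF A] .
  qed
  from Lim_transform_eventually[OF 1 this] have "A s - A t = - (LINT x:{s..t}. B x)" by (rule LIMSEQ_unique) (rule 2)
  hence "cmod (A t - A s) = cmod (LINT x:{s..t}. B x)" by (metis norm_minus_cancel norm_minus_commute)
  also have "... <= (LINT x. norm (indicator {s..t} x *R B x))" unfolding set_lebesgue_integral_def by (rule integral_norm_bound)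
  also have "... <= (LINT x. indicator {s..t} x *R \<beta> x)"
  proof (rule integral_mono_AE)
   have sub: "{s..t} \<subseteq> ?I" using st by auto
   show "L1 (%x. norm (indicator {s..t} x *R B x))" "L1 (%x. indicator {s..t} x *R \<beta> x)"
    using set_integrable_subset[OF B _ sub] set_integrable_subset[OF \<beta>(1) _ sub]
    unfolding set_integrable_def by (auto intro: integrable_norm simp del: norm_scaleR)
   show "AE x. norm (indicator {s..t} x *R B x) <= indicator {s..t} x *R \<beta> x"
    using \<beta>(2) by eventually_elim (use sub in \<open>auto simp: indicator_def\<close>)
  qed
  finally show ?thesis by (simp add: set_lebesgue_integral_def)
 qed
 moreover have "AE x. x : ?I --> x : S" using r(2) unfolding S_def by eventually_elim blast
 ultimately show ?thesis by blast
qed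

section \<open>Strong measurability and Bochner integrals tested by pairings\<close>

definition bq :: "('a::euclidean_space => complex) => ('a => complex) => complex" where
 "bq u e = (LINT x|lebesgue. u x * e x)"

text \<open>The value 0 outside L2 makes \<open>rep u\<close> a member of \<open>LB\<close> for
  every u, so that no side condition has to be carried along.\<close>

definition rep :: "('a::euclidean_space => complex) => 'a => complex" where
 "rep u = (if Lp_norm 2 u < \<infinity> then SOME v. v : LB \<and> (AE x. u x = v x) else (%x. 0))"

lemma rep_AE: "Lp_norm 2 u < \<infinity> ==> AE x. u x = rep u x"
 using someI_ex[OF Lp_norm2_representative[unfolded Bex_def], of u] by (simp add: rep_def)

lemma rep_LB [simp]: "rep u : LB" using someI_ex[OF Lp_norm2_representative[unfolded Bex_def], of u] by (simp add: rep_def)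

lemma rep_diff_AE: assumes "Lp_norm 2 u < \<infinity>" "Lp_norm 2 v < \<infinity>" shows "AE x. u x - v x = rep u x - rep v x"
 using rep_AE[OF assms(1)] rep_AE[OF assms(2)] by eventually_elim simp

lemma Lp_norm_rep: "Lp_norm 2 u < \<infinity> ==> Lp_norm 2 u = ennreal (nb (rep u))" using Lp_norm_cong[OF rep_AE, of u 2] by (simp add: Lp_norm_LB)

lemma Lp_norm_rep_diff: assumes "Lp_norm 2 u < \<infinity>" "Lp_norm 2 v < \<infinity>"
 shows "Lp_norm 2 (%x. u x - v x) = ennreal (nb (%x. rep u x - rep v x))"
 using Lp_norm_cong[OF rep_diff_AE[OF assms]] by (simp add: Lp_norm_LB L2_diff)

lemma bq_AE: assumes "AE x. u x = v x" and [measurable]: "v : Borel" "e : Borel" shows "bq u e = bl v e"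
proof -
 have "bq u e = (LINT x|lebesgue. v x * e x)" unfolding bq_def by (rule lebesgue_integral_cong) (use assms(1) in eventually_elim, simp)
 thus ?thesis unfolding bl_def by (simp add: lebesgue_integral_borel)
qed

lemma bq_rep: "Lp_norm 2 u < \<infinity> ==> e : LB ==> bq u e = bl (rep u) e" by (rule bq_AE[OF rep_AE]) (auto intro: LB_borel)

lemma bl_diff_left: "u : LB ==> v : LB ==> e : LB ==> bl (%x. u x - v x) e = bl u e - bl v e" unfolding bl_ib by (simp add: ip_diff_left L2_cnj)

lemma bq_diff_le: assumes "Lp_norm 2 u < \<infinity>" "Lp_norm 2 v < \<infinity>" and e: "e : LB" "nb e <= 1"
 shows "ennreal (cmod (bq u e - bq v e)) <= Lp_norm 2 (%x. u x - v x)"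
proof -
 have "cmod (bq u e - bq v e) = cmod (bl (%x. rep u x - rep v x) e)" using assms by (simp add: bq_rep bl_diff_left)
 also have "... <= nb (%x. rep u x - rep v x) * nb e" by (intro bl_le L2_diff e) auto
 also have "... <= nb (%x. rep u x - rep v x) * 1" by (intro mult_left_mono e) auto
 finally show ?thesis using assms by (simp add: Lp_norm_rep_diff ennreal_leI)
qed

lemma Lp_norm_limit:
 fixes s :: "nat => 'a::euclidean_space => complex" assumes s: "!!n. Lp_norm 2 (s n) < \<infinity>" and l: "(%n. Lp_norm 2 (%c. s n c - g c)) ~> 0"
 shows "Lp_norm 2 g < \<infinity>" "(%n. nb (%x. rep (s n) x - rep g x)) ~> 0"
proof -
 have "EV n. Lp_norm 2 (%c. s n c - g c) < top" by (rule order_tendstoD(2)[OF l]) simp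
 then obtain n where n: "Lp_norm 2 (%c. s n c - g c) < \<infinity>" by (auto simp: eventually_sequentially)
 have "AE x. g x = rep (s n) x - rep (%c. s n c - g c) x" using rep_AE[OF s[of n]] rep_AE[OF n] by eventually_elim (simp add: algebra_simps)
 from Lp_norm_cong[OF this, of 2] show g: "Lp_norm 2 g < \<infinity>" by (simp add: Lp_norm_LB L2_diff)
 have "(%n. ennreal (nb (%x. rep (s n) x - rep g x))) ~> 0" using l by (simp add: Lp_norm_rep_diff[OF s g])
 thus "(%n. nb (%x. rep (s n) x - rep g x)) ~> 0" by (subst (asm) ennreal_tendsto_0_iff) auto
qed

lemma AE_lebesgue_on: "S : sets borel ==> (AE t in lebesgue_on S. P t) \<longleftrightarrow> (AE t. t : S --> P t)"
 by (subst AE_restrict_space_iff) (auto simp: AE_completion_iff)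

lemma lebesgue_on_integral_eq:
 fixes A A' :: "real => complex" assumes S: "S : sets borel" and A': "A' : Borel" and ae: "AE t. t : S --> A t = A' t"
 shows "(LINT t|lebesgue_on S. A t) = (LINT t:S. A' t)"
proof -
 have [measurable]: "S : sets borel" "A' : Borel" by fact+
 have "(LINT t|lebesgue_on S. A t) = (LINT t|lebesgue. indicator S t *R A t)" by (rule integral_restrict_space) (use S in simp)
 also have "... = (LINT t|lebesgue. indicator S t *R A' t)" by (rule lebesgue_integral_cong) (use ae in eventually_elim, auto simp: indicator_def)
 also have "... = (LINT t:S. A' t)" unfolding set_lebesgue_integral_def by (rule lebesgue_integral_borel) measurable
 finally show ?thesis .
qed

lemma lebesgue_on_nn_integral_eq:
 fixes A A' :: "real => ennreal" assumes S: "S : sets borel" and A': "A' : Borel" and ae: "AE t. t : S --> A t = A' t"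
 shows "(\<integral>\<^sup>+t. A t \<partial>lebesgue_on S) = (NINT t:S. A' t)"
proof -
 have [measurable]: "S : sets borel" "A' : Borel" by fact+
 have "(\<integral>\<^sup>+t. A t \<partial>lebesgue_on S) = (\<integral>\<^sup>+t\<in>S. A t \<partial>lebesgue)"
  by (rule nn_integral_restrict_space) (use S in simp)
 also have "... = (\<integral>\<^sup>+t\<in>S. A' t \<partial>lebesgue)"
  by (intro nn_integral_cong_AE AE_completion) (use ae in eventually_elim, auto simp: indicator_def)
 also have "... = (NINT t:S. A' t)" by (rule nn_integral_completion)
 finally show ?thesis .
qed

lemma time_representative:
 fixes A :: "real => complex" assumes S: "S : sets borel" and A: "A : borel_measurable (lebesgue_on S)"
 shows "EX A':Borel. AE t. t : S --> A t = A' t"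
proof -
 have "(%t. indicator S t *R A t) : borel_measurable lebesgue" using A S by (subst (asm) borel_measurable_restrict_space_iff) auto
 from borel_representative[OF this] obtain A' where A': "A' : Borel" "AE t. indicator S t *R A t = A' t" by blast
 have "AE t. t : S --> A t = A' t" using A'(2) by eventually_elim (auto simp: indicator_def)
 thus ?thesis using A'(1) by (rule bexI)
qed

lemma time_representative_ennreal:
 fixes A :: "real => ennreal" assumes S: "S : sets borel" and A: "A : borel_measurable (lebesgue_on S)"
 shows "EX A':Borel. AE t. t : S --> A t = A' t"
proof -
 have "(%t. A t * indicator S t) : borel_measurable lebesgue" using A S by (subst (asm) borel_measurable_restrict_space_iff_ennreal) auto
 from completion_ex_borel_measurable[OF this] obtain A' where A': "A' : borel_measurable lborel" "AE t. A t * indicator S t = A' t" by blast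
 have "AE t. t : S --> A t = A' t" using A'(2) by eventually_elim (auto simp: indicator_def)
 thus ?thesis using A'(1) by (intro bexI) auto
qed

lemma X_measurable_E:
 fixes g :: "real => 'a::euclidean_space => complex" assumes g: "X_measurable (Lp_norm 2) I g" and I: "I : sets borel"
 obtains s where "!!n. X_simple (Lp_norm 2) I (s n)"
  "AE t. t : I --> (ALL n. Lp_norm 2 (s n t) < \<infinity>) \<and> Lp_norm 2 (g t) < \<infinity> \<and> (%n. nb (%x. rep (s n t) x - rep (g t) x)) ~> 0"
proof -
 obtain s where s: "!!n. X_simple (Lp_norm 2) I (s n)" "AE t. t : I --> (%n. Lp_norm 2 (%c. s n t c - g t c)) ~> 0"
  using g unfolding X_measurable_def AE_lebesgue_on[OF I] by blast
 have f: "Lp_norm 2 (s n t) < \<infinity>" if "t : I" for n t using s(1)[of n] that by (simp add: X_simple_def)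
 have "AE t. t : I --> (ALL n. Lp_norm 2 (s n t) < \<infinity>) \<and> Lp_norm 2 (g t) < \<infinity> \<and> (%n. nb (%x. rep (s n t) x - rep (g t) x)) ~> 0"
  using s(2)
 proof eventually_elim
  case (elim t)
  show ?case
  proof
   assume t: "t : I"
   show "(ALL n. Lp_norm 2 (s n t) < \<infinity>) \<and> Lp_norm 2 (g t) < \<infinity> \<and> (%n. nb (%x. rep (s n t) x - rep (g t) x)) ~> 0"
    using Lp_norm_limit[of "%n. s n t" "g t", OF f[OF t]] elim t f[OF t] by blast
  qed
 qed
 thus ?thesis using s(1) that by blast
qed

text \<open>Pairings with the approximating simple functions are measurable and converge; a Borel
  version of the limit is kept, for use with integrals over \<open>lborel\<close>.\<close>

lemma X_measurable_bq:
 fixes g :: "real => 'a::euclidean_space => complex" assumes g: "X_measurable (Lp_norm 2) I g" and I: "I : sets borel" and e: "e : LB"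
 shows "EX A:Borel. AE t. t : I --> bq (g t) e = A t"
proof -
 from X_measurable_E[OF g I] obtain s where s: "!!n. X_simple (Lp_norm 2) I (s n)"
  "AE t. t : I --> (ALL n. Lp_norm 2 (s n t) < \<infinity>) \<and> Lp_norm 2 (g t) < \<infinity> \<and> (%n. nb (%x. rep (s n t) x - rep (g t) x)) ~> 0" by blast
 have [measurable]: "(%t. bq (s n t) e) : borel_measurable (lebesgue_on I)" for n
  using s(1)[of n] unfolding X_simple_def by (intro borel_measurable_simple_function simple_function_compose1[where g = "%u. bq u e"]) blast
 have "(%t. lim (%n. bq (s n t) e)) : borel_measurable (lebesgue_on I)" by measurable
 from time_representative[OF I this] obtain A where A: "A : Borel" "AE t. t : I --> lim (%n. bq (s n t) e) = A t" by blast
 have "AE t. t : I --> bq (g t) e = A t" using A(2) s(2)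
 proof eventually_elim
  case (elim t)
  have "(%n. bq (s n t) e) ~> bq (g t) e" if "t : I" using elim that e by (simp add: bq_rep) (intro bl_tendsto, auto)
  thus ?case using elim(1) by (auto simp: limI)
 qed
 thus ?thesis using A(1) by (rule bexI)
qed

lemma X_measurable_norm:
 fixes g :: "real => 'a::euclidean_space => complex" assumes g: "X_measurable (Lp_norm 2) I g" and I: "I : sets borel"
 shows "EX \<beta>:Borel. AE t. t : I --> Lp_norm 2 (g t) = \<beta> t"
proof -
 from X_measurable_E[OF g I] obtain s where s: "!!n. X_simple (Lp_norm 2) I (s n)"
  "AE t. t : I --> (ALL n. Lp_norm 2 (s n t) < \<infinity>) \<and> Lp_norm 2 (g t) < \<infinity> \<and> (%n. nb (%x. rep (s n t) x - rep (g t) x)) ~> 0" by blast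
 have [measurable]: "(%t. Lp_norm 2 (s n t)) : borel_measurable (lebesgue_on I)" for n
  using s(1)[of n] unfolding X_simple_def by (intro borel_measurable_simple_function simple_function_compose1[where g = "Lp_norm 2"]) blast
 have "(%t. liminf (%n. Lp_norm 2 (s n t))) : borel_measurable (lebesgue_on I)" by measurable
 from time_representative_ennreal[OF I this] obtain A where A: "A : Borel" "AE t. t : I --> liminf (%n. Lp_norm 2 (s n t)) = A t" by blast
 have "AE t. t : I --> Lp_norm 2 (g t) = A t" using A(2) s(2)
 proof eventually_elim
  case (elim t)
  have "liminf (%n. Lp_norm 2 (s n t)) = Lp_norm 2 (g t)" if t: "t : I"
  proof (rule lim_imp_Liminf)
   have f: "Lp_norm 2 (s n t) = ennreal (nb (rep (s n t)))" "Lp_norm 2 (g t) = ennreal (nb (rep (g t)))" for n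
    using elim(2) t by (auto intro: Lp_norm_rep)
   show "(%n. Lp_norm 2 (s n t)) ~> Lp_norm 2 (g t)" unfolding f using elim(2) t by (intro tendsto_ennrealI n2_tendsto) auto
  qed simp
  thus ?case using elim(1) by auto
 qed
 thus ?thesis using A(1) by (rule bexI)
qed

lemma bq_sum: assumes "finite Y" "!!y. y : Y ==> Lp_norm 2 y < \<infinity>" and e: "e : LB"
 shows "Lp_norm 2 (%c. SUM y:Y. k y * y c) < \<infinity> \<and> bq (%c. SUM y:Y. k y * y c) e = (SUM y:Y. k y * bq y e)"
proof -
 have "AE x. ALL y:Y. y x = rep y x" using assms(1,2) by (subst AE_finite_all) (auto intro: rep_AE)
 hence ae: "AE x. (SUM y:Y. k y * y x) = (SUM y:Y. k y * rep y x)" by eventually_elim (intro sum.cong refl, simp)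
 have L: "(%x. SUM y:Y. k y * rep y x) : LB" by (intro L2_sum assms L2_cmult) auto
 have "bl (%x. SUM y:Y. k y * rep y x) e = (SUM y:Y. bl (%x. k y * rep y x) e)" unfolding bl_ib by (intro ip_sum_left assms L2_cmult L2_cnj e) auto
 also have "... = (SUM y:Y. k y * bq y e)" using assms by (intro sum.cong refl) (simp add: bl_cmult bq_rep)
 finally show ?thesis using bq_AE[OF ae LB_borel[OF L] LB_borel[OF e]] Lp_norm_cong[OF ae, of 2] by (simp add: Lp_norm_LB[OF L])
qed

text \<open>Bochner integrals commute with continuous functionals. For simple functions this is
  linearity; pairing with e of norm at most 1 is a contraction, which carries the identity to the
  limit.\<close>

lemma X_integral_bq:
 fixes g :: "real => 'a::euclidean_space => complex" assumes g: "X_integral (Lp_norm 2) {0<..<T} g J" and e: "e : LB" "nb e <= 1"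
  and A: "A : Borel" "AE t. t : {0<..<T} --> bq (g t) e = A t" shows "set_L1 {0<..<T} A" "(LINT t:{0<..<T}. A t) = bq J e"
proof -
 let ?I = "{0<..<T}" let ?M = "lebesgue_on {0<..<T}"
 have I: "?I : sets borel" by simp
 obtain s where J: "Lp_norm 2 J < \<infinity>" and gm: "X_measurable (Lp_norm 2) ?I g" and s: "!!n. X_simple (Lp_norm 2) ?I (s n)"
  and D: "(%n. \<integral>\<^sup>+t. Lp_norm 2 (%c. s n t c - g t c) \<partial>?M) ~> 0"
  and S: "(%n. Lp_norm 2 (%c. (SUM y:s n ` ?I. of_real (measure lebesgue (s n -` {y} \<inter> ?I)) * y c) - J c)) ~> 0"
  using g unfolding X_integral_def by blast
 have f: "Lp_norm 2 (s n t) < \<infinity>" if "t : ?I" for n t using s[of n] that by (simp add: X_simple_def)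
 have sim: "simple_function ?M (s n)" for n using s[of n] by (simp add: X_simple_def)
 have fin: "finite (s n ` ?I)" for n using simple_functionD(1)[OF sim, of n] by (simp add: space_restrict_space)
 have gfin: "AE t. t : ?I --> Lp_norm 2 (g t) < \<infinity>"
 proof -
  obtain s' where "AE t. t : ?I --> (ALL n. Lp_norm 2 (s' n t) < \<infinity>) \<and> Lp_norm 2 (g t) < \<infinity> \<and> (%n::nat. nb (%x. rep (s' n t) x - rep (g t) x)) ~> 0"
   by (rule X_measurable_E[OF gm I]) blast
  thus ?thesis by eventually_elim blast
 qed
 have ff: "Lp_norm 2 y < \<infinity>" if "y : s n ` ?I" for n y using f that by blast
 note sum = bq_sum[OF fin ff e(1)]
 define a where "a n t = bq (s n t) e" for n t
 have asim: "simple_function ?M (a n)" for n unfolding a_def[abs_def] by (rule simple_function_compose1[OF sim])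
 have meas: "s n -` {y} \<inter> ?I : sets ?M" for n y using simple_functionD(2)[OF sim, of n "{y}"] by (simp add: space_restrict_space)
 have mfin: "emeasure ?M (s n -` {y} \<inter> ?I) < \<infinity>" for n y
 proof -
  have "emeasure ?M (s n -` {y} \<inter> ?I) <= emeasure ?M ?I" by (intro emeasure_mono) (auto simp: sets_restrict_space)
  also have "... < \<infinity>" using emeasure_bounded_finite[of ?I] by (subst emeasure_restrict_space) auto
  finally show ?thesis .
 qed
 have aI: "integrable ?M (a n)" and aint: "(LINT t|?M. a n t) = bq (%c. SUM y:s n ` ?I. of_real (measure lebesgue (s n -` {y} \<inter> ?I)) * y c) e" for n
 proof -
  have i: "integrable ?M (%t. indicator (s n -` {y} \<inter> ?I) t *R bq y e)" for y
   using meas[of n y] mfin[of n y] by (intro integrable_scaleR_left integrable_real_indicator) auto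
  have eq: "a n t = (SUM y:s n ` ?I. indicator (s n -` {y} \<inter> ?I) t *R bq y e)" if "t : space ?M" for t
  proof -
   have t: "t : ?I" using that by (simp add: space_restrict_space)
   have "(SUM y:s n ` ?I. indicator (s n -` {y} \<inter> ?I) t *R bq y e) = (SUM y:s n ` ?I. if y = s n t then bq y e else 0)"
    using t by (intro sum.cong refl) (auto simp: indicator_def)
   also have "... = bq (s n t) e" using t fin[of n] by (subst sum.delta) auto
   finally show ?thesis by (simp add: a_def)
  qed
  show "integrable ?M (a n)" by (subst Bochner_Integration.integrable_cong[OF refl eq]) (auto intro!: Bochner_Integration.integrable_sum i)
  have "(LINT t|?M. a n t) = (LINT t|?M. (SUM y:s n ` ?I. indicator (s n -` {y} \<inter> ?I) t *R bq y e))"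
   by (rule Bochner_Integration.integral_cong[OF refl eq])
  also have "... = (SUM y:s n ` ?I. LINT t|?M. indicator (s n -` {y} \<inter> ?I) t *R bq y e)" by (rule Bochner_Integration.integral_sum[OF i])
  also have "... = (SUM y:s n ` ?I. of_real (measure lebesgue (s n -` {y} \<inter> ?I)) * bq y e)"
  proof (intro sum.cong refl)
   fix y
   have "(LINT t|?M. indicator (s n -` {y} \<inter> ?I) t *R bq y e) = measure ?M (s n -` {y} \<inter> ?I) *R bq y e"
    using meas[of n y] mfin[of n y] by (subst integral_scaleR_left) (auto intro: integrable_real_indicator)
   also have "measure ?M (s n -` {y} \<inter> ?I) = measure lebesgue (s n -` {y} \<inter> ?I)" by (rule measure_restrict_space) auto
   finally show "(LINT t|?M. indicator (s n -` {y} \<inter> ?I) t *R bq y e) = of_real (measure lebesgue (s n -` {y} \<inter> ?I)) * bq y e"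
    by (simp add: scaleR_conv_of_real)
  qed
  finally show "(LINT t|?M. a n t) = bq (%c. SUM y:s n ` ?I. of_real (measure lebesgue (s n -` {y} \<inter> ?I)) * y c) e" by (simp only: sum)
 qed
 have AM: "A : borel_measurable ?M" using A(1) by (intro measurable_restrict_space1 measurable_completion) simp
 have am [measurable]: "a n : borel_measurable ?M" "A : borel_measurable ?M" for n using aI[of n] AM by auto
 have diff: "(\<integral>\<^sup>+t. ennreal (norm (a n t - A t)) \<partial>?M) <= (\<integral>\<^sup>+t. Lp_norm 2 (%c. s n t c - g t c) \<partial>?M)" for n
 proof (rule nn_integral_mono_AE)
  show "AE t in ?M. ennreal (norm (a n t - A t)) <= Lp_norm 2 (%c. s n t c - g t c)" unfolding AE_lebesgue_on[OF I] using A(2) gfin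
  proof eventually_elim
   case (elim t)
   show ?case
   proof
    assume t: "t : ?I"
    have "ennreal (cmod (bq (s n t) e - bq (g t) e)) <= Lp_norm 2 (%c. s n t c - g t c)" using elim t by (intro bq_diff_le f e) auto
    thus "ennreal (norm (a n t - A t)) <= Lp_norm 2 (%c. s n t c - g t c)" using elim t by (simp add: a_def)
   qed
  qed
 qed
 have lim: "(%n. \<integral>\<^sup>+t. ennreal (norm (a n t - A t)) \<partial>?M) ~> 0"
  by (rule tendsto_sandwich[OF _ _ tendsto_const D]) (use diff in auto)
 have "EV n. (\<integral>\<^sup>+t. ennreal (norm (a n t - A t)) \<partial>?M) < top" by (rule order_tendstoD(2)[OF lim]) simp
 then obtain n where "(\<integral>\<^sup>+t. ennreal (norm (a n t - A t)) \<partial>?M) < top" by (auto simp: eventually_sequentially)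
 hence "integrable ?M (%t. a n t - A t)" by (simp add: integrable_iff_bounded)
 from Bochner_Integration.integrable_diff[OF aI[of n] this] have AI: "integrable ?M A" by simp
 thus "set_L1 ?I A" using A(1) unfolding set_integrable_def by (subst (asm) integrable_restrict_space) (auto simp: integrable_completion)
 have "(%n. LINT t|?M. a n t) ~> (LINT t|?M. A t)" by (rule tendsto_L1_int[OF aI AI lim])
 moreover have "(%n. LINT t|?M. a n t) ~> bq J e"
 proof -
  have sf: "Lp_norm 2 (%c. SUM y:s n ` ?I. of_real (measure lebesgue (s n -` {y} \<inter> ?I)) * y c) < \<infinity>" for n
   by (rule sum[THEN conjunct1])
  have "(%n. ennreal (cmod ((LINT t|?M. a n t) - bq J e))) ~> 0"
   unfolding aint by (rule tendsto_sandwich[OF _ _ tendsto_const S]) (auto intro!: always_eventually bq_diff_le sf J e)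
  hence "(%n. cmod ((LINT t|?M. a n t) - bq J e)) ~> 0" by (subst (asm) ennreal_tendsto_0_iff) auto
  thus ?thesis by (simp add: tendsto_norm_zero_iff LIM_zero_iff)
 qed
 ultimately have "(LINT t|?M. A t) = bq J e" by (rule LIMSEQ_unique)
 thus "(LINT t:?I. A t) = bq J e" using lebesgue_on_integral_eq[OF I A(1), of A] by simp
qed

lemma epowr_1 [simp]: "epowr x 1 = x" by (cases x) (auto simp: epowr_def top.not_eq_extremum)

lemma bq_cmult: "bq (%c. k * u c) e = k * bq u e" unfolding bq_def by (simp add: mult.assoc)

lemma bq_le:
 fixes u :: "'a::euclidean_space => complex" assumes e: "e : LB" "nb e <= 1" shows "ennreal (cmod (bq u e)) <= Lp_norm 2 u"
proof (cases "Lp_norm 2 u < \<infinity>")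
 case True
 have "Lp_norm 2 (%x::'a. 0) < \<infinity>" by (simp add: Lp_norm_LB)
 from bq_diff_le[OF True this e] show ?thesis by (simp add: bq_def)
qed (simp add: not_less top_unique)

text \<open>The norm of g is an integrable majorant that serves all pairings with e of norm at most
  1 at once.\<close>

lemma X_integrable_bq:
 fixes g :: "real => 'a::euclidean_space => complex" assumes I: "I : sets borel" and g: "Lp_time 1 (Lp_norm 2) I g"
 shows "EX \<beta>:Borel. set_L1 I \<beta> \<and> (ALL t. \<beta> t >= 0) \<and> (AE t. t : I --> Lp_norm 2 (g t) = ennreal (\<beta> t)) \<and>
  (ALL e A. e : LB --> nb e <= 1 --> A : Borel --> (AE t. t : I --> bq (g t) e = A t) -->
   set_L1 I A \<and> (AE t. t : I --> cmod (A t) <= \<beta> t))"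
proof -
 have m: "X_measurable (Lp_norm 2) I g" and fin: "(\<integral>\<^sup>+t. Lp_norm 2 (g t) \<partial>lebesgue_on I) < \<infinity>"
  using g by (auto simp: Lp_time_def)
 obtain \<beta>0 where \<beta>0: "\<beta>0 : Borel" "AE t. t : I --> Lp_norm 2 (g t) = \<beta>0 t" using X_measurable_norm[OF m I] by blast
 have [measurable]: "\<beta>0 : Borel" "I : sets borel" by fact+
 define \<beta> where "\<beta> t = enn2real (\<beta>0 t)" for t
 have \<beta>m [measurable]: "\<beta> : Borel" unfolding \<beta>_def by measurable
 have fin': "(NINT t:I. \<beta>0 t) < \<infinity>" using fin lebesgue_on_nn_integral_eq[OF I \<beta>0] by simp
 hence "AE t. \<beta>0 t * indicator I t \<noteq> \<infinity>" by (intro nn_integral_noteq_infinite) auto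
 hence ae: "AE t. t : I --> Lp_norm 2 (g t) = ennreal (\<beta> t)" using \<beta>0(2) by eventually_elim (auto simp: \<beta>_def less_top)
 have "(NINT t. ennreal (norm (indicator I t *R \<beta> t))) <= (NINT t:I. \<beta>0 t)"
  by (rule nn_integral_mono) (auto simp: \<beta>_def indicator_def ennreal_enn2real_if)
 hence \<beta>i: "set_L1 I \<beta>" unfolding set_integrable_def integrable_iff_bounded using fin' by (auto intro: le_less_trans)
 have "set_L1 I A \<and> (AE t. t : I --> cmod (A t) <= \<beta> t)"
  if e: "e : LB" "nb e <= 1" and A: "A : Borel" "AE t. t : I --> bq (g t) e = A t" for e A
 proof -
  have b: "AE t. t : I --> cmod (A t) <= \<beta> t" using ae A(2)
  proof eventually_elim
   case (elim t)
   have "ennreal (cmod (bq (g t) e)) <= Lp_norm 2 (g t)" by (rule bq_le[OF e])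
   thus ?case using elim by (auto simp: \<beta>_def)
  qed
  have [measurable]: "A : Borel" by fact
  have "L1 (%t. indicator I t *R A t)" by (rule Bochner_Integration.integrable_bound[OF \<beta>i[unfolded set_integrable_def]], measurable)
    (use b in eventually_elim, auto simp: indicator_def \<beta>_def)
  thus ?thesis using b by (simp add: set_integrable_def)
 qed
 thus ?thesis using \<beta>m \<beta>i ae by (intro bexI[of _ \<beta>]) (auto simp: \<beta>_def)
qed

text \<open>Norms are computed by pairing with the countably many normalised differences of values of the
 simple functions that approximate \<open>f\<close>, so that only scalar functions of time have to be treated.\<close>

lemma W11_lipschitz:
 fixes f :: "real => 'a::euclidean_space => complex" assumes f: "W1p_time 1 (Lp_norm 2) {0<..<T} f" and T: "T > 0"
 shows "EX \<beta> S. set_L1 {0<..<T} \<beta> \<and> (ALL t. \<beta> t >= 0) \<and> (AE t. t : {0<..<T} --> t : S) \<and>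
  (ALL t:S. Lp_norm 2 (f t) < \<infinity>) \<and>
  (ALL s:S. ALL t:S. 0 < s \<and> s < t \<and> t < T --> nb (%x. rep (f t) x - rep (f s) x) <= (LINT r:{s..t}. \<beta> r))"
proof -
 let ?I = "{0<..<T}"
 have I: "?I : sets borel" by simp
 obtain v where fI: "Lp_time 1 (Lp_norm 2) ?I f" and vI: "Lp_time 1 (Lp_norm 2) ?I v"
  and eq: "!!\<theta>. \<theta> : test_functions ?I ==> EX J. X_integral (Lp_norm 2) ?I (%t c. pd 1 \<theta> t * f t c) J \<and> X_integral (Lp_norm 2) ?I (%t c. - \<theta> t * v t c) J"
  using f unfolding W1p_time_def by blast
 note fm = fI[unfolded Lp_time_def, THEN conjunct1] note vm = vI[unfolded Lp_time_def, THEN conjunct1]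
 obtain \<gamma> where \<gamma>: "!!e A. e : LB ==> nb e <= 1 ==> A : Borel ==> AE t. t : ?I --> bq (f t) e = A t ==>
   set_L1 ?I A \<and> (AE t. t : ?I --> cmod (A t) <= \<gamma> t)" using X_integrable_bq[OF I fI] by blast
 obtain \<beta> where \<beta>: "set_L1 ?I \<beta>" "!!t. \<beta> t >= 0" "!!e A. e : LB ==> nb e <= 1 ==> A : Borel ==> AE t. t : ?I --> bq (v t) e = A t ==>
   set_L1 ?I A \<and> (AE t. t : ?I --> cmod (A t) <= \<beta> t)" using X_integrable_bq[OF I vI] by blast
 from X_measurable_E[OF fm I] obtain s where s: "!!n. X_simple (Lp_norm 2) ?I (s n)"
  "AE t. t : ?I --> (ALL n. Lp_norm 2 (s n t) < \<infinity>) \<and> Lp_norm 2 (f t) < \<infinity> \<and> (%n. nb (%x. rep (s n t) x - rep (f t) x)) ~> 0"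
  by blast
 define D where "D = (\<Union>n. s n ` ?I)"
 have "finite (s n ` ?I)" for n using simple_functionD(1)[of "lebesgue_on ?I" "s n"] s(1)[of n] by (simp add: X_simple_def space_restrict_space)
 hence "countable D" unfolding D_def by (intro countable_UN[OF countableI_type] countable_finite)
 hence Dc: "countable (D \<times> D)" by simp
 define z where "z p x = rep (fst p) x - rep (snd p) x" for p :: "('a => complex) \<times> ('a => complex)" and x
 \<comment> \<open>The dual element of \<open>z p\<close>: pairing with it returns the norm. If the
   norm is 0, the convention 1/0 = 0 gives e = 0 and the identity still holds.\<close>
 define e where "e p x = of_real (1 / nb (z p)) * cnj (z p x)" for p x
 have zL: "z p : LB" for p unfolding z_def[abs_def] by (intro L2_diff) auto
 have eL: "e p : LB" for p unfolding e_def[abs_def] by (intro L2_cmult L2_cnj zL)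
 have e1: "nb (e p) <= 1" for p unfolding e_def[abs_def] n2_cmult n2_cnj by (simp add: norm_divide)
 have blz: "bl (z p) (e p) = of_real (nb (z p))" for p
  unfolding e_def[abs_def] bl_cmult using ip_self[of lborel "z p"] by (simp add: bl_ib power2_eq_square)
 define P where "P p A S \<longleftrightarrow> (AE t. t : ?I --> bq (f t) (e p) = A t) \<and> (AE r. r : ?I --> r : S) \<and>
   (ALL s:S. ALL t:S. 0 < s \<and> s < t \<and> t < T --> cmod (A t - A s) <= (LINT r:{s..t}. \<beta> r))" for p A S
 have "EX A S. P p A S" for p
 proof -
  obtain A where A: "A : Borel" "AE t. t : ?I --> bq (f t) (e p) = A t" using X_measurable_bq[OF fm I eL] by blast
  obtain B where B: "B : Borel" "AE t. t : ?I --> bq (v t) (e p) = B t" using X_measurable_bq[OF vm I eL] by blast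
  have [measurable]: "A : Borel" "B : Borel" by fact+
  have "(LINT r:?I. pd 1 \<theta> r * A r) = - (LINT r:?I. \<theta> r * B r)" if \<theta>: "\<theta> : test_functions ?I" for \<theta>
  proof -
   have [measurable]: "\<theta> : Borel" "pd 1 \<theta> : Borel" using test_functionsD(1)[OF \<theta>] tf_pd[of \<theta> 1] by (auto intro: tf_borel)
   obtain J where J: "X_integral (Lp_norm 2) ?I (%t c. pd 1 \<theta> t * f t c) J" "X_integral (Lp_norm 2) ?I (%t c. - \<theta> t * v t c) J"
    using eq[OF \<theta>] by blast
   have "(LINT r:?I. pd 1 \<theta> r * A r) = bq J (e p)"
    by (rule X_integral_bq(2)[OF J(1) eL e1], measurable, use A(2) in eventually_elim) (simp add: bq_cmult del: greaterThanLessThan_iff)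
   moreover have "(LINT r:?I. - \<theta> r * B r) = bq J (e p)"
    by (rule X_integral_bq(2)[OF J(2) eL e1], measurable, use B(2) in eventually_elim) (unfold bq_cmult, metis)
   ultimately show ?thesis by (simp add: set_lebesgue_integral_def)
  qed
  from du_bois_reymond_increment[OF T \<gamma>[OF eL e1 A, THEN conjunct1] \<beta>(3)[OF eL e1 B, THEN conjunct1] \<beta>(1) \<beta>(3)[OF eL e1 B, THEN conjunct2] this]
  show ?thesis unfolding P_def using A(2) by blast
 qed
 then obtain A S where "!!p. P p (A p) (S p)" by metis
 hence AS: "!!p. AE t. t : ?I --> bq (f t) (e p) = A p t" "!!p. AE r. r : ?I --> r : S p"
  "!!p s t. s : S p ==> t : S p ==> 0 < s ==> s < t ==> t < T ==> cmod (A p t - A p s) <= (LINT r:{s..t}. \<beta> r)" unfolding P_def by blast+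
 \<comment> \<open>Each pairing has its own exceptional set of times; over the countable set D x D
   their union is still negligible.\<close>
 define S' where "S' = {t\<in>?I. ((ALL n. Lp_norm 2 (s n t) < \<infinity>) \<and> Lp_norm 2 (f t) < \<infinity> \<and> (%n. nb (%x. rep (s n t) x - rep (f t) x)) ~> 0)
  \<and> (ALL p:D \<times> D. bq (f t) (e p) = A p t \<and> t : S p)}"
 have S': "t : ?I" "Lp_norm 2 (s n t) < \<infinity>" "Lp_norm 2 (f t) < \<infinity>" "(%n. nb (%x. rep (s n t) x - rep (f t) x)) ~> 0"
  "p : D \<times> D ==> bq (f t) (e p) = A p t" "p : D \<times> D ==> t : S p" if "t : S'" for t n p using that unfolding S'_def by blast+
 have "AE t. ALL p:D \<times> D. t : ?I --> bq (f t) (e p) = A p t \<and> t : S p" unfolding AE_ball_countable[OF Dc]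
 proof
  fix p
  show "AE t. t : ?I --> bq (f t) (e p) = A p t \<and> t : S p" using AS(1)[of p] AS(2)[of p] by eventually_elim blast
 qed
 hence "AE t. t : ?I --> t : S'" using s(2) unfolding S'_def by eventually_elim blast
 moreover have "nb (%x. rep (f t2) x - rep (f t1) x) <= (LINT r:{t1..t2}. \<beta> r)" if t: "t1 : S'" "t2 : S'" "t1 < t2" for t1 t2
 proof -
  let ?w = "%x. rep (f t2) x - rep (f t1) x"
  have wL: "?w : LB" by (intro L2_diff) auto
  define d where "d n = nb (%x. rep (s n t2) x - rep (f t2) x) + nb (%x. rep (s n t1) x - rep (f t1) x)" for n
  have d: "d ~> 0" unfolding d_def using tendsto_add[OF S'(4)[OF t(2)] S'(4)[OF t(1)]] by simp
  \<comment> \<open>The increment of f is replaced by the difference of two approximating values, at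
    a cost \<open>d n\<close>, and the pairing is converted back at the same cost.\<close>
  have "nb ?w <= (LINT r:{t1..t2}. \<beta> r) + 2 * d n" for n
  proof -
   let ?p = "(s n t2, s n t1)"
   have p: "?p : D \<times> D" unfolding D_def using S'(1)[OF t(1)] S'(1)[OF t(2)] by blast
   have "(%x. z ?p x - ?w x) = (%x. (rep (s n t2) x - rep (f t2) x) - (rep (s n t1) x - rep (f t1) x))" by (auto simp: z_def)
   hence dn: "nb (%x. z ?p x - ?w x) <= d n" unfolding d_def by (simp add: n2_triangle_diff L2_diff)
   have "nb ?w <= nb (z ?p) + nb (%x. ?w x - z ?p x)" by (rule n2_le_add[OF wL zL])
   hence 1: "nb ?w <= nb (z ?p) + d n" using dn by (simp add: n2_minus_commute[of lborel "z ?p"])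
   have "nb (z ?p) = cmod (bl (z ?p) (e ?p))" unfolding blz by simp
   also have "bl (z ?p) (e ?p) = bl ?w (e ?p) + bl (%x. z ?p x - ?w x) (e ?p)" using bl_diff_left[OF zL wL eL, of ?p ?p] by simp
   also have "cmod ... <= cmod (bl ?w (e ?p)) + cmod (bl (%x. z ?p x - ?w x) (e ?p))" by (rule norm_triangle_ineq)
   also have "cmod (bl (%x. z ?p x - ?w x) (e ?p)) <= d n"
   proof -
    have "cmod (bl (%x. z ?p x - ?w x) (e ?p)) <= nb (%x. z ?p x - ?w x) * nb (e ?p)" by (intro bl_le L2_diff[OF zL wL] eL)
    also have "... <= d n * 1" by (intro mult_mono dn e1) (auto intro: order_trans[OF _ dn])
    finally show ?thesis by simp
   qed
   also have "bl ?w (e ?p) = A ?p t2 - A ?p t1"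
    by (simp only: S'(5)[OF t(1) p, symmetric] S'(5)[OF t(2) p, symmetric] bq_rep[OF S'(3)[OF t(1)] eL] bq_rep[OF S'(3)[OF t(2)] eL] bl_diff_left[OF rep_LB rep_LB eL])
   also have "cmod ... <= (LINT r:{t1..t2}. \<beta> r)" using S'(1)[OF t(1)] S'(1)[OF t(2)] t(3) by (intro AS S'(6)[OF t(1) p] S'(6)[OF t(2) p]) auto
   finally show ?thesis using 1 by simp
  qed
  moreover have "(%n. (LINT r:{t1..t2}. \<beta> r) + 2 * d n) ~> (LINT r:{t1..t2}. \<beta> r) + 2 * 0" by (intro tendsto_intros d)
  ultimately show ?thesis by (intro LIMSEQ_le_const[of "%n. (LINT r:{t1..t2}. \<beta> r) + 2 * d n"]) auto
 qed
 ultimately show ?thesis using \<beta>(1,2) S'(3) by blast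
qed

lemma AE_shift:
 fixes h :: real assumes "AE t. P t" shows "AE t. P (t + h)"
proof -
 obtain N where N: "N : null_sets lborel" "{t : space lborel. \<not> P t} \<subseteq> N" using assms by (auto simp: eventually_ae_filter)
 have [measurable]: "N : sets borel" using N(1) by (auto simp: null_sets_def)
 have "AE t. t \<notin> N" using N(1) by (rule AE_not_in)
 hence "AE t. h + 1 * t \<notin> N" by (intro AE_borel_affine) auto
 thus ?thesis by eventually_elim (use N(2) in \<open>auto simp: add.commute\<close>)
qed

lemma integral_interval_continuity:
 fixes b :: "real => real" assumes b: "L1 b" and e: "e > 0"
 shows "EX d>0. ALL s:{0..T}. ALL t:{0..T}. s < t --> t - s < d --> (LINT r:{s..t}. b r) < e"
proof -
 define V where "V t = integral {0..t} b" for t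
 have si: "set_L1 {s..t} b" for s t by (rule integrable_mult_indicator[OF _ b, folded set_integrable_def]) simp
 have io: "b integrable_on {s..t}" for s t by (rule set_borel_integral_eq_integral(1)[OF si])
 have "continuous_on {0..T} V" unfolding V_def by (rule indefinite_integral_continuous_1[OF io])
 hence "uniformly_continuous_on {0..T} V" by (rule compact_uniformly_continuous) simp
 then obtain d where d: "d > 0" "!!s t. s : {0..T} ==> t : {0..T} ==> dist t s < d ==> dist (V t) (V s) < e"
  using e unfolding uniformly_continuous_on_def by blast
 have "(LINT r:{s..t}. b r) < e" if "s : {0..T}" "t : {0..T}" "s < t" "t - s < d" for s t
 proof -
  have "V s + integral {s..t} b = V t" unfolding V_def using that by (intro Henstock_Kurzweil_Integration.integral_combine io) auto
  thus ?thesis using d(2)[OF that(1,2)] that set_borel_integral_eq_integral(2)[OF si, of s t] by (simp add: dist_real_def)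
 qed
 thus ?thesis using d(1) by blast
qed

text \<open>On each interval (0, n + 1) the source has, off a null set, increments bounded by
  integrals of one integrable function. This yields a jointly measurable representative and, by
  Tonelli, a bound of order h for its integrated time increments. The vanishing of f after
  \<open>T0\<close> makes the bounds global.\<close>

lemma source_regular:
 fixes f :: "real => 'a::euclidean_space => complex" assumes f: "W1p_loc 1 (Lp_norm 2) f" and T0: "T0 >= 0" "AE t. t > T0 --> (AE x. f t x = 0)"
 shows "EX F C. C >= 0 \<and> joint F \<and>
  (AE t. t > 0 --> F t : LB \<and> (AE x. f t x = F t x) \<and> nb (F t) <= C) \<and>
  (AE t. t > T0 --> (AE x. F t x = 0)) \<and>
  (ALL h:{0<..<1}. (NINT t:{0<..}. ennreal (nb (%x. F (t + h) x - F t x))) <= ennreal (h * C))"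
proof -
 define P where "P n \<beta> S \<longleftrightarrow> set_L1 {0<..<real (Suc n)} \<beta> \<and> (ALL t. \<beta> t >= 0) \<and> (AE t. t : {0<..<real (Suc n)} --> t : S) \<and>
  (ALL t:S. Lp_norm 2 (f t) < \<infinity>) \<and>
  (ALL s:S. ALL t:S. 0 < s \<and> s < t \<and> t < real (Suc n) --> nb (%x. rep (f t) x - rep (f s) x) <= (LINT r:{s..t}. \<beta> r))" for n \<beta> S
 have "EX \<beta> S. P n \<beta> S" for n unfolding P_def using f unfolding W1p_loc_def by (intro W11_lipschitz) auto
 then obtain \<beta> S where "!!n. P n (\<beta> n) (S n)" by metis
 hence \<beta>: "!!n. set_L1 {0<..<real (Suc n)} (\<beta> n)" "!!n t. \<beta> n t >= 0" "!!n. AE t. t : {0<..<real (Suc n)} --> t : S n"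
  "!!n t. t : S n ==> Lp_norm 2 (f t) < \<infinity>"
  "!!n s t. s : S n ==> t : S n ==> 0 < s ==> s < t ==> t < real (Suc n) ==> nb (%x. rep (f t) x - rep (f s) x) <= (LINT r:{s..t}. \<beta> n r)"
  unfolding P_def by blast+
 define b where "b n r = indicator {0<..<real (Suc n)} r *R \<beta> n r" for n r
 have b: "L1 (b n)" "b n r >= 0" for n r using \<beta>(1,2) by (auto simp: b_def[abs_def] set_integrable_def)
 \<comment> \<open>The good times, of full measure: each belongs to the set \<open>S n\<close> of
   every interval that contains it.\<close>
 define A where "A = {t. 0 < t \<and> (ALL n. t < real (Suc n) --> t : S n) \<and> (t > T0 --> (AE x. f t x = 0))}"
 have A_ae: "AE t. t > 0 --> t : A"
 proof -
  have "AE t. ALL n. t : {0<..<real (Suc n)} --> t : S n" using \<beta>(3) by (simp add: AE_all_countable)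
  thus ?thesis using T0(2) unfolding A_def by eventually_elim auto
 qed
 have fA: "Lp_norm 2 (f t) < \<infinity>" if "t : A" for t
 proof -
  obtain n where "t < real n" using reals_Archimedean2 by blast
  hence "t < real (Suc n)" by simp
  hence "t : S n" using that unfolding A_def by blast
  thus ?thesis by (rule \<beta>(4))
 qed
 have lip: "nb (%x. rep (f t) x - rep (f s) x) <= (LINT r:{s..t}. b n r)" if "s : A" "t : A" "s < t" "t < real (Suc n)" for n s t
 proof -
  have st: "s : S n" "t : S n" "0 < s" using that unfolding A_def by (blast intro: less_trans)+
  have "(LINT r:{s..t}. \<beta> n r) = (LINT r:{s..t}. b n r)"
   unfolding set_lebesgue_integral_def by (intro Bochner_Integration.integral_cong refl) (use st that in \<open>auto simp: b_def indicator_def simp del: of_nat_Suc\<close>)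
  thus ?thesis using \<beta>(5)[OF st that(3,4)] by simp
 qed
 have cont: "EX d>0. ALL s:A. ALL t:A. s <= T --> t <= T --> \<bar>s - t\<bar> < d --> nb (%x. rep (f s) x - rep (f t) x) < e" if e: "e > 0" for T e
 proof -
  obtain n where n: "T < real n" using reals_Archimedean2 by blast
  obtain d where d: "d > 0" "!!s t. s : {0..T} ==> t : {0..T} ==> s < t ==> t - s < d ==> (LINT r:{s..t}. b n r) < e"
   using integral_interval_continuity[OF b(1) e] by blast
  have *: "nb (%x. rep (f t) x - rep (f s) x) < e" if "s : A" "t : A" "s < t" "t <= T" "t - s < d" for s t
  proof -
   have "nb (%x. rep (f t) x - rep (f s) x) <= (LINT r:{s..t}. b n r)" using that n by (intro lip) auto
   also have "... < e" using that by (intro d) (auto simp: A_def)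
   finally show ?thesis .
  qed
  have "nb (%x. rep (f s) x - rep (f t) x) < e" if "s : A" "t : A" "s <= T" "t <= T" "\<bar>s - t\<bar> < d" for s t
  proof (cases s t rule: linorder_cases)
   case less
   thus ?thesis using *[of s t] that by (simp add: n2_minus_commute[of lborel "rep (f s)"])
  next
   case greater
   thus ?thesis using *[of t s] that by simp
  qed (use e in simp)
  thus ?thesis using d(1) by blast
 qed
 have "A \<subseteq> {0..}" by (auto simp: A_def)
 from joint_representative[OF this rep_LB cont] obtain F where F: "joint F"
  "!!t. t : A ==> AE x. F t x = rep (f t) x" by blast
 have Fm: "F t : Borel" for t by (rule section_measurable[OF F(1)])
 have FL: "F t : LB" if t: "t : A" for t
 proof -
  have "AE x. rep (f t) x = F t x" using F(2)[OF t] by eventually_elim simp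
  thus ?thesis using Fm by (intro L2_cong_AE[OF rep_LB]) auto
 qed
 have Fd: "nb (%x. F t x - F s x) = nb (%x. rep (f t) x - rep (f s) x)" if "s : A" "t : A" for s t
 proof (rule n2_cong_AE)
  show "AE x. F t x - F s x = rep (f t) x - rep (f s) x" using F(2)[OF that(1)] F(2)[OF that(2)] by eventually_elim simp
 qed (use Fm rep_LB[THEN LB_borel] in measurable)
 have Ff: "AE x. f t x = F t x" if "t : A" for t using F(2)[OF that] rep_AE[OF fA[OF that]] by eventually_elim simp
 have F0: "AE x. F t x = 0" if "t : A" "t > T0" for t
 proof -
  have "AE x. f t x = 0" using that unfolding A_def by blast
  thus ?thesis using Ff[OF that(1)] by eventually_elim simp
 qed
 have nF0: "nb (F t) = 0" if "t : A" "t > T0" for t using n2_cong_AE[OF _ _ F0[OF that]] Fm by simp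
 \<comment> \<open>Times up to \<open>T0\<close>, shifted by less than 1, stay below k, so the
   single majorant \<open>b k\<close> covers every increment that does not vanish.\<close>
 obtain k where k: "T0 + 1 < real k" using reals_Archimedean2 by blast
 define B where "B = (LINT r. b k r)"
 have B: "B >= 0" unfolding B_def by (rule Bochner_Integration.integral_nonneg) (rule b)
 have le: "(LINT r:{s..t}. b k r) <= B" for s t unfolding set_lebesgue_integral_def B_def using b
  by (intro Bochner_Integration.integral_mono integrable_mult_indicator[OF _ b(1)]) (auto simp: indicator_def)
 \<comment> \<open>A reference time, from which the increments bound the norm at all good times up
   to \<open>T0\<close>.\<close>
 obtain t0 where t0: "t0 : A" "t0 < real (Suc k)"
 proof -
  have "\<not> (AE t. t \<notin> {0<..<1::real})" by (subst AE_iff_measurable[of "{0<..<1::real}"]) auto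
  hence "EX t. t : A \<and> t < 1" using A_ae by (metis (mono_tags, lifting) AE_mp AE_I2 greaterThanLessThan_iff)
  thus ?thesis using that k T0 by fastforce
 qed
 define C where "C = nb (F t0) + B"
 have C: "C >= 0" "B <= C" using B by (auto simp: C_def)
 have bound: "nb (F t) <= C" if t: "t : A" for t
 proof (cases "t > T0")
  case False
  have "nb (%x. F t x - F t0 x) <= B"
  proof (cases t t0 rule: linorder_cases)
   case less
   thus ?thesis using Fd[OF t t0(1)] lip[OF t t0(1) less t0(2)] le[of t t0] by (simp add: n2_minus_commute[of lborel "F t"])
  next
   case greater
   have "t < real (Suc k)" using False k by simp
   from lip[OF t0(1) t greater this] show ?thesis using Fd[OF t0(1) t] le[of t0 t] by simp
  qed (use B in simp)
  thus ?thesis using n2_le_add[OF FL[OF t] FL[OF t0(1)]] by (simp add: C_def)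
 qed (use nF0[OF t] C in simp)
 have shift: "(NINT t:{0<..}. ennreal (nb (%x. F (t + h) x - F t x))) <= ennreal (h * C)" if h: "h : {0<..<1}" for h
 proof -
  have [measurable]: "b k : Borel" using b(1)[of k] by auto
  note sh = AE_shift[OF A_ae, of h]
  have "(NINT t:{0<..}. ennreal (nb (%x. F (t + h) x - F t x))) <= (NINT t. NINT r. ennreal (b k r) * indicator {r - h..r} t)"
  proof (intro nn_integral_mono_AE, use A_ae sh in eventually_elim)
   case (elim t)
   show ?case
   proof (cases "t > 0")
    case True
    hence t: "t : A" "t + h : A" using elim h by auto
    show ?thesis
    proof (cases "t > T0")
     case True
     have "nb (%x. F (t + h) x - F t x) <= nb (F (t + h)) + nb (F t)" by (intro n2_triangle_diff FL t)
     hence "nb (%x. F (t + h) x - F t x) <= 0" using nF0[OF t(1)] nF0[OF t(2)] True h by simp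
     thus ?thesis by (simp add: ennreal_neg)
    next
     case False
     have "t + h < real (Suc k)" using False k h by simp
     from lip[OF t _ this] have "ennreal (nb (%x. F (t + h) x - F t x)) <= ennreal (LINT r:{t..t + h}. b k r)"
      using h by (auto simp: Fd[OF t] intro!: ennreal_leI)
     also have "... = (NINT r. ennreal (indicator {t..t + h} r *R b k r))" unfolding set_lebesgue_integral_def
      by (rule nn_integral_eq_integral[symmetric], rule integrable_mult_indicator[OF _ b(1)]) (use b in auto)
     also have "... = (NINT r. ennreal (b k r) * indicator {r - h..r} t)" by (intro nn_integral_cong) (auto simp: indicator_def)
     finally show ?thesis using True by simp
    qed
   qed simp
  qed
  \<comment> \<open>Each time r is counted for the starting times t in [r - h, r], an interval of
    length h.\<close>
  also have "... = (NINT r. NINT t. ennreal (b k r) * indicator {r - h..r} t)"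
  proof (rule pair_sigma_finite.Fubini'[OF pair_sigma_finite_lborel])
   have "Measurable.pred (borel \<Otimes>\<^sub>M borel) (%p. fst p - h <= snd p \<and> snd p <= fst p)" for h :: real by measurable
   hence [measurable]: "(%p. indicator {fst p - h..fst p} (snd p) :: ennreal) : Borel2" by (simp add: indicator_def)
   show "(%(r, t). ennreal (b k r) * indicator {r - h..r} t) : borel_measurable (lborel \<Otimes>\<^sub>M lborel)"
    unfolding case_prod_beta' by measurable
  qed
  also have "... = (NINT r. ennreal (b k r) * ennreal h)" using h by (intro nn_integral_cong) (simp add: nn_integral_cmult_indicator)
  also have "... = ennreal h * ennreal B"
   unfolding B_def nn_integral_eq_integral[OF b(1) AE_I2[OF b(2)], symmetric] by (simp add: nn_integral_cmult mult.commute)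
  also have "... <= ennreal (h * C)" using h C B by (simp add: ennreal_mult[symmetric] mult_left_mono)
  finally show ?thesis .
 qed
 have "AE t. t > 0 --> F t : LB \<and> (AE x. f t x = F t x) \<and> nb (F t) <= C" using A_ae by eventually_elim (use FL Ff bound in blast)
 moreover have "AE t. t > T0 --> (AE x. F t x = 0)" using A_ae by eventually_elim (use F0 T0(1) in auto)
 ultimately show ?thesis using F(1) C(1) shift by blast
qed

lemma joint_compose: assumes "joint w" "g : Borel" "h : Borel" shows "joint (%t x. w (g t) (h x))"
proof -
 have [measurable]: "joint w" "g : Borel" "h : Borel" by fact+
 show ?thesis by measurable
qed

lemma joint_diff: assumes [measurable]: "joint w" "joint v" shows "joint (%t x. w t x - v t x)" by measurable

section \<open>Solutions as evolutions\<close>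

lemma evolutionI: assumes "joint w" "joint G" "joint F" "!!t. t >= 0 ==> w t : LB" "!!T. EX K. ALL t:{0..T}. nb (w t) <= K"
  "!!T. (NINT t:{0..T}. pint (1 + m) (w t)) < \<infinity>" "!!T. (NINT t:{0..T}. pint ((1 + m) / m) (G t)) < \<infinity>"
  "AE t. t >= 0 --> F t : LB" "!!T. (NINT t:{0..T}. ennreal (nb (F t))) < \<infinity>"
  "!!\<phi> s t. \<phi> : tf ==> 0 <= s ==> s <= t ==> \<i> * (bl (w t) \<phi> - bl (w s) \<phi>) + (LINT q:{s..t}. bl (w q) (laplacian \<phi>))
   + a * (LINT q:{s..t}. bl (G q) \<phi>) = (LINT q:{s..t}. bl (F q) \<phi>)" shows "evolution m a w G F"
 unfolding evolution_def using assms unfolding bl_def by blast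

lemma evolution_weak: assumes "evolution m a w G F" "\<phi> : tf" "0 <= s" "s <= t"
 shows "\<i> * (bl (w t) \<phi> - bl (w s) \<phi>) + (LINT q:{s..t}. bl (w q) (laplacian \<phi>))
   + a * (LINT q:{s..t}. bl (G q) \<phi>) = (LINT q:{s..t}. bl (F q) \<phi>)" using assms unfolding evolution_def bl_def by blast

lemma evolution_pairings_integrable: assumes ev: "evolution m a w G F" and m: "0 < m" "m < 1" and \<phi>: "\<phi> : tf" and s: "0 <= s"
 shows "set_L1 {s..t} (%q. bl (w q) \<phi>)" "set_L1 {s..t} (%q. bl (G q) \<phi>)"
  "set_L1 {s..t} (%q. bl (F q) \<phi>)"
proof -
 note pq = conj_exponents[OF m] note reg = evolution_regular[OF ev]
 show "set_L1 {s..t} (%q. bl (w q) \<phi>)" "set_L1 {s..t} (%q. bl (G q) \<phi>)" unfolding bl_def using pq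
  by (auto intro!: pair_time_integrable[OF reg(1) _ set_nn_mono[OF s reg(6)]] pair_time_integrable[OF reg(2) _ set_nn_mono[OF s reg(7)]] \<phi> simp del: divide_le_eq)
 have "AE q. q : {s..t} --> F q : LB" using reg(5) by eventually_elim (use s in auto)
 from pair_time_integrable_L2[OF reg(3) this set_nn_mono[OF s reg(8)] tf_LB[OF \<phi>]]
 show "set_L1 {s..t} (%q. bl (F q) \<phi>)" unfolding bl_def .
qed

lemma set_nn_integral_add_le:
 fixes f g h :: "real => ennreal" assumes [measurable]: "f : Borel" "g : Borel"
  and fin: "(NINT t:{0..T}. f t) < \<infinity>" "(NINT t:{0..T}. g t) < \<infinity>" and le: "AE t. t >= 0 --> h t <= ennreal c * (f t + g t)"
 shows "(NINT t:{0..T}. h t) < \<infinity>"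
proof -
 have "(NINT t:{0..T}. h t) <= (NINT t. ennreal c * (f t * indicator {0..T} t + g t * indicator {0..T} t))"
  by (rule nn_integral_mono_AE, use le in eventually_elim) (auto simp: indicator_def)
 also have "... = ennreal c * ((NINT t:{0..T}. f t) + (NINT t:{0..T}. g t))" by (subst nn_integral_cmult, simp, subst nn_integral_add) auto
 also have "... < \<infinity>" using fin by (simp add: ennreal_mult_less_top)
 finally show ?thesis .
qed

lemma evolution_diff: assumes 1: "evolution m a w G F" and 2: "evolution m a v H K" and m: "0 < m" "m < 1"
 shows "evolution m a (%t x. w t x - v t x) (%t x. G t x - H t x) (%t x. F t x - K t x)"
proof (rule evolutionI)
 note pq = conj_exponents[OF m] note r1 = evolution_regular[OF 1] note r2 = evolution_regular[OF 2]
 note sec = r1(1-3)[THEN section_measurable] r2(1-3)[THEN section_measurable]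
 note joint = r1(1-3) r2(1-3)
 show "joint (%t x. w t x - v t x)" "joint (%t x. G t x - H t x)" "joint (%t x. F t x - K t x)" by (intro joint_diff joint)+
 show L: "(%x. w t x - v t x) : LB" if "t >= 0" for t using that by (intro L2_diff r1 r2)
 show "EX C. ALL t:{0..T}. nb (%x. w t x - v t x) <= C" for T
 proof -
  obtain A B where AB: "ALL t:{0..T}. nb (w t) <= A" "ALL t:{0..T}. nb (v t) <= B"
   using evolution_bounded[OF 1, of T] evolution_bounded[OF 2, of T] by blast
  have "nb (%x. w t x - v t x) <= A + B" if "t : {0..T}" for t using n2_triangle_diff[OF r1(4) r2(4), of t t] AB that by fastforce
  thus ?thesis by blast
 qed
 show "(NINT t:{0..T}. pint (1 + m) (%x. w t x - v t x)) < \<infinity>" for T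
  using m by (intro set_nn_integral_add_le[OF pint_measurable pint_measurable r1(6) r2(6), where c = "2 powr (1 + m)"] joint AE_I2 impI pint_diff_le sec) auto
 show "(NINT t:{0..T}. pint ((1 + m) / m) (%x. G t x - H t x)) < \<infinity>" for T
  using m by (intro set_nn_integral_add_le[OF pint_measurable pint_measurable r1(7) r2(7), where c = "2 powr ((1 + m) / m)"] joint AE_I2 impI pint_diff_le sec) auto
 show LF: "AE t. t >= 0 --> (%x. F t x - K t x) : LB" using r1(5) r2(5) by eventually_elim (auto intro: L2_diff)
 show "(NINT t:{0..T}. ennreal (nb (%x. F t x - K t x))) < \<infinity>" for T
 proof (rule set_nn_integral_add_le[OF _ _ r1(8) r2(8), of _ 1])
  show "(%t. ennreal (nb (F t))) : Borel" "(%t. ennreal (nb (K t))) : Borel" using nb_measurable[OF joint(3)] nb_measurable[OF joint(6)] by measurable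
  show "AE t. t >= 0 --> ennreal (nb (%x. F t x - K t x)) <= ennreal 1 * (ennreal (nb (F t)) + ennreal (nb (K t)))"
   using r1(5) r2(5) by eventually_elim (auto simp: ennreal_plus[symmetric] simp del: ennreal_plus intro!: ennreal_leI n2_triangle_diff)
 qed
 fix \<phi> :: "'a => complex" and s t :: real assume \<phi>: "\<phi> : tf" and st: "0 <= s" "s <= t"
 \<comment> \<open>The pairing is subtractive only where both products are integrable, that is, for
   almost every time.\<close>
 have set: "(LINT q:{s..t}. bl (%x. A q x - B q x) \<psi>) = (LINT q:{s..t}. bl (A q) \<psi>) - (LINT q:{s..t}. bl (B q) \<psi>)"
  if "AE q. q : {s..t} --> L1 (%x. A q x * \<psi> x) \<and> L1 (%x. B q x * \<psi> x)"
   "set_L1 {s..t} (%q. bl (A q) \<psi>)" "set_L1 {s..t} (%q. bl (B q) \<psi>)" "joint A" "joint B" "\<psi> : tf"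
  for A B :: "real => 'a => complex" and \<psi>
 proof -
  have [measurable]: "joint A" "joint B" "\<psi> : Borel" using that tf_borel by auto
  have "(LINT q:{s..t}. bl (%x. A q x - B q x) \<psi>) = (LINT q:{s..t}. bl (A q) \<psi> - bl (B q) \<psi>)"
  proof (rule set_lebesgue_integral_cong_AE)
   show "AE q\<in>{s..t} in lborel. bl (%x. A q x - B q x) \<psi> = bl (A q) \<psi> - bl (B q) \<psi>"
    using that(1) by eventually_elim (simp add: bl_def left_diff_distrib)
  qed (unfold bl_def, measurable)
  thus ?thesis using that(2,3) by (simp add: set_integral_diff)
 qed
 have wi: "AE q. q : {s..t} --> L1 (%x. w q x * \<psi> x) \<and> L1 (%x. v q x * \<psi> x)" if "\<psi> : tf" for \<psi>
  using st by (intro AE_I2) (auto intro!: L2_mult_integrable r1(4) r2(4) tf_LB[OF that])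
 have Gi: "AE q. q : {s..t} --> L1 (%x. G q x * \<phi> x) \<and> L1 (%x. H q x * \<phi> x)"
  using evolution_AE[OF 1 st(1), of t] evolution_AE[OF 2 st(1), of t] by eventually_elim (use pq in \<open>auto intro!: LL_mult_tf_integrable \<phi> simp del: divide_le_eq\<close>)
 have Fi: "AE q. q : {s..t} --> L1 (%x. F q x * \<phi> x) \<and> L1 (%x. K q x * \<phi> x)"
  using evolution_AE[OF 1 st(1), of t] evolution_AE[OF 2 st(1), of t] by eventually_elim (auto intro!: L2_mult_integrable tf_LB[OF \<phi>])
 note i1 = evolution_pairings_integrable[OF 1 m _ st(1)] note i2 = evolution_pairings_integrable[OF 2 m _ st(1)]
 note \<phi>' = tf_laplacian[OF \<phi>]
 have d: "bl (%x. w r x - v r x) \<phi> = bl (w r) \<phi> - bl (v r) \<phi>" if "r >= 0" for r by (intro bl_diff_left r1 r2 that tf_LB \<phi>)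
 show "\<i> * (bl (%x. w t x - v t x) \<phi> - bl (%x. w s x - v s x) \<phi>) + (LINT q:{s..t}. bl (%x. w q x - v q x) (laplacian \<phi>))
   + a * (LINT q:{s..t}. bl (%x. G q x - H q x) \<phi>) = (LINT q:{s..t}. bl (%x. F q x - K q x) \<phi>)"
  unfolding set[OF wi[OF \<phi>'] i1(1)[OF \<phi>'] i2(1)[OF \<phi>'] joint(1,4) \<phi>'] set[OF Gi i1(2)[OF \<phi>] i2(2)[OF \<phi>] joint(2,5) \<phi>]
   set[OF Fi i1(3)[OF \<phi>] i2(3)[OF \<phi>] joint(3,6) \<phi>] evolution_weak[OF 1 \<phi> st, symmetric] evolution_weak[OF 2 \<phi> st, symmetric]
  using st by (simp add: d algebra_simps)
qed

lemma laplacian_translate: assumes "\<phi> : tf" shows "laplacian (%x. \<phi> (x + h)) = (%x. laplacian \<phi> (x + h))"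
proof
 fix x
 have "pd b (pd b (%x. \<phi> (x + h))) x = pd b (pd b \<phi>) (x + h)" if "b : Basis" for b
  using fun_cong[OF pds_translate[OF assms, of "[b, b]" h], of x] that by (simp add: pds_def)
 thus "laplacian (%x. \<phi> (x + h)) x = laplacian \<phi> (x + h)" unfolding laplacian_def by simp
qed

lemma evolution_translate: assumes ev: "evolution m a w G F" shows "evolution m a (%t x. w t (x + h)) (%t x. G t (x + h)) (%t x. F t (x + h))"
proof (rule evolutionI)
 note reg = evolution_regular[OF ev]
 have sec: "w t : Borel" "G t : Borel" "F t : Borel" for t using reg(1-3) by (auto intro: section_measurable)
 show "joint (%t x. w t (x + h))" "joint (%t x. G t (x + h))" "joint (%t x. F t (x + h))"
  using joint_compose[of _ "%t. t" "%x. x + h"] reg(1-3) by auto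
 have bl: "bl (%x. z (x + h)) \<phi> = bl z (%x. \<phi> (x + (- h)))" if [measurable]: "z : Borel" and "\<phi> : tf" for z \<phi>
 proof -
  have [measurable]: "\<phi> : Borel" using that by (simp add: tf_borel)
  show ?thesis unfolding bl_def using integral_translate[of "%x. z x * \<phi> (x + (- h))" h] by (simp add: add.commute)
 qed
 fix \<phi> :: "'a => complex" and s t :: real assume \<phi>: "\<phi> : tf" and st: "0 <= s" "s <= t"
 show "\<i> * (bl (%x. w t (x + h)) \<phi> - bl (%x. w s (x + h)) \<phi>) + (LINT q:{s..t}. bl (%x. w q (x + h)) (laplacian \<phi>))
   + a * (LINT q:{s..t}. bl (%x. G q (x + h)) \<phi>) = (LINT q:{s..t}. bl (%x. F q (x + h)) \<phi>)"
  using evolution_weak[OF ev tf_translate[OF \<phi>, of "- h"] st] by (simp only: bl sec \<phi> tf_laplacian laplacian_translate)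
qed (use assms in \<open>auto simp: evolution_def pint_translate nb_translate section_measurable intro: LB_translate\<close>)

lemma evolution_time_shift: assumes ev: "evolution m a w G F" and h: "h >= 0" shows "evolution m a (%t. w (t + h)) (%t. G (t + h)) (%t. F (t + h))"
proof (rule evolutionI)
 note reg = evolution_regular[OF ev]
 show "joint (%t. w (t + h))" "joint (%t. G (t + h))" "joint (%t. F (t + h))" using joint_compose[of _ "%t. t + h" "%x. x"] reg(1-3) by auto
 show "w (t + h) : LB" if "t >= 0" for t using that h by (intro reg) simp
 show "EX K. ALL t:{0..T}. nb (w (t + h)) <= K" for T
 proof -
  obtain K where "ALL t:{0..T + h}. nb (w t) <= K" using evolution_bounded[OF ev] by blast
  thus ?thesis using h by (intro exI[of _ K]) auto
 qed
 have nn: "(NINT t:{0..T}. g (t + h)) < \<infinity>" if [measurable]: "g : Borel" and fin: "(NINT t:{0..T + h}. g t) < \<infinity>" for g :: "real => ennreal" and T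
 proof -
  have "(NINT t:{0..T}. g (t + h)) <= (NINT t. g (h + t) * indicator {0..T + h} (h + t))"
   using h by (intro nn_integral_mono) (auto simp: indicator_def add.commute)
  also have "... = (NINT t:{0..T + h}. g t)" by (rule nn_integral_translate) measurable
  finally show ?thesis using fin by simp
 qed
 have [measurable]: "(%t. nb (F t)) : Borel" by (rule nb_measurable[OF reg(3)])
 show "(NINT t:{0..T}. pint (1 + m) (w (t + h))) < \<infinity>" "(NINT t:{0..T}. pint ((1 + m) / m) (G (t + h))) < \<infinity>"
  "(NINT t:{0..T}. ennreal (nb (F (t + h)))) < \<infinity>" for T
  by (rule nn[OF pint_measurable[OF reg(1)] reg(6)], rule nn[OF pint_measurable[OF reg(2)] reg(7)], rule nn[OF _ reg(8)]) measurable
 show "AE t. t >= 0 --> F (t + h) : LB" using AE_shift[OF reg(5), of h] by eventually_elim (use h in auto)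
 fix \<phi> :: "'a => complex" and s t :: real assume \<phi>: "\<phi> : tf" and st: "0 <= s" "s <= t"
 have int: "(LINT q:{s..t}. g (q + h)) = (LINT q:{s + h..t + h}. g q)" if [measurable]: "g : Borel" for g :: "real => complex"
  unfolding set_lebesgue_integral_def using integral_translate[of "%q. indicator {s + h..t + h} q *R g q" h] by (simp add: indicator_def add.commute)
 have gm: "(%q. bl (A q) \<psi>) : Borel" if "joint A" "\<psi> : tf" for A :: "real => 'a => complex" and \<psi>
 proof -
  have [measurable]: "joint A" "\<psi> : Borel" using that tf_borel by auto
  show ?thesis unfolding bl_def by measurable
 qed
 have "0 <= s + h" "s + h <= t + h" using st h by auto
 from evolution_weak[OF ev \<phi> this]
 show "\<i> * (bl (w (t + h)) \<phi> - bl (w (s + h)) \<phi>) + (LINT q:{s..t}. bl (w (q + h)) (laplacian \<phi>))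
   + a * (LINT q:{s..t}. bl (G (q + h)) \<phi>) = (LINT q:{s..t}. bl (F (q + h)) \<phi>)"
  unfolding int[OF gm[OF reg(1) tf_laplacian[OF \<phi>]]] int[OF gm[OF reg(2) \<phi>]] int[OF gm[OF reg(3) \<phi>]] .
qed

text \<open>Meant for the initial value: frozen in time it solves an evolution with its own source,
  and comparison with the solution bounds the initial speed.\<close>

lemma evolution_stationary: assumes w: "w : LB" "w : LL (1 + m)" and G: "G : LL ((1 + m) / m)" and F: "F : LB"
  and eq: "!!\<phi>. \<phi> : tf ==> bl w (laplacian \<phi>) + a * bl G \<phi> = bl F \<phi>" shows "evolution m a (%t. w) (%t. G) (%t. F)"
proof (rule evolutionI)
 have j: "joint (%t. z)" if [measurable]: "z : Borel" for z :: "'a => complex" by measurable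
 show "joint (%t. w)" "joint (%t. G)" "joint (%t. F)" using w(1) G F by (auto intro!: j elim: LB_borel LL_borel)
 show "(NINT t:{0..T}. pint (1 + m) w) < \<infinity>" "(NINT t:{0..T}. pint ((1 + m) / m) G) < \<infinity>"
  "(NINT t:{0..T}. ennreal (nb F)) < \<infinity>" for T :: real
 proof -
  have "(NINT t:{0..T}. c) < \<infinity>" if "c < \<infinity>" for c
   using that by (subst nn_integral_cmult_indicator) (auto simp: ennreal_mult_less_top emeasure_lborel_Icc_eq)
  thus "(NINT t:{0..T}. pint (1 + m) w) < \<infinity>" "(NINT t:{0..T}. pint ((1 + m) / m) G) < \<infinity>"
   "(NINT t:{0..T}. ennreal (nb F)) < \<infinity>" using w(2) G by (auto simp: LL_def)
 qed
 fix \<phi> and s t :: real assume \<phi>: "\<phi> : (tf :: ('a => complex) set)" and "0 <= s" "s <= t"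
 show "\<i> * (bl w \<phi> - bl w \<phi>) + (LINT q:{s..t}. bl w (laplacian \<phi>)) + a * (LINT q:{s..t}. bl G \<phi>) = (LINT q:{s..t}. bl F \<phi>)"
  unfolding eq[OF \<phi>, symmetric] set_lebesgue_integral_def by (simp add: scaleR_conv_of_real algebra_simps)
qed (use w F in auto)

section \<open>From the distributional equation to an evolution\<close>

lemma conv_mo_tendsto:
 fixes g :: "'a::euclidean_space => complex" assumes g: "g : LL 1" and s: "isCont g s" shows "(%n. conv (mo n) g s) ~> g s"
proof (rule tendstoI)
 fix e :: real assume e: "e > 0"
 have [measurable]: "g : Borel" using g by (rule LL_borel)
 obtain d where d: "d > 0" "!!r. dist r s < d ==> dist (g r) (g s) < e / 2" using s e unfolding continuous_at_eps_delta by (metis half_gt_zero)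
 obtain n0 where n0: "1 / real (Suc n0) < d" using reals_Archimedean[OF d(1)] unfolding inverse_eq_divide by blast
 have gi: "L1 (%r. g r * mo n (s - r))" for n by (rule conv_integrable[OF g _ tf_moll]) simp
 have mr: "L1 (%r. moll n (s - r))" "(LINT r. moll n (s - r)) = 1" for n
  using tf_integrable[OF tf_reflect[OF tf_moll], of n s] integral_reflect[of "moll n" s] by (auto simp: complex_of_real_integrable_eq moll_integral)
 show "EV n. dist (conv (mo n) g s) (g s) < e" using eventually_ge_at_top[of n0]
 proof eventually_elim
  case (elim n)
  have mi: "L1 (%r. g s * mo n (s - r))" using mr[of n] by (simp add: complex_of_real_integrable_eq)
  have "g s = (LINT r. g s * mo n (s - r))" using mr(2)[of n] by (simp add: integral_complex_of_real)
  hence "conv (mo n) g s - g s = (LINT r. g r * mo n (s - r) - g s * mo n (s - r))"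
   unfolding conv_def by (subst Bochner_Integration.integral_diff[OF gi mi]) simp
  also have "norm ... <= (LINT r. norm (g r * mo n (s - r) - g s * mo n (s - r)))" by (rule integral_norm_bound)
  also have "... <= (LINT r. e / 2 * moll n (s - r))"
  proof (rule Bochner_Integration.integral_mono)
   show "L1 (%r. norm (g r * mo n (s - r) - g s * mo n (s - r)))" by (intro integrable_norm Bochner_Integration.integrable_diff gi mi)
   show "L1 (%r. e / 2 * moll n (s - r))" using mr(1) by simp
   fix r
   show "norm (g r * mo n (s - r) - g s * mo n (s - r)) <= e / 2 * moll n (s - r)"
   proof (cases "norm (s - r) >= 1 / Suc n")
    case False
    have "1 / real (Suc n) <= 1 / real (Suc n0)" using elim by (intro divide_left_mono) auto
    hence "dist r s < d" using False n0 by (simp add: dist_norm norm_minus_commute)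
    hence "norm (g r - g s) <= e / 2" using d(2) by (simp add: dist_norm less_imp_le)
    thus ?thesis using moll_nonneg[of n "s - r"] by (simp only: left_diff_distrib[symmetric] norm_mult norm_of_real abs_of_nonneg mult_right_mono)
   qed (simp add: moll_eq_0)
  qed
  also have "... = e / 2" using mr(2)[of n] by simp
  finally show ?case using e by (simp add: dist_norm)
 qed
qed

text \<open>The converse direction of integration by parts: a continuous function with an integrable weak
 derivative is its primitive. Plateau functions approximate the indicator of \<open>{s..t}\<close>.\<close>

lemma du_bois_reymond:
 fixes A B :: "real => complex" assumes A: "continuous_on {0..} A" and B: "!!s t. 0 <= s ==> set_L1 {s..t} B"
  and eq: "!!\<theta>. \<theta> : test_functions {0<..} ==> \<i> * (LINT r:{0<..}. pd 1 \<theta> r * A r) = - (LINT r:{0<..}. \<theta> r * B r)"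
  and st: "0 <= s" "s <= t" shows "\<i> * (A t - A s) = (LINT r:{s..t}. B r)"
proof -
 have pos: "\<i> * (A t - A s) = (LINT r:{s..t}. B r)" if st: "0 < s" "s < t" for s
 proof -
  \<comment> \<open>A margin on both sides: for large n the plateau is supported inside, at a
    positive distance from 0.\<close>
  let ?I = "{s / 2..t + 1}" and ?\<theta> = "%n. plateau n s t"
  have sub: "{s..t} \<subseteq> ?I" "?I : sets borel" using st by auto
  have AI: "set_L1 ?I A" by (intro borel_integrable_atLeastAtMost' continuous_on_subset[OF A]) (use st in auto)
  have c: "isCont (%r. indicator ?I r *R A r) x" if "x : {s, t}" for x
  proof -
   have "{s / 2<..<t + 1} \<subseteq> {0..}" using st by (intro subsetI) (auto intro: order_trans[of 0 "s / 2"])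
   hence "continuous_on {s / 2<..<t + 1} (%r. indicator ?I r *R A r)"
    using continuous_on_subset[OF A, of "{s / 2<..<t + 1}"] by (subst continuous_on_cong[OF refl, of _ _ A]) auto
   thus ?thesis using that st by (auto simp: continuous_on_eq_continuous_at)
  qed
  have 1: "(%n. LINT r:?I. pd 1 (?\<theta> n) r * A r) ~> A s - A t"
  proof -
   have "(%n. LINT r:?I. pd 1 (?\<theta> n) r * A r) ~> indicator ?I s *R A s - indicator ?I t *R A t"
    unfolding pairing_pd_plateau[OF AI] by (intro tendsto_diff conv_mo_tendsto set_integrable_LL1 AI c) auto
   thus ?thesis using st by simp
  qed
  have 2: "(%n. - (LINT r:?I. ?\<theta> n r * B r)) ~> - (LINT r:{s..t}. B r)" using st by (intro tendsto_minus pairing_plateau_tendsto sub B) auto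
  have "min (s / 2) 1 > 0" using st by simp
  hence "EV n. 1 / real (Suc n) < min (s / 2) 1" by (rule order_tendstoD(2)[OF lim_over_Suc])
  hence "EV n. \<i> * (LINT r:?I. pd 1 (?\<theta> n) r * A r) = - (LINT r:?I. ?\<theta> n r * B r)"
  proof eventually_elim
   case (elim n)
   define d where "d = 1 / real (Suc n)"
   have d: "0 < d" "d < s / 2" "d < 1" using elim by (auto simp: d_def)
   have \<theta>: "?\<theta> n : test_functions {s / 2<..<t + 1}" "?\<theta> n : test_functions {0<..}"
   proof -
    show 1: "?\<theta> n : test_functions {s / 2<..<t + 1}"
     by (rule plateau_test_function) (use d st in \<open>auto simp: d_def[symmetric] simp del: of_nat_Suc\<close>)
    have "{s / 2<..<t + 1} \<subseteq> {0<..}" using st by auto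
    thus "?\<theta> n : test_functions {0<..}" using test_functions_mono 1 by blast
   qed
   have z: "?\<theta> n r = 0" "pd 1 (?\<theta> n) r = 0" if "r \<notin> ?I" for r
   proof -
    have "r \<notin> closure {x. ?\<theta> n x \<noteq> 0}" using test_functionsD(2)[OF \<theta>(1)] that by auto
    thus "?\<theta> n r = 0" using closure_subset[of "{x. ?\<theta> n x \<noteq> 0}"] by auto
    have "s / 2 < s - d" "t + d < t + 1" using d by auto
    moreover have "r < s / 2 \<or> t + 1 < r" using that by auto
    ultimately have "norm (r - s) >= d" "norm (r - t) >= d" using d st unfolding real_norm_def by linarith+
    thus "pd 1 (?\<theta> n) r = 0" unfolding pd_plateau d_def by (simp add: moll_eq_0)
   qed
   have ind: "indicator {0<..} r *R c = indicator ?I r *R c" if "r \<notin> ?I ==> c = 0" for r and c :: complex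
    using that st by (cases "r : ?I") auto
   have "(LINT r:{0<..}. X r) = (LINT r:?I. X r)" if "!!r. r \<notin> ?I ==> X r = 0" for X :: "real => complex"
    unfolding set_lebesgue_integral_def by (intro Bochner_Integration.integral_cong refl ind that)
   from this[of "%r. pd 1 (?\<theta> n) r * A r"] this[of "%r. ?\<theta> n r * B r"]
   have "(LINT r:{0<..}. pd 1 (?\<theta> n) r * A r) = (LINT r:?I. pd 1 (?\<theta> n) r * A r)"
    "(LINT r:{0<..}. ?\<theta> n r * B r) = (LINT r:?I. ?\<theta> n r * B r)" using z by simp_all
   thus ?case using eq[OF \<theta>(2)] by simp
  qed
  from Lim_transform_eventually[OF tendsto_mult[OF tendsto_const 1, of \<i>] this]
  have "\<i> * (A s - A t) = - (LINT r:{s..t}. B r)" by (rule LIMSEQ_unique) (rule 2)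
  moreover have "A t - A s = - (A s - A t)" by simp
  ultimately show ?thesis by (simp only: mult_minus_right minus_minus)
 qed
 consider "s = t" | "0 < s" "s < t" | "s = 0" "0 < t" using st by linarith
 thus ?thesis
 proof cases
  case 1
  have "(LINT r:{t..t}. B r) = (LINT r|(lborel :: real measure). 0)" unfolding set_lebesgue_integral_def
  proof (rule integral_cong_AE)
   show "(%r. indicator {t..t} r *R B r) : borel_measurable lborel" using B[of t t] st by (auto simp: set_integrable_def)
   have "AE r. r \<noteq> t" by (rule AE_lborel_singleton)
   thus "AE r. indicator {t..t} r *R B r = 0" by eventually_elim simp
  qed simp
  thus ?thesis using 1 by simp
 next
  case 3
  \<comment> \<open>Test functions vanish near 0, so the initial time is reached only as a limit, by
    continuity of A. Starting at t/2 keeps the sequence below t.\<close>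
  define q where "q n = t / real (Suc (Suc n))" for n
  have q: "0 < q n" "q n < t" for n using 3 by (auto simp: q_def field_simps add_pos_nonneg)
  have q0: "q ~> 0" unfolding q_def by (rule LIMSEQ_Suc[OF lim_over_Suc])
  have "(%n. A (q n)) ~> A 0" by (rule continuous_on_tendsto_compose[OF A q0]) (use less_imp_le[OF q(1)] in auto)
  hence "(%n. \<i> * (A t - A (q n))) ~> \<i> * (A t - A 0)" by (intro tendsto_intros)
  moreover have "(%n. \<i> * (A t - A (q n))) ~> (LINT r:{0..t}. B r)" unfolding pos[OF q] set_lebesgue_integral_def
  proof (rule integral_dominated_convergence[where w = "%r. norm (indicator {0..t} r *R B r)"])
   have "AE r. r \<noteq> (0::real)" by (rule AE_lborel_singleton)
   thus "AE r. (%n. indicator {q n..t} r *R B r) ~> indicator {0..t} r *R B r"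
   proof eventually_elim
    case (elim r)
    have "EV n. indicator {q n..t} r *R B r = indicator {0..t} r *R B r"
    proof (cases "r > 0")
     case True
     show ?thesis using order_tendstoD(2)[OF q0 True] by eventually_elim (use True in \<open>auto simp: indicator_def\<close>)
    next
     case False
     hence "r < q n" for n using q(1)[of n] by linarith
     thus ?thesis using False elim by (auto simp: indicator_def not_le)
    qed
    thus ?case by (rule tendsto_eventually)
   qed
   show "AE r. norm (indicator {q n..t} r *R B r) <= norm (indicator {0..t} r *R B r)" for n
    using less_imp_le[OF q(1), of n] by (auto simp: indicator_def intro: order_trans)
   show "(%r. indicator {q n..t} r *R B r) : borel_measurable lborel" for n using B[of "q n" t] q(1)[of n] by (auto simp: set_integrable_def)
  qed (use B[of 0 t] in \<open>auto simp: set_integrable_def intro!: integrable_norm simp del: norm_scaleR\<close>)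
  ultimately show ?thesis using 3 LIMSEQ_unique by blast
 qed (rule pos)
qed

text \<open>Heine's theorem by a Lebesgue number, written out because distances are measured by
  \<open>nb\<close>, a seminorm on functions.\<close>

lemma uniform_continuity_time:
 fixes w :: "real => 'a::euclidean_space => complex" assumes w: "!!t. t >= 0 ==> w t : LB"
  and c: "!!t. t >= 0 ==> ((%s. nb (%x. w s x - w t x)) \<longlongrightarrow> 0) (at t within {0..})" and e: "e > 0"
 shows "EX d>0. ALL s:{0..T}. ALL t:{0..T}. \<bar>s - t\<bar> < d --> nb (%x. w s x - w t x) < e"
proof -
 have "EX d>0. ALL s:{0..}. dist s t < d --> nb (%x. w s x - w t x) < e / 2" if "t >= 0" for t
 proof -
  have "\<forall>\<^sub>F s in at t within {0..}. nb (%x. w s x - w t x) < e / 2" using e by (intro order_tendstoD(2)[OF c[OF that]]) simp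
  then obtain d where d: "d > 0" "ALL s:{0..}. s \<noteq> t \<and> dist s t < d --> nb (%x. w s x - w t x) < e / 2" unfolding eventually_at by blast
  have "nb (%x. w s x - w t x) < e / 2" if "s : {0..}" "dist s t < d" for s using d(2) that e by (cases "s = t") auto
  thus ?thesis using d(1) by blast
 qed
 then obtain \<delta> where \<delta>: "!!t. t >= 0 ==> \<delta> t > 0" "!!s t. t >= 0 ==> s >= 0 ==> dist s t < \<delta> t ==> nb (%x. w s x - w t x) < e / 2"
  by (metis atLeast_iff)
 have "{0..T} \<subseteq> (\<Union>t\<in>{0..T}. ball t (\<delta> t))" using \<delta>(1) by fastforce
 from Heine_Borel_lemma[OF compact_Icc this] obtain d where d: "d > 0" "!!s. s : {0..T} ==> EX G:(%t. ball t (\<delta> t)) ` {0..T}. ball s d \<subseteq> G"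
  by auto
 have "nb (%x. w s x - w t x) < e" if st: "s : {0..T}" "t : {0..T}" "\<bar>s - t\<bar> < d" for s t
 proof -
  obtain r where r: "r : {0..T}" "ball s d \<subseteq> ball r (\<delta> r)" using d(2)[OF st(1)] by blast
  have "s : ball s d" "t : ball s d" using d(1) st by (auto simp: dist_real_def)
  hence "s : ball r (\<delta> r)" "t : ball r (\<delta> r)" using r(2) by blast+
  hence "dist s r < \<delta> r" "dist t r < \<delta> r" by (auto simp: dist_commute)
  hence "nb (%x. w s x - w r x) < e / 2" "nb (%x. w t x - w r x) < e / 2" using \<delta>(2) r st by auto
  thus ?thesis using n2_triangle3[OF w w w, of s r t] n2_minus_commute[of lborel "w t" "w r"] st r by simp
 qed
 thus ?thesis using d(1) by blast
qed

lemma epowr_mono: "x <= y ==> r >= 0 ==> epowr x r <= epowr y r"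
 unfolding epowr_def by (auto simp: top_unique less_top intro!: ennreal_leI powr_mono2 enn2real_mono)

lemma epowr_epowr: "p > 0 ==> epowr (epowr x (1 / p)) p = x" by (cases x) (auto simp: epowr_def powr_powr)

lemma nl_pint: "0 < m ==> pint ((1 + m) / m) (%x. nl m (w x)) = pint (1 + m) w" unfolding pint_def by (simp add: cmod_nl powr_powr)

lemma st_dist_tensor:
 fixes v :: "real => 'a::euclidean_space => complex" assumes V: "joint V" and uv: "AE t. t > 0 --> (AE x. v t x = V t x)"
  and \<theta>: "\<theta> : Borel" and \<phi>: "\<phi> : tf"
 shows "st_dist v (%(t, x). \<theta> t * \<phi> x) = (LINT t:{0<..}. \<theta> t * bl (V t) \<phi>)"
proof -
 have [measurable]: "joint V" "\<phi> : Borel" "\<theta> : Borel" using V \<phi> \<theta> tf_borel by auto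
 have "AE t. t : {0<..} --> (LINT x|lebesgue. v t x * (\<theta> t * \<phi> x)) = \<theta> t * bl (V t) \<phi>" using uv
 proof eventually_elim
  case (elim t)
  have "(LINT x|lebesgue. v t x * (\<theta> t * \<phi> x)) = \<theta> t * bq (v t) \<phi>"
   unfolding bq_def by (simp only: mult.left_commute[of _ "\<theta> t"] integral_mult_right_zero)
  thus ?case using elim bq_AE[of "v t" "V t" \<phi>] by auto
 qed
 thus ?thesis unfolding st_dist_def prod.case by (intro lebesgue_on_integral_eq) (auto simp: bl_def)
qed

text \<open>The equation is tested with products \<theta>(t) \<phi>(x). For fixed \<phi> it becomes
  a weak equation for the pairing of W(t) with \<phi>, a continuous scalar function of time, which
  \<open>du_bois_reymond\<close> integrates.\<close>

lemma nls_evolution: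
 fixes u f :: "real => 'a::euclidean_space => complex"
 assumes m: "0 < m" "m < 1" and uc: "continuous_time (Lp_norm 2) u" and uL: "Lp_loc (m + 1) (cap_norm (Hk_norm 1) (Lp_norm (m + 1))) u"
  and eq: "nls_equation m a f u" and F: "joint F" and C: "C >= 0" and fF: "AE t. t > 0 --> F t : LB \<and> (AE x. f t x = F t x) \<and> nb (F t) <= C"
 shows "EX W. evolution m a W (%t x. nl m (W t x)) F \<and> (ALL t>=0. AE x. u t x = W t x) \<and>
  (ALL T. ALL e>0. EX d>0. ALL s:{0..T}. ALL t:{0..T}. \<bar>s - t\<bar> < d --> nb (%x. W s x - W t x) < e)"
proof -
 have uf: "Lp_norm 2 (u t) < \<infinity>" if "t >= 0" for t using uc that by (simp add: continuous_time_def)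
 have uni: "EX d>0. ALL s:{0..T}. ALL t:{0..T}. \<bar>s - t\<bar> < d --> nb (%x. rep (u s) x - rep (u t) x) < e" if "e > 0" for T e
 proof (rule uniform_continuity_time[OF rep_LB _ that])
  fix t :: real assume t: "t >= 0"
  have "((%s. Lp_norm 2 (%c. u s c - u t c)) \<longlongrightarrow> 0) (at t within {0..})" using uc t unfolding continuous_time_def by blast
  hence "((%s. ennreal (nb (%x. rep (u s) x - rep (u t) x))) \<longlongrightarrow> 0) (at t within {0..})"
   by (rule Lim_transform_eventually) (intro eventually_at_filter[THEN iffD2] always_eventually allI impI Lp_norm_rep_diff uf t, simp)
  thus "((%s. nb (%x. rep (u s) x - rep (u t) x)) \<longlongrightarrow> 0) (at t within {0..})"
   using tendsto_ennreal_iff[of "%s. nb (%x. rep (u s) x - rep (u t) x)" "at t within {0..}" 0] by simp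
 qed
 have "EX d>0. ALL s:{0..}. ALL t:{0..}. s <= T --> t <= T --> \<bar>s - t\<bar> < d --> nb (%x. rep (u s) x - rep (u t) x) < e" if "e > 0" for T e
  using uni[OF that, of T] by (metis atLeastAtMost_iff atLeast_iff)
 from joint_representative[OF order_refl rep_LB this] obtain W where W: "joint W" "!!t. t >= 0 ==> AE x. W t x = rep (u t) x" by auto
 have Wm: "W t : Borel" for t by (rule section_measurable[OF W(1)])
 have [measurable]: "joint W" by (rule W(1))
 have uW: "AE x. u t x = W t x" if "t >= 0" for t using rep_AE[OF uf[OF that]] W(2)[OF that] by eventually_elim simp
 have WL: "W t : LB" if "t >= 0" for t
 proof -
  have "AE x. rep (u t) x = W t x" using W(2)[OF that] by eventually_elim simp
  thus ?thesis using Wm by (intro L2_cong_AE[OF rep_LB]) auto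
 qed
 have Wu: "nb (%x. W s x - W t x) = nb (%x. rep (u s) x - rep (u t) x)" if "s >= 0" "t >= 0" for s t
 proof (rule n2_cong_AE)
  show "AE x. W s x - W t x = rep (u s) x - rep (u t) x" using W(2)[OF that(1)] W(2)[OF that(2)] by eventually_elim simp
 qed (use Wm rep_LB[THEN LB_borel] in measurable)
 have cont: "EX d>0. ALL s:{0..T}. ALL t:{0..T}. \<bar>s - t\<bar> < d --> nb (%x. W s x - W t x) < e" if "e > 0" for T e
  using uni[OF that, of T] by (simp add: Wu)
 have JN: "joint (%t x. nl m (W t x))" by measurable
 have Wp: "(NINT t:{0..T}. pint (1 + m) (W t)) < \<infinity>" for T
 proof -
  \<comment> \<open>\<open>Lp_loc\<close> speaks of open intervals (0, T) with T > 0, while here T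
    is arbitrary and the interval closed.\<close>
  define T' where "T' = max T 0 + 1"
  have T': "T' > 0" "T < T'" by (auto simp: T'_def)
  have p: "pint (1 + m) (W t) <= epowr (cap_norm (Hk_norm 1) (Lp_norm (m + 1)) (u t)) (m + 1)" if "t >= 0" for t
  proof -
   have "Lp_norm (m + 1) (u t) = epowr (pint (1 + m) (W t)) (1 / (m + 1))"
    using Lp_norm_cong[OF uW[OF that]] Lp_norm_borel[OF Wm] by (simp add: add.commute)
   hence "pint (1 + m) (W t) = epowr (Lp_norm (m + 1) (u t)) (m + 1)" using m by (simp add: epowr_epowr)
   also have "... <= epowr (cap_norm (Hk_norm 1) (Lp_norm (m + 1)) (u t)) (m + 1)" using m by (intro epowr_mono) (auto simp: cap_norm_def)
   finally show ?thesis .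
  qed
  have "(NINT t:{0..T}. pint (1 + m) (W t)) <= (NINT t:{0<..<T'}. pint (1 + m) (W t))"
   by (rule nn_integral_mono_AE, use AE_lborel_singleton[of "0::real"] in eventually_elim) (use T' in \<open>auto simp: indicator_def\<close>)
  also have "... = (\<integral>\<^sup>+t. pint (1 + m) (W t) \<partial>lebesgue_on {0<..<T'})"
   by (rule lebesgue_on_nn_integral_eq[symmetric]) (auto intro: pint_measurable W)
  also have "... <= (\<integral>\<^sup>+t. epowr (cap_norm (Hk_norm 1) (Lp_norm (m + 1)) (u t)) (m + 1) \<partial>lebesgue_on {0<..<T'})"
   by (intro nn_integral_mono p) (auto simp: space_restrict_space)
  also have "... < \<infinity>" using uL T' by (auto simp: Lp_loc_def Lp_time_def)
  finally show ?thesis .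
 qed
 have Np: "(NINT t:{0..T}. pint ((1 + m) / m) (%x. nl m (W t x))) < \<infinity>" for T using Wp m by (simp add: nl_pint)
 have FL: "AE t. t >= 0 --> F t : LB" using fF AE_lborel_singleton[of "0::real"] by eventually_elim auto
 have Fi: "(NINT t:{0..T}. ennreal (nb (F t))) < \<infinity>" for T
 proof -
  have "(NINT t:{0..T}. ennreal (nb (F t))) <= (NINT t:{0..T}. ennreal C)"
   by (rule nn_integral_mono_AE, use fF AE_lborel_singleton[of "0::real"] in eventually_elim) (auto simp: indicator_def intro: ennreal_leI)
  also have "... < \<infinity>" by (subst nn_integral_cmult_indicator) (auto simp: ennreal_mult_less_top emeasure_lborel_Icc_eq)
  finally show ?thesis .
 qed
 have "evolution m a W (%t x. nl m (W t x)) F"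
 proof (rule evolutionI[OF W(1) JN F WL _ Wp Np FL Fi])
  show "EX K. ALL t:{0..T}. nb (W t) <= K" for T
  proof -
   have "continuous_on {0..T} (%t. nb (W t))" unfolding continuous_on_iff
   proof (intro ballI allI impI)
    fix t e :: real assume t: "t : {0..T}" "e > 0"
    obtain d where d: "d > 0" "ALL s:{0..T}. ALL t:{0..T}. \<bar>s - t\<bar> < d --> nb (%x. W s x - W t x) < e" using cont[OF t(2)] by blast
    have "dist (nb (W s)) (nb (W t)) < e" if "s : {0..T}" "dist s t < d" for s
     using n2_reverse_triangle[OF WL WL, of s t] d(2) that t by (fastforce simp: dist_real_def)
    thus "EX d>0. ALL s:{0..T}. dist s t < d --> dist (nb (W s)) (nb (W t)) < e" using d(1) by blast
   qed
   hence "bounded ((%t. nb (W t)) ` {0..T})" by (intro compact_imp_bounded compact_continuous_image) auto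
   thus ?thesis by (auto simp: bounded_iff)
  qed
  fix \<phi> :: "'a => complex" and s t :: real assume \<phi>: "\<phi> : tf" and st: "0 <= s" "s <= t"
  note \<phi>' = tf_laplacian[OF \<phi>]
  note pq = conj_exponents[OF m]
  have Wi: "set_L1 {s..t} (%r. bl (W r) \<psi>)" if "\<psi> : tf" "0 <= s" for s t \<psi>
   unfolding bl_def using pq by (intro pair_time_integrable[OF W(1) _ set_nn_mono[OF that(2) Wp]] that) auto
  have Ni: "set_L1 {s..t} (%r. bl (%x. nl m (W r x)) \<phi>)" if "0 <= s" for s t
   unfolding bl_def using pq by (intro pair_time_integrable[OF JN _ set_nn_mono[OF that Np]] \<phi>) (auto simp del: divide_le_eq)
  have Fi': "set_L1 {s..t} (%r. bl (F r) \<phi>)" if "0 <= s" for s t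
  proof -
   have "AE q. q : {s..t} --> F q : LB" using FL by eventually_elim (use that in auto)
   thus ?thesis unfolding bl_def by (rule pair_time_integrable_L2[OF F _ set_nn_mono[OF that Fi] tf_LB[OF \<phi>]])
  qed
  let ?B = "%r. bl (F r) \<phi> - bl (W r) (laplacian \<phi>) - a * bl (%x. nl m (W r x)) \<phi>"
  have Bi: "set_L1 {s..t} ?B" if "0 <= s" for s t by (intro set_integral_diff(1) set_integrable_mult_right Wi Ni Fi' \<phi>' that)
  have "\<i> * (bl (W t) \<phi> - bl (W s) \<phi>) = (LINT r:{s..t}. ?B r)"
  proof (rule du_bois_reymond[OF _ Bi _ st])
   show "continuous_on {0..} (%t. bl (W t) \<phi>)" unfolding continuous_on_iff
   proof (intro ballI allI impI)
    fix t e :: real assume t: "t : {0..}" "e > 0"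
    define e' where "e' = e / (nb \<phi> + 1)"
    have n1: "nb \<phi> + 1 > 0" using n2_nonneg[of lborel \<phi>] by linarith
    have e': "e' > 0" "e' * (nb \<phi> + 1) = e" using t n1 by (auto simp: e'_def)
    obtain d where d: "d > 0" "ALL s:{0..t + 1}. ALL r:{0..t + 1}. \<bar>s - r\<bar> < d --> nb (%x. W s x - W r x) < e'" using cont[OF e'(1)] by blast
    have "dist (bl (W s) \<phi>) (bl (W t) \<phi>) < e" if "s : {0..}" "dist s t < min d 1" for s
    proof -
     have "dist (bl (W s) \<phi>) (bl (W t) \<phi>) = cmod (bl (%x. W s x - W t x) \<phi>)"
      unfolding dist_norm using that t by (simp add: bl_diff_left WL tf_LB \<phi>)
     also have "... <= nb (%x. W s x - W t x) * nb \<phi>" using that t by (intro bl_le L2_diff WL tf_LB \<phi>) auto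
     also have "... <= e' * nb \<phi>" using d(2) that t by (intro mult_right_mono) (auto simp: dist_real_def intro!: less_imp_le)
     also have "... < e" using e' by (simp add: algebra_simps)
     finally show ?thesis .
    qed
    thus "EX d>0. ALL s:{0..}. dist s t < d --> dist (bl (W s) \<phi>) (bl (W t) \<phi>) < e" using d(1) by (intro exI[of _ "min d 1"]) auto
   qed
   fix \<theta> :: "real => complex" assume \<theta>: "\<theta> : test_functions {0<..}"
   have \<theta>t: "\<theta> : tf" by (rule test_functionsD(1)[OF \<theta>])
   have \<theta>m: "\<theta> : Borel" "pd 1 \<theta> : Borel" using \<theta>t tf_pd[of \<theta> 1] by (auto intro: tf_borel)
   define K where "K = closure {r. \<theta> r \<noteq> 0}"
   have K: "compact K" "K \<subseteq> {0<..}" using \<theta> by (auto simp: K_def test_functions_def)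
   obtain R where R: "R > 0" "!!r. r : K ==> \<bar>r\<bar> <= R" using compact_imp_bounded[OF K(1)] by (auto simp: bounded_pos)
   \<comment> \<open>The support of \<theta> is compact in the open half line, so integrability on
     [0, R] suffices although the integrals extend over all positive times.\<close>
   have i\<theta>: "set_L1 {0<..} (%r. \<theta> r * X r)" if "set_L1 {0..R} X" for X
   proof -
    obtain B where B: "!!r. cmod (\<theta> r) <= B" using tf_bounded[OF \<theta>t] by auto
    have "L1 (%r. \<theta> r * (indicator {0..R} r *R X r))"
    proof (rule Bochner_Integration.integrable_bound)
     show "L1 (%r. complex_of_real B * (indicator {0..R} r *R X r))" using that unfolding set_integrable_def by (rule integrable_mult_right)
     show "(%r. \<theta> r * (indicator {0..R} r *R X r)) : borel_measurable lborel"
      using that \<theta>m(1) unfolding set_integrable_def by (intro borel_measurable_times) auto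
     show "AE r. norm (\<theta> r * (indicator {0..R} r *R X r)) <= norm (complex_of_real B * (indicator {0..R} r *R X r))"
      using order_trans[OF B abs_ge_self] by (intro AE_I2) (auto simp: norm_mult intro!: mult_right_mono mult_left_mono)
    qed
    moreover have "\<theta> r * (indicator {0..R} r *R X r) = indicator {0<..} r *R (\<theta> r * X r)" for r
    proof (cases "\<theta> r = 0")
     case False
     hence "r : K" using closure_subset[of "{r. \<theta> r \<noteq> 0}"] unfolding K_def by auto
     hence "0 < r" "r <= R" using K(2) R(2)[of r] by auto
     thus ?thesis by simp
    qed simp
    ultimately show ?thesis unfolding set_integrable_def by (simp only:)
   qed
   have lap: "(%(t, x). laplacian (%y. case (t, y) of (t, x) => \<theta> t * \<phi> x) x) = (%(t, x). \<theta> t * laplacian \<phi> x)"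
    by (auto simp: laplacian_cmult[OF \<phi>])
   have pdt: "pd (1, 0) (%(t, x). \<theta> t * \<phi> x) = (%(t, x). pd 1 \<theta> t * \<phi> x)" by (auto simp: pd_tensor_time[OF \<theta>t \<phi>])
   have ae: "AE t. t > 0 --> (AE x. u t x = W t x)" by (rule AE_I2, rule impI, rule uW) simp
   have ae': "AE t. t > 0 --> (AE x. nl m (u t x) = nl m (W t x))"
   proof (rule AE_I2, rule impI)
    fix t :: real assume "t > 0"
    hence "AE x. u t x = W t x" by (intro uW) simp
    thus "AE x. nl m (u t x) = nl m (W t x)" by eventually_elim simp
   qed
   have ae'': "AE t. t > 0 --> (AE x. f t x = F t x)" using fF by eventually_elim blast
   note sd = st_dist_tensor[OF W(1) ae \<theta>m(2) \<phi>] st_dist_tensor[OF W(1) ae \<theta>m(1) \<phi>'] st_dist_tensor[OF JN ae' \<theta>m(1) \<phi>] st_dist_tensor[OF F ae'' \<theta>m(1) \<phi>]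
   note e = eq[unfolded nls_equation_def, rule_format, OF tensor_test_function[OF \<theta> \<phi>], unfolded lap pdt sd]
   have "\<theta> r * ?B r = \<theta> r * bl (F r) \<phi> - \<theta> r * bl (W r) (laplacian \<phi>) - a * (\<theta> r * bl (%x. nl m (W r x)) \<phi>)" for r
    by (simp add: algebra_simps)
   hence I: "(LINT r:{0<..}. \<theta> r * ?B r) = (LINT r:{0<..}. \<theta> r * bl (F r) \<phi>)
     - (LINT r:{0<..}. \<theta> r * bl (W r) (laplacian \<phi>)) - a * (LINT r:{0<..}. \<theta> r * bl (%x. nl m (W r x)) \<phi>)"
    by (simp add: set_integral_diff set_integrable_mult_right i\<theta> Wi Ni Fi' \<phi>')
   show "\<i> * (LINT r:{0<..}. pd 1 \<theta> r * bl (W r) \<phi>) = - (LINT r:{0<..}. \<theta> r * ?B r)"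
    unfolding I using e by (simp add: algebra_simps)
  qed
  also have "... = (LINT r:{s..t}. bl (F r) \<phi>) - (LINT r:{s..t}. bl (W r) (laplacian \<phi>)) - a * (LINT r:{s..t}. bl (%x. nl m (W r x)) \<phi>)"
   by (simp add: set_integral_diff set_integrable_mult_right Wi Ni Fi' \<phi>' st)
  finally show "\<i> * (bl (W t) \<phi> - bl (W s) \<phi>) + (LINT q:{s..t}. bl (W q) (laplacian \<phi>))
   + a * (LINT q:{s..t}. bl (%x. nl m (W q x)) \<phi>) = (LINT q:{s..t}. bl (F q) \<phi>)" by (simp add: algebra_simps)
 qed
 thus ?thesis using uW cont by blast
qed

text \<open>The stability estimate behind the regularity bounds: it compares the solution with its
  translates in space and time and with its frozen initial value.\<close>

lemma contraction_diff: assumes 1: "evolution m a w (%t x. nl m (w t x)) F" and 2: "evolution m a v (%t x. nl m (v t x)) K"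
  and m: "0 < m" "m < 1" and a: "2 * sqrt m * Im a >= (1 - m) * \<bar>Re a\<bar>"
  and B: "(NINT t:{0..T}. ennreal (nb (%x. F t x - K t x))) <= ennreal B" "B >= 0" and T: "T >= 0"
 shows "nb (%x. w T x - v T x) <= nb (%x. w 0 x - v 0 x) + 2 * B"
 by (rule evolution_contraction[OF evolution_diff[OF 1 2 m] m nl_dissipative[OF m a] B]) (use T in auto)

section \<open>Sobolev bounds for solutions\<close>

text \<open>The increment of the equation in direction b is paired with the increment z of w and
  multiplied by \<open>rot m a\<close>. The Dirichlet form keeps a positive real part and the
  nonlinear term has a favourable sign, so the gradient of z is bounded by a multiple of |k| times
  the norm of S.\<close>

lemma elliptic_estimate: assumes w: "w : LB" "w : LL (1 + m)" "(%x. nl m (w x)) : LL ((1 + m) / m)" and S: "S : LB"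
  and eq: "!!\<phi>. \<phi> : tf ==> bl w (laplacian \<phi>) + a * bl (%x. nl m (w x)) \<phi> = bl S \<phi>"
  and m: "0 < m" "m < 1" and R: "Re (rot m a) > 0" and b: "b : Basis" "b' : Basis"
 shows "nb (shd (k' *R b') (shd (k *R b) w)) <= \<bar>k'\<bar> * (\<bar>k\<bar> * (cmod (rot m a) / Re (rot m a) * nb S))"
proof -
 let ?g = "%x. nl m (w x)" let ?h = "k *R b" and ?h' = "k' *R b'"
 define z \<gamma> where "z = shd ?h w" and "\<gamma> = shd ?h ?g"
 define c where "c = Re (rot m a)"
 define B where "B = cmod (rot m a) * (\<bar>k\<bar> * nb S)"
 note pq = conj_exponents[OF m]
 have c: "c > 0" using R by (simp add: c_def)
 have zL: "z : LB" "z : LL (1 + m)" and gL: "\<gamma> : LL ((1 + m) / m)" unfolding z_def \<gamma>_def using w m by (auto intro!: LB_shd LL_shd)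
 define X where "X n = sqrt (SUM b:Basis. (nb (conv (pd b (mo n)) z))^2)" for n
 have X0: "X n >= 0" for n by (simp add: X_def sum_nonneg)
 have pdX: "nb (conv (pd b (mo n)) z) <= X n" if "b : Basis" for b n unfolding X_def using that by (intro real_le_rsqrt member_le_sum) auto
 define P where "P n = a * ib (conv (mo n) \<gamma>) (conv (mo n) z)" for n
 \<comment> \<open>The mollified equation for the increment, paired with the mollified z;
   \<open>X n\<close> is the L2 norm of its gradient.\<close>
 have id: "of_real ((X n)^2) = P n - ib (conv (mo n) (shd ?h S)) (conv (mo n) z)" for n
 proof -
  have e: "conv (mo n) S y = conv (laplacian (mo n)) w y + a * conv (mo n) ?g y" for y
  proof -
   have "laplacian (%x. mo n (y - x)) = (%x. laplacian (mo n) (y - x))" using laplacian_reflect[OF tf_moll] by auto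
   thus ?thesis using eq[OF tf_reflect[OF tf_moll, of n y]] by (simp add: bl_def conv_def)
  qed
  have "conv (mo n) (shd ?h S) = shd ?h (conv (mo n) S)" "conv (laplacian (mo n)) z = shd ?h (conv (laplacian (mo n)) w)"
   "conv (mo n) \<gamma> = shd ?h (conv (mo n) ?g)" unfolding z_def \<gamma>_def using S w pq(2) less_imp_le[OF pq(2)]
   by (simp_all only: LB_eq_LL conv_shd[of _ 2, OF _ _ tf_moll] conv_shd[of _ 2, OF _ _ tf_laplacian[OF tf_moll]] conv_shd[of _ "(1 + m) / m", OF _ _ tf_moll] one_le_numeral)
  hence "(%y. a * conv (mo n) \<gamma> y) = (%y. conv (mo n) (shd ?h S) y - conv (laplacian (mo n)) z y)" by (auto simp: shd_def e algebra_simps)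
  hence "P n = ib (%y. conv (mo n) (shd ?h S) y - conv (laplacian (mo n)) z y) (conv (mo n) z)"
   unfolding P_def ip_cmult_left[symmetric] by (simp only:)
  also have "... = ib (conv (mo n) (shd ?h S)) (conv (mo n) z) - ib (conv (laplacian (mo n)) z) (conv (mo n) z)"
   by (intro ip_diff_left conv_LB LB_shd S zL tf_moll tf_laplacian)
  also have "ib (conv (laplacian (mo n)) z) (conv (mo n) z) = - of_real ((X n)^2)"
   unfolding ib_laplacian[OF zL(1) tf_moll] X_def by (simp add: sum_nonneg)
  finally show ?thesis by simp
 qed
 have est: "c * (X n)^2 <= Re (rot m a * P n) + B * X n" for n
 proof -
  have "conv (mo n) (shd ?h S) = shd ?h (conv (mo n) S)" using S by (intro conv_shd[of _ 2] tf_moll) (auto simp: LB_eq_LL)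
  \<comment> \<open>Moving the increment from S to z costs |k| times the gradient of the mollified
    z, so S is not differentiated.\<close>
  hence "ib (conv (mo n) (shd ?h S)) (conv (mo n) z) = ib (conv (mo n) S) (shd (- ?h) (conv (mo n) z))" by (simp add: ib_shd conv_LB tf_moll S zL)
  hence "cmod (ib (conv (mo n) (shd ?h S)) (conv (mo n) z)) <= nb (conv (mo n) S) * nb (shd ((- k) *R b) (conv (mo n) z))"
   using ip_cauchy_schwarz[OF conv_LB[OF S tf_moll] LB_shd[OF conv_LB[OF zL(1) tf_moll]], of n] by simp
  also have "... <= nb S * (\<bar>- k\<bar> * X n)"
   by (intro mult_mono nb_mo_le S order_trans[OF nb_shd_conv_le[OF zL(1) tf_moll b(1)]] mult_left_mono pdX b) auto
  finally have *: "cmod (ib (conv (mo n) (shd ?h S)) (conv (mo n) z)) <= nb S * (\<bar>k\<bar> * X n)" by simp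
  have "c * (X n)^2 = Re (rot m a * of_real ((X n)^2))" by (simp add: c_def)
  also have "... = Re (rot m a * P n) + Re (- (rot m a * ib (conv (mo n) (shd ?h S)) (conv (mo n) z)))" unfolding id right_diff_distrib by simp
  also have "Re (- (rot m a * ib (conv (mo n) (shd ?h S)) (conv (mo n) z))) <= cmod (rot m a) * (nb S * (\<bar>k\<bar> * X n))"
   by (rule order_trans[OF complex_Re_le_cmod]) (simp only: norm_minus_cancel norm_mult mult_left_mono[OF * norm_ge_zero])
  finally show ?thesis by (simp add: B_def mult_ac)
 qed
 have lim: "(%n. Re (rot m a * P n)) ~> Re (rot m a * (a * ib \<gamma> z))"
  unfolding P_def by (intro tendsto_intros pairing_mo_tendsto[OF pq gL zL(2)])
 \<comment> \<open>Mollification does not commute with the nonlinearity, so the sign is available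
   only for the limit; hence the small excess e below, which is removed at the end.\<close>
 have neg: "Re (rot m a * (a * ib \<gamma> z)) <= 0"
 proof -
  have i: "L1 (%x. rot m a * (a * (\<gamma> x * cnj (z x))))" by (intro integrable_mult_right pairing_integrable[OF pq gL zL(2)])
  have "rot m a * (a * ib \<gamma> z) = (LINT x. rot m a * (a * (\<gamma> x * cnj (z x))))" unfolding ip_def by simp
  hence "Re (rot m a * (a * ib \<gamma> z)) = (LINT x. Re (rot m a * (a * (\<gamma> x * cnj (z x)))))" using i by (simp only: integral_Re)
  also have "... <= (LINT x|(lborel::'a measure). 0)" using i rot_sector[OF m, of a] unfolding \<gamma>_def z_def shd_def
   by (intro Bochner_Integration.integral_mono integrable_Re) auto
  finally show ?thesis by simp
 qed
 have "nb (shd ?h' z) <= \<bar>k'\<bar> * (B / c) + \<epsilon>" if \<epsilon>: "\<epsilon> > 0" for \<epsilon>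
 proof -
  define e where "e = \<epsilon> / (\<bar>k'\<bar> + 1)"
  have e: "e > 0" "\<bar>k'\<bar> * e <= \<epsilon>" using \<epsilon> by (auto simp: e_def field_simps add_pos_nonneg)
  have "c * e^2 > 0" using c e by simp
  hence "EV n. Re (rot m a * P n) < c * e^2" by (intro order_tendstoD(2)[OF lim] le_less_trans[OF neg])
  hence "EV n. nb (conv (mo n) (shd ?h' z)) <= \<bar>k'\<bar> * (B / c + e)"
  proof eventually_elim
   case (elim n)
   \<comment> \<open>Here c X^2 < c e^2 + B X, whereas a value X above B/c + e would give X^2 >
     (B/c) X + e^2.\<close>
   have "X n <= B / c + e"
   proof (rule ccontr)
    assume "\<not> X n <= B / c + e"
    hence x: "X n > B / c + e" by simp
    have B0: "B / c >= 0" using c by (simp add: B_def)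
    hence "X n > e" using x by simp
    hence "e * e < e * X n" using e by simp
    moreover have "(B / c + e) * X n <= X n * X n" using x X0 by (intro mult_right_mono) auto
    ultimately have "B / c * X n + e^2 < (X n)^2" by (simp add: power2_eq_square distrib_right)
    hence "c * (B / c * X n + e^2) < c * (X n)^2" using c by simp
    thus False using est[of n] elim c by (simp add: distrib_left)
   qed
   moreover have "nb (conv (mo n) (shd ?h' z)) <= \<bar>k'\<bar> * nb (conv (pd b' (mo n)) z)"
    using nb_shd_conv_le[OF zL(1) tf_moll b(2), of k' n] zL(1) by (subst conv_shd[of _ 2]) (auto simp: LB_eq_LL tf_moll)
   ultimately show ?case using pdX[OF b(2), of n] by (meson abs_ge_zero mult_left_mono order_trans)
  qed
  from tendsto_upperbound[OF mo_nb_tendsto[OF LB_shd[OF zL(1)]] this] have "nb (shd ?h' z) <= \<bar>k'\<bar> * (B / c + e)" by simp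
  thus ?thesis using e by (simp add: distrib_left)
 qed
 hence "nb (shd ?h' z) <= \<bar>k'\<bar> * (B / c)" by (rule field_le_epsilon)
 thus ?thesis by (simp add: z_def B_def c_def mult_ac)
qed

text \<open>Hoelder continuity of exponent m < 1 gives no direct bound by the L2 distance; t^m <=
  d^m + d^(m-2) t^2 separates a part that is small with d from a part quadratic in the
  distance.\<close>

lemma bl_nl_diff_le: assumes m: "0 < m" "m < 1" and u: "u : LB" "v : LB" and \<phi>: "\<phi> : tf" and B: "!!x. cmod (\<phi> x) <= B" and d: "d > 0"
  and i: "L1 (%x. nl m (u x) * \<phi> x)" "L1 (%x. nl m (v x) * \<phi> x)" shows "cmod (bl (%x. nl m (u x)) \<phi> - bl (%x. nl m (v x)) \<phi>)
  <= 3 * (d powr m * (LINT x. cmod (\<phi> x)) + d powr (m - 2) * (B * (nb (%x. u x - v x))^2))"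
proof -
 have j: "L1 (%x. 3 * (d powr m * cmod (\<phi> x) + d powr (m - 2) * (B * (cmod (u x - v x))^2)))"
  using L2_integrable[OF L2_diff[OF u]] integrable_norm[OF tf_integrable[OF \<phi>]] by simp
 have le: "norm (nl m (u x) * \<phi> x - nl m (v x) * \<phi> x) <= 3 * (d powr m * cmod (\<phi> x) + d powr (m - 2) * (B * (cmod (u x - v x))^2))" for x
 proof -
  let ?t = "cmod (u x - v x)"
  have "?t powr m <= d powr m + d powr (m - 2) * ?t^2"
  proof (cases "?t <= d")
   case True
   hence "?t powr m <= d powr m" using m by (intro powr_mono2) auto
   thus ?thesis by (smt (verit) mult_nonneg_nonneg powr_ge_zero zero_le_power2)
  next
   case False
   hence "?t powr (m - 2) <= d powr (m - 2)" using m d by (intro powr_mono2') auto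
   hence "?t powr (m - 2) * ?t powr 2 <= d powr (m - 2) * ?t^2" by (intro mult_mono) auto
   moreover have "?t powr (m - 2) * ?t powr 2 = ?t powr m" by (simp only: powr_add[symmetric]) simp
   ultimately have "?t powr m <= d powr (m - 2) * ?t^2" by (simp only:)
   thus ?thesis by (rule add_increasing[OF powr_ge_zero])
  qed
  hence "?t powr m * cmod (\<phi> x) <= (d powr m + d powr (m - 2) * ?t^2) * cmod (\<phi> x)" by (rule mult_right_mono) simp
  also have "... <= d powr m * cmod (\<phi> x) + d powr (m - 2) * (B * ?t^2)"
   using mult_left_mono[OF B[of x], of "d powr (m - 2) * ?t^2"] by (simp add: algebra_simps)
  finally have 1: "?t powr m * cmod (\<phi> x) <= d powr m * cmod (\<phi> x) + d powr (m - 2) * (B * ?t^2)" .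
  have "norm (nl m (u x) * \<phi> x - nl m (v x) * \<phi> x) = cmod (nl m (u x) - nl m (v x)) * cmod (\<phi> x)"
   by (simp only: left_diff_distrib[symmetric] norm_mult)
  also have "... <= (3 * ?t powr m) * cmod (\<phi> x)" by (intro mult_right_mono nl_holder m) simp
  also have "... <= 3 * (d powr m * cmod (\<phi> x) + d powr (m - 2) * (B * ?t^2))" unfolding mult.assoc[of 3] by (rule mult_left_mono[OF 1]) simp
  finally show ?thesis .
 qed
 have "bl (%x. nl m (u x)) \<phi> - bl (%x. nl m (v x)) \<phi> = (LINT x. nl m (u x) * \<phi> x - nl m (v x) * \<phi> x)"
  unfolding bl_def using i by simp
 also have "norm ... <= (LINT x. norm (nl m (u x) * \<phi> x - nl m (v x) * \<phi> x))" by (rule integral_norm_bound)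
 also have "... <= (LINT x. 3 * (d powr m * cmod (\<phi> x) + d powr (m - 2) * (B * (cmod (u x - v x))^2)))"
  using i j le by (intro Bochner_Integration.integral_mono integrable_norm) auto
 also have "... = 3 * (d powr m * (LINT x. cmod (\<phi> x)) + d powr (m - 2) * (B * (nb (%x. u x - v x))^2))"
  unfolding n2_sq using L2_integrable[OF L2_diff[OF u]] integrable_norm[OF tf_integrable[OF \<phi>]] by simp
 finally show ?thesis .
qed

lemma h1_increments:
 assumes ev: "evolution m a W (%t x. nl m (W t x)) F" and m: "0 < m" "m < 1" and a: "2 * sqrt m * Im a >= (1 - m) * \<bar>Re a\<bar>"
  and W0: "nb (shd h (W 0)) <= A" and F: "!!T. (NINT t:{0..T}. ennreal (nb (shd h (F t)))) <= ennreal B" "B >= 0" and t: "t >= 0"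
 shows "nb (shd h (W t)) <= A + 2 * B"
 using contraction_diff[OF evolution_translate[OF ev] ev m a F(1)[unfolded shd_def[abs_def]] F(2) t] W0 unfolding shd_def[abs_def] by simp

lemma set_integral_norm_le:
 fixes g :: "real => complex" assumes g: "set_L1 {s..s + h} g" and c: "AE r. r : {s..s + h} --> cmod (g r) <= c" and h: "h > 0"
 shows "cmod (LINT r:{s..s + h}. g r) <= h * c"
proof -
 have "cmod (LINT r:{s..s + h}. g r) <= (LINT r. norm (indicator {s..s + h} r *R g r))"
  unfolding set_lebesgue_integral_def by (rule integral_norm_bound)
 also have "... <= (LINT r. indicator {s..s + h} r * c)"
 proof (rule integral_mono_AE)
  show "L1 (%r. norm (indicator {s..s + h} r *R g r))" using g unfolding set_integrable_def by (rule integrable_norm)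
  show "AE r. norm (indicator {s..s + h} r *R g r) <= indicator {s..s + h} r * c" using c by eventually_elim (simp add: indicator_def)
 qed (use h in simp)
 finally show ?thesis using h by simp
qed

lemma AE_interval_exists: assumes "AE t. 0 < t --> P t" "0 <= s" "s < (r::real)" shows "EX t. s < t \<and> t < r \<and> P t"
proof (rule ccontr)
 assume n: "\<not> ?thesis"
 have "AE t. t \<notin> {s<..<r}" using assms(1) by eventually_elim (use n assms in auto)
 thus False using assms(2,3) by (subst (asm) AE_iff_measurable[of "{s<..<r}"]) auto
qed

lemma evolution_AE_pos: assumes ev: "evolution m a w G F" shows "AE r. r > 0 --> w r : LL (1 + m) \<and> G r : LL ((1 + m) / m)"
proof -
 have "AE r. ALL n. r : {0..real n} --> w r : LL (1 + m) \<and> G r : LL ((1 + m) / m)" unfolding AE_all_countable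
 proof
  fix n
  show "AE r. r : {0..real n} --> w r : LL (1 + m) \<and> G r : LL ((1 + m) / m)"
   using evolution_AE[OF ev order_refl, of "real n"] by eventually_elim blast
 qed
 thus ?thesis
 proof eventually_elim
  case (elim r)
  obtain n where "r < real n" using reals_Archimedean2 by blast
  thus ?case using elim[rule_format, of n] by auto
 qed
qed

text \<open>The initial speed is finite because the stationary source \<open>L0\<close> of the
  initial value lies in L2. The resulting Lipschitz bound in time makes the Laplacian plus the
  nonlinear term, tested with \<phi>, a bounded functional; its representative is the source of a
  stationary equation, to which \<open>elliptic_estimate\<close> applies.\<close>

lemma h2_increments:
 fixes W F :: "real => 'a::euclidean_space => complex"
 assumes ev: "evolution m a W (%t x. nl m (W t x)) F" and m: "0 < m" "m < 1" and a: "2 * sqrt m * Im a >= (1 - m) * \<bar>Re a\<bar>"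
  and R: "Re (rot m a) > 0" and cont: "!!T e. e > 0 ==> EX d>0. ALL s:{0..T}. ALL t:{0..T}. \<bar>s - t\<bar> < d --> nb (%x. W s x - W t x) < e"
  and C: "C >= 0" "AE t. t > 0 --> F t : LB \<and> nb (F t) <= C"
  and Fs: "!!h. h : {0<..<1} ==> (NINT t:{0<..}. ennreal (nb (%x. F (t + h) x - F t x))) <= ennreal (h * C)"
  and W0: "W 0 : LL (2 * m)" "sobolev 2 (W 0) v"
 shows "EX L>=0. ALL t>=0. ALL b:Basis. ALL b':Basis. ALL k k'. nb (shd (k' *R b') (shd (k *R b) (W t))) <= \<bar>k'\<bar> * (\<bar>k\<bar> * L)"
proof -
 note pq = conj_exponents[OF m] note reg = evolution_regular[OF ev]
 let ?g = "%x. nl m (W 0 x)"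
 have WL: "W t : LB" if "t >= 0" for t using that by (rule reg(4))
 note AEt = evolution_AE_pos[OF ev]
 have W0L: "W 0 : LB" by (rule WL) simp
 have [measurable]: "W 0 : Borel" using W0L by (rule LB_borel)
 \<comment> \<open>The exponent 1 + m lies between 2m and 2.\<close>
 have W0p: "W 0 : LL (1 + m)"
 proof -
  have "pint (1 + m) (W 0) <= (NINT x. ennreal (cmod (W 0 x) powr (2 * m)) + ennreal (cmod (W 0 x) powr 2))" unfolding pint_def
  proof (rule nn_integral_mono)
   fix x
   have "cmod (W 0 x) powr (1 + m) <= cmod (W 0 x) powr (2 * m) + cmod (W 0 x) powr 2"
   proof (cases "cmod (W 0 x) <= 1")
    case True
    hence "cmod (W 0 x) powr (1 + m) <= cmod (W 0 x) powr (2 * m)" using m by (cases "W 0 x = 0") (auto intro!: powr_mono')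
    thus ?thesis using powr_ge_zero[of "cmod (W 0 x)" 2] by linarith
   next
    case False
    hence "cmod (W 0 x) powr (1 + m) <= cmod (W 0 x) powr 2" using m by (intro powr_mono) auto
    thus ?thesis using powr_ge_zero[of "cmod (W 0 x)" "2 * m"] by linarith
   qed
   thus "ennreal (cmod (W 0 x) powr (1 + m)) <= ennreal (cmod (W 0 x) powr (2 * m)) + ennreal (cmod (W 0 x) powr 2)"
    using ennreal_leI by (simp only: ennreal_plus[OF powr_ge_zero powr_ge_zero, symmetric])
  qed
  also have "... = pint (2 * m) (W 0) + pint 2 (W 0)" unfolding pint_def by (rule nn_integral_add) measurable
  also have "... < \<infinity>" using W0(1) W0L by (auto simp: LL_def LB_eq_LL)
  finally show ?thesis by (simp add: LL_def)
 qed
 have gq: "?g : LL ((1 + m) / m)" using W0p m by (auto simp: LL_def nl_pint)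
 have "(cmod z powr m)^2 = cmod z powr (2 * m)" for z by (simp add: power2_eq_square powr_add[symmetric])
 \<comment> \<open>The purpose of the integrability with exponent 2m: the nonlinear term at time 0
   is square integrable.\<close>
 hence gL: "?g : LB" using W0(1) m unfolding LB_eq_LL LL_def pint_def by (simp add: cmod_nl)
 have v: "v [b, b] : LB" "weak_deriv [b, b] (W 0) (v [b, b])" if "b : Basis" for b using W0(2) that by (auto simp: sobolev_def multi_def)
 define D where "D x = (SUM b:Basis. v [b, b] x)" for x
 define L0 where "L0 x = D x + a * ?g x" for x
 have DL: "D : LB" unfolding D_def[abs_def] by (intro L2_sum v) auto
 have L0L: "L0 : LB" unfolding L0_def[abs_def] by (intro L2_add L2_cmult DL gL)
 have bl_sum: "bl (W 0) (laplacian \<phi>) = bl D \<phi>" if \<phi>: "\<phi> : tf" for \<phi>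
 proof -
  have i: "L1 (%x. W 0 x * pd b (pd b \<phi>) x)" "L1 (%x. v [b, b] x * \<phi> x)" if "b : Basis" for b
   using tf_LB[OF \<phi>] tf_LB[OF tf_pd[OF tf_pd[OF \<phi> that] that]] W0L v(1)[OF that] by (auto intro: L2_mult_integrable)
  have e: "bl (W 0) (pd b (pd b \<phi>)) = bl (v [b, b]) \<phi>" if "b : Basis" for b
   using v(2)[OF that] that \<phi> W0L v(1)[OF that] by (subst (asm) weak_deriv_borel) (auto simp: pds_def LB_borel)
  have "bl (W 0) (laplacian \<phi>) = (SUM b:Basis. bl (W 0) (pd b (pd b \<phi>)))"
   unfolding bl_def laplacian_def sum_distrib_left by (rule Bochner_Integration.integral_sum) (rule i)
  also have "... = bl D \<phi>" unfolding D_def using e by (simp add: bl_def sum_distrib_right Bochner_Integration.integral_sum[OF i(2)])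
  finally show ?thesis .
 qed
 have stat: "evolution m a (%t. W 0) (%t. ?g) (%t. L0)"
 proof (rule evolution_stationary[OF W0L W0p gq L0L])
  fix \<phi> :: "'a => complex" assume \<phi>: "\<phi> : tf"
  have "L1 (%x. D x * \<phi> x)" "L1 (%x. a * (?g x * \<phi> x))"
   using L2_mult_integrable[OF DL tf_LB[OF \<phi>]] L2_mult_integrable[OF gL tf_LB[OF \<phi>]] by auto
  thus "bl (W 0) (laplacian \<phi>) + a * bl ?g \<phi> = bl L0 \<phi>"
   unfolding bl_sum[OF \<phi>] by (simp add: bl_def L0_def distrib_right mult.assoc)
 qed
 have initial: "nb (%x. W h x - W 0 x) <= h * (2 * (C + nb L0))" if h: "h > 0" for h
 proof -
  have "(NINT t:{0..h}. ennreal (nb (%x. F t x - L0 x))) <= (NINT t. ennreal (C + nb L0) * indicator {0..h} t)"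
  proof (rule nn_integral_mono_AE, use C(2) AE_lborel_singleton[of "0::real"] in eventually_elim)
   case (elim t)
   have "nb (%x. F t x - L0 x) <= C + nb L0" if "t > 0" using n2_triangle_diff[of "F t" lborel L0] elim that L0L by force
   thus ?case using elim by (auto simp: indicator_def intro!: ennreal_leI)
  qed
  also have "... = ennreal ((C + nb L0) * h)" using h C by (subst nn_integral_cmult_indicator) (auto simp: ennreal_mult)
  finally have "nb (%x. W h x - W 0 x) <= nb (%x. W 0 x - W 0 x) + 2 * ((C + nb L0) * h)" using h C by (intro contraction_diff[OF ev stat m a]) auto
  thus ?thesis by (simp add: algebra_simps)
 qed
 define \<Lambda> where "\<Lambda> = 2 * (C + nb L0) + 2 * C"
 have \<Lambda>: "\<Lambda> >= 0" using C by (simp add: \<Lambda>_def)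
 have lip: "nb (%x. W (t + h) x - W t x) <= h * \<Lambda>" if t: "t >= 0" and h: "h : {0<..<1}" for t h
 proof -
  have "(NINT s:{0..t}. ennreal (nb (%x. F (s + h) x - F s x))) <= (NINT s:{0<..}. ennreal (nb (%x. F (s + h) x - F s x)))"
   by (rule nn_integral_mono_AE, use AE_lborel_singleton[of "0::real"] in eventually_elim) (auto simp: indicator_def)
  also have "... <= ennreal (h * C)" by (rule Fs[OF h])
  finally have "nb (%x. W (t + h) x - W t x) <= nb (%x. W (0 + h) x - W 0 x) + 2 * (h * C)"
   using h C t by (intro contraction_diff[OF evolution_time_shift[OF ev] ev m a]) auto
  thus ?thesis using initial[of h] h by (simp add: \<Lambda>_def algebra_simps)
 qed
 \<comment> \<open>The equation is averaged over [t, t + h]: the time difference and the source are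
   of order h, and the integrand differs little from its value at t. No time derivative has to
   exist.\<close>
 have func: "cmod (bl (W t) (laplacian \<phi>) + a * bl (%x. nl m (W t x)) \<phi>) <= (\<Lambda> + C) * nb \<phi>" if t: "t >= 0" and \<phi>: "\<phi> : tf" for t \<phi>
 proof (rule field_le_epsilon)
  fix \<epsilon> :: real assume \<epsilon>: "\<epsilon> > 0"
  note \<phi>' = tf_laplacian[OF \<phi>]
  let ?q = "%r. bl (W r) (laplacian \<phi>) + a * bl (%x. nl m (W r x)) \<phi>"
  obtain B where B: "B > 0" "!!x. cmod (\<phi> x) <= B" using tf_bounded[OF \<phi>] by auto
  let ?I = "LINT x. cmod (\<phi> x)"
  have I0: "?I >= 0" by (rule Bochner_Integration.integral_nonneg) simp
  define A where "A = cmod a"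
  \<comment> \<open>The parameters are fixed in this order: d makes the part with d^m small, then
    \<eta> the part with d^(m-2), and h keeps W within \<eta> of its value at t.\<close>
  have "((%d. 3 * A * (d powr m * ?I)) \<longlongrightarrow> 3 * A * (0 powr m * ?I)) (at_right 0)"
   using m by (intro tendsto_intros tendsto_powr') (auto simp: eventually_at_filter)
  hence "\<forall>\<^sub>F d in at_right 0. 3 * A * (d powr m * ?I) < \<epsilon> / 2" using \<epsilon> m by (intro order_tendstoD(2)) auto
  hence "\<forall>\<^sub>F d in at_right 0. 3 * A * (d powr m * ?I) < \<epsilon> / 2 \<and> d > (0::real)"
   using eventually_at_right_less[of "0::real"] by eventually_elim simp
  then obtain d where d: "d > 0" "3 * A * (d powr m * ?I) < \<epsilon> / 2" using eventually_happens'[of "at_right (0::real)"] by auto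
  have "((%\<eta>. \<eta> * nb (laplacian \<phi>) + 3 * A * (d powr (m - 2) * (B * \<eta>^2))) \<longlongrightarrow> 0 * nb (laplacian \<phi>) + 3 * A * (d powr (m - 2) * (B * 0^2))) (at_right 0)"
   by (intro tendsto_intros)
  hence "\<forall>\<^sub>F \<eta> in at_right 0. \<eta> * nb (laplacian \<phi>) + 3 * A * (d powr (m - 2) * (B * \<eta>^2)) < \<epsilon> / 2" using \<epsilon> by (intro order_tendstoD(2)) auto
  hence "\<forall>\<^sub>F \<eta> in at_right 0. \<eta> * nb (laplacian \<phi>) + 3 * A * (d powr (m - 2) * (B * \<eta>^2)) < \<epsilon> / 2 \<and> \<eta> > (0::real)"
   using eventually_at_right_less[of "0::real"] by eventually_elim simp
  then obtain \<eta> where \<eta>: "\<eta> > 0" "\<eta> * nb (laplacian \<phi>) + 3 * A * (d powr (m - 2) * (B * \<eta>^2)) < \<epsilon> / 2"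
   using eventually_happens'[of "at_right (0::real)"] by auto
  obtain \<delta> where \<delta>: "\<delta> > 0" "ALL s:{0..t + 1}. ALL r:{0..t + 1}. \<bar>s - r\<bar> < \<delta> --> nb (%x. W s x - W r x) < \<eta>" using cont[OF \<eta>(1)] by blast
  define h where "h = min (\<delta> / 2) (1 / 2)"
  have h: "h : {0<..<1}" "h < \<delta>" "h > 0" using \<delta>(1) by (auto simp: h_def)
  have gi: "AE r. r > 0 --> L1 (%x. nl m (W r x) * \<phi> x)"
   using AEt by eventually_elim (use pq in \<open>auto intro: LL_mult_tf_integrable[OF _ _ \<phi>, of _ "(1 + m) / m"] simp del: divide_le_eq\<close>)
  have git: "L1 (%x. nl m (W t x) * \<phi> x)"
  proof (rule Bochner_Integration.integrable_bound)
   show "L1 (%x. (1 + cmod (W t x)) * cmod (\<phi> x))"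
    using L2_cmod_mult_integrable[OF WL[OF t] tf_LB[OF \<phi>]] integrable_norm[OF tf_integrable[OF \<phi>]] by (simp add: distrib_right)
   show "(%x. nl m (W t x) * \<phi> x) : borel_measurable lborel" using WL[OF t, THEN LB_borel] tf_borel[OF \<phi>] by measurable
   have "cmod (W t x) powr m <= 1 + cmod (W t x)" for x
   proof (cases "cmod (W t x) <= 1")
    case True
    hence "cmod (W t x) powr m <= 1 powr m" using m by (intro powr_mono2) auto
    thus ?thesis by (simp add: add_increasing2)
   next
    case False
    hence "cmod (W t x) powr m <= cmod (W t x) powr 1" using m by (intro powr_mono) auto
    thus ?thesis using False by simp
   qed
   thus "AE x. norm (nl m (W t x) * \<phi> x) <= norm ((1 + cmod (W t x)) * cmod (\<phi> x))"
    using m by (auto simp: norm_mult cmod_nl intro!: mult_right_mono)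
  qed
  note int = evolution_pairings_integrable[OF ev m _ t]
  have qi: "set_L1 {t..t + h} ?q" by (intro set_integral_add set_integrable_mult_right int \<phi> \<phi>')
  have near: "AE r. r : {t..t + h} --> cmod (?q t - ?q r) <= \<epsilon>" using gi AE_lborel_singleton[of "0::real"]
  proof eventually_elim
   case (elim r)
   show ?case
   proof
    assume r: "r : {t..t + h}"
    hence r': "r > 0" "r : {0..t + 1}" "t : {0..t + 1}" "\<bar>t - r\<bar> < \<delta>" using t h elim by auto
    have n: "nb (%x. W t x - W r x) <= \<eta>" using \<delta>(2) r' by (intro less_imp_le) blast
    have WLr: "W r : LB" using r'(1) by (intro WL) simp
    have "cmod (bl (W t) (laplacian \<phi>) - bl (W r) (laplacian \<phi>)) <= nb (%x. W t x - W r x) * nb (laplacian \<phi>)"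
     unfolding bl_diff_left[OF WL[OF t] WLr tf_LB[OF \<phi>'], symmetric] by (intro bl_le L2_diff WL[OF t] WLr tf_LB[OF \<phi>'])
    also have "... <= \<eta> * nb (laplacian \<phi>)" by (intro mult_right_mono n) simp
    finally have 1: "cmod (bl (W t) (laplacian \<phi>) - bl (W r) (laplacian \<phi>)) <= \<eta> * nb (laplacian \<phi>)" .
    have "cmod (a * (bl (%x. nl m (W t x)) \<phi> - bl (%x. nl m (W r x)) \<phi>))
      <= A * (3 * (d powr m * ?I + d powr (m - 2) * (B * (nb (%x. W t x - W r x))^2)))"
     unfolding norm_mult A_def using elim r'(1) by (intro mult_left_mono bl_nl_diff_le m WL[OF t] WLr \<phi> B(2) d(1) git) auto
    also have "... <= A * (3 * (d powr m * ?I + d powr (m - 2) * (B * \<eta>^2)))"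
     using n B by (intro mult_left_mono add_mono power_mono) (auto simp: A_def)
    finally have 2: "cmod (a * (bl (%x. nl m (W t x)) \<phi> - bl (%x. nl m (W r x)) \<phi>)) <= 3 * A * (d powr m * ?I) + 3 * A * (d powr (m - 2) * (B * \<eta>^2))"
     by (simp add: algebra_simps)
    have "?q t - ?q r = (bl (W t) (laplacian \<phi>) - bl (W r) (laplacian \<phi>)) + a * (bl (%x. nl m (W t x)) \<phi> - bl (%x. nl m (W r x)) \<phi>)"
     by (simp add: algebra_simps)
    moreover have "x <= \<epsilon>" if "x <= p + q" "p <= p1" "q <= q1 + q2" "q1 < \<epsilon> / 2" "p1 + q2 < \<epsilon> / 2" for x p q p1 q1 q2 :: real
     using that by linarith
    ultimately show "cmod (?q t - ?q r) <= \<epsilon>" using norm_triangle_ineq 1 2 d(2) \<eta>(2) by metis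
   qed
  qed
  have tt: "t <= t + h" "t + h >= 0" using h t by auto
  have Fb: "cmod (LINT r:{t..t + h}. bl (F r) \<phi>) <= h * (C * nb \<phi>)"
  proof (rule set_integral_norm_le[OF int(3)[OF \<phi>] _ h(3)], use C(2) AE_lborel_singleton[of "0::real"] in eventually_elim)
   case (elim r)
   have "cmod (bl (F r) \<phi>) <= C * nb \<phi>" if "r > 0" using elim that bl_le[OF _ tf_LB[OF \<phi>], of "F r"] mult_right_mono[of "nb (F r)" C "nb \<phi>"] by fastforce
   thus ?case using elim t by auto
  qed
  have "cmod (bl (%x. W (t + h) x - W t x) \<phi>) <= nb (%x. W (t + h) x - W t x) * nb \<phi>" by (intro bl_le L2_diff WL t tt tf_LB \<phi>)
  also have "... <= h * \<Lambda> * nb \<phi>" by (intro mult_right_mono lip t h) simp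
  finally have Wb: "cmod (\<i> * (bl (W (t + h)) \<phi> - bl (W t) \<phi>)) <= h * \<Lambda> * nb \<phi>"
   by (simp add: norm_mult bl_diff_left[OF WL[OF tt(2)] WL[OF t] tf_LB[OF \<phi>], symmetric])
  have "\<i> * (bl (W (t + h)) \<phi> - bl (W t) \<phi>) + (LINT r:{t..t + h}. ?q r) = (LINT r:{t..t + h}. bl (F r) \<phi>)"
   using evolution_weak[OF ev \<phi> t tt(1)] by (simp add: set_integral_add set_integrable_mult_right int \<phi> \<phi>' add.assoc)
  hence "(LINT r:{t..t + h}. ?q r) = (LINT r:{t..t + h}. bl (F r) \<phi>) - \<i> * (bl (W (t + h)) \<phi> - bl (W t) \<phi>)"
   by (simp add: eq_diff_eq add.commute)
  hence 1: "cmod (LINT r:{t..t + h}. ?q r) <= h * (C * nb \<phi>) + h * \<Lambda> * nb \<phi>"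
   by (simp only: order_trans[OF norm_triangle_ineq4 add_mono[OF Fb Wb]])
  have ci: "set_L1 {t..t + h} (%r. ?q t)" by (intro borel_integrable_atLeastAtMost' continuous_on_const)
  have 2: "cmod (LINT r:{t..t + h}. ?q t - ?q r) <= h * \<epsilon>" by (rule set_integral_norm_le[OF set_integral_diff(1)[OF ci qi] near h(3)])
  have "(LINT r:{t..t + h}. ?q t - ?q r) = of_real h * ?q t - (LINT r:{t..t + h}. ?q r)"
   using h by (subst set_integral_diff(2)[OF ci qi]) (simp add: set_lebesgue_integral_def scaleR_conv_of_real)
  hence "cmod (of_real h * ?q t) <= h * \<epsilon> + (h * (C * nb \<phi>) + h * \<Lambda> * nb \<phi>)"
   using norm_triangle_sub[of "of_real h * ?q t" "LINT r:{t..t + h}. ?q r"] 1 2 by simp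
  moreover have "cmod (of_real h * ?q t) = h * cmod (?q t)" using h by (simp only: norm_mult norm_of_real abs_of_pos)
  moreover have "h * \<epsilon> + (h * (C * nb \<phi>) + h * \<Lambda> * nb \<phi>) = h * ((\<Lambda> + C) * nb \<phi> + \<epsilon>)" by (simp add: algebra_simps)
  ultimately have "h * cmod (?q t) <= h * ((\<Lambda> + C) * nb \<phi> + \<epsilon>)" by (simp only:)
  thus "cmod (?q t) <= (\<Lambda> + C) * nb \<phi> + \<epsilon>" using h by (simp only: mult_le_cancel_left_pos)
 qed
 define L where "L = cmod (rot m a) / Re (rot m a) * (\<Lambda> + C)"
 have L: "L >= 0" using R \<Lambda> C by (simp add: L_def)
 \<comment> \<open>Only at almost every time are W(t) and the nonlinear term known to lie in the
   dual Lebesgue spaces; continuity extends the bound to all times afterwards.\<close>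
 have ae: "AE t. 0 < t --> (ALL b:Basis. ALL b':Basis. ALL k k'. nb (shd (k' *R b') (shd (k *R b) (W t))) <= \<bar>k'\<bar> * (\<bar>k\<bar> * L))"
 proof -
  show ?thesis using AEt
  proof (eventually_elim, intro impI ballI allI)
   fix t k k' and b b' :: 'a assume *: "t > 0 --> W t : LL (1 + m) \<and> (%x. nl m (W t x)) : LL ((1 + m) / m)"
    and t: "0 < t" and b: "b : Basis" "b' : Basis"
   have G: "W t : LL (1 + m)" "(%x. nl m (W t x)) : LL ((1 + m) / m)" using * t by auto
   have t0: "t >= 0" using t by simp
   have gi: "L1 (%x. nl m (W t x) * \<phi> x)" if "\<phi> : tf" for \<phi> using pq by (intro LL_mult_tf_integrable[OF G(2) _ that]) auto
   have "EX S:LB. nb S <= \<Lambda> + C \<and> (ALL \<phi>:tf. bl (W t) (laplacian \<phi>) + a * bl (%x. nl m (W t x)) \<phi> = (LINT x. S x * \<phi> x))"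
   proof (rule riesz_representation[OF _ _ func[OF t0]])
    fix \<phi> \<psi> :: "'a => complex" and c assume \<phi>: "\<phi> : tf"
    have "laplacian (%x. c * \<phi> x) = (%x. c * laplacian \<phi> x)" using laplacian_cmult[OF \<phi>] by auto
    thus "bl (W t) (laplacian (%x. c * \<phi> x)) + a * bl (%x. nl m (W t x)) (%x. c * \<phi> x) = c * (bl (W t) (laplacian \<phi>) + a * bl (%x. nl m (W t x)) \<phi>)"
     by (simp add: bl_cmult distrib_left mult.left_commute)
    assume \<psi>: "\<psi> : tf"
    have "laplacian (%x. \<phi> x + \<psi> x) = (%x. laplacian \<phi> x + laplacian \<psi> x)"
    proof
     fix x
     have "pd b (pd b (%x. \<phi> x + \<psi> x)) x = pd b (pd b \<phi>) x + pd b (pd b \<psi>) x" if "b : Basis" for b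
     proof -
      have "pd b (%x. \<phi> x + \<psi> x) = (%x. pd b \<phi> x + pd b \<psi> x)" using pd_add[OF \<phi> \<psi>] by auto
      thus ?thesis using pd_add[OF tf_pd[OF \<phi> that] tf_pd[OF \<psi> that]] by simp
     qed
     thus "laplacian (%x. \<phi> x + \<psi> x) x = laplacian \<phi> x + laplacian \<psi> x" unfolding laplacian_def by (simp add: sum.distrib)
    qed
    moreover have "bl (%x. nl m (W t x)) (%x. \<phi> x + \<psi> x) = bl (%x. nl m (W t x)) \<phi> + bl (%x. nl m (W t x)) \<psi>"
     unfolding bl_def distrib_left by (rule Bochner_Integration.integral_add[OF gi gi]) (rule \<phi> \<psi>)+
    ultimately show "bl (W t) (laplacian (%x. \<phi> x + \<psi> x)) + a * bl (%x. nl m (W t x)) (%x. \<phi> x + \<psi> x)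
      = (bl (W t) (laplacian \<phi>) + a * bl (%x. nl m (W t x)) \<phi>) + (bl (W t) (laplacian \<psi>) + a * bl (%x. nl m (W t x)) \<psi>)"
     by (simp add: bl_add_right WL t0 tf_LB tf_laplacian \<phi> \<psi> distrib_left)
   qed (use \<Lambda> C in auto)
   then obtain S where S: "S : LB" "nb S <= \<Lambda> + C" "!!\<phi>. \<phi> : tf ==> bl (W t) (laplacian \<phi>) + a * bl (%x. nl m (W t x)) \<phi> = bl S \<phi>"
    by (auto simp: bl_def)
   have "nb (shd (k' *R b') (shd (k *R b) (W t))) <= \<bar>k'\<bar> * (\<bar>k\<bar> * (cmod (rot m a) / Re (rot m a) * nb S))"
    by (rule elliptic_estimate[OF WL[OF t0] G S(1,3) m R b])
   also have "... <= \<bar>k'\<bar> * (\<bar>k\<bar> * L)" unfolding L_def using S(2) R by (intro mult_left_mono) auto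
   finally show "nb (shd (k' *R b') (shd (k *R b) (W t))) <= \<bar>k'\<bar> * (\<bar>k\<bar> * L)" .
  qed
 qed
 have "nb (shd (k' *R b') (shd (k *R b) (W t))) <= \<bar>k'\<bar> * (\<bar>k\<bar> * L)" if t: "t >= 0" and b: "b : Basis" "b' : Basis" for t b b' k k'
 proof (rule field_le_epsilon)
  fix e :: real assume e: "e > 0"
  have e4: "e / 4 > 0" using e by simp
  obtain d where d: "d > 0" "ALL s:{0..t + 1}. ALL r:{0..t + 1}. \<bar>s - r\<bar> < d --> nb (%x. W s x - W r x) < e / 4" using cont[OF e4] by blast
  have "t < min (t + d) (t + 1)" using d(1) by simp
  from AE_interval_exists[OF ae t this] obtain r where r: "t < r" "r < t + d" "r < t + 1"
   "nb (shd (k' *R b') (shd (k *R b) (W r))) <= \<bar>k'\<bar> * (\<bar>k\<bar> * L)" using b by auto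
  have WLr: "W r : LB" using r t by (intro WL) simp
  let ?D = "%x. W t x - W r x"
  have DL: "?D : LB" by (intro L2_diff WL t WLr)
  have "shd (k' *R b') (shd (k *R b) (W t)) = (%x. shd (k' *R b') (shd (k *R b) (W r)) x + shd (k' *R b') (shd (k *R b) ?D) x)"
   by (auto simp: shd_def)
  hence "nb (shd (k' *R b') (shd (k *R b) (W t))) <= nb (shd (k' *R b') (shd (k *R b) (W r))) + nb (shd (k' *R b') (shd (k *R b) ?D))"
   by (simp add: n2_triangle LB_shd WLr DL)
  moreover have "nb (shd (k' *R b') (shd (k *R b) ?D)) <= 4 * nb ?D"
   using nb_shd_le[OF LB_shd[OF DL], of "k' *R b'" "k *R b"] nb_shd_le[OF DL, of "k *R b"] by simp
  moreover have "nb ?D < e / 4" using d(2) r t by auto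
  ultimately show "nb (shd (k' *R b') (shd (k *R b) (W t))) <= \<bar>k'\<bar> * (\<bar>k\<bar> * L) + e" using r(4) by linarith
 qed
 thus ?thesis using L by blast
qed

lemma sobolev_cong: assumes "sobolev k w v" "AE x. w x = z x" "z : LB" shows "sobolev k z v"
 using assms weak_deriv_cong[OF assms(2) AE_I2[OF refl]] by (auto simp: sobolev_def)

lemma X_measurable_cong: assumes "X_measurable (Hk_norm k) {0<..} W" and ae: "!!t. t > 0 ==> AE x. u t x = W t x"
 shows "X_measurable (Hk_norm k) {0<..} u"
proof -
 have e: "Hk_norm k (%c. s c - u t c) = Hk_norm k (%c. s c - W t c)" if "t > 0" for t s
  by (rule Hk_norm_cong) (use ae[OF that] in eventually_elim, simp)
 obtain s where s: "!!n. X_simple (Hk_norm k) {0<..} (s n)" "AE t. t : {0<..} --> (%n. Hk_norm k (%c. s n t c - W t c)) ~> 0"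
  using assms(1) unfolding X_measurable_def by (auto simp: AE_lebesgue_on)
 have "AE t. t : {0<..} --> (%n. Hk_norm k (%c. s n t c - u t c)) ~> 0" using s(2) by eventually_elim (simp add: e)
 thus ?thesis using s(1) unfolding X_measurable_def by (auto simp: AE_lebesgue_on)
qed

lemma sobolev_initial: assumes "Hk_norm k u0 < \<infinity>" "AE x. u0 x = z x" "z : LB" shows "EX v. sobolev k z v"
proof -
 obtain w v where w: "AE x. u0 x = w x" "sobolev k w v" using Hk_norm_sobolev[OF assms(1)] by blast
 have "AE x. w x = z x" using w(1) assms(2) by eventually_elim simp
 thus ?thesis using sobolev_cong w(2) assms(3) by blast
qed

lemma nb_shd_le_Hk:
 fixes g :: "'a::euclidean_space => complex" assumes "AE x. g x = z x" "z : LB" and b: "b : Basis" and k: "k \<noteq> 0"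
 shows "ennreal (nb (shd (k *R b) z) / \<bar>k\<bar>) <= Hk_norm 1 g"
proof (cases "Hk_norm 1 g < \<infinity>")
 case True
 obtain v where v: "sobolev 1 z v" using sobolev_initial[OF True assms(1,2)] by blast
 have bm: "[b] : multi 1" using b by (simp add: multi_def)
 hence "nb (shd (k *R b) z) / \<bar>k\<bar> <= nb (v [b])"
  using weak_deriv1_nb[OF assms(2) _ _ b, of "v [b]" k] v k by (auto simp: sobolev_def field_simps)
 also have "... <= sqrt (SUM bs:multi 1. (nb (v bs))^2)" using bm by (intro real_le_rsqrt member_le_sum) auto
 finally show ?thesis using Hk_norm_eq[OF v] Hk_norm_cong[OF assms(1)] by (simp add: ennreal_leI)
qed (simp add: not_less top_unique)

text \<open>One constant serves all T because F vanishes after \<open>T0\<close>. The interval ends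
  at T0 + 1 so that its length is positive even for T0 = 0.\<close>

lemma h1_source:
 fixes f F :: "real => 'a::euclidean_space => complex" assumes f: "Lp_time 1 (Hk_norm 1) {0<..<T0 + 1} f" and T0: "T0 >= 0" and F: "joint F"
  and fF: "AE t. t > 0 --> F t : LB \<and> (AE x. f t x = F t x)" and F0: "AE t. t > T0 --> (AE x. F t x = 0)"
 shows "EX B>=0. ALL b:Basis. ALL k T. (NINT t:{0..T}. ennreal (nb (shd (k *R b) (F t)))) <= ennreal (\<bar>k\<bar> * B)"
proof -
 let ?H = "\<integral>\<^sup>+t. Hk_norm 1 (f t) \<partial>lebesgue_on {0<..<T0 + 1}"
 have H: "?H < \<infinity>" using f by (simp add: Lp_time_def)
 have "(NINT t:{0..T}. ennreal (nb (shd (k *R b) (F t)))) <= ennreal (\<bar>k\<bar> * enn2real ?H)" if b: "b : Basis" for b k T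
 proof (cases "k = 0")
  case False
  define q where "q t = nb (shd (k *R b) (F t)) / \<bar>k\<bar>" for t
  have "joint (%t. shd (k *R b) (F t))" unfolding shd_def[abs_def] by (intro joint_diff joint_compose[OF F, of "%t. t" "%x. x + k *R b"] F) auto
  from nb_measurable[OF this] have [measurable]: "q : Borel" unfolding q_def by measurable
  have "(NINT t:{0..T}. ennreal (nb (shd (k *R b) (F t)))) <= (NINT t. ennreal \<bar>k\<bar> * (ennreal (q t) * indicator {0<..<T0 + 1} t))"
  proof (rule nn_integral_mono_AE, use F0 fF AE_lborel_singleton[of "0::real"] in eventually_elim)
   case (elim t)
   have "nb (shd (k *R b) (F t)) = 0" if "t > T0"
   proof -
    have L: "F t : LB" using elim that T0 by auto
    have "AE x. F t x = 0" using elim that by blast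
    hence "nb (F t) = 0" using n2_cong_AE[of "F t" lborel "%x. 0"] L by (auto dest: LB_borel)
    thus ?thesis using nb_shd_le[OF L, of "k *R b"] by (simp add: antisym)
   qed
   thus ?case using False elim T0 by (cases "t > T0") (auto simp: indicator_def q_def ennreal_mult[symmetric])
  qed
  also have "... = ennreal \<bar>k\<bar> * (NINT t:{0<..<T0 + 1}. ennreal (q t))" by (rule nn_integral_cmult) measurable
  also have "(NINT t:{0<..<T0 + 1}. ennreal (q t)) = (\<integral>\<^sup>+t. ennreal (q t) \<partial>lebesgue_on {0<..<T0 + 1})"
   by (rule lebesgue_on_nn_integral_eq[symmetric]) auto
  also have "... <= ?H"
  proof (rule nn_integral_mono_AE)
   have "AE t. t : {0<..<T0 + 1} --> ennreal (q t) <= Hk_norm 1 (f t)"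
    using fF by eventually_elim (use nb_shd_le_Hk[OF _ _ b False] in \<open>auto simp: q_def\<close>)
   thus "AE t in lebesgue_on {0<..<T0 + 1}. ennreal (q t) <= Hk_norm 1 (f t)" by (subst AE_lebesgue_on) auto
  qed
  also have "?H = ennreal (enn2real ?H)" using H by simp
  finally show ?thesis by (simp add: ennreal_mult mult_left_mono)
 qed (simp add: shd_def[abs_def])
 thus ?thesis by (intro exI[of _ "enn2real ?H"]) auto
qed

section \<open>The decay estimate for strong solutions\<close>

lemma solution_decay:
 fixes u f :: "real => 'a::euclidean_space => complex" assumes N: "DIM('a) >= 4" and m: "0 < m" "m < 1"
  and a: "2 * sqrt m * Im a >= (1 - m) * \<bar>Re a\<bar>" "Re a >= 0 --> 2 * sqrt m * Im a > (1 - m) * Re a"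
  and f: "W1p_loc 1 (Lp_norm 2) f" and u0: "Hk_norm 1 u0 < \<infinity>"
  and l: "W1p_loc 1 (Hk_norm 1) f \<and> l = 1 \<or> Hk_norm 2 u0 < \<infinity> \<and> Lp_norm (2 * m) u0 < \<infinity> \<and> l = 2"
  and sol: "solution Hstar m a f u0 u" and T0: "T0 >= 0" "AE t in lebesgue_on {T0<..}. AE x in lebesgue. f t x = 0"
 defines "M \<equiv> enn2real (Linf_norm (Hk_norm l) {0<..} u)"
  and "\<mu> \<equiv> %t. enn2real (Lp_norm 2 (u t))" and "\<alpha> \<equiv> (1 - m) * (real DIM('a) - 2 * real l) / (2 * real l)"
 shows "Linf_time (Hk_norm l) {0<..} u" and "\<alpha> = 0 ==> t >= T0 ==> \<mu> t <= \<mu> T0 * exp (- (Im a * gn_const DIM('a) M m l) * (t - T0))"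
  and "\<alpha> > 0 ==> t >= T0 ==> \<mu> t <= \<mu> T0 / (1 + \<alpha> * Im a * gn_const DIM('a) M m l * \<mu> T0 powr \<alpha> * (t - T0)) powr (1 / \<alpha>)"
proof -
 have l12: "l : {1, 2}" using l by auto
 have b: "Im a > 0"
 proof -
  have "2 * sqrt m * Im a > 0" using a m by (cases "Re a >= 0") (smt (verit) mult_nonneg_nonneg mult_pos_pos)+
  thus ?thesis using m by (simp add: zero_less_mult_iff)
 qed
 have R: "Re (rot m a) > 0" by (rule rot_pos[OF m a])
 have uc: "continuous_time (Lp_norm 2) u" and uL: "Lp_loc (m + 1) (cap_norm (Hk_norm 1) (Lp_norm (m + 1))) u"
  and eq: "nls_equation m a f u" and ui: "AE x. u 0 x = u0 x" using sol by (auto simp: solution_def AE_completion_iff)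
 have f0: "AE t. t > T0 --> (AE x. f t x = 0)" using T0(2) by (simp add: AE_lebesgue_on AE_completion_iff)
 obtain F C where C: "C >= 0" and F: "joint F" and fF: "AE t. t > 0 --> F t : LB \<and> (AE x. f t x = F t x) \<and> nb (F t) <= C"
  and F0: "AE t. t > T0 --> (AE x. F t x = 0)"
  and Fs: "!!h. h : {0<..<1} ==> (NINT t:{0<..}. ennreal (nb (%x. F (t + h) x - F t x))) <= ennreal (h * C)"
  using source_regular[OF f T0(1) f0] by blast
 obtain W where ev: "evolution m a W (%t x. nl m (W t x)) F" and uW: "!!t. t >= 0 ==> AE x. u t x = W t x"
  and cont: "!!T e. e > 0 ==> EX d>0. ALL s:{0..T}. ALL t:{0..T}. \<bar>s - t\<bar> < d --> nb (%x. W s x - W t x) < e"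
  using nls_evolution[OF m uc uL eq F C fF] by blast
 note reg = evolution_regular[OF ev]
 have WL: "W t : LB" if "t >= 0" for t using that by (rule reg(4))
 have uW0: "AE x. u0 x = W 0 x" using ui uW[of 0, OF order_refl] by eventually_elim simp
 \<comment> \<open>The source acts up to \<open>T0\<close> only, which makes the bound uniform in
   time.\<close>
 have bounded: "nb (W t) <= nb (W 0) + 2 * (C * T0)" if t: "t >= 0" for t
 proof (rule evolution_contraction[OF ev m])
  show "Im (a * (nl m (W s x) * cnj (W s x))) >= 0" for s x using nl_dissipative[OF m a(1), of "W s x" 0] by simp
  have "(NINT s:{0..t}. ennreal (nb (F s))) <= (NINT s. ennreal C * indicator {0..T0} s)"
  proof (rule nn_integral_mono_AE, use fF F0 AE_lborel_singleton[of "0::real"] in eventually_elim)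
   case (elim s)
   have "nb (F s) = 0" if "s > T0" "s > 0" using elim that n2_cong_AE[of "F s" lborel "%x. 0"] by (auto dest: LB_borel)
   thus ?case using elim T0(1) by (cases "s > T0") (auto simp: indicator_def intro: ennreal_leI)
  qed
  also have "... = ennreal (C * T0)" using T0(1) C by (subst nn_integral_cmult_indicator) (auto simp: ennreal_mult)
  finally show "(NINT s:{0..t}. ennreal (nb (F s))) <= ennreal (C * T0)" .
 qed (use C T0 t in auto)
 define K0 where "K0 = nb (W 0) + 2 * (C * T0)"
 have K0: "K0 >= 0" using C T0 by (simp add: K0_def)
 have "EX L>=0. (l = 1 --> (ALL t>=0. ALL b:Basis. ALL k. nb (shd (k *R b) (W t)) <= \<bar>k\<bar> * L)) \<and>
   (l = 2 --> (ALL t>=0. ALL b:Basis. ALL b':Basis. ALL k k'. nb (shd (k' *R b') (shd (k *R b) (W t))) <= \<bar>k'\<bar> * (\<bar>k\<bar> * L)))"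
 proof (cases "l = 1")
  case True
  hence "Lp_time 1 (Hk_norm 1) {0<..<T0 + 1} f" using l T0 by (auto simp: W1p_loc_def W1p_time_def)
  moreover have "AE t. t > 0 --> F t : LB \<and> (AE x. f t x = F t x)" using fF by eventually_elim blast
  ultimately obtain B where B: "B >= 0" "!!b k T. b : Basis ==> (NINT t:{0..T}. ennreal (nb (shd (k *R b) (F t)))) <= ennreal (\<bar>k\<bar> * B)"
   using h1_source[OF _ T0(1) F _ F0] by blast
  obtain v where v: "sobolev 1 (W 0) v" using sobolev_initial[OF u0 uW0 WL] by auto
  define A where "A = (SUM b:Basis. nb (v [b]))"
  have A: "A >= 0" by (simp add: A_def sum_nonneg)
  have "nb (shd (k *R b) (W t)) <= \<bar>k\<bar> * (A + 2 * B)" if t: "t >= 0" and bb: "b : Basis" for t b k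
  proof -
   have "[b] : multi 1" using bb by (simp add: multi_def)
   hence "v [b] : LB" "weak_deriv [b] (W 0) (v [b])" using v by (auto simp: sobolev_def)
   hence "nb (shd (k *R b) (W 0)) <= \<bar>k\<bar> * nb (v [b])" using bb by (intro weak_deriv1_nb WL) auto
   also have "nb (v [b]) <= A" unfolding A_def using bb by (intro member_le_sum) auto
   finally have "nb (shd (k *R b) (W 0)) <= \<bar>k\<bar> * A" by (simp add: mult_left_mono)
   from h1_increments[OF ev m a(1) this B(2)[OF bb] _ t] show ?thesis using B(1) by (simp add: algebra_simps)
  qed
  thus ?thesis using True A B by (intro exI[of _ "A + 2 * B"]) auto
 next
  case False
  hence u2: "Hk_norm 2 u0 < \<infinity>" "Lp_norm (2 * m) u0 < \<infinity>" using l by auto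
  obtain v where v: "sobolev 2 (W 0) v" using sobolev_initial[OF u2(1) uW0 WL] by auto
  have W0m: "W 0 : Borel" by (intro LB_borel WL) simp
  have W0p: "W 0 : LL (2 * m)" using u2(2) W0m unfolding Lp_norm_cong[OF uW0] Lp_norm_borel[OF W0m] by (simp add: epowr_finite_iff LL_def)
  have fF': "AE t. t > 0 --> F t : LB \<and> nb (F t) <= C" using fF by eventually_elim blast
  have "EX L>=0. ALL t>=0. ALL b:Basis. ALL b':Basis. ALL k k'. nb (shd (k' *R b') (shd (k *R b) (W t))) <= \<bar>k'\<bar> * (\<bar>k\<bar> * L)"
   by (rule h2_increments[OF ev m a(1) R cont C fF' Fs W0p v])
  thus ?thesis using False by auto
 qed
 then obtain L where L: "L >= 0" "l = 1 --> (ALL t>=0. ALL b:Basis. ALL k. nb (shd (k *R b) (W t)) <= \<bar>k\<bar> * L)"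
   "l = 2 --> (ALL t>=0. ALL b:Basis. ALL b':Basis. ALL k k'. nb (shd (k' *R b') (shd (k *R b) (W t))) <= \<bar>k'\<bar> * (\<bar>k\<bar> * L))"
  by (elim exE conjE) (rule that)
 define K where "K = K0 + L + sqrt (K0 * L)"
 have "EX v. sobolev l (W t) v \<and> (ALL bs:multi l. nb (v bs) <= K)" if t: "t >= 0" for t
 proof -
  obtain v where v: "sobolev l (W t) v" "ALL bs:multi l. nb (v bs) <= nb (W t) + L + sqrt (nb (W t) * L)"
   using sobolev_of_increments[OF WL[OF t] L(1) l12] L(2,3)[THEN mp, rule_format, OF _ t] by blast
  have "nb (W t) + L + sqrt (nb (W t) * L) <= K"
   using bounded[OF t] L(1) unfolding K_def K0_def by (intro add_mono real_sqrt_le_mono mult_right_mono) auto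
  thus ?thesis using v by (auto intro: order_trans)
 qed
 then obtain v where v: "!!t. t >= 0 ==> sobolev l (W t) (v t)" "!!t bs. t >= 0 ==> bs : multi l ==> nb (v t bs) <= K" by metis
 note X = sobolev_X_measurable[OF WL cont v(1)[OF less_imp_le]]
 have Hu: "Hk_norm l (u t) = Hk_norm l (W t)" if "t >= 0" for t by (rule Hk_norm_cong[OF uW[OF that]])
 have mu: "(%t. Hk_norm l (u t)) : borel_measurable (lebesgue_on {0<..})"
  using X(2) by (subst measurable_cong[of _ _ "%t. Hk_norm l (W t)"]) (auto simp: space_restrict_space Hu)
 have le: "Hk_norm l (u t) <= ennreal (sqrt (SUM bs:(multi l :: 'a list set). K^2))" if "t > 0" for t
  using that v unfolding Hu[OF less_imp_le[OF that]] Hk_norm_eq[OF v(1)[OF less_imp_le[OF that]]]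
  by (intro ennreal_leI real_sqrt_le_mono sum_mono power_mono) auto
 \<comment> \<open>Finiteness is essential, as \<open>enn2real\<close> would turn an infinite norm
   into 0 and the constant would lose its meaning.\<close>
 have "esssup (lebesgue_on {0<..}) (%t. Hk_norm l (u t)) <= ennreal (sqrt (SUM bs:(multi l :: 'a list set). K^2))"
  by (rule esssup_I[OF mu]) (subst AE_lebesgue_on, simp, rule AE_I2, rule impI, rule le, simp)
 hence fin: "Linf_norm (Hk_norm l) {0<..} u < \<infinity>" unfolding Linf_norm_def by (auto elim: le_less_trans)
 have "X_measurable (Hk_norm l) {0<..} u" by (rule X_measurable_cong[OF X(1)]) (auto intro: uW)
 thus "Linf_time (Hk_norm l) {0<..} u" using fin by (simp add: Linf_time_def)
 \<comment> \<open>The decay constant must depend on the norm of u itself, so the bound K, which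
   depends on the data, is now replaced by M.\<close>
 have "AE t. t : {0<..} --> Hk_norm l (u t) <= Linf_norm (Hk_norm l) {0<..} u"
  using esssup_AE[where M = "lebesgue_on {0<..}" and f = "%t. Hk_norm l (u t)"] unfolding Linf_norm_def by (subst (asm) AE_lebesgue_on) auto
 hence vM: "AE t. t > 0 --> (ALL bs:multi l. nb (v t bs) <= M)"
 proof eventually_elim
  case (elim t)
  show ?case
  proof (intro impI ballI)
   fix bs :: "'a list" assume t: "t > 0" and bs: "bs : multi l"
   have "ennreal (sqrt (SUM bs:multi l. (nb (v t bs))^2)) <= ennreal M" using elim t fin Hu[of t] Hk_norm_eq[OF v(1)[of t]] by (simp add: M_def)
   hence "sqrt (SUM bs:multi l. (nb (v t bs))^2) <= M" by (simp add: M_def ennreal_le_iff)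
   moreover have "nb (v t bs) <= sqrt (SUM bs:multi l. (nb (v t bs))^2)" using bs by (intro real_le_rsqrt member_le_sum) auto
   ultimately show "nb (v t bs) <= M" by linarith
  qed
 qed
 have \<mu>: "\<mu> t = nb (W t)" if "t >= 0" for t unfolding \<mu>_def Lp_norm_cong[OF uW[OF that]] Lp_norm_LB[OF WL[OF that]] by simp
 have M0: "M >= 0" by (simp add: M_def)
 have Nl: "real DIM('a) - 2 * real l >= 0" using N l12 by auto
 \<comment> \<open>The exponent in the interpolation inequality exceeds 2 by \<alpha>, which is
   nonnegative for both values of l because N >= 4.\<close>
 have \<alpha>: "\<alpha> >= 0" "1 + m + real DIM('a) * (1 - m) / (2 * real l) = 2 + \<alpha>"
  using Nl m l12 unfolding \<alpha>_def by (intro divide_nonneg_nonneg mult_nonneg_nonneg, simp_all) (auto simp: field_simps)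
 have main: "(\<alpha> = 0 --> nb (W t) <= nb (W T0) * exp (- (Im a * gn_const DIM('a) M m l) * (t - T0))) \<and>
  (\<alpha> > 0 --> nb (W t) <= nb (W T0) / (1 + \<alpha> * Im a * gn_const DIM('a) M m l * nb (W T0) powr \<alpha> * (t - T0)) powr (1 / \<alpha>))"
  if t: "t >= T0" for t
 \<comment> \<open>For M = 0 the interpolation constant is degenerate, but then u vanishes at almost
   every time and, by continuity, at every time.\<close>
 proof (cases "M = 0")
  case True
  have t0: "t >= 0" using t T0 by simp
  have "nb (W t) <= 0 + e" if e: "e > 0" for e
  proof -
   obtain d where d: "d > 0" "ALL s:{0..t + 1}. ALL r:{0..t + 1}. \<bar>s - r\<bar> < d --> nb (%x. W s x - W r x) < e" using cont[OF e] by blast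
   have "t < min (t + d) (t + 1)" using d(1) by simp
   from AE_interval_exists[OF vM t0 this] obtain r where r: "t < r" "r < t + d" "r < t + 1" "ALL bs:multi l. nb (v r bs) <= M" by auto
   have r0: "r >= 0" using r t0 by simp
   have "[] : multi l" by (simp add: multi_def)
   hence "nb (v r []) <= 0" "v r [] : LB" "weak_deriv [] (W r) (v r [])" using r(4) True v(1)[OF r0] by (auto simp: sobolev_def)
   hence "nb (W r) <= 0" using weak_deriv0_nb[OF WL[OF r0], of "v r []"] by simp
   moreover have "nb (%x. W t x - W r x) < e" using d(2) r t0 by auto
   ultimately show ?thesis using n2_le_add[OF WL[OF t0] WL[OF r0]] by simp
  qed
  hence "nb (W t) <= 0" by (rule field_le_epsilon)
  moreover have "1 + \<alpha> * Im a * gn_const DIM('a) M m l * nb (W T0) powr \<alpha> * (t - T0) >= 0"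
   using b \<alpha>(1) t by (intro add_nonneg_nonneg mult_nonneg_nonneg) (auto simp: gn_const_def)
  ultimately show ?thesis by (auto intro!: order_trans[of "nb (W t)" 0])
 next
  case False
  hence M: "M > 0" using M0 by simp
  have cW: "continuous_on {0..} (%t. nb (W t))" unfolding continuous_on_iff
  proof (intro ballI allI impI)
   fix t e :: real assume t: "t : {0..}" "e > 0"
   obtain d where d: "d > 0" "ALL s:{0..t + 1}. ALL r:{0..t + 1}. \<bar>s - r\<bar> < d --> nb (%x. W s x - W r x) < e" using cont[OF t(2)] by blast
   have "dist (nb (W s)) (nb (W t)) < e" if s: "s : {0..}" "dist s t < min d 1" for s
   proof -
    have "nb (%x. W s x - W t x) < e" using d(2) s t by (auto simp: dist_real_def)
    thus ?thesis using n2_reverse_triangle[OF WL WL, of s t] s t by (simp add: dist_real_def)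
   qed
   thus "EX d>0. ALL s:{0..}. dist s t < d --> dist (nb (W s)) (nb (W t)) < e" using d(1) by (intro exI[of _ "min d 1"]) auto
  qed
  have gn: "AE t. t > 0 --> gn_const DIM('a) M m l * nb (W t) powr (2 + \<alpha>) <= enn2real (pint (1 + m) (W t))" using vM evolution_AE_pos[OF ev]
   by eventually_elim (use sobolev_gagliardo_nirenberg[OF v(1) M _ l12 _ m] in \<open>simp add: \<alpha>(2)\<close>)
  have "gn_const DIM('a) M m l > 0" using M by (intro gn_const_pos) auto
  from energy_decay[OF ev m b this T0(1) t F0 cW \<alpha>(1) gn] show ?thesis by blast
 qed
 show "\<mu> t <= \<mu> T0 * exp (- (Im a * gn_const DIM('a) M m l) * (t - T0))" if "\<alpha> = 0" "t >= T0"
  using main[OF that(2)] that T0 by (simp add: \<mu>)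
 show "\<mu> t <= \<mu> T0 / (1 + \<alpha> * Im a * gn_const DIM('a) M m l * \<mu> T0 powr \<alpha> * (t - T0)) powr (1 / \<alpha>)" if "\<alpha> > 0" "t >= T0"
  using main[OF that(2)] that T0 by (simp add: \<mu>)
qed

lemma gn_const_continuous: assumes "N > 0" shows "continuous_on ({0<..} \<times> S \<times> {0<..<1}) (%(M, b, m). gn_const N M m l)"
proof -
 have "0 < unit_ball_vol (real N) * (real N ^ l * fst p) powr - (real N / real l)" if "p : {0<..} \<times> S \<times> {0<..<1::real}" for p
  using that assms by (intro mult_pos_pos) auto
 thus ?thesis unfolding gn_const_def case_prod_beta'
  using assms by (intro continuous_intros) (auto simp: less_imp_neq[symmetric] intro: less_imp_neq[symmetric])
qed

theorem theorem3p4: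
  assumes "CARD('n::finite) \<ge> 4"
  shows "\<exists>C :: real \<Rightarrow> real \<Rightarrow> real \<Rightarrow> nat \<Rightarrow> real.
    (\<forall>l\<in>{1, 2}. continuous_on ({0<..} \<times> {0<..} \<times> {0<..<1}) (\<lambda>(M, b, m). C M b m l)) \<and>
    (\<forall>l\<in>{1, 2}. \<forall>M>0. \<forall>b>0. \<forall>m\<in>{0<..<1}. C M b m l > 0) \<and>
    (\<forall>(m::real) (a::complex) (f :: real \<Rightarrow> real ^ 'n \<Rightarrow> complex) (u0 :: real ^ 'n \<Rightarrow> complex)
      (u :: real \<Rightarrow> real ^ 'n \<Rightarrow> complex) (T0::real) (l::nat).
        0 < m \<longrightarrow> m < 1 \<longrightarrow>
        2 * sqrt m * Im a \<ge> (1 - m) * \<bar>Re a\<bar> \<longrightarrow>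
        (Re a \<ge> 0 \<longrightarrow> 2 * sqrt m * Im a > (1 - m) * Re a) \<longrightarrow>
        W1p_loc 1 (Lp_norm 2) f \<longrightarrow>
        Hk_norm 1 u0 < \<infinity> \<longrightarrow>
        (W1p_loc 1 (Hk_norm 1) f \<and> l = 1 \<or>
         Hk_norm 2 u0 < \<infinity> \<and> Lp_norm (2 * m) u0 < \<infinity> \<and> l = 2) \<longrightarrow>
        strong_solution m a f u0 u \<longrightarrow>
        T0 \<ge> 0 \<longrightarrow>
        (AE t in lebesgue_on {T0<..}. AE x in lebesgue. f t x = 0) \<longrightarrow>
        Linf_time (Hk_norm l) {0<..} u \<and>
        (let c = C (enn2real (Linf_norm (Hk_norm l) {0<..} u)) (Im a) m l;
             \<mu> = (\<lambda>t. enn2real (Lp_norm 2 (u t)));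
             \<alpha> = (1 - m) * (real CARD('n) - 2 * real l) / (2 * real l)
         in (CARD('n) = 4 \<and> l = 2 \<longrightarrow>
               (\<forall>t\<ge>T0. \<mu> t \<le> \<mu> T0 * exp (- c * (t - T0)))) \<and>
            (CARD('n) \<ge> 5 \<or> l = 1 \<longrightarrow>
               (\<forall>t\<ge>T0. \<mu> t \<le> \<mu> T0 / (1 + c * \<mu> T0 powr \<alpha> * (t - T0)) powr (1 / \<alpha>)))))"
proof -
 define N where "N = CARD('n)"
 define k where "k l = (real N - 2 * real l) / (2 * real l)" for l :: nat
 \<comment> \<open>The factor \<alpha> of the algebraic decay. For N = 4 and l = 2 it would be 0;
   the decay is then exponential, with factor 1 instead.\<close>
 define A where "A m l = (if N = 4 \<and> l = 2 then 1 else (1 - m) * k l)" for m :: real and l :: nat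
 define C where "C M b m l = A m l * b * gn_const N M m l" for M b m :: real and l :: nat
 have N: "N >= 4" "N > 0" using assms by (auto simp: N_def)
 have k: "k l > 0" if "l : {1, 2}" "\<not> (N = 4 \<and> l = 2)" for l using that N unfolding k_def by (intro divide_pos_pos) auto
 show ?thesis
 proof (intro exI[of _ C] conjI ballI allI impI)
  fix l :: nat assume l: "l : {1, 2}"
  have "continuous_on ({0<..} \<times> {0<..} \<times> {0<..<1}) (%p::real \<times> real \<times> real. A (snd (snd p)) l)"
   unfolding A_def by (cases "N = 4 \<and> l = 2") (auto intro!: continuous_intros)
  moreover have "continuous_on ({0<..} \<times> {0<..} \<times> {0<..<1}) (%p::real \<times> real \<times> real. gn_const N (fst p) (snd (snd p)) l)"
   using gn_const_continuous[OF N(2), of "{0<..}" l] by (simp add: case_prod_beta')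
  ultimately show "continuous_on ({0<..} \<times> {0<..} \<times> {0<..<1}) (%(M, b, m). C M b m l)"
   unfolding C_def case_prod_beta' by (intro continuous_intros)
  fix M b m :: real assume "M > 0" "b > 0" "m : {0<..<1}"
  thus "C M b m l > 0" using k[OF l] gn_const_pos[OF _ N(2), of M m l] by (simp add: C_def A_def)
 next
  fix m T0 :: real and a :: complex and f u :: "real => real ^ 'n => complex" and u0 :: "real ^ 'n => complex" and l :: nat
  assume m: "0 < m" "m < 1" and a: "2 * sqrt m * Im a >= (1 - m) * \<bar>Re a\<bar>" "Re a >= 0 --> 2 * sqrt m * Im a > (1 - m) * Re a"
   and f: "W1p_loc 1 (Lp_norm 2) f" and u0: "Hk_norm 1 u0 < \<infinity>"
   and l: "W1p_loc 1 (Hk_norm 1) f \<and> l = 1 \<or> Hk_norm 2 u0 < \<infinity> \<and> Lp_norm (2 * m) u0 < \<infinity> \<and> l = 2"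
   and sol: "strong_solution m a f u0 u" and T0: "T0 >= 0" "AE t in lebesgue_on {T0<..}. AE x in lebesgue. f t x = 0"
  obtain Hstar where sol': "solution Hstar m a f u0 u" using sol unfolding strong_solution_def H1_solution_def H2_solution_def by blast
  have D: "DIM(real ^ 'n) = N" by (simp add: N_def)
  note dec = solution_decay[OF N(1)[folded D] m a f u0 l sol' T0, unfolded D]
  show "Linf_time (Hk_norm l) {0<..} u" by (rule dec(1))
  define M where "M = enn2real (Linf_norm (Hk_norm l) {0<..} u)"
  define \<alpha> where "\<alpha> = (1 - m) * (real N - 2 * real l) / (2 * real l)"
  have l12: "l : {1, 2}" using l by auto
  have \<alpha>k: "\<alpha> = (1 - m) * k l" by (simp add: \<alpha>_def k_def)
  have 1: "enn2real (Lp_norm 2 (u t)) <= enn2real (Lp_norm 2 (u T0)) * exp (- C M (Im a) m l * (t - T0))"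
   if "N = 4 \<and> l = 2" "t >= T0" for t using dec(2)[of t] that by (simp add: C_def A_def M_def)
  have 2: "enn2real (Lp_norm 2 (u t)) <= enn2real (Lp_norm 2 (u T0)) / (1 + C M (Im a) m l * enn2real (Lp_norm 2 (u T0)) powr \<alpha> * (t - T0)) powr (1 / \<alpha>)"
   if "N >= 5 \<or> l = 1" "t >= T0" for t
  proof -
   have n: "\<not> (N = 4 \<and> l = 2)" using that by auto
   have "\<alpha> > 0" using k[OF l12 n] m by (simp add: \<alpha>k)
   moreover have "C M (Im a) m l = \<alpha> * Im a * gn_const N M m l" unfolding C_def A_def \<alpha>k if_not_P[OF n] ..
   ultimately show ?thesis using dec(3)[of t, folded \<alpha>_def M_def] that(2) by simp
  qed
  show "let c = C (enn2real (Linf_norm (Hk_norm l) {0<..} u)) (Im a) m l;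
       \<mu> = (%t. enn2real (Lp_norm 2 (u t)));
       \<alpha> = (1 - m) * (real CARD('n) - 2 * real l) / (2 * real l)
     in (CARD('n) = 4 \<and> l = 2 -->
        (ALL t>=T0. \<mu> t <= \<mu> T0 * exp (- c * (t - T0)))) \<and>
      (CARD('n) >= 5 \<or> l = 1 -->
        (ALL t>=T0. \<mu> t <= \<mu> T0 / (1 + c * \<mu> T0 powr \<alpha> * (t - T0)) powr (1 / \<alpha>)))"
   unfolding Let_def N_def[symmetric] M_def[symmetric] \<alpha>_def[symmetric] using 1 2 by blast
 qed
qed

end
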